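(* For every natural number $n\ge 1$ there exists an ergodic automorphism $T$ of a space $(X,\mu)$ with sigma-finite measure such that the tensor power $T^{\otimes 2n}$ is conservative, the spectrum of $T^{\otimes (n+1)}$ is Lebesgue, and the spectrum of $T^{\otimes n}$ is singular.
   Context: An automorphism of a sigma-finite measure space $(X,\mu)$ is an invertible (mod null sets) measurable transformation $T:X\to X$ preserving $\mu$. Its tensor power $T^{\otimes d}$ is the product transformation $T\times\cdots\times T$ ($d$ factors) on $(X^d,\mu^{d})$; the same symbol denotes the induced unitary operator on $L_2(X^d,\mu^d)$. Conservative: there is no wandering set of positive measure (a measurable set $W$ is wandering for $S$ if the sets $S^mW$, $m\in\mathbb Z$, are pairwise disjoint). Spectrum: a unitary operator $S$ on a separable Hilbert space is isomorphic to the operator $V$, $Vf(z,n)=zf(z,n)$, on $L_2(\mathbb T\times\mathbb N,\sigma)$, where $\mathbb T$ is the unit circle in $\mathbb C$ and $\sigma$ is a normalized Borel measure on $\mathbb T\times\mathbb N$. The spectrum of $S$ is called singular if the projection of $\sigma$ to $\mathbb T$ (the maximal spectral type) is singular with respect to Lebesgue measure on $\mathbb T$, and Lebesgue if this projection is equivalent to Lebesgue measure on $\mathbb T$. The spectrum of an automorphism is that of its induced unitary operator. *)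

theory Defs
  imports "HOL-Probability.Probability"
begin

text \<open>Automorphisms are invertible only modulo null sets, so the inverse is an
  almost-everywhere inverse; it automatically preserves the measure as well.\<close>

definition automorphism :: "'a measure \<Rightarrow> ('a \<Rightarrow> 'a) \<Rightarrow> bool" where
  "automorphism M T \<longleftrightarrow>
     T \<in> measurable M M \<and> distr M M T = M \<and>
     (\<exists>S\<in>measurable M M. (AE x in M. S (T x) = x) \<and> (AE x in M. T (S x) = x))"

definition ergodic :: "'a measure \<Rightarrow> ('a \<Rightarrow> 'a) \<Rightarrow> bool" where
  "ergodic M T \<longleftrightarrow>
     (\<forall>A\<in>sets M. T -` A \<inter> space M = A \<longrightarrow> A \<in> null_sets M \<or> space M - A \<in> null_sets M)"

text \<open>The set \<open>T\<^sup>m W\<close> for an integer \<open>m\<close>: a forward image if \<open>m \<ge> 0\<close>, a preimage otherwise.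
  No choice of an almost-everywhere inverse is involved. Forward images need not be measurable,
  but only their disjointness is used.\<close>

definition set_power :: "'a measure \<Rightarrow> ('a \<Rightarrow> 'a) \<Rightarrow> int \<Rightarrow> 'a set \<Rightarrow> 'a set" where
  "set_power M T m W =
     (if 0 \<le> m then (T ^^ nat m) ` W else (T ^^ nat (- m)) -` W \<inter> space M)"

definition wandering :: "'a measure \<Rightarrow> ('a \<Rightarrow> 'a) \<Rightarrow> 'a set \<Rightarrow> bool" where
  "wandering M T W \<longleftrightarrow> W \<in> sets M \<and> disjoint_family (\<lambda>m::int. set_power M T m W)"

definition conservative :: "'a measure \<Rightarrow> ('a \<Rightarrow> 'a) \<Rightarrow> bool" where
  "conservative M T \<longleftrightarrow> \<not> (\<exists>W. wandering M T W \<and> emeasure M W > 0)"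

definition power_space :: "nat \<Rightarrow> 'a measure \<Rightarrow> (nat \<Rightarrow> 'a) measure" where
  "power_space d M = PiM {..<d} (\<lambda>_. M)"

definition tensor_power :: "nat \<Rightarrow> ('a \<Rightarrow> 'a) \<Rightarrow> (nat \<Rightarrow> 'a) \<Rightarrow> (nat \<Rightarrow> 'a)" where
  "tensor_power d T = (\<lambda>x. \<lambda>i\<in>{..<d}. T (x i))"

text \<open>Elements of \<open>L\<^sub>2\<close> are represented by square-integrable functions, and operators by maps
  between representatives; every identity between elements of \<open>L\<^sub>2\<close> is an identity almost
  everywhere.\<close>

definition L2 :: "'a measure \<Rightarrow> ('a \<Rightarrow> complex) set" where
  "L2 M = {f \<in> borel_measurable M. integrable M (\<lambda>x. (cmod (f x))\<^sup>2)}"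

text \<open>Almost-everywhere linearity and preservation of the norm make \<open>\<Phi>\<close> well defined on classes
  modulo almost-everywhere equality.\<close>

definition unitary_L2 ::
  "'a measure \<Rightarrow> 'b measure \<Rightarrow> (('a \<Rightarrow> complex) \<Rightarrow> ('b \<Rightarrow> complex)) \<Rightarrow> bool" where
  "unitary_L2 M N \<Phi> \<longleftrightarrow>
     (\<forall>f\<in>L2 M. \<Phi> f \<in> L2 N) \<and>
     (\<forall>f\<in>L2 M. \<forall>g\<in>L2 M. \<forall>a b. AE y in N. \<Phi> (\<lambda>x. a * f x + b * g x) y = a * \<Phi> f y + b * \<Phi> g y) \<and>
     (\<forall>f\<in>L2 M. (\<integral>y. (cmod (\<Phi> f y))\<^sup>2 \<partial>N) = (\<integral>x. (cmod (f x))\<^sup>2 \<partial>M)) \<and>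
     (\<forall>g\<in>L2 N. \<exists>f\<in>L2 M. AE y in N. \<Phi> f y = g y)"

definition koopman :: "('a \<Rightarrow> 'a) \<Rightarrow> ('a \<Rightarrow> complex) \<Rightarrow> ('a \<Rightarrow> complex)" where
  "koopman T f = (\<lambda>x. f (T x))"

definition circle_borel :: "complex measure" where
  "circle_borel = restrict_space borel (sphere 0 1)"

definition circle_lebesgue :: "complex measure" where
  "circle_lebesgue = distr (restrict_space lborel {0..<2 * pi}) circle_borel cis"

lemma measurable_cis_circle: "cis \<in> measurable (restrict_space lborel {0..<2 * pi}) circle_borel"
  unfolding circle_borel_def
  by (intro measurable_restrict_space2 measurable_restrict_space1)
     (auto intro!: borel_measurable_continuous_onI continuous_intros)

definition mult_coordinate :: "(complex \<times> nat \<Rightarrow> complex) \<Rightarrow> (complex \<times> nat \<Rightarrow> complex)" where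
  "mult_coordinate f = (\<lambda>(z, k). z * f (z, k))"

definition spectral_model ::
  "'a measure \<Rightarrow> (('a \<Rightarrow> complex) \<Rightarrow> ('a \<Rightarrow> complex)) \<Rightarrow> (complex \<times> nat) measure \<Rightarrow> bool" where
  "spectral_model M U \<sigma> \<longleftrightarrow>
     prob_space \<sigma> \<and> sets \<sigma> = sets (circle_borel \<Otimes>\<^sub>M count_space UNIV) \<and>
     (\<exists>\<Phi>. unitary_L2 M \<sigma> \<Phi> \<and> (\<forall>f\<in>L2 M. AE w in \<sigma>. \<Phi> (U f) w = mult_coordinate (\<Phi> f) w))"

definition circle_projection :: "(complex \<times> nat) measure \<Rightarrow> complex measure" where
  "circle_projection \<sigma> = distr \<sigma> circle_borel fst"

definition mutually_singular :: "'a measure \<Rightarrow> 'a measure \<Rightarrow> bool" where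
  "mutually_singular M N \<longleftrightarrow>
     sets M = sets N \<and> (\<exists>A\<in>sets M. emeasure M A = 0 \<and> emeasure N (space N - A) = 0)"

definition equivalent_measures :: "'a measure \<Rightarrow> 'a measure \<Rightarrow> bool" where
  "equivalent_measures M N \<longleftrightarrow>
     sets M = sets N \<and> absolutely_continuous M N \<and> absolutely_continuous N M"

text \<open>The measure class of \<open>circle_projection \<sigma>\<close> is the same for all spectral models \<open>\<sigma>\<close> of
  a given operator, so that it does not matter which one is used.\<close>

definition singular_spectrum :: "'a measure \<Rightarrow> (('a \<Rightarrow> complex) \<Rightarrow> ('a \<Rightarrow> complex)) \<Rightarrow> bool" where
  "singular_spectrum M U \<longleftrightarrow>
     (\<exists>\<sigma>. spectral_model M U \<sigma> \<and> mutually_singular (circle_projection \<sigma>) circle_lebesgue)"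

definition lebesgue_spectrum :: "'a measure \<Rightarrow> (('a \<Rightarrow> complex) \<Rightarrow> ('a \<Rightarrow> complex)) \<Rightarrow> bool" where
  "lebesgue_spectrum M U \<longleftrightarrow>
     (\<exists>\<sigma>. spectral_model M U \<sigma> \<and> equivalent_measures (circle_projection \<sigma>) circle_lebesgue)"

end

theory Submission
  imports Defs
begin

text \<open>\<open>T\<close> is a rank-one transformation. Tower \<open>j + 1\<close>, of height \<open>h\<^sub>j \<cdot> 2\<close> to the power \<open>r\<^sub>j + 3\<close>, is made of
  \<open>r\<^sub>j\<close> copies of tower \<open>j\<close> placed at the heights \<open>h\<^sub>j a\<close> with \<open>a\<close> in the Sidon set \<open>{2, 4, 8, \<dots>}\<close>, all other
  levels being new. If \<open>B\<close> is the base of tower \<open>0\<close>, then \<open>\<mu>(B \<inter> T\<^sup>k B)\<close> is the product over the digits of \<open>k\<close> of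
  \<open>1\<close> (digit \<open>0\<close>), \<open>1 / r\<^sub>j\<close> (digit a difference of two spots) or \<open>0\<close>, so the spectral measure of \<open>B\<close> is a
  generalized Riesz product and that of its \<open>d\<close>-fold tensor power has \<open>r\<^sub>j\<close> to the power \<open>- d\<close> in place of \<open>1 / r\<^sub>j\<close>.
  Such a product is singular if the sum of \<open>r\<^sub>j\<close> to the power \<open>1 - 2d\<close> diverges (a Chebyshev argument separates
  it from Lebesgue measure), and equivalent to Lebesgue measure if the sum of \<open>r\<^sub>j\<close> to the power \<open>2 - 2d\<close> converges
  (the partial products converge in \<open>L\<^sub>2\<close>, and their negative logarithms are bounded in \<open>L\<^sub>1\<close>). The power
  \<open>T\<^sup>\<otimes>\<^sup>d\<close> is conservative if the sum of \<open>r\<^sub>j\<close> to the power \<open>1 - d\<close> diverges, since then almost every point has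
  infinitely often all its \<open>j\<close>-th digits equal and can be moved back to its own levels.
  With \<open>r\<^sub>j\<close> about \<open>j\<close> to the power \<open>1 / (2n - 1)\<close>, the sum of \<open>r\<^sub>j\<close> to the power \<open>1 - 2n\<close> diverges and that of
  \<open>r\<^sub>j\<close> to the power \<open>- 2n\<close> converges, which is what is needed for the powers \<open>2n\<close>, \<open>n\<close> and \<open>n + 1\<close>.\<close>

section \<open>Square-integrable functions and unitary operators\<close>

text \<open>A priori the spectral measure of the base governs only the cyclic space of its
  indicator. That nothing larger occurs rests on the levels: the base is a disjoint union of
  translates of any thinner base \<open>L m 0\<close>, so the indicator of \<open>L m 0\<close> is
  modelled by 1 divided by a trigonometric polynomial \<open>gen m\<close>. The zeros of this
  polynomial must be null, hence the spectral measures must have no atoms. Rectangles of levels are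
  then matched by functions on a d-torus, on which the tensor power acts as multiplication by the
  product of the coordinates. The image of the torus measure under this product has the Fourier
  coefficients \<open>corr k ^ d\<close>; it is a Riesz product, and it is the maximal spectral type
  because the constant 1 is among the functions. The form over the circle times the naturals comes
  from splitting these functions over the fibres of the product map. Unitary operators arise by
  matching Gram matrices of total families, so only inner products are ever computed, and spectral
  measures arise from positive definite sequences by Fejer means.\<close>

definition ip :: "'a measure \<Rightarrow> ('a \<Rightarrow> complex) \<Rightarrow> ('a \<Rightarrow> complex) \<Rightarrow> complex" where
  "ip M f g = (\<integral>x. f x * cnj (g x) \<partial>M)"

definition nsq :: "'a measure \<Rightarrow> ('a \<Rightarrow> complex) \<Rightarrow> real" where
  "nsq M f = (\<integral>x. (cmod (f x))\<^sup>2 \<partial>M)"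

lemma measurable_cnj [measurable (raw)]: "f \<in> borel_measurable M \<Longrightarrow> (\<lambda>x. cnj (f x)) \<in> borel_measurable M"
  by (rule measurable_compose[of f M borel cnj])
     (auto intro!: borel_measurable_continuous_onI continuous_intros)

lemma mult_cnj_self: "z * cnj z = (complex_of_real (cmod z))\<^sup>2"
  by (metis complex_norm_square of_real_power)

lemma L2_measurable [measurable_dest]: "f \<in> L2 M \<Longrightarrow> f \<in> borel_measurable M"
  by (simp add: L2_def)

lemma L2_integrable: "f \<in> L2 M \<Longrightarrow> integrable M (\<lambda>x. (cmod (f x))\<^sup>2)"
  by (simp add: L2_def)

lemma L2_I: "f \<in> borel_measurable M \<Longrightarrow> integrable M (\<lambda>x. (cmod (f x))\<^sup>2) \<Longrightarrow> f \<in> L2 M"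
  by (simp add: L2_def)

lemma cmod_sum_squared_le: "(cmod (a + b))\<^sup>2 \<le> 2 * (cmod a)\<^sup>2 + 2 * (cmod b)\<^sup>2"
proof -
  have "(cmod (a + b))\<^sup>2 \<le> (cmod a + cmod b)\<^sup>2"
    by (intro power_mono norm_triangle_ineq) auto
  also have "\<dots> \<le> 2 * (cmod a)\<^sup>2 + 2 * (cmod b)\<^sup>2"
    using sum_squares_bound[of "cmod a" "cmod b"] by (simp add: power2_sum)
  finally show ?thesis .
qed

lemma L2_scale: assumes "f \<in> L2 M" shows "(\<lambda>x. c * f x) \<in> L2 M"
proof -
  note [measurable] = L2_measurable[OF assms]
  show ?thesis using L2_integrable[OF assms]
    by (intro L2_I) (auto simp: norm_mult power_mult_distrib)
qed

lemma L2_add: assumes "f \<in> L2 M" "g \<in> L2 M" shows "(\<lambda>x. f x + g x) \<in> L2 M"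
proof (rule L2_I)
  note [measurable] = L2_measurable[OF assms(1)] L2_measurable[OF assms(2)]
  show "(\<lambda>x. f x + g x) \<in> borel_measurable M" by measurable
  show "integrable M (\<lambda>x. (cmod (f x + g x))\<^sup>2)"
    by (rule Bochner_Integration.integrable_bound[of _ "\<lambda>x. 2 * (cmod (f x))\<^sup>2 + 2 * (cmod (g x))\<^sup>2"])
       (auto intro!: Bochner_Integration.integrable_add integrable_mult_right L2_integrable assms
             intro: cmod_sum_squared_le)
qed

lemma L2_diff: "f \<in> L2 M \<Longrightarrow> g \<in> L2 M \<Longrightarrow> (\<lambda>x. f x - g x) \<in> L2 M"
  using L2_add[of f M "\<lambda>x. -1 * g x"] L2_scale[of g M "-1"] by simp

lemma L2_zero: "(\<lambda>x. 0) \<in> L2 M" by (simp add: L2_def)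

lemma L2_sum: "(\<And>i. i \<in> I \<Longrightarrow> f i \<in> L2 M) \<Longrightarrow> (\<lambda>x. \<Sum>i\<in>I. f i x) \<in> L2 M"
  by (induction I rule: infinite_finite_induct) (auto intro: L2_add L2_zero)

lemma L2_mult_integrable: assumes "f \<in> L2 M" "g \<in> L2 M"
  shows "integrable M (\<lambda>x. f x * cnj (g x))"
proof (rule Bochner_Integration.integrable_bound[of _ "\<lambda>x. (cmod (f x))\<^sup>2 + (cmod (g x))\<^sup>2"])
  note [measurable] = L2_measurable[OF assms(1)] L2_measurable[OF assms(2)]
  show "(\<lambda>x. f x * cnj (g x)) \<in> borel_measurable M" by measurable
  show "integrable M (\<lambda>x. (cmod (f x))\<^sup>2 + (cmod (g x))\<^sup>2)"
    by (auto intro!: Bochner_Integration.integrable_add L2_integrable assms)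
  show "AE x in M. norm (f x * cnj (g x)) \<le> norm ((cmod (f x))\<^sup>2 + (cmod (g x))\<^sup>2)"
  proof (rule AE_I2)
    fix x
    have "norm (f x * cnj (g x)) = cmod (f x) * cmod (g x)" by (simp add: norm_mult)
    also have "\<dots> \<le> (cmod (f x))\<^sup>2 + (cmod (g x))\<^sup>2"
      using sum_squares_bound[of "cmod (f x)" "cmod (g x)"]
        mult_nonneg_nonneg[OF norm_ge_zero[of "f x"] norm_ge_zero[of "g x"]] by linarith
    finally show "norm (f x * cnj (g x)) \<le> norm ((cmod (f x))\<^sup>2 + (cmod (g x))\<^sup>2)" by simp
  qed
qed

lemma ip_commute: "ip M g f = cnj (ip M f g)"
proof -
  have "cnj (ip M f g) = (\<integral>x. cnj (f x * cnj (g x)) \<partial>M)" unfolding ip_def by (rule Bochner_Integration.integral_cnj[symmetric])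
  then show ?thesis by (simp add: ip_def mult.commute)
qed

lemma ip_self: "ip M f f = of_real (nsq M f)"
  unfolding ip_def nsq_def integral_complex_of_real[symmetric]
  by (simp add: mult_cnj_self)

lemma ip_scale_left: "ip M (\<lambda>x. c * f x) g = c * ip M f g"
  unfolding ip_def by (simp add: mult.assoc)

lemma ip_scale_right: "ip M f (\<lambda>x. c * g x) = cnj c * ip M f g"
  by (subst (1 2) ip_commute) (simp add: ip_scale_left)

lemma ip_add_left: "f \<in> L2 M \<Longrightarrow> g \<in> L2 M \<Longrightarrow> h \<in> L2 M \<Longrightarrow>
    ip M (\<lambda>x. f x + g x) h = ip M f h + ip M g h"
  unfolding ip_def by (simp add: distrib_right L2_mult_integrable)

lemma ip_diff_left: "f \<in> L2 M \<Longrightarrow> g \<in> L2 M \<Longrightarrow> h \<in> L2 M \<Longrightarrow>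
    ip M (\<lambda>x. f x - g x) h = ip M f h - ip M g h"
  unfolding ip_def by (simp add: left_diff_distrib L2_mult_integrable)

lemma ip_sum_left: "(\<And>i. i \<in> I \<Longrightarrow> f i \<in> L2 M) \<Longrightarrow> h \<in> L2 M \<Longrightarrow>
    ip M (\<lambda>x. \<Sum>i\<in>I. f i x) h = (\<Sum>i\<in>I. ip M (f i) h)"
  unfolding ip_def by (simp add: sum_distrib_right L2_mult_integrable)

lemma ip_sum_right: "(\<And>i. i \<in> I \<Longrightarrow> f i \<in> L2 M) \<Longrightarrow> h \<in> L2 M \<Longrightarrow>
    ip M h (\<lambda>x. \<Sum>i\<in>I. f i x) = (\<Sum>i\<in>I. ip M h (f i))"
  by (subst (1 2) ip_commute) (simp add: ip_sum_left)

lemma ip_add_right: "f \<in> L2 M \<Longrightarrow> g \<in> L2 M \<Longrightarrow> h \<in> L2 M \<Longrightarrow>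
    ip M h (\<lambda>x. f x + g x) = ip M h f + ip M h g"
  by (subst (1 2 3) ip_commute) (simp add: ip_add_left)

lemma nsq_nonneg: "0 \<le> nsq M f" by (simp add: nsq_def)

lemma nsq_scale: "nsq M (\<lambda>x. c * f x) = (cmod c)\<^sup>2 * nsq M f"
  by (simp add: nsq_def norm_mult power_mult_distrib)

lemma nsq_add: assumes "f \<in> L2 M" "g \<in> L2 M"
  shows "nsq M (\<lambda>x. f x + g x) = nsq M f + nsq M g + 2 * Re (ip M f g)"
proof -
  have "of_real (nsq M (\<lambda>x. f x + g x)) = ip M f f + ip M g g + (ip M f g + cnj (ip M f g))"
    using assms
    by (simp add: ip_self[symmetric] ip_add_left ip_add_right L2_add ip_commute[of M f g] algebra_simps)
  also have "\<dots> = of_real (nsq M f + nsq M g + 2 * Re (ip M f g))"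
    unfolding complex_add_cnj by (simp add: ip_self)
  finally show ?thesis unfolding of_real_eq_iff .
qed

lemma nsq_diff: assumes "f \<in> L2 M" "g \<in> L2 M"
  shows "nsq M (\<lambda>x. f x - g x) = nsq M f + nsq M g - 2 * Re (ip M f g)"
  using nsq_add[OF assms(1) L2_scale[OF assms(2), of "-1"]]
  by (simp add: ip_scale_right[of M f "-1" g, simplified] nsq_scale[of M "-1" g, simplified])

lemma nsq_add_le: assumes "f \<in> L2 M" "g \<in> L2 M"
  shows "nsq M (\<lambda>x. f x + g x) \<le> 2 * nsq M f + 2 * nsq M g"
proof -
  have "nsq M (\<lambda>x. f x + g x) + nsq M (\<lambda>x. f x - g x) = 2 * nsq M f + 2 * nsq M g"
    using assms by (simp add: nsq_add nsq_diff)
  then show ?thesis using nsq_nonneg[of M "\<lambda>x. f x - g x"] by linarith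
qed

lemma nsq_minus_commute: "nsq M (\<lambda>x. f x - g x) = nsq M (\<lambda>x. g x - f x)"
  by (simp add: nsq_def norm_minus_commute)

lemma nsq_eq_0_iff: assumes "f \<in> L2 M" shows "nsq M f = 0 \<longleftrightarrow> (AE x in M. f x = 0)"
  unfolding nsq_def using L2_integrable[OF assms]
  by (subst integral_nonneg_eq_0_iff_AE) auto

lemma ip_cong_AE: assumes "f \<in> borel_measurable M" "f' \<in> borel_measurable M" "g \<in> borel_measurable M"
  "AE x in M. f x = f' x" shows "ip M f g = ip M f' g"
  unfolding ip_def using assms(4) by (intro integral_cong_AE borel_measurable_times measurable_cnj assms) auto

lemma ip_Cauchy_Schwarz: assumes "f \<in> L2 M" "g \<in> L2 M"
  shows "(cmod (ip M f g))\<^sup>2 \<le> nsq M f * nsq M g"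
proof (cases "nsq M g = 0")
  case True
  then have "AE x in M. g x = 0" using nsq_eq_0_iff assms by blast
  then have "ip M g f = ip M (\<lambda>x. 0) f"
    using assms by (intro ip_cong_AE) (auto intro: L2_measurable)
  then have "ip M g f = 0" by (simp add: ip_def)
  then have "ip M f g = 0" by (subst ip_commute) simp
  then show ?thesis using True by simp
next
  case False
  then have pos: "nsq M g > 0" using nsq_nonneg[of M g] by simp
  define c where "c = ip M f g / nsq M g"
  have "0 \<le> nsq M (\<lambda>x. f x - c * g x)" by (rule nsq_nonneg)
  also have "\<dots> = nsq M f + (cmod c)\<^sup>2 * nsq M g - 2 * Re (cnj c * ip M f g)"
    using assms by (simp add: nsq_diff L2_scale nsq_scale ip_scale_right)
  also have "cnj c * ip M f g = of_real ((cmod (ip M f g))\<^sup>2 / nsq M g)"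
    by (simp add: c_def mult.commute[of _ "ip M f g"] mult_cnj_self)
  also have "(cmod c)\<^sup>2 * nsq M g = (cmod (ip M f g))\<^sup>2 / nsq M g"
    using pos by (simp add: c_def norm_divide power_divide power2_eq_square)
  finally show ?thesis using pos by (simp add: field_simps)
qed

lemma L2_unitary_mult: assumes "f \<in> L2 M" "u \<in> borel_measurable M" "\<And>x. x \<in> space M \<Longrightarrow> cmod (u x) = 1"
  shows "(\<lambda>x. u x * f x) \<in> L2 M"
proof -
  note [measurable] = L2_measurable[OF assms(1)] assms(2)
  have "integrable M (\<lambda>x. (cmod (u x * f x))\<^sup>2) = integrable M (\<lambda>x. (cmod (f x))\<^sup>2)"
    using assms by (intro Bochner_Integration.integrable_cong) (auto simp: norm_mult)
  then show ?thesis using L2_integrable[OF assms(1)] by (intro L2_I) auto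
qed

text \<open>Riesz-Fischer. The subsequence converging almost everywhere belongs to the conclusion
  because \<open>lebesgue\<close> needs it: to see that the limit of the partial products is real
  and nonnegative, and to apply Fatou's lemma.\<close>

lemma L2_complete:
  fixes s :: "nat \<Rightarrow> 'a \<Rightarrow> complex"
  assumes s: "\<And>n. s n \<in> L2 M"
  assumes Cauchy: "\<And>e. e > 0 \<Longrightarrow> \<exists>N. \<forall>m\<ge>N. \<forall>n\<ge>N. nsq M (\<lambda>x. s m x - s n x) < e"
  shows "\<exists>g\<in>L2 M. (\<lambda>n. nsq M (\<lambda>x. s n x - g x)) \<longlonglongrightarrow> 0 \<and>
    (\<exists>r::nat \<Rightarrow> nat. strict_mono r \<and> (AE x in M. (\<lambda>k. s (r k) x) \<longlonglongrightarrow> g x))"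
proof -
  note [measurable] = L2_measurable[OF s]
  \<comment> \<open>The rate 4^-k leaves room for the weights 2^k below: the weighted squares still
    have summable integrals.\<close>
  have "\<exists>N. \<forall>k. (\<forall>m\<ge>N k. \<forall>n\<ge>N k. nsq M (\<lambda>x. s m x - s n x) < (1/4)^k) \<and> k \<le> N k"
  proof (intro choice allI)
    fix k :: nat
    obtain N where N: "\<forall>m\<ge>N. \<forall>n\<ge>N. nsq M (\<lambda>x. s m x - s n x) < (1/4)^k"
      using Cauchy[of "(1/4)^k"] by auto
    then show "\<exists>N. (\<forall>m\<ge>N. \<forall>n\<ge>N. nsq M (\<lambda>x. s m x - s n x) < (1/4)^k) \<and> k \<le> N"
      by (intro exI[of _ "max N k"]) auto
  qed
  then obtain N where N: "\<And>k m n. m \<ge> N k \<Longrightarrow> n \<ge> N k \<Longrightarrow> nsq M (\<lambda>x. s m x - s n x) < (1/4)^k"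
    by blast
  define r where "r k = (\<Sum>i\<le>k. N i) + k" for k
  have r: "strict_mono r" by (rule strict_monoI_Suc) (simp add: r_def)
  have rN: "r j \<ge> N k" if "j \<ge> k" for j k
  proof -
    have "N k \<le> (\<Sum>i\<le>j. N i)" using that by (intro member_le_sum) auto
    then show ?thesis by (simp add: r_def)
  qed
  define d where "d k x = s (r (Suc k)) x - s (r k) x" for k x
  have dm[measurable]: "d k \<in> borel_measurable M" for k unfolding d_def by measurable
  have dL2: "d k \<in> L2 M" for k unfolding d_def by (intro L2_diff s)
  have dle: "nsq M (d k) \<le> (1/4)^k" for k
    unfolding d_def by (rule less_imp_le, rule N) (auto intro: rN)
  have "(\<integral>\<^sup>+x. (\<Sum>k. ennreal (2^k * (cmod (d k x))\<^sup>2)) \<partial>M) = (\<Sum>k. \<integral>\<^sup>+x. ennreal (2^k * (cmod (d k x))\<^sup>2) \<partial>M)"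
    by (rule nn_integral_suminf) measurable
  also have "\<dots> = (\<Sum>k. ennreal (2^k * nsq M (d k)))"
    using L2_integrable[OF dL2] by (intro suminf_cong, subst nn_integral_eq_integral) (auto simp: nsq_def)
  also have "\<dots> \<le> (\<Sum>k. ennreal ((1/2)^k))"
  proof (intro suminf_le summableI ennreal_leI)
    fix k
    have "2^k * nsq M (d k) \<le> 2^k * (1/4)^k" using dle by (intro mult_left_mono) auto
    also have "\<dots> = (1/2::real)^k" by (simp add: power_mult_distrib[symmetric])
    finally show "2^k * nsq M (d k) \<le> (1/2)^k" .
  qed
  also have "\<dots> = ennreal (\<Sum>k. (1/2)^k)" by (intro suminf_ennreal2) auto
  finally have "(\<integral>\<^sup>+x. (\<Sum>k. ennreal (2^k * (cmod (d k x))\<^sup>2)) \<partial>M) \<noteq> \<infinity>"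
    by (auto simp: top_unique)
  then have "AE x in M. (\<Sum>k. ennreal (2^k * (cmod (d k x))\<^sup>2)) \<noteq> \<infinity>"
    by (intro nn_integral_PInf_AE) auto
  then have conv: "AE x in M. convergent (\<lambda>k. s (r k) x)"
  proof eventually_elim
    fix x assume fin: "(\<Sum>k. ennreal (2^k * (cmod (d k x))\<^sup>2)) \<noteq> \<infinity>"
    have sm: "summable (\<lambda>k. 2^k * (cmod (d k x))\<^sup>2)"
      using fin by (intro summable_suminf_not_top) auto
    have "summable (\<lambda>k. ((1/2)^k + 2^k * (cmod (d k x))\<^sup>2))"
      by (intro summable_add sm) auto
    then have "summable (\<lambda>k. d k x)"
    proof (rule summable_comparison_test')
      fix k :: nat
      \<comment> \<open>The inequality of the means turns the weighted squares, whose sum is finite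
        almost everywhere, into a summable bound for the moduli themselves.\<close>
      have "2 * 1 * (2^k * cmod (d k x)) \<le> 1\<^sup>2 + (2^k * cmod (d k x))\<^sup>2" by (rule sum_squares_bound)
      then have "(1/2)^k * (2 * (2^k * cmod (d k x))) \<le> (1/2)^k * (1 + (2^k * cmod (d k x))\<^sup>2)"
        by (intro mult_left_mono) auto
      then have "2 * cmod (d k x) \<le> (1/2)^k + 2^k * (cmod (d k x))\<^sup>2"
        by (simp add: power_divide power_mult_distrib distrib_left power2_eq_square mult_ac)
      then show "norm (d k x) \<le> (1/2)^k + 2^k * (cmod (d k x))\<^sup>2"
        using norm_ge_zero[of "d k x"] by linarith
    qed
    then have "convergent (\<lambda>n. \<Sum>k<n. d k x)" by (simp add: summable_iff_convergent)
    then have "convergent (\<lambda>n. s (r n) x - s (r 0) x)"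
      by (simp add: d_def sum_lessThan_telescope[of "\<lambda>k. s (r k) x"])
    then have "convergent (\<lambda>n. (s (r n) x - s (r 0) x) + s (r 0) x)"
      by (intro convergent_add convergent_const)
    then show "convergent (\<lambda>k. s (r k) x)" by simp
  qed
  define g where "g x = lim (\<lambda>k. s (r k) x)" for x
  have g[measurable]: "g \<in> borel_measurable M" unfolding g_def by measurable
  have lim: "AE x in M. (\<lambda>k. s (r k) x) \<longlonglongrightarrow> g x"
    using conv by eventually_elim (simp add: g_def convergent_LIMSEQ_iff)
  \<comment> \<open>Fatou's lemma along the subsequence passes the Cauchy bound on to the distance
    from the limit.\<close>
  have key: "(\<integral>\<^sup>+x. ennreal ((cmod (s m x - g x))\<^sup>2) \<partial>M) \<le> ennreal ((1/4)^k)" if m: "m \<ge> N k" for m k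
  proof -
    have "(\<integral>\<^sup>+x. ennreal ((cmod (s m x - g x))\<^sup>2) \<partial>M)
        = (\<integral>\<^sup>+x. liminf (\<lambda>j. ennreal ((cmod (s m x - s (r j) x))\<^sup>2)) \<partial>M)"
    proof (intro nn_integral_cong_AE)
      show "AE x in M. ennreal ((cmod (s m x - g x))\<^sup>2) = liminf (\<lambda>j. ennreal ((cmod (s m x - s (r j) x))\<^sup>2))"
        using lim
      proof eventually_elim
        fix x assume "(\<lambda>k. s (r k) x) \<longlonglongrightarrow> g x"
        then have "(\<lambda>j. ennreal ((cmod (s m x - s (r j) x))\<^sup>2)) \<longlonglongrightarrow> ennreal ((cmod (s m x - g x))\<^sup>2)"
          by (intro tendsto_intros)
        then show "ennreal ((cmod (s m x - g x))\<^sup>2) = liminf (\<lambda>j. ennreal ((cmod (s m x - s (r j) x))\<^sup>2))"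
          by (metis lim_imp_Liminf trivial_limit_sequentially)
      qed
    qed
    also have "\<dots> \<le> liminf (\<lambda>j. \<integral>\<^sup>+x. ennreal ((cmod (s m x - s (r j) x))\<^sup>2) \<partial>M)"
      by (intro nn_integral_liminf) measurable
    also have "\<dots> \<le> limsup (\<lambda>j. \<integral>\<^sup>+x. ennreal ((cmod (s m x - s (r j) x))\<^sup>2) \<partial>M)"
      by (intro Liminf_le_Limsup) auto
    also have "\<dots> \<le> ennreal ((1/4)^k)"
    proof (rule Limsup_bounded)
      show "\<forall>\<^sub>F j in sequentially. (\<integral>\<^sup>+x. ennreal ((cmod (s m x - s (r j) x))\<^sup>2) \<partial>M) \<le> ennreal ((1/4)^k)"
        using eventually_ge_at_top[of k]
      proof eventually_elim
        case (elim j)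
        have "(\<integral>\<^sup>+x. ennreal ((cmod (s m x - s (r j) x))\<^sup>2) \<partial>M) = ennreal (nsq M (\<lambda>x. s m x - s (r j) x))"
          unfolding nsq_def by (intro nn_integral_eq_integral L2_integrable L2_diff s) auto
        also have "\<dots> \<le> ennreal ((1/4)^k)"
          by (rule ennreal_leI, rule less_imp_le, rule N) (use m rN elim in auto)
        finally show ?case .
      qed
    qed
    finally show ?thesis .
  qed
  have dg: "(\<lambda>x. s (N 0) x - g x) \<in> L2 M"
  proof (rule L2_I)
    show "integrable M (\<lambda>x. (cmod (s (N 0) x - g x))\<^sup>2)"
      using key[of 0 "N 0"] by (intro integrableI_nonneg) (auto simp: less_top[symmetric] top_unique)
  qed measurable
  have gL: "g \<in> L2 M" using L2_diff[OF s[of "N 0"] dg] by simp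
  have "(\<lambda>n. nsq M (\<lambda>x. s n x - g x)) \<longlonglongrightarrow> 0"
  proof (rule LIMSEQ_I)
    fix e :: real assume "e > 0"
    then obtain k where k: "(1/4::real)^k < e" using real_arch_pow_inv[of e "1/4"] by auto
    show "\<exists>no. \<forall>n\<ge>no. norm (nsq M (\<lambda>x. s n x - g x) - 0) < e"
    proof (intro exI[of _ "N k"] allI impI)
      fix n assume "n \<ge> N k"
      have "ennreal (nsq M (\<lambda>x. s n x - g x)) = (\<integral>\<^sup>+x. ennreal ((cmod (s n x - g x))\<^sup>2) \<partial>M)"
        unfolding nsq_def by (intro nn_integral_eq_integral[symmetric] L2_integrable L2_diff s gL) auto
      also have "\<dots> \<le> ennreal ((1/4)^k)" by (rule key) fact
      finally have "nsq M (\<lambda>x. s n x - g x) \<le> (1/4)^k" by (subst (asm) ennreal_le_iff) auto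
      then show "norm (nsq M (\<lambda>x. s n x - g x) - 0) < e"
        using k nsq_nonneg[of M "\<lambda>x. s n x - g x"] by simp
    qed
  qed
  then show ?thesis using gL r lim by blast
qed

lemma ip_tendsto:
  assumes s: "\<And>n. s n \<in> L2 M" and g: "g \<in> L2 M" and h: "h \<in> L2 M"
  and lim: "(\<lambda>n. nsq M (\<lambda>x. s n x - g x)) \<longlonglongrightarrow> 0"
  shows "(\<lambda>n. ip M (s n) h) \<longlonglongrightarrow> ip M g h"
proof -
  have "(\<lambda>n. (cmod (ip M (s n) h - ip M g h))\<^sup>2) \<longlonglongrightarrow> 0"
  proof (rule tendsto_sandwich[OF _ _ tendsto_const])
    show "\<forall>\<^sub>F n in sequentially. (cmod (ip M (s n) h - ip M g h))\<^sup>2 \<le> nsq M (\<lambda>x. s n x - g x) * nsq M h"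
      using ip_Cauchy_Schwarz[OF L2_diff[OF s g] h] by (simp add: ip_diff_left s g h)
    show "(\<lambda>n. nsq M (\<lambda>x. s n x - g x) * nsq M h) \<longlonglongrightarrow> 0"
      by (rule tendsto_mult_left_zero[OF lim])
  qed auto
  then have "(\<lambda>n. sqrt ((cmod (ip M (s n) h - ip M g h))\<^sup>2)) \<longlonglongrightarrow> sqrt 0"
    by (rule tendsto_real_sqrt)
  then have "(\<lambda>n. ip M (s n) h - ip M g h) \<longlonglongrightarrow> 0"
    by (simp add: tendsto_norm_zero_iff)
  then show ?thesis by (simp add: LIM_zero_iff)
qed

lemma nsq_tendsto:
  assumes s: "\<And>n. s n \<in> L2 M" and g: "g \<in> L2 M" and h: "h \<in> L2 M"
  and lim: "(\<lambda>n. nsq M (\<lambda>x. s n x - g x)) \<longlonglongrightarrow> 0"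
  shows "(\<lambda>n. nsq M (\<lambda>x. s n x - h x)) \<longlonglongrightarrow> nsq M (\<lambda>x. g x - h x)"
proof -
  have eq: "nsq M (\<lambda>x. s n x - h x)
      = nsq M (\<lambda>x. s n x - g x) + nsq M (\<lambda>x. g x - h x) + 2 * Re (ip M (s n) (\<lambda>x. g x - h x) - ip M g (\<lambda>x. g x - h x))" for n
    using nsq_add[OF L2_diff[OF s g] L2_diff[OF g h], of n]
    by (simp add: ip_diff_left s g h L2_diff)
  have "(\<lambda>n. nsq M (\<lambda>x. s n x - h x)) \<longlonglongrightarrow>
      0 + nsq M (\<lambda>x. g x - h x) + 2 * Re (ip M g (\<lambda>x. g x - h x) - ip M g (\<lambda>x. g x - h x))"
    unfolding eq by (intro tendsto_intros lim ip_tendsto s g L2_diff h)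
  then show ?thesis by simp
qed

section \<open>Total families and operators determined by Gram matrices\<close>

definition lincomb :: "(nat \<Rightarrow> 'a \<Rightarrow> complex) \<Rightarrow> (nat \<Rightarrow> complex) \<Rightarrow> nat \<Rightarrow> 'a \<Rightarrow> complex" where
  "lincomb a c n = (\<lambda>x. \<Sum>i<n. c i * a i x)"

lemma lincomb_L2: "(\<And>i. a i \<in> L2 M) \<Longrightarrow> lincomb a c n \<in> L2 M"
  unfolding lincomb_def by (intro L2_sum L2_scale) auto

lemma lincomb_mono: "n \<le> m \<Longrightarrow> lincomb a c n = lincomb a (\<lambda>i. if i < n then c i else 0) m"
proof -
  assume nm: "n \<le> m"
  have "(\<Sum>i<n. c i * a i x) = (\<Sum>i<m. (if i < n then c i else 0) * a i x)" for x
    by (rule sum.mono_neutral_cong_left) (use nm in auto)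
  then show ?thesis by (simp add: lincomb_def)
qed

lemma lincomb_combine:
  "\<exists>c'' n''. \<forall>a :: nat \<Rightarrow> 'a \<Rightarrow> complex. (\<lambda>x. u * lincomb a c n x + v * lincomb a c' n' x) = lincomb a c'' n''"
proof (intro exI allI)
  fix a :: "nat \<Rightarrow> 'a \<Rightarrow> complex"
  show "(\<lambda>x. u * lincomb a c n x + v * lincomb a c' n' x)
     = lincomb a (\<lambda>i. u * (if i < n then c i else 0) + v * (if i < n' then c' i else 0)) (max n n')"
    by (subst lincomb_mono[of n "max n n'"], simp, subst lincomb_mono[of n' "max n n'"], simp)
       (simp add: lincomb_def sum_distrib_left sum.distrib[symmetric] algebra_simps)
qed

lemma nsq_lincomb: assumes "\<And>i. a i \<in> L2 M"
  shows "complex_of_real (nsq M (lincomb a c n)) = (\<Sum>i<n. \<Sum>j<n. c i * cnj (c j) * ip M (a i) (a j))"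
  unfolding ip_self[symmetric] lincomb_def using assms
  by (simp add: ip_sum_left ip_sum_right L2_scale L2_sum ip_scale_left ip_scale_right
      sum_distrib_left mult.assoc mult.left_commute)

definition total :: "'a measure \<Rightarrow> (nat \<Rightarrow> 'a \<Rightarrow> complex) \<Rightarrow> bool" where
  "total M a \<longleftrightarrow> (\<forall>i. a i \<in> L2 M) \<and>
     (\<forall>f\<in>L2 M. (\<forall>i. ip M f (a i) = 0) \<longrightarrow> (AE x in M. f x = 0))"

text \<open>Nearest-point argument: a sequence of combinations minimizing the distance to
  \<open>f\<close> is Cauchy by the parallelogram law, and the error of its limit is orthogonal to
  every \<open>a j\<close>, hence zero by totality.\<close>

lemma total_approx:
  assumes tot: "total M a" and f: "f \<in> L2 M"
  shows "\<exists>c n. (\<lambda>t. nsq M (\<lambda>x. lincomb a (c t) (n t) x - f x)) \<longlonglongrightarrow> 0"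
proof -
  have a: "a i \<in> L2 M" for i using tot by (simp add: total_def)
  note lc = lincomb_L2[OF a]
  let ?d = "\<lambda>c n. nsq M (\<lambda>x. f x - lincomb a c n x)"
  define D where "D = Inf {?d c n |c n. True}"
  have bdd: "bdd_below {?d c n |c n. True}"
    by (rule bdd_belowI[of _ 0]) (auto simp: nsq_nonneg)
  have Dle: "D \<le> ?d c n" for c n
    unfolding D_def by (rule cInf_lower[OF _ bdd]) auto
  have "\<exists>cn. ?d (fst cn) (snd cn) < D + 1 / real (Suc t)" for t
  proof -
    have "D < D + 1 / real (Suc t)" by simp
    then obtain y where "y \<in> {?d c n |c n. True}" "y < D + 1 / real (Suc t)"
      unfolding D_def by (subst (asm) cInf_less_iff[OF _ bdd]) auto
    then show ?thesis by auto
  qed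
  then obtain cn where cn: "\<And>t. ?d (fst (cn t)) (snd (cn t)) < D + 1 / real (Suc t)" by metis
  define c where "c t = fst (cn t)" for t
  define n where "n t = snd (cn t)" for t
  define s where "s t = lincomb a (c t) (n t)" for t
  have sL: "s t \<in> L2 M" for t unfolding s_def by (rule lc)
  have sd: "nsq M (\<lambda>x. f x - s t x) < D + 1 / real (Suc t)" for t
    using cn[of t] by (simp add: s_def c_def n_def)
  have Cau: "nsq M (\<lambda>x. s t x - s u x) \<le> 2 / real (Suc t) + 2 / real (Suc u)" for t u
  proof -
    \<comment> \<open>The midpoint of two approximants is again a combination, so its squared
      distance is at least \<open>D\<close>; the parallelogram law then bounds their
      difference.\<close>
    obtain c'' n'' where mid: "(\<lambda>x. 1/2 * s t x + 1/2 * s u x) = lincomb a c'' n''"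
      using lincomb_combine[of "1/2" "c t" "n t" "1/2" "c u" "n u"] unfolding s_def by blast
    let ?p = "\<lambda>x. f x - s t x" and ?q = "\<lambda>x. f x - s u x"
    have pq: "?p \<in> L2 M" "?q \<in> L2 M" by (auto intro: L2_diff f sL)
    have "nsq M (\<lambda>x. ?p x + ?q x) = nsq M (\<lambda>x. 2 * (f x - lincomb a c'' n'' x))"
      unfolding mid[symmetric] by (rule arg_cong[where f="nsq M"]) (auto simp: algebra_simps)
    also have "\<dots> = 4 * ?d c'' n''" by (simp only: nsq_scale) simp
    finally have 1: "nsq M (\<lambda>x. ?p x + ?q x) \<ge> 4 * D" using Dle[of c'' n''] by linarith
    have "nsq M (\<lambda>x. ?p x - ?q x) = nsq M (\<lambda>x. s t x - s u x)"
      by (simp add: nsq_def norm_minus_commute)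
    moreover have "nsq M (\<lambda>x. ?p x + ?q x) + nsq M (\<lambda>x. ?p x - ?q x) = 2 * nsq M ?p + 2 * nsq M ?q"
      by (simp only: nsq_add[OF pq] nsq_diff[OF pq])
    ultimately show ?thesis using 1 sd[of t] sd[of u] by simp
  qed
  have "\<exists>g\<in>L2 M. (\<lambda>n. nsq M (\<lambda>x. s n x - g x)) \<longlonglongrightarrow> 0 \<and>
    (\<exists>r::nat \<Rightarrow> nat. strict_mono r \<and> (AE x in M. (\<lambda>k. s (r k) x) \<longlonglongrightarrow> g x))"
  proof (rule L2_complete[OF sL])
    fix e :: real assume "e > 0"
    then obtain N where N: "1 / real (Suc N) < e / 4" using nat_approx_posE[of "e/4"] by auto
    show "\<exists>N. \<forall>m\<ge>N. \<forall>n\<ge>N. nsq M (\<lambda>x. s m x - s n x) < e"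
    proof (intro exI[of _ N] allI impI)
      fix t u assume tu: "t \<ge> N" "u \<ge> N"
      have "1 / real (Suc t) \<le> 1 / real (Suc N)" "1 / real (Suc u) \<le> 1 / real (Suc N)"
        using tu by (auto intro!: divide_left_mono)
      then show "nsq M (\<lambda>x. s t x - s u x) < e" using Cau[of t u] N by simp
    qed
  qed
  then obtain g where g: "g \<in> L2 M" and lim: "(\<lambda>n. nsq M (\<lambda>x. s n x - g x)) \<longlonglongrightarrow> 0" by blast
  let ?u = "\<lambda>x. f x - g x"
  have u: "?u \<in> L2 M" by (intro L2_diff f g)
  have uD: "nsq M ?u \<le> D"
  proof (rule LIMSEQ_le)
    show "(\<lambda>t. nsq M (\<lambda>x. s t x - f x)) \<longlonglongrightarrow> nsq M ?u"
      using nsq_tendsto[OF sL g f lim] by (simp only: nsq_minus_commute[of M f g])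
    have "(\<lambda>t. D + 1 / real (Suc t)) \<longlonglongrightarrow> D + 0"
      by (intro tendsto_add tendsto_const lim_1_over_n LIMSEQ_Suc[of "\<lambda>n. 1 / real n", unfolded inverse_eq_divide])
    then show "(\<lambda>t. D + 1 / real (Suc t)) \<longlonglongrightarrow> D" by simp
    show "\<exists>N. \<forall>n\<ge>N. nsq M (\<lambda>x. s n x - f x) \<le> D + 1 / real (Suc n)"
      using sd by (auto simp: nsq_minus_commute[of M _ f] intro: less_imp_le)
  qed
  have "ip M ?u (a j) = 0" for j
  proof (rule ccontr)
    assume nz: "ip M ?u (a j) \<noteq> 0"
    \<comment> \<open>Moving the approximants by \<open>l\<close> along \<open>a j\<close> would
      push the squared distance below \<open>D\<close>: \<open>t\<close> is so small that the
      quadratic term of the change is at most half of the linear one.\<close>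
    define t where "t = 1 / (nsq M (a j) + 1)"
    have t: "t > 0" "t * nsq M (a j) < 1" using nsq_nonneg[of M "a j"] by (auto simp: t_def field_simps)
    define l where "l = of_real t * ip M ?u (a j)"
    have "D \<le> nsq M (\<lambda>x. s n' x - (f x - l * a j x))" for n'
    proof -
      have aj: "a j = lincomb a (\<lambda>i. if i = j then 1 else 0) (Suc j)"
        by (rule ext) (simp add: lincomb_def)
      obtain c'' n'' where cc: "(\<lambda>x. 1 * lincomb a (c n') (n n') x + l * lincomb a (\<lambda>i. if i = j then 1 else 0) (Suc j) x) = lincomb a c'' n''"
        using lincomb_combine by blast
      have "(\<lambda>x. s n' x + l * a j x) = lincomb a c'' n''"
        using cc unfolding aj[symmetric] s_def by simp
      then have "(\<lambda>x. f x - lincomb a c'' n'' x) = (\<lambda>x. (f x - l * a j x) - s n' x)"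
        by (auto simp: fun_eq_iff algebra_simps)
      then show ?thesis using Dle[of c'' n''] by (simp add: nsq_minus_commute[of M "s n'"])
    qed
    moreover have "(\<lambda>n'. nsq M (\<lambda>x. s n' x - (f x - l * a j x))) \<longlonglongrightarrow> nsq M (\<lambda>x. g x - (f x - l * a j x))"
      by (intro nsq_tendsto sL g lim L2_diff f L2_scale a)
    ultimately have "D \<le> nsq M (\<lambda>x. g x - (f x - l * a j x))"
      by (intro LIMSEQ_le_const) auto
    also have "\<dots> = nsq M (\<lambda>x. ?u x - l * a j x)"
      by (subst nsq_minus_commute) (simp add: algebra_simps)
    also have "\<dots> = nsq M ?u + (cmod l)\<^sup>2 * nsq M (a j) - 2 * Re (cnj l * ip M ?u (a j))"
      by (simp add: nsq_diff u L2_scale a nsq_scale ip_scale_right)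
    also have "cnj l * ip M ?u (a j) = of_real (t * (cmod (ip M ?u (a j)))\<^sup>2)"
      by (simp add: l_def mult.assoc mult.commute[of "cnj _"] mult_cnj_self)
    also have "(cmod l)\<^sup>2 = t * (t * (cmod (ip M ?u (a j)))\<^sup>2)"
      using t by (simp add: l_def norm_mult power_mult_distrib power2_eq_square)
    finally have "2 * (t * (cmod (ip M ?u (a j)))\<^sup>2) \<le> (t * nsq M (a j)) * (t * (cmod (ip M ?u (a j)))\<^sup>2)"
      using uD by (simp add: mult_ac)
    also have "\<dots> \<le> 1 * (t * (cmod (ip M ?u (a j)))\<^sup>2)"
      using t by (intro mult_right_mono) auto
    finally show False using t nz by simp
  qed
  then have "AE x in M. ?u x = 0" using tot u unfolding total_def by blast
  then have "nsq M ?u = 0" using nsq_eq_0_iff[OF u] by simp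
  then have "(\<lambda>n. nsq M (\<lambda>x. s n x - f x)) \<longlonglongrightarrow> 0"
    using nsq_tendsto[OF sL g f lim] by (simp add: nsq_minus_commute[of M g])
  then show ?thesis unfolding s_def by blast
qed

text \<open>Equal Gram matrices give combinations with equal coefficients the same norm. The
  coefficients that approximate \<open>f\<close> over \<open>a\<close> are therefore Cauchy over
  \<open>b\<close>, and the limit is the partner of \<open>f\<close>. Exchanging the two sides later
  gives surjectivity.\<close>

lemma match_vector:
  assumes tot: "total M a" and b: "\<And>i. b i \<in> L2 N"
  and Gram: "\<And>i j. ip M (a i) (a j) = ip N (b i) (b j)" and f: "f \<in> L2 M"
  shows "\<exists>g\<in>L2 N. (\<forall>j. ip N g (b j) = ip M f (a j)) \<and> nsq N g = nsq M f"
proof -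
  have a: "a i \<in> L2 M" for i using tot by (simp add: total_def)
  obtain c n where lim: "(\<lambda>t. nsq M (\<lambda>x. lincomb a (c t) (n t) x - f x)) \<longlonglongrightarrow> 0"
    using total_approx[OF tot f] by blast
  define s where "s t = lincomb a (c t) (n t)" for t
  define s' where "s' t = lincomb b (c t) (n t)" for t
  have sL: "s t \<in> L2 M" for t unfolding s_def by (rule lincomb_L2[OF a])
  have s'L: "s' t \<in> L2 N" for t unfolding s'_def by (rule lincomb_L2[OF b])
  have nsqeq: "nsq N (lincomb b d m) = nsq M (lincomb a d m)" for d m
  proof -
    have "complex_of_real (nsq N (lincomb b d m)) = complex_of_real (nsq M (lincomb a d m))"
      by (simp add: nsq_lincomb a b Gram)
    then show ?thesis unfolding of_real_eq_iff .
  qed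
  have dist: "nsq N (\<lambda>x. s' t x - s' u x) = nsq M (\<lambda>x. s t x - s u x)" for t u
  proof -
    have M: "(\<lambda>x. s t x - s u x) = lincomb a (\<lambda>i. (if i < n t then c t i else 0) - (if i < n u then c u i else 0)) (max (n t) (n u))"
      unfolding s_def by (subst lincomb_mono[of "n t" "max (n t) (n u)"], simp, subst lincomb_mono[of "n u" "max (n t) (n u)"], simp)
       (simp add: lincomb_def sum_subtractf[symmetric] algebra_simps)
    have N: "(\<lambda>x. s' t x - s' u x) = lincomb b (\<lambda>i. (if i < n t then c t i else 0) - (if i < n u then c u i else 0)) (max (n t) (n u))"
      unfolding s'_def by (subst lincomb_mono[of "n t" "max (n t) (n u)"], simp, subst lincomb_mono[of "n u" "max (n t) (n u)"], simp)
       (simp add: lincomb_def sum_subtractf[symmetric] algebra_simps)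
    show ?thesis unfolding M N by (rule nsqeq)
  qed
  have "\<exists>g\<in>L2 N. (\<lambda>n. nsq N (\<lambda>x. s' n x - g x)) \<longlonglongrightarrow> 0 \<and>
    (\<exists>r::nat \<Rightarrow> nat. strict_mono r \<and> (AE x in N. (\<lambda>k. s' (r k) x) \<longlonglongrightarrow> g x))"
  proof (rule L2_complete[OF s'L])
    fix e :: real assume "e > 0"
    then obtain K where "\<And>t. t \<ge> K \<Longrightarrow> norm (nsq M (\<lambda>x. lincomb a (c t) (n t) x - f x) - 0) < e / 4"
      using LIMSEQ_D[OF lim, of "e/4"] by auto
    then have K: "nsq M (\<lambda>x. s t x - f x) < e / 4" if "t \<ge> K" for t
      using that nsq_nonneg[of M "\<lambda>x. s t x - f x"] by (force simp: s_def)
    show "\<exists>K. \<forall>m\<ge>K. \<forall>n\<ge>K. nsq N (\<lambda>x. s' m x - s' n x) < e"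
    proof (intro exI[of _ K] allI impI)
      fix t u assume "t \<ge> K" "u \<ge> K"
      have "nsq M (\<lambda>x. (s t x - f x) + (f x - s u x)) \<le> 2 * nsq M (\<lambda>x. s t x - f x) + 2 * nsq M (\<lambda>x. f x - s u x)"
        by (intro nsq_add_le L2_diff sL f)
      then show "nsq N (\<lambda>x. s' t x - s' u x) < e"
        using K[OF \<open>t \<ge> K\<close>] K[OF \<open>u \<ge> K\<close>] by (simp add: dist nsq_minus_commute[of M f])
    qed
  qed
  then obtain g where g: "g \<in> L2 N" and lim': "(\<lambda>n. nsq N (\<lambda>x. s' n x - g x)) \<longlonglongrightarrow> 0" by blast
  have lim2: "(\<lambda>t. nsq M (\<lambda>x. s t x - f x)) \<longlonglongrightarrow> 0" using lim by (simp add: s_def)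
  have "ip N g (b j) = ip M f (a j)" for j
  proof -
    have "ip N (s' t) (b j) = ip M (s t) (a j)" for t
      unfolding s_def s'_def lincomb_def
      by (simp add: ip_sum_left L2_scale a b ip_scale_left Gram)
    then have "(\<lambda>t. ip M (s t) (a j)) \<longlonglongrightarrow> ip N g (b j)"
      using ip_tendsto[OF s'L g b[of j] lim'] by simp
    then show ?thesis using ip_tendsto[OF sL f a lim2] by (rule LIMSEQ_unique)
  qed
  moreover have "nsq N g = nsq M f"
  proof -
    have "(\<lambda>t. nsq N (s' t)) \<longlonglongrightarrow> nsq N g" using nsq_tendsto[OF s'L g L2_zero lim'] by simp
    moreover have "(\<lambda>t. nsq M (s t)) \<longlonglongrightarrow> nsq M f" using nsq_tendsto[OF sL f L2_zero lim2] by simp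
    moreover have "nsq N (s' t) = nsq M (s t)" for t unfolding s_def s'_def by (rule nsqeq)
    ultimately show ?thesis by (auto intro: LIMSEQ_unique)
  qed
  ultimately show ?thesis using g by blast
qed

lemma total_unique:
  assumes "total N b" "g \<in> L2 N" "g' \<in> L2 N" "\<And>j. ip N g (b j) = ip N g' (b j)"
  shows "AE x in N. g x = g' x"
proof -
  have "AE x in N. g x - g' x = 0"
    using assms L2_diff[OF assms(2,3)] ip_diff_left[OF assms(2,3)] unfolding total_def by auto
  then show ?thesis by simp
qed

text \<open>\<open>\<Phi>\<close> is any choice of partners. Linearity and surjectivity hold almost
  everywhere because a function is determined by its inner products with the total family
  \<open>b\<close>.\<close>

lemma unitary_from_Gram:
  assumes A: "total M a" and B: "total N b"
  and Gram: "\<And>i j. ip M (a i) (a j) = ip N (b i) (b j)"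
  shows "\<exists>\<Phi>. unitary_L2 M N \<Phi> \<and> (\<forall>f\<in>L2 M. \<forall>j. ip N (\<Phi> f) (b j) = ip M f (a j))"
proof -
  have a: "a i \<in> L2 M" for i using A by (simp add: total_def)
  have b: "b i \<in> L2 N" for i using B by (simp add: total_def)
  have "\<forall>f\<in>L2 M. \<exists>g. g \<in> L2 N \<and> (\<forall>j. ip N g (b j) = ip M f (a j)) \<and> nsq N g = nsq M f"
    using match_vector[OF A b Gram] by blast
  then obtain \<Phi> where \<Phi>: "\<And>f. f \<in> L2 M \<Longrightarrow> \<Phi> f \<in> L2 N"
    "\<And>f j. f \<in> L2 M \<Longrightarrow> ip N (\<Phi> f) (b j) = ip M f (a j)" "\<And>f. f \<in> L2 M \<Longrightarrow> nsq N (\<Phi> f) = nsq M f"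
    by metis
  have "unitary_L2 M N \<Phi>"
    unfolding unitary_L2_def
  proof (intro conjI ballI allI)
    fix f assume f: "f \<in> L2 M"
    show "\<Phi> f \<in> L2 N" by (rule \<Phi>(1)[OF f])
    show "(\<integral>y. (cmod (\<Phi> f y))\<^sup>2 \<partial>N) = (\<integral>x. (cmod (f x))\<^sup>2 \<partial>M)"
      using \<Phi>(3)[OF f] by (simp add: nsq_def)
    fix g u v assume g: "g \<in> L2 M"
    show "AE y in N. \<Phi> (\<lambda>x. u * f x + v * g x) y = u * \<Phi> f y + v * \<Phi> g y"
      by (rule total_unique[OF B])
        (auto intro!: \<Phi>(1) L2_add L2_scale f g simp: \<Phi>(2) ip_add_left ip_scale_left L2_add L2_scale f g a b \<Phi>(1))
  next
    fix g assume g: "g \<in> L2 N"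
    obtain f where f: "f \<in> L2 M" "\<And>j. ip M f (a j) = ip N g (b j)"
      using match_vector[OF B a Gram[symmetric] g] by blast
    have "AE y in N. \<Phi> f y = g y"
      by (rule total_unique[OF B]) (auto intro: \<Phi>(1) f g simp: \<Phi>(2) f)
    then show "\<exists>f\<in>L2 M. AE y in N. \<Phi> f y = g y" using f(1) by blast
  qed
  then show ?thesis using \<Phi>(2) by blast
qed

lemma sets_circle_borel: "A \<in> sets circle_borel \<Longrightarrow> A \<in> sets borel"
  unfolding circle_borel_def by (subst (asm) sets_restrict_space_iff) auto

lemma space_circle_borel [simp]: "space circle_borel = sphere 0 1"
  by (simp add: circle_borel_def)

lemma borel_measurable_circle:
  assumes "f \<in> borel_measurable borel" "sets \<mu> = sets circle_borel"
  shows "f \<in> borel_measurable \<mu>"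
  unfolding measurable_cong_sets[OF assms(2) refl] circle_borel_def
  by (rule measurable_restrict_space1) fact

lemma continuous_measurable_circle:
  assumes "continuous_on (sphere 0 1) f" "sets \<mu> = sets circle_borel"
  shows "f \<in> borel_measurable \<mu>"
  unfolding measurable_cong_sets[OF assms(2) refl] circle_borel_def
  using assms(1) by (intro borel_measurable_continuous_on_restrict)

lemma power_int_circle_measurable:
  assumes "sets \<mu> = sets circle_borel" shows "(\<lambda>z. z powi k) \<in> borel_measurable \<mu>"
  by (rule continuous_measurable_circle[OF _ assms]) (auto intro!: continuous_intros)

section \<open>Measures on the circle\<close>

text \<open>Trigonometric polynomials up to their values off the circle: \<open>cong\<close> makes
  \<open>cnj z\<close> and \<open>z powi (-1)\<close> interchangeable and admits functions given by
  squared moduli, such as the factors of a Riesz product.\<close>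

inductive trig :: "(complex \<Rightarrow> complex) \<Rightarrow> bool" where
  monom: "trig (\<lambda>z. c * z powi k)"
| add: "trig u \<Longrightarrow> trig v \<Longrightarrow> trig (\<lambda>z. u z + v z)"
| cong: "trig u \<Longrightarrow> (\<And>z. cmod z = 1 \<Longrightarrow> v z = u z) \<Longrightarrow> trig v"

lemma trig_monom_mult: "trig v \<Longrightarrow> trig (\<lambda>z. c * z powi k * v z)"
proof (induction rule: trig.induct)
  case (monom c' k')
  show ?case
  proof (rule trig.cong[OF trig.monom[of "c * c'" "k + k'"]])
    fix z :: complex assume "cmod z = 1"
    then have "z \<noteq> 0" by auto
    then show "c * z powi k * (c' * z powi k') = c * c' * z powi (k + k')"
      by (simp add: power_int_add)
  qed
next
  case (add u v)
  show ?case by (rule trig.cong[OF trig.add[OF add.IH]]) (auto simp: algebra_simps)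
next
  case (cong u v)
  show ?case by (rule trig.cong[OF cong.IH]) (auto simp: cong.hyps)
qed

lemma trig_mult: "trig u \<Longrightarrow> trig v \<Longrightarrow> trig (\<lambda>z. u z * v z)"
proof (induction rule: trig.induct)
  case (monom c k)
  then show ?case by (rule trig_monom_mult)
next
  case (add u u')
  show ?case by (rule trig.cong[OF trig.add[OF add.IH(1)[OF add.prems] add.IH(2)[OF add.prems]]]) (auto simp: algebra_simps)
next
  case (cong u u')
  show ?case by (rule trig.cong[OF cong.IH[OF cong.prems]]) (auto simp: cong.hyps)
qed

lemma Re_Im_linear:
  "complex_of_real (Re z * u + Im z * v) = (u - \<i> * v)/2 * z + (u + \<i> * v)/2 * cnj z"
proof -
  have "(u - \<i> * v)/2 * z + (u + \<i> * v)/2 * cnj z = u * (z + cnj z) / 2 - \<i> * v * (z - cnj z) / 2"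
    by (simp only: ring_distribs diff_divide_distrib add_divide_distrib times_divide_eq_left) simp
  also have "\<dots> = complex_of_real (Re z * u + Im z * v)"
    by (simp add: complex_add_cnj complex_diff_cnj) (simp add: complex_eq_iff)
  finally show ?thesis by simp
qed

text \<open>On the circle \<open>cnj z\<close> is the inverse of \<open>z\<close>, so both
  coordinates are trigonometric polynomials. This connects the theorem of Stone and Weierstrass for
  real polynomials with Fourier coefficients.\<close>

lemma trig_polynomial: "real_polynomial_function p \<Longrightarrow> trig (\<lambda>z. complex_of_real (p z))"
proof (induction rule: real_polynomial_function.induct)
  case (linear f)
  interpret bounded_linear f by fact
  have f: "f z = Re z * f 1 + Im z * f \<i>" for z
  proof -
    have "z = Re z *\<^sub>R 1 + Im z *\<^sub>R \<i>" by (simp add: complex_eq_iff)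
    then have "f z = f (Re z *\<^sub>R 1 + Im z *\<^sub>R \<i>)" by (rule arg_cong)
    then show ?thesis by (simp only: add scaleR real_scaleR_def)
  qed
  show ?case
  proof (rule trig.cong[OF trig.add[OF trig.monom[of "(f 1 - \<i> * f \<i>)/2" 1] trig.monom[of "(f 1 + \<i> * f \<i>)/2" "-1"]]])
    fix z :: complex assume z: "cmod z = 1"
    have "z * cnj z = 1" using z by (simp add: complex_mult_cnj cmod_def)
    then have inv: "z powi (-1) = cnj z" by (simp add: power_int_minus inverse_unique)
    show "complex_of_real (f z) = (f 1 - \<i> * f \<i>)/2 * z powi 1 + (f 1 + \<i> * f \<i>)/2 * z powi (-1)"
      unfolding f[of z] inv power_int_1_right by (rule Re_Im_linear)
  qed
next
  case (const c)
  show ?case using trig.monom[of "complex_of_real c" 0] by simp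
next
  case (add f g)
  then show ?case using trig.add by simp
next
  case (mult f g)
  then show ?case using trig_mult by simp
qed

lemma trig_bounded: "trig u \<Longrightarrow> \<exists>B. \<forall>z. cmod z = 1 \<longrightarrow> cmod (u z) \<le> B"
proof (induction rule: trig.induct)
  case (monom c k)
  show ?case by (intro exI[of _ "cmod c"]) (auto simp: norm_mult norm_power_int)
next
  case (add u v)
  then obtain B C where "\<forall>z. cmod z = 1 \<longrightarrow> cmod (u z) \<le> B" "\<forall>z. cmod z = 1 \<longrightarrow> cmod (v z) \<le> C" by blast
  then show ?case by (intro exI[of _ "B + C"]) (auto intro: norm_triangle_le add_mono)
qed auto

lemma trig_measurable: "trig u \<Longrightarrow> sets \<mu> = sets circle_borel \<Longrightarrow> u \<in> borel_measurable \<mu>"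
proof (induction rule: trig.induct)
  case (monom c k)
  show ?case by (intro borel_measurable_times borel_measurable_const power_int_circle_measurable monom)
next
  case (cong u v)
  have sp: "space \<mu> = sphere 0 1" using sets_eq_imp_space_eq[OF cong.prems] by simp
  show ?case using cong sp by (subst measurable_cong[of \<mu> v u]) auto
qed auto

lemma trig_integrable: assumes "trig u" "sets \<mu> = sets circle_borel" "finite_measure \<mu>"
  shows "integrable \<mu> u"
proof -
  interpret finite_measure \<mu> by fact
  obtain B where "\<forall>z. cmod z = 1 \<longrightarrow> cmod (u z) \<le> B" using trig_bounded[OF assms(1)] by blast
  then show ?thesis using sets_eq_imp_space_eq[OF assms(2)]
    by (intro integrable_const_bound[of _ B] trig_measurable assms AE_I2) auto
qed

text \<open>Equality spreads from powers to trigonometric polynomials, by uniform approximation to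
  continuous functions, by distance cut-offs to closed sets, and from these to Borel sets, since
  closed sets are stable under intersection and generate.\<close>

lemma circle_measure_eqI:
  assumes fin: "finite_measure \<mu>" "finite_measure \<nu>"
  and sets: "sets \<mu> = sets circle_borel" "sets \<nu> = sets circle_borel"
  and eq: "\<And>k::int. (\<integral>z. z powi k \<partial>\<mu>) = (\<integral>z. z powi k \<partial>\<nu>)"
  shows "\<mu> = \<nu>"
proof -
  have sp: "space \<mu> = sphere 0 1" "space \<nu> = sphere 0 1"
    using sets_eq_imp_space_eq[OF sets(1)] sets_eq_imp_space_eq[OF sets(2)] by auto
  have trig_eq: "integral\<^sup>L \<mu> u = integral\<^sup>L \<nu> u" if "trig u" for u
    using that
  proof (induction rule: trig.induct)
    case (monom c k) show ?case by (simp add: eq)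
  next
    case (add u v)
    then show ?case using trig_integrable sets fin by (simp add: Bochner_Integration.integral_add)
  next
    case (cong u v)
    have "integral\<^sup>L \<mu> v = integral\<^sup>L \<mu> u" "integral\<^sup>L \<nu> v = integral\<^sup>L \<nu> u"
      using sp by (auto intro!: Bochner_Integration.integral_cong simp: cong.hyps)
    then show ?case using cong.IH by simp
  qed
  have cont_eq: "integral\<^sup>L \<mu> g = integral\<^sup>L \<nu> g" if g: "continuous_on (sphere 0 1) g" for g :: "complex \<Rightarrow> real"
  proof -
    have ig: "integrable \<kappa> g" if "finite_measure \<kappa>" "sets \<kappa> = sets circle_borel" for \<kappa>
    proof -
      interpret finite_measure \<kappa> by fact
      have "compact (g ` sphere 0 1)" by (intro compact_continuous_image g compact_sphere)
      then have "bounded (g ` sphere 0 1)" by (rule compact_imp_bounded)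
      then obtain B where "\<forall>z\<in>sphere 0 1. norm (g z) \<le> B"
        unfolding bounded_iff by blast
      then show ?thesis using sets_eq_imp_space_eq[OF that(2)]
        by (intro integrable_const_bound[of _ B] continuous_measurable_circle g that AE_I2) auto
    qed
    have bound: "\<bar>integral\<^sup>L \<kappa> g - integral\<^sup>L \<kappa> p\<bar> \<le> e * measure \<kappa> (space \<kappa>)"
      if "finite_measure \<kappa>" "sets \<kappa> = sets circle_borel" "real_polynomial_function p"
        "\<And>z. z \<in> sphere 0 1 \<Longrightarrow> \<bar>g z - p z\<bar> < e" for \<kappa> p e
    proof -
      interpret finite_measure \<kappa> by fact
      have ip: "integrable \<kappa> p"
        using trig_integrable[OF trig_polynomial[OF that(3)] that(2,1)]
        by (simp only: complex_of_real_integrable_eq)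
      have "\<bar>integral\<^sup>L \<kappa> g - integral\<^sup>L \<kappa> p\<bar> = \<bar>\<integral>z. g z - p z \<partial>\<kappa>\<bar>"
        using ig[OF that(1,2)] ip by simp
      also have "\<dots> \<le> (\<integral>z. \<bar>g z - p z\<bar> \<partial>\<kappa>)" by (rule integral_abs_bound)
      also have "\<dots> \<le> (\<integral>z. e \<partial>\<kappa>)"
        using ig[OF that(1,2)] ip that(4) sets_eq_imp_space_eq[OF that(2)]
        by (intro integral_mono) (auto intro: less_imp_le)
      finally show ?thesis by (simp add: mult.commute)
    qed
    have "\<bar>integral\<^sup>L \<mu> g - integral\<^sup>L \<nu> g\<bar> \<le> e" if "e > 0" for e
    proof -
      \<comment> \<open>The summand 1 keeps the divisor positive when both measures vanish.\<close>
      define K where "K = measure \<mu> (space \<mu>) + measure \<nu> (space \<nu>) + 1"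
      have K: "K > 0" by (simp add: K_def add_nonneg_pos)
      obtain p where p: "real_polynomial_function p" "\<And>z. z \<in> sphere 0 1 \<Longrightarrow> \<bar>g z - p z\<bar> < e / K"
        using Stone_Weierstrass_real_polynomial_function[OF compact_sphere g, of "e / K"] K \<open>e > 0\<close> by auto
      have "complex_of_real (integral\<^sup>L \<mu> p) = complex_of_real (integral\<^sup>L \<nu> p)"
        using trig_eq[OF trig_polynomial[OF p(1)]] by simp
      then have "integral\<^sup>L \<mu> p = integral\<^sup>L \<nu> p" by simp
      then have "\<bar>integral\<^sup>L \<mu> g - integral\<^sup>L \<nu> g\<bar> \<le> e / K * measure \<mu> (space \<mu>) + e / K * measure \<nu> (space \<nu>)"
        using bound[OF fin(1) sets(1) p] bound[OF fin(2) sets(2) p] by linarith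
      also have "\<dots> = e * ((K - 1) / K)" by (simp add: K_def add_divide_distrib distrib_left)
      also have "\<dots> \<le> e * 1" using K \<open>e > 0\<close> by (intro mult_left_mono) auto
      finally show ?thesis by simp
    qed
    then have "\<bar>integral\<^sup>L \<mu> g - integral\<^sup>L \<nu> g\<bar> \<le> 0" by (rule field_le_epsilon) simp
    then show ?thesis by simp
  qed
  have closed_eq: "emeasure \<mu> (C \<inter> sphere 0 1) = emeasure \<nu> (C \<inter> sphere 0 1)" if C: "closed C" for C :: "complex set"
  proof (cases "C = {}")
    case False
    define g where "g n z = max 0 (1 - real n * infdist z C)" for n z
    have gc: "continuous_on S (g n)" for n S unfolding g_def by (intro continuous_intros)
    have lim: "(\<lambda>n. integral\<^sup>L \<kappa> (g n)) \<longlonglongrightarrow> (\<integral>z. indicator C z \<partial>\<kappa>)"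
      if "finite_measure \<kappa>" "sets \<kappa> = sets circle_borel" for \<kappa>
    proof (rule integral_dominated_convergence[where w="\<lambda>_. 1"])
      interpret finite_measure \<kappa> by fact
      show "(\<lambda>z. indicator C z :: real) \<in> borel_measurable \<kappa>"
        using C by (intro borel_measurable_circle[OF _ that(2)]) auto
      show "integrable \<kappa> (\<lambda>_. 1::real)" by simp
      show "\<And>n. g n \<in> borel_measurable \<kappa>" by (intro continuous_measurable_circle gc that)
      show "AE z in \<kappa>. (\<lambda>n. g n z) \<longlonglongrightarrow> indicator C z"
      proof (rule AE_I2)
        fix z show "(\<lambda>n. g n z) \<longlonglongrightarrow> indicator C z"
        proof (cases "z \<in> C")
          case True then show ?thesis by (simp add: g_def)
        next
          case z: False
          then have pos: "infdist z C > 0"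
            using C False infdist_pos_not_in_closed by auto
          obtain N where N: "real N * infdist z C > 1"
            using reals_Archimedean3[OF pos] by blast
          have "\<forall>\<^sub>F n in sequentially. g n z = 0"
            using eventually_ge_at_top[of N]
          proof eventually_elim
            case (elim n)
            have "real N * infdist z C \<le> real n * infdist z C" using elim pos by (intro mult_right_mono) auto
            then show ?case using N by (simp add: g_def)
          qed
          then show ?thesis using z by (simp add: tendsto_eventually)
        qed
      qed
      show "AE z in \<kappa>. norm (g n z) \<le> 1" for n by (auto simp: g_def infdist_nonneg)
    qed
    have "(\<integral>z. indicator C z \<partial>\<mu>) = (\<integral>z. indicator C z \<partial>\<nu> :: real)"
      using lim[OF fin(1) sets(1)] lim[OF fin(2) sets(2)] cont_eq[OF gc] by (auto intro: LIMSEQ_unique)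
    then have "measure \<mu> (C \<inter> sphere 0 1) = measure \<nu> (C \<inter> sphere 0 1)"
      by (simp add: sp)
    then show ?thesis using fin by (simp add: finite_measure.emeasure_eq_measure)
  qed simp
  \<comment> \<open>Both measures are carried to the Borel sets of the plane, where the closed sets
    are a generator.\<close>
  define \<mu>' where "\<mu>' = distr \<mu> borel (\<lambda>z. z)"
  define \<nu>' where "\<nu>' = distr \<nu> borel (\<lambda>z. z)"
  have m: "(\<lambda>z. z) \<in> measurable \<mu> borel" "(\<lambda>z. z) \<in> measurable \<nu> borel"
    using borel_measurable_circle[of "\<lambda>z. z"] sets by auto
  have em: "emeasure \<mu>' A = emeasure \<mu> (A \<inter> sphere 0 1)" "emeasure \<nu>' A = emeasure \<nu> (A \<inter> sphere 0 1)"
    if "A \<in> sets borel" for A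
    using that m by (simp_all add: \<mu>'_def \<nu>'_def emeasure_distr sp)
  have "\<mu>' = \<nu>'"
  proof (rule measure_eqI_generator_eq[where \<Omega>=UNIV and E="Collect closed" and A="\<lambda>_. UNIV"])
    show "Int_stable (Collect closed)" by (auto simp: Int_stable_def)
    show "sets \<mu>' = sigma_sets UNIV (Collect closed)" "sets \<nu>' = sigma_sets UNIV (Collect closed)"
      by (simp_all add: \<mu>'_def \<nu>'_def borel_eq_closed)
    show "\<And>X. X \<in> Collect closed \<Longrightarrow> emeasure \<mu>' X = emeasure \<nu>' X"
      using closed_eq by (auto simp: em)
    show "\<And>i::nat. emeasure \<mu>' UNIV \<noteq> \<infinity>"
      using fin(1) by (simp add: em sp(1)[symmetric] finite_measure.emeasure_finite)
  qed auto
  show ?thesis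
  proof (rule measure_eqI)
    fix A assume A: "A \<in> sets \<mu>"
    then have "A \<in> sets borel" "A \<inter> sphere 0 1 = A"
      using sets_circle_borel sets sets.sets_into_space[OF A] sp by auto
    then show "emeasure \<mu> A = emeasure \<nu> A" using em[of A] \<open>\<mu>' = \<nu>'\<close> by simp
  qed (simp add: sets)
qed

section \<open>Fourier coefficients of Lebesgue measure and the theorem of Herglotz\<close>

lemma cis_measurable [measurable]: "(\<lambda>t. cis (c * t)) \<in> borel_measurable borel"
  by (intro borel_measurable_continuous_onI continuous_intros)

lemma integral_cis:
  "(\<integral>t. indicator {0..<2*pi} t *\<^sub>R cis (of_int m * t) \<partial>lborel) = (if m = 0 then 2 * pi else 0)"
proof -
  have eq: "(\<integral>t. indicator {0..<2*pi} t *\<^sub>R cis (of_int m * t) \<partial>lborel)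
      = (\<integral>t. indicator {0..2*pi} t *\<^sub>R cis (of_int m * t) \<partial>lborel)"
  proof (rule integral_cong_AE)
    show "AE t in lborel. indicator {0..<2*pi} t *\<^sub>R cis (of_int m * t) = indicator {0..2*pi} t *\<^sub>R cis (of_int m * t)"
      using AE_lborel_singleton[of "2*pi"] by eventually_elim (auto simp: indicator_def)
  qed measurable
  show ?thesis
  proof (cases "m = 0")
    case True
    then show ?thesis by (simp add: eq scaleR_conv_of_real)
  next
    case False
    define F where "F t = cis (of_int m * t) / (\<i> * of_int m)" for t
    have "(F has_vector_derivative cis (of_int m * t)) (at t within A)" for t A
    proof -
      have "((\<lambda>z. exp (\<i> * of_int m * z) / (\<i> * of_int m)) has_field_derivative exp (\<i> * of_int m * of_real t)) (at (of_real t))"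
        using False by (auto intro!: derivative_eq_intros)
      from has_vector_derivative_real_field[OF this, of A] show ?thesis
        by (simp add: F_def[abs_def] cis_conv_exp mult_ac)
    qed
    then have "has_bochner_integral lborel (\<lambda>t. indicator {0..2*pi} t *\<^sub>R cis (of_int m * t)) (F (2*pi) - F 0)"
      by (intro has_bochner_integral_FTC_Icc) (auto intro!: continuous_intros)
    moreover have "F (2*pi) = F 0"
      using cis_multiple_2pi[of "of_int m"] by (simp add: F_def mult.commute)
    ultimately show ?thesis using False by (simp add: eq has_bochner_integral_integral_eq)
  qed
qed

lemma sets_circle_lebesgue [simp]: "sets circle_lebesgue = sets circle_borel"
  by (simp add: circle_lebesgue_def)

lemma circle_lebesgue_integral:
  fixes f :: "complex \<Rightarrow> 'b::{banach, second_countable_topology}"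
  assumes "f \<in> borel_measurable circle_borel"
  shows "integral\<^sup>L circle_lebesgue f = (\<integral>t. indicator {0..<2*pi} t *\<^sub>R f (cis t) \<partial>lborel)"
  unfolding circle_lebesgue_def
  by (subst integral_distr[OF measurable_cis_circle assms]) (simp add: integral_restrict_space)

text \<open>The measure is not normalized; its mass \<open>2 * pi\<close> is the source of this
  factor in all moments of Riesz products below.\<close>

lemma circle_lebesgue_powi:
  "(\<integral>z. z powi k \<partial>circle_lebesgue) = (if k = 0 then 2 * pi else 0)"
  using integral_cis[of k]
  by (subst circle_lebesgue_integral[OF power_int_circle_measurable]) (simp_all add: cis_power_int)

lemma finite_circle_lebesgue: "finite_measure circle_lebesgue"
proof (rule finite_measureI)
  let ?R = "restrict_space lborel {0..<2 * pi}"
  have "emeasure circle_lebesgue (space circle_lebesgue) = emeasure ?R (cis -` space circle_borel \<inter> space ?R)"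
    unfolding circle_lebesgue_def by (simp only: space_distr emeasure_distr[OF measurable_cis_circle sets.top])
  also have "cis -` space circle_borel \<inter> space ?R = {0..<2 * pi}"
    using measurable_space[OF measurable_cis_circle] by (auto simp: space_restrict_space)
  also have "emeasure ?R {0..<2 * pi} = ennreal (2 * pi)" by (subst emeasure_restrict_space) auto
  finally show "emeasure circle_lebesgue (space circle_lebesgue) \<noteq> \<infinity>" by simp
qed

lemma card_int_diff_eq: "card {(k, l). k < N \<and> l < N \<and> int k - int l = j} = N - nat \<bar>j\<bar>"
proof (cases "j \<ge> 0")
  case True
  have "{(k, l). k < N \<and> l < N \<and> int k - int l = j} = (\<lambda>l. (l + nat j, l)) ` {..<N - nat j}"
    using True by (auto simp: image_iff)
  then show ?thesis using True by (simp add: card_image inj_on_def)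
next
  case False
  have "{(k, l). k < N \<and> l < N \<and> int k - int l = j} = (\<lambda>k. (k, k + nat (-j))) ` {..<N - nat (-j)}"
    using False by (auto simp: image_iff)
  then show ?thesis using False by (simp add: card_image inj_on_def)
qed

text \<open>Fejer means: the assumption makes \<open>D N\<close> a nonnegative density on the
  interval from 0 to \<open>2 * pi\<close>, with the coefficients of \<open>\<phi>\<close> damped by
  1 - |j| / (N + 1). The resulting measures on the line are tight, and a weak limit, wrapped around
  the circle, has the coefficients \<open>\<phi>\<close>.\<close>

lemma Herglotz:
  fixes \<phi> :: "int \<Rightarrow> complex"
  assumes pd: "\<And>N z. cmod z = 1 \<Longrightarrow>
    \<exists>x\<ge>0. (\<Sum>k<N. \<Sum>l<N. \<phi> (int k - int l) * z powi (int l - int k)) = complex_of_real x"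
  and one: "\<phi> 0 = 1"
  shows "\<exists>\<sigma>. prob_space \<sigma> \<and> sets \<sigma> = sets circle_borel \<and> (\<forall>k. (\<integral>z. z powi k \<partial>\<sigma>) = \<phi> k)"
proof -
  define P where "P N z = (\<Sum>k<N. \<Sum>l<N. \<phi> (int k - int l) * z powi (int l - int k))" for N z
  define D where "D N t = indicator {0..<2*pi} t * (Re (P (Suc N) (cis t)) / (2 * pi * Suc N))" for N t
  have P: "P N (cis t) = complex_of_real (Re (P N (cis t)))" "Re (P N (cis t)) \<ge> 0" for N t
    using pd[of "cis t" N, folded P_def] by auto
  have Pcis: "P N (cis t) = (\<Sum>k<N. \<Sum>l<N. \<phi> (int k - int l) * cis (of_int (int l - int k) * t))" for N t
    by (simp add: P_def cis_power_int)
  have Pm: "(\<lambda>t. P N (cis t)) \<in> borel_measurable borel" for N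
    unfolding Pcis by (intro borel_measurable_continuous_onI continuous_intros)
  have Dm[measurable]: "D N \<in> borel_measurable borel" for N
  proof -
    have "(\<lambda>t. Re (P (Suc N) (cis t))) \<in> borel_measurable borel"
      by (rule measurable_compose[OF Pm borel_measurable_Re])
    then show ?thesis unfolding D_def by measurable
  qed
  have D0: "D N t \<ge> 0" for N t using P(2) by (simp add: D_def)
  \<comment> \<open>Of the (N + 1)^2 exponentials only those with \<open>int k - int l = j\<close>
    survive the integration; \<open>card_int_diff_eq\<close> counts them.\<close>
  have coef: "(\<integral>t. D N t *\<^sub>R cis (of_int j * t) \<partial>lborel) = \<phi> j * of_real (real (Suc N - nat \<bar>j\<bar>) / real (Suc N))" for N j
  proof -
    let ?N = "Suc N"
    have int: "integrable lborel (\<lambda>t. indicator {0..<2*pi} t *\<^sub>R cis (of_int m * t))" for m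
    proof (rule integrableI_bounded_set[where A="{0..<2*pi}" and B=1])
      show "(\<lambda>t. indicator {0..<2*pi} t *\<^sub>R cis (of_int m * t)) \<in> borel_measurable lborel"
        by measurable
    qed (auto simp: indicator_def)
    have "D N t *\<^sub>R cis (of_int j * t) = (\<Sum>k<?N. \<Sum>l<?N. \<phi> (int k - int l) / (2 * pi * ?N) *
        (indicator {0..<2*pi} t *\<^sub>R cis (of_int (j + int l - int k) * t)))" for t
    proof -
      have "D N t *\<^sub>R cis (of_int j * t) = indicator {0..<2*pi} t *\<^sub>R (P ?N (cis t) * cis (of_int j * t) / (2 * pi * ?N))"
        by (subst P(1)) (simp add: D_def scaleR_conv_of_real)
      also have "P ?N (cis t) * cis (of_int j * t) = (\<Sum>k<?N. \<Sum>l<?N. \<phi> (int k - int l) * cis (of_int (j + int l - int k) * t))"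
        unfolding Pcis sum_distrib_right
        by (intro sum.cong refl) (simp add: mult.assoc cis_mult algebra_simps)
      also have "indicator {0..<2*pi} t *\<^sub>R (\<dots> / (2 * pi * ?N)) = (\<Sum>k<?N. \<Sum>l<?N. \<phi> (int k - int l) / (2 * pi * ?N) *
        (indicator {0..<2*pi} t *\<^sub>R cis (of_int (j + int l - int k) * t)))"
        unfolding sum_divide_distrib scaleR_sum_right
        by (intro sum.cong refl) (simp add: scaleR_conv_of_real)
      finally show ?thesis .
    qed
    then have "(\<integral>t. D N t *\<^sub>R cis (of_int j * t) \<partial>lborel) = (\<Sum>k<?N. \<Sum>l<?N. \<phi> (int k - int l) / (2 * pi * ?N) *
        (if j + int l - int k = 0 then 2 * pi else 0))"
      by (simp only: Bochner_Integration.integral_sum integrable_mult_right int Bochner_Integration.integrable_sum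
          integral_mult_right_zero integral_cis) 
    also have "\<dots> = (\<Sum>k<?N. \<Sum>l<?N. if int k - int l = j then \<phi> j / ?N else 0)"
      by (intro sum.cong refl) auto
    also have "\<dots> = (\<Sum>p\<in>{..<?N} \<times> {..<?N}. if int (fst p) - int (snd p) = j then \<phi> j / ?N else 0)"
      by (subst sum.cartesian_product) (simp add: case_prod_beta del: sum.lessThan_Suc lessThan_Suc)
    also have "\<dots> = (\<Sum>p\<in>{(k, l). k < ?N \<and> l < ?N \<and> int k - int l = j}. \<phi> j / ?N)"
      by (subst sum.inter_filter[symmetric]) (auto intro!: sum.cong simp del: sum_constant)
    also have "\<dots> = \<phi> j * of_real (real (Suc N - nat \<bar>j\<bar>) / real (Suc N))"
      by (simp add: card_int_diff_eq del: of_nat_Suc)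
    finally show ?thesis .
  qed
  define \<mu> where "\<mu> N = density lborel (\<lambda>t. ennreal (D N t))" for N
  have int\<mu>: "(\<integral>t. cis (of_int j * t) \<partial>\<mu> N) = \<phi> j * of_real (real (Suc N - nat \<bar>j\<bar>) / real (Suc N))" for N j
    unfolding \<mu>_def using coef[of N j] D0
    by (subst integral_density) auto
  have mass: "emeasure (\<mu> N) UNIV = 1" "AE t in \<mu> N. t \<in> {0..<2*pi}" for N
  proof -
    have "integrable lborel (D N)"
    proof (rule integrableI_bounded_set[where A="{0..<2*pi}" and B="(\<Sum>k<Suc N. \<Sum>l<Suc N. cmod (\<phi> (int k - int l))) / (2 * pi * Suc N)"])
      show "AE t in lborel. t \<in> {0..<2*pi} \<longrightarrow> norm (D N t) \<le> (\<Sum>k<Suc N. \<Sum>l<Suc N. cmod (\<phi> (int k - int l))) / (2 * pi * Suc N)"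
      proof (intro AE_I2 impI)
        fix t assume "t \<in> {0..<2*pi}"
        have "Re (P (Suc N) (cis t)) \<le> cmod (P (Suc N) (cis t))" by (rule complex_Re_le_cmod)
        also have "\<dots> \<le> (\<Sum>k<Suc N. \<Sum>l<Suc N. cmod (\<phi> (int k - int l)))"
          unfolding Pcis by (intro order_trans[OF norm_sum] sum_mono) (simp add: norm_mult)
        finally show "norm (D N t) \<le> (\<Sum>k<Suc N. \<Sum>l<Suc N. cmod (\<phi> (int k - int l))) / (2 * pi * Suc N)"
          using P(2)[of "Suc N" t] \<open>t \<in> {0..<2*pi}\<close>
          by (auto simp: D_def simp del: sum.lessThan_Suc intro!: divide_right_mono)
      qed
    qed (auto simp: D_def)
    then have "emeasure (\<mu> N) UNIV = ennreal (\<integral>t. D N t \<partial>lborel)"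
      unfolding \<mu>_def using D0 by (subst emeasure_density) (auto intro!: nn_integral_eq_integral)
    also have "complex_of_real (\<integral>t. D N t \<partial>lborel) = 1"
      using coef[of N 0] unfolding integral_complex_of_real[symmetric] by (simp add: scaleR_conv_of_real one)
    then have "(\<integral>t. D N t \<partial>lborel) = 1" by simp
    finally show "emeasure (\<mu> N) UNIV = 1" by simp
    show "AE t in \<mu> N. t \<in> {0..<2*pi}"
      unfolding \<mu>_def using AE_I2[of lborel "\<lambda>t. 0 < ennreal (D N t) \<longrightarrow> t \<in> {0..<2*pi}"]
      by (subst AE_density, measurable) (auto simp: D_def indicator_def split: if_splits)
  qed
  have rd: "real_distribution (\<mu> N)" for N
    unfolding real_distribution_def real_distribution_axioms_def
    using mass(1)[of N] by (auto intro!: prob_spaceI simp: \<mu>_def)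
  have "tight \<mu>"
    unfolding tight_def
  proof (intro conjI allI impI rd)
    fix e :: real assume "e > 0"
    show "\<exists>a b. a < b \<and> (\<forall>n. 1 - e < measure (\<mu> n) {a<..b})"
    proof (rule exI[of _ "-1"], rule exI[of _ "2*pi"], intro conjI allI)
      show "-1 < 2*pi" using pi_gt_zero by linarith
      fix N interpret real_distribution "\<mu> N" by (rule rd)
      have "AE t in \<mu> N. t \<in> {-1<..2*pi}" using mass(2)[of N] by eventually_elim auto
      then have "prob {-1<..2*pi} = 1" by (subst prob_eq_1) auto
      then show "1 - e < measure (\<mu> N) {-1<..2*pi}" using \<open>e > 0\<close> by simp
    qed
  qed
  from tight_imp_convergent_subsubsequence[OF this strict_mono_id]
  obtain r M where r: "strict_mono (r :: nat \<Rightarrow> nat)" and M: "real_distribution M"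
    and wc: "weak_conv_m (\<mu> \<circ> id \<circ> r) M" by blast
  have isCont: "isCont (\<lambda>t. cis (of_int j * t)) t" for j :: int and t
  proof -
    have "continuous_on UNIV (\<lambda>t. cis (of_int j * t))" by (intro continuous_intros)
    then show ?thesis by (simp add: continuous_on_eq_continuous_at)
  qed
  have limM: "(\<integral>t. cis (of_int j * t) \<partial>M) = \<phi> j" for j
  proof -
    have "(\<lambda>n. integral\<^sup>L ((\<mu> \<circ> id \<circ> r) n) (\<lambda>t. cis (of_int j * t))) \<longlonglongrightarrow> (\<integral>t. cis (of_int j * t) \<partial>M)"
      by (rule weak_conv_imp_integral_bdd_continuous_conv[OF _ M wc, where B=1]) (auto simp: rd isCont)
    moreover have "(\<lambda>n. \<phi> j * of_real (real (Suc n - nat \<bar>j\<bar>) / real (Suc n))) \<longlonglongrightarrow> \<phi> j * of_real 1"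
    proof (intro tendsto_intros)
      have "(\<lambda>n. 1 - real (nat \<bar>j\<bar>) * (1 / real (Suc n))) \<longlonglongrightarrow> 1 - real (nat \<bar>j\<bar>) * 0"
        by (intro tendsto_intros LIMSEQ_Suc[OF lim_1_over_n])
      moreover have "\<forall>\<^sub>F n in sequentially. 1 - real (nat \<bar>j\<bar>) * (1 / real (Suc n)) = real (Suc n - nat \<bar>j\<bar>) / real (Suc n)"
        using eventually_ge_at_top[of "nat \<bar>j\<bar>"]
        by eventually_elim (simp add: of_nat_diff field_simps del: of_nat_Suc)
      ultimately show "(\<lambda>n. real (Suc n - nat \<bar>j\<bar>) / real (Suc n)) \<longlonglongrightarrow> 1"
        by (simp add: tendsto_cong)
    qed
    from LIMSEQ_subseq_LIMSEQ[OF this r]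
    have "(\<lambda>n. integral\<^sup>L ((\<mu> \<circ> id \<circ> r) n) (\<lambda>t. cis (of_int j * t))) \<longlonglongrightarrow> \<phi> j"
      by (simp add: int\<mu> o_def del: of_nat_Suc)
    ultimately show ?thesis by (rule LIMSEQ_unique)
  qed
  interpret M: real_distribution M by (rule M)
  \<comment> \<open>The limit may have mass at \<open>2 * pi\<close>, where the approximating
    densities vanish; \<open>cis\<close> folds this point onto the image of 0.\<close>
  have cism: "cis \<in> measurable M circle_borel"
    unfolding circle_borel_def
    using cis_measurable[of 1]
    by (intro measurable_restrict_space2) (auto simp: measurable_cong_sets[OF M.events_eq_borel refl])
  show ?thesis
  proof (intro exI[of _ "distr M circle_borel cis"] conjI allI)
    show "prob_space (distr M circle_borel cis)" by (rule M.prob_space_distr[OF cism])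
    fix k :: int
    show "(\<integral>z. z powi k \<partial>distr M circle_borel cis) = \<phi> k"
      by (subst integral_distr[OF cism power_int_circle_measurable]) (simp_all add: cis_power_int limM)
  qed simp
qed

section \<open>Spectral decomposition of a family of square-integrable functions\<close>

definition qform :: "(nat \<Rightarrow> nat \<Rightarrow> complex) \<Rightarrow> nat \<Rightarrow> (nat \<Rightarrow> complex) \<Rightarrow> complex" where
  "qform G n a = (\<Sum>i<n. \<Sum>j<n. a i * cnj (a j) * G i j)"

text \<open>Membership of the complex value in \<open>nonneg_Reals\<close> includes that it is real.
  For all complex vectors together this forces hermitian symmetry, which is therefore a
  lemma.\<close>

definition psd :: "(nat \<Rightarrow> nat \<Rightarrow> complex) \<Rightarrow> bool" where
  "psd G \<longleftrightarrow> (\<forall>n a. qform G n a \<in> nonneg_Reals)"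

lemma qform_pad: "n \<le> m \<Longrightarrow> qform G n a = qform G m (\<lambda>i. if i < n then a i else 0)"
proof -
  assume nm: "n \<le> m"
  have "(\<Sum>j<n. a i * cnj (a j) * G i j) = (\<Sum>j<m. a i * cnj (if j < n then a j else 0) * G i j)" for i
    by (rule sum.mono_neutral_cong_left) (use nm in auto)
  then have "qform G n a = (\<Sum>i<n. \<Sum>j<m. a i * cnj (if j < n then a j else 0) * G i j)"
    by (simp add: qform_def)
  also have "\<dots> = qform G m (\<lambda>i. if i < n then a i else 0)"
    unfolding qform_def by (rule sum.mono_neutral_cong_left) (use nm in \<open>auto intro!: sum.neutral\<close>)
  finally show ?thesis .
qed

lemma qform_two:
  assumes "i < n" "j < n"
  shows "qform G n (\<lambda>m. (if m = i then u else 0) + (if m = j then v else 0))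
    = u * cnj u * G i i + u * cnj v * G i j + v * cnj u * G j i + v * cnj v * G j j"
proof -
  have 1: "(\<Sum>l<n. x * cnj ((if l = i then u else 0) + (if l = j then v else 0)) * G m l)
     = x * cnj u * G m i + x * cnj v * G m j" for x m
  proof -
    have "(\<Sum>l<n. x * cnj ((if l = i then u else 0) + (if l = j then v else 0)) * G m l)
      = (\<Sum>l<n. (if l = i then x * cnj u * G m i else 0) + (if l = j then x * cnj v * G m j else 0))"
      by (intro sum.cong) (auto simp: algebra_simps)
    then show ?thesis using assms by (simp add: sum.distrib)
  qed
  have "qform G n (\<lambda>m. (if m = i then u else 0) + (if m = j then v else 0))
     = (\<Sum>m<n. (if m = i then u * cnj u * G i i + u * cnj v * G i j else 0)
             + (if m = j then v * cnj u * G j i + v * cnj v * G j j else 0))"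
    unfolding qform_def 1 by (intro sum.cong) (auto simp: algebra_simps)
  then show ?thesis using assms by (simp add: sum.distrib)
qed

lemma psd_two:
  "psd G \<Longrightarrow> u * cnj u * G i i + u * cnj v * G i j + v * cnj u * G j i + v * cnj v * G j j \<in> nonneg_Reals"
  using qform_two[of i "Suc (max i j)" j G u v, symmetric] by (simp add: psd_def)

lemma psd_diag: "psd G \<Longrightarrow> G i i \<in> nonneg_Reals"
  using psd_two[of G 1 i 0 i] by simp

lemma psd_diag_Im: "psd G \<Longrightarrow> Im (G i i) = 0" and psd_diag_Re: "psd G \<Longrightarrow> Re (G i i) \<ge> 0"
  using psd_diag[of G i] by (auto simp: complex_nonneg_Reals_iff)

lemma psd_hermitian: assumes "psd G" shows "G j i = cnj (G i j)"
proof -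
  note i = psd_diag[OF assms, of i, unfolded complex_nonneg_Reals_iff]
  note j = psd_diag[OF assms, of j, unfolded complex_nonneg_Reals_iff]
  have "Im (G i j) + Im (G j i) = 0"
    using psd_two[OF assms, of 1 i 1 j] i j by (simp add: complex_nonneg_Reals_iff)
  moreover have "Re (G j i) = Re (G i j)"
    using psd_two[OF assms, of 1 i \<i> j] i j by (simp add: complex_nonneg_Reals_iff)
  ultimately show ?thesis by (simp add: complex_eq_iff)
qed

lemma psd_diag_zero: assumes "psd G" "G k k = 0" shows "G i k = 0"
proof (rule ccontr)
  assume nz: "G i k \<noteq> 0"
  define c where "c = (cmod (G i k))\<^sup>2"
  have c: "c > 0" using nz by (simp add: c_def)
  \<comment> \<open>Chosen so that the vector with entry 1 at \<open>i\<close> and \<open>t\<close>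
    at \<open>k\<close> would give the form the value -1.\<close>
  define s where "s = (Re (G i i) + 1) / (2 * c)"
  define t where "t = - of_real s * G i k"
  have "1 * cnj 1 * G i i + 1 * cnj t * G i k + t * cnj 1 * G k i + t * cnj t * G k k \<in> nonneg_Reals"
    by (rule psd_two[OF assms(1)])
  then have "G i i + cnj t * G i k + t * cnj (G i k) \<in> nonneg_Reals"
    using psd_hermitian[OF assms(1), of k i] assms(2) by simp
  then have "Re (G i i + cnj t * G i k + t * cnj (G i k)) \<ge> 0" by (simp add: complex_nonneg_Reals_iff)
  also have "Re (G i i + cnj t * G i k + t * cnj (G i k)) = Re (G i i) - 2 * s * c"
    unfolding c_def cmod_power2 by (simp add: t_def power2_eq_square algebra_simps)
  also have "2 * s * c = Re (G i i) + 1" using c unfolding s_def by simp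
  finally show False by simp
qed

text \<open>If the pivot \<open>G k k\<close> vanishes, so do row and column \<open>k\<close> of a positive semidefinite \<open>G\<close>; the division by
  \<open>0\<close> then yields \<open>0\<close>, which is the right value here and in \<open>chol\<close>.\<close>

definition schur :: "(nat \<Rightarrow> nat \<Rightarrow> complex) \<Rightarrow> nat \<Rightarrow> nat \<Rightarrow> nat \<Rightarrow> complex" where
  "schur G k i j = G i j - G i k * G k j / G k k"

text \<open>Completing the square: the form of the complement at \<open>a\<close> is the form of
  \<open>G\<close> at \<open>a'\<close>, which differs from \<open>a\<close> only in the entry
  \<open>k\<close>, adjusted so that \<open>a'\<close> is orthogonal to the \<open>k\<close>-th
  basis vector with respect to \<open>G\<close>.\<close>

lemma psd_schur: assumes G: "psd G" shows "psd (schur G k)"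
proof (cases "G k k = 0")
  case True
  then have "schur G k = G" by (intro ext) (simp add: schur_def)
  then show ?thesis using G by simp
next
  case nz: False
  show ?thesis
    unfolding psd_def
  proof (intro allI)
    fix n0 :: nat and a0 :: "nat \<Rightarrow> complex"
    \<comment> \<open>The vector is padded by zeros so that the pivot index \<open>k\<close> is in
      range.\<close>
    define n where "n = max n0 (Suc k)"
    define a where "a i = (if i < n0 then a0 i else 0)" for i
    have n: "k < n" "n0 \<le> n" by (auto simp: n_def)
    have eq: "qform H n0 a0 = qform H n a" for H
      unfolding a_def by (rule qform_pad) (rule n)
    define g where "g = G k k"
    have greal: "cnj g = g" by (simp add: g_def complex_eq_iff psd_diag_Im[OF G])
    define c where "c = (\<Sum>i<n. a i * G i k)"
    have c': "(\<Sum>j<n. cnj (a j) * G k j) = cnj c"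
      unfolding c_def cnj_sum by (intro sum.cong refl) (simp add: psd_hermitian[OF G, of k])
    define a' where "a' m = a m - (if m = k then c / g else 0)" for m
    define R where "R i = (\<Sum>j<n. cnj (a j) * G i j) - (cnj c / g) * G i k" for i
    have inner: "(\<Sum>j<n. cnj (a' j) * G i j) = R i" for i
    proof -
      have "(\<Sum>j<n. cnj (a' j) * G i j) = (\<Sum>j<n. cnj (a j) * G i j - (if j = k then (cnj c / g) * G i k else 0))"
        by (intro sum.cong) (auto simp: a'_def left_diff_distrib greal)
      then show ?thesis using n by (simp add: sum_subtractf R_def)
    qed
    have "R k = 0" using nz by (simp add: R_def c') (simp add: g_def)
    have "qform G n a' = (\<Sum>i<n. a' i * R i)"
      by (simp add: qform_def inner[symmetric] sum_distrib_left mult.assoc)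
    also have "\<dots> = (\<Sum>i<n. a i * R i)"
      by (intro sum.cong refl) (simp add: a'_def \<open>R k = 0\<close>)
    also have "\<dots> = qform G n a - (\<Sum>i<n. a i * ((cnj c / g) * G i k))"
      by (simp add: R_def qform_def right_diff_distrib sum_subtractf sum_distrib_left mult.assoc)
    also have "(\<Sum>i<n. a i * ((cnj c / g) * G i k)) = c * (cnj c / g)"
      unfolding c_def sum_distrib_right by (intro sum.cong refl) (simp add: mult_ac)
    also have "qform G n a - c * (cnj c / g) = qform (schur G k) n a"
    proof -
      have "(\<Sum>i<n. a i * G i k) * ((\<Sum>j<n. cnj (a j) * G k j) / g) = (\<Sum>i<n. \<Sum>j<n. a i * cnj (a j) * (G i k * G k j / g))"
        unfolding sum_divide_distrib sum_product by (intro sum.cong refl) (simp add: mult_ac)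
      then have "c * (cnj c / g) = (\<Sum>i<n. \<Sum>j<n. a i * cnj (a j) * (G i k * G k j / g))"
        unfolding c' by (simp only: c_def[symmetric])
      then show ?thesis
        by (simp only: qform_def schur_def g_def[symmetric] right_diff_distrib sum_subtractf)
    qed
    finally have "qform (schur G k) n a = qform G n a'" by simp
    then show "qform (schur G k) n0 a0 \<in> nonneg_Reals"
      unfolding eq using G by (simp add: psd_def)
  qed
qed

fun schurs :: "(nat \<Rightarrow> nat \<Rightarrow> complex) \<Rightarrow> nat \<Rightarrow> nat \<Rightarrow> nat \<Rightarrow> complex" where
  "schurs G 0 = G"
| "schurs G (Suc k) = schur (schurs G k) k"

definition chol :: "(nat \<Rightarrow> nat \<Rightarrow> complex) \<Rightarrow> nat \<Rightarrow> nat \<Rightarrow> complex" where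
  "chol G i k = schurs G k i k / of_real (sqrt (Re (schurs G k k k)))"

lemma psd_schurs: "psd G \<Longrightarrow> psd (schurs G k)"
  by (induction k) (auto intro: psd_schur)

text \<open>Each elimination clears one more row and leaves cleared rows at zero; if the pivot
  vanishes, its row was zero already by \<open>psd_diag_zero\<close>.\<close>

lemma schurs_zero: "psd G \<Longrightarrow> k < n \<Longrightarrow> schurs G n k j = 0"
proof (induction n arbitrary: j)
  case (Suc n)
  note P = psd_schurs[OF Suc.prems(1), of n]
  show ?case
  proof (cases "k = n")
    case True
    show ?thesis
    proof (cases "schurs G n n n = 0")
      case z: True
      then have "schurs G n n j = 0" using psd_diag_zero[OF P z, of j] psd_hermitian[OF P, of n j] by simp
      then show ?thesis using True z by (simp add: schur_def)
    qed (use True in \<open>simp add: schur_def\<close>)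
  next
    case False
    then have "k < n" using Suc.prems by simp
    have z: "schurs G n k l = 0" for l
      by (rule Suc.IH[OF Suc.prems(1) \<open>k < n\<close>])
    show ?thesis by (simp add: schur_def z)
  qed
qed simp

lemma chol_prod: assumes "psd G" shows "chol G i k * cnj (chol G j k) = schurs G k i k * schurs G k k j / schurs G k k k"
proof -
  note P = psd_schurs[OF assms, of k]
  have "cnj (schurs G k j k) = schurs G k k j" using psd_hermitian[OF P, of k j] by simp
  moreover have "complex_of_real (sqrt (Re (schurs G k k k))) * complex_of_real (sqrt (Re (schurs G k k k))) = schurs G k k k"
    using psd_diag_Re[OF P, of k] psd_diag_Im[OF P, of k] by (simp add: complex_eq_iff)
  ultimately show ?thesis by (simp add: chol_def)
qed

lemma schurs_chol: "psd G \<Longrightarrow> schurs G n i j = G i j - (\<Sum>k<n. chol G i k * cnj (chol G j k))"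
  by (induction n) (auto simp: schur_def chol_prod)

lemma chol_decomp: "psd G \<Longrightarrow> G i j = (\<Sum>k\<le>i. chol G i k * cnj (chol G j k))"
  using schurs_chol[of G "Suc i" i j] schurs_zero[of G i "Suc i" j] by (simp add: lessThan_Suc_atMost del: schurs.simps)

lemma chol_upper: "psd G \<Longrightarrow> i < k \<Longrightarrow> chol G i k = 0"
  by (simp add: chol_def schurs_zero)

lemma chol_diag: assumes "psd G" shows "chol G i i = 0 \<longleftrightarrow> Re (schurs G i i i) = 0"
  using psd_diag_Im[OF psd_schurs[OF assms, of i], of i] by (auto simp: chol_def complex_eq_iff[of _ 0])

text \<open>Where the pivot \<open>k\<close> vanishes, the fibre coordinate \<open>k\<close> carries
  nothing of any vector; \<open>spectral_decomposition\<close> gives it weight zero there.\<close>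

lemma chol_zero_column: assumes "psd G" "chol G k k = 0" shows "chol G i k = 0"
proof -
  have "schurs G k k k = 0"
    using assms chol_diag[of G k] psd_diag_Im[OF psd_schurs[OF assms(1), of k], of k]
    by (simp add: complex_eq_iff[of _ 0])
  then show ?thesis by (simp add: chol_def)
qed

lemma schurs_measurable:
  "(\<And>i j. (\<lambda>z. G z i j) \<in> borel_measurable M) \<Longrightarrow> (\<lambda>z. schurs (G z) k i j) \<in> borel_measurable M"
  by (induction k arbitrary: i j) (auto simp: schur_def intro!: borel_measurable_diff borel_measurable_times borel_measurable_divide)

text \<open>The recursion uses field operations and square roots only. This is the advantage of
  Cholesky over a diagonalization, which would call for a measurable choice of eigenvectors.\<close>

lemma chol_measurable:
  assumes "\<And>i j. (\<lambda>z. G z i j) \<in> borel_measurable M" shows "(\<lambda>z. chol (G z) i k) \<in> borel_measurable M"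
proof -
  note [measurable] = schurs_measurable[of G M, OF assms]
  show ?thesis unfolding chol_def by measurable
qed

text \<open>By continuity the vectors with entries in a dense set test positivity. With a countable
  \<open>D\<close>, conditions that hold almost everywhere for each vector hold almost everywhere
  for all of them at once.\<close>

lemma psd_dense:
  assumes D: "\<And>X :: complex set. open X \<Longrightarrow> X \<noteq> {} \<Longrightarrow> \<exists>d\<in>D. d \<in> X"
  and pos: "\<And>n a. a \<in> {..<n} \<rightarrow>\<^sub>E D \<Longrightarrow> qform G n a \<in> nonneg_Reals"
  shows "psd G"
  unfolding psd_def
proof (intro allI)
  fix n :: nat and a :: "nat \<Rightarrow> complex"
  have "\<exists>d\<in>D. d \<in> ball (a i) (1 / real (Suc t))" for i t by (rule D) auto
  then obtain d where d: "\<And>i t. d i t \<in> D" "\<And>i t. d i t \<in> ball (a i) (1 / real (Suc t))" by metis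
  have lim: "(\<lambda>t. d i t) \<longlonglongrightarrow> a i" for i
  proof (rule metric_LIMSEQ_I)
    fix e :: real assume "e > 0"
    then obtain N where N: "1 / real (Suc N) < e" using nat_approx_posE by blast
    show "\<exists>N. \<forall>t\<ge>N. dist (d i t) (a i) < e"
    proof (intro exI[of _ N] allI impI)
      fix t assume "t \<ge> N"
      then have "1 / real (Suc t) \<le> 1 / real (Suc N)" by (auto intro!: divide_left_mono)
      then show "dist (d i t) (a i) < e" using d(2)[of i t] N by (simp add: dist_commute)
    qed
  qed
  have "(\<lambda>t. qform G n (\<lambda>i. d i t)) \<longlonglongrightarrow> qform G n a"
    unfolding qform_def by (intro tendsto_intros lim)
  moreover have "qform G n (\<lambda>i. d i t) \<in> nonneg_Reals" for t
  proof -
    have "qform G n (\<lambda>i\<in>{..<n}. d i t) \<in> nonneg_Reals" by (rule pos) (auto simp: d)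
    also have "qform G n (\<lambda>i\<in>{..<n}. d i t) = qform G n (\<lambda>i. d i t)" by (simp add: qform_def)
    finally show ?thesis .
  qed
  ultimately show "qform G n a \<in> nonneg_Reals"
    by (rule_tac closed_sequentially[OF closed_nonneg_Reals_complex])
qed

text \<open>\<open>g\<close> is the Radon-Nikodym density of the image of the measure with density
  \<open>F\<close> with respect to the image of \<open>\<tau>\<close>: the conditional expectation
  of \<open>F\<close> given \<open>p\<close>, as a function on the target.\<close>

lemma cond_density_nonneg:
  fixes F :: "'a \<Rightarrow> real"
  assumes P: "prob_space \<tau>" and p: "p \<in> measurable \<tau> N" and F: "integrable \<tau> F" "\<And>y. 0 \<le> F y"
  shows "\<exists>g. integrable (distr \<tau> N p) g \<and> (\<forall>z. 0 \<le> g z) \<and>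
    (\<forall>u :: 'b \<Rightarrow> complex. u \<in> borel_measurable N \<longrightarrow>
      (\<integral>z. u z * of_real (g z) \<partial>distr \<tau> N p) = (\<integral>y. u (p y) * of_real (F y) \<partial>\<tau>))"
proof -
  interpret prob_space \<tau> by fact
  note Fm[measurable] = borel_measurable_integrable[OF F(1)]
  note [measurable] = p
  define \<nu> where "\<nu> = distr \<tau> N p"
  define \<rho> where "\<rho> = distr (density \<tau> (\<lambda>y. ennreal (F y))) N p"
  interpret \<nu>: prob_space \<nu> unfolding \<nu>_def by (rule prob_space_distr[OF p])
  have pd: "p \<in> measurable (density \<tau> (\<lambda>y. ennreal (F y))) N" by simp
  have fin: "finite_measure \<rho>"
  proof (rule finite_measureI)
    have "emeasure \<rho> (space \<rho>) = emeasure (density \<tau> (\<lambda>y. ennreal (F y))) (p -` space N \<inter> space \<tau>)"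
      unfolding \<rho>_def by (simp add: emeasure_distr[OF pd])
    also have "p -` space N \<inter> space \<tau> = space \<tau>" using measurable_space[OF p] by auto
    also have "emeasure (density \<tau> (\<lambda>y. ennreal (F y))) (space \<tau>) = (\<integral>\<^sup>+y. ennreal (F y) \<partial>\<tau>)"
      by (subst emeasure_density) (auto intro!: nn_integral_cong)
    also have "\<dots> = ennreal (\<integral>y. F y \<partial>\<tau>)" using F by (intro nn_integral_eq_integral) auto
    finally show "emeasure \<rho> (space \<rho>) \<noteq> \<infinity>" by simp
  qed
  have ac: "absolutely_continuous \<nu> \<rho>"
    unfolding absolutely_continuous_def
  proof
    fix E assume E: "E \<in> null_sets \<nu>"
    then have E': "E \<in> sets N" "emeasure \<tau> (p -` E \<inter> space \<tau>) = 0"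
      unfolding \<nu>_def by (auto simp: null_sets_def emeasure_distr[OF p])
    have "p -` E \<inter> space \<tau> \<in> null_sets (density \<tau> (\<lambda>y. ennreal (F y)))"
    proof (subst null_sets_density_iff)
      have "p -` E \<inter> space \<tau> \<in> null_sets \<tau>" using E' by (intro null_setsI) auto
      from AE_not_in[OF this] have "AE y in \<tau>. y \<in> p -` E \<inter> space \<tau> \<longrightarrow> ennreal (F y) = 0"
        by eventually_elim auto
      then show "p -` E \<inter> space \<tau> \<in> sets \<tau> \<and> (AE y in \<tau>. y \<in> p -` E \<inter> space \<tau> \<longrightarrow> ennreal (F y) = 0)"
        using E' by auto
    qed simp
    then show "E \<in> null_sets \<rho>"
      using E' unfolding \<rho>_def by (auto simp: null_sets_def emeasure_distr[OF pd])
  qed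
  have sets: "sets \<rho> = sets \<nu>" by (simp add: \<rho>_def \<nu>_def)
  obtain g where g[measurable]: "g \<in> borel_measurable \<nu>" and gRN: "AE z in \<nu>. RN_deriv \<nu> \<rho> z = ennreal (g z)"
    and g0: "\<And>z. 0 \<le> g z"
    using \<nu>.real_RN_deriv[OF fin ac sets] by metis
  have dens: "\<rho> = density \<nu> (\<lambda>z. ennreal (g z))"
    using \<nu>.density_RN_deriv[OF ac sets] density_cong[OF borel_measurable_RN_deriv _ gRN] by simp
  have "(\<integral>\<^sup>+z. ennreal (g z) \<partial>\<nu>) = emeasure \<rho> (space \<rho>)"
    unfolding dens by (subst emeasure_density) (auto intro!: nn_integral_cong)
  then have "integrable \<nu> g"
    using g0 finite_measure.emeasure_finite[OF fin, of "space \<rho>"]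
    by (intro integrableI_nonneg) (auto simp: less_top)
  moreover have "(\<integral>z. u z * of_real (g z) \<partial>\<nu>) = (\<integral>y. u (p y) * of_real (F y) \<partial>\<tau>)"
    if u: "u \<in> borel_measurable N" for u :: "'b \<Rightarrow> complex"
  proof -
    note [measurable] = u
    have u\<nu>: "u \<in> borel_measurable \<nu>" by (simp add: \<nu>_def)
    have "(\<integral>z. u z * of_real (g z) \<partial>\<nu>) = (\<integral>z. g z *\<^sub>R u z \<partial>\<nu>)"
      by (simp add: scaleR_conv_of_real mult.commute)
    also have "\<dots> = (\<integral>z. u z \<partial>\<rho>)" unfolding dens using g0 u\<nu> by (subst integral_density) auto
    also have "\<dots> = (\<integral>y. u (p y) \<partial>density \<tau> (\<lambda>y. ennreal (F y)))"
      unfolding \<rho>_def by (rule integral_distr[OF pd u])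
    also have "\<dots> = (\<integral>y. F y *\<^sub>R u (p y) \<partial>\<tau>)" using F(2) by (subst integral_density) auto
    finally show ?thesis by (simp add: scaleR_conv_of_real mult.commute)
  qed
  ultimately show ?thesis using g0 unfolding \<nu>_def[symmetric] by blast
qed

lemma integrable_bounded_mult:
  fixes g :: "'a \<Rightarrow> complex"
  assumes "integrable M g" "u \<in> borel_measurable M" "\<And>x. x \<in> space M \<Longrightarrow> cmod (u x) \<le> B"
  shows "integrable M (\<lambda>x. u x * g x)"
proof (rule Bochner_Integration.integrable_bound[of _ "\<lambda>x. of_real \<bar>B\<bar> * g x"])
  note [measurable] = assms(2) borel_measurable_integrable[OF assms(1)]
  show "(\<lambda>x. u x * g x) \<in> borel_measurable M" by measurable
  show "AE x in M. norm (u x * g x) \<le> norm (of_real \<bar>B\<bar> * g x)"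
    using assms(3) by (intro AE_I2) (force simp: norm_mult intro!: mult_right_mono)
qed (use assms in auto)

text \<open>Positive and negative parts of the real and the imaginary part reduce to the nonnegative
  case; bounded test functions keep the four integrals finite, so that they can be added.\<close>

lemma cond_density:
  fixes F :: "'a \<Rightarrow> complex"
  assumes P: "prob_space \<tau>" and p: "p \<in> measurable \<tau> N" and F: "integrable \<tau> F"
  shows "\<exists>g. integrable (distr \<tau> N p) g \<and>
    (\<forall>u B. u \<in> borel_measurable N \<longrightarrow> (\<forall>z\<in>space N. cmod (u z) \<le> B) \<longrightarrow>
      (\<integral>z. u z * g z \<partial>distr \<tau> N p) = (\<integral>y. u (p y) * F y \<partial>\<tau>))"
proof -
  define A where "A k y = (if k = 0 then max 0 (Re (F y)) else if k = 1 then max 0 (- Re (F y))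
     else if k = 2 then max 0 (Im (F y)) else max 0 (- Im (F y)))" for k :: nat and y
  define c :: "nat \<Rightarrow> complex" where "c k = (if k = 0 then 1 else if k = 1 then -1 else if k = 2 then \<i> else -\<i>)" for k
  have dec: "F y = (\<Sum>k<4. c k * of_real (A k y))" for y
    by (simp add: A_def c_def numeral_eq_Suc complex_eq_iff max_def)
  have Ai: "integrable \<tau> (A k)" and A0: "0 \<le> A k y" for k y
  proof -
    have "integrable \<tau> (\<lambda>y. Re (F y))" "integrable \<tau> (\<lambda>y. Im (F y))" using F by auto
    then show "integrable \<tau> (A k)" unfolding A_def by (cases "k = 0"; cases "k = 1"; cases "k = 2") auto
  qed (simp add: A_def)
  have "\<forall>k. \<exists>g. integrable (distr \<tau> N p) g \<and> (\<forall>z. 0 \<le> g z) \<and>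
    (\<forall>u :: 'b \<Rightarrow> complex. u \<in> borel_measurable N \<longrightarrow>
      (\<integral>z. u z * of_real (g z) \<partial>distr \<tau> N p) = (\<integral>y. u (p y) * of_real (A k y) \<partial>\<tau>))"
    using cond_density_nonneg[OF P p Ai A0] by blast
  then obtain g where g: "\<And>k. integrable (distr \<tau> N p) (g k)"
    "\<And>k (u :: 'b \<Rightarrow> complex). u \<in> borel_measurable N \<Longrightarrow>
      (\<integral>z. u z * of_real (g k z) \<partial>distr \<tau> N p) = (\<integral>y. u (p y) * of_real (A k y) \<partial>\<tau>)"
    by metis
  show ?thesis
  proof (intro exI conjI allI impI)
    show "integrable (distr \<tau> N p) (\<lambda>z. \<Sum>k<4. c k * of_real (g k z))"
      using g(1) by (intro Bochner_Integration.integrable_sum integrable_mult_right) auto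
    fix u :: "'b \<Rightarrow> complex" and B
    assume u: "u \<in> borel_measurable N" and B: "\<forall>z\<in>space N. cmod (u z) \<le> B"
    have i1: "integrable (distr \<tau> N p) (\<lambda>z. u z * of_real (g k z))" for k
      using u B g(1)[of k] by (intro integrable_bounded_mult[where B=B]) auto
    have i2: "integrable \<tau> (\<lambda>y. u (p y) * of_real (A k y))" for k
      using u B Ai[of k] measurable_space[OF p] p
      by (intro integrable_bounded_mult[where B=B]) (auto intro: measurable_compose)
    have "(\<integral>z. u z * (\<Sum>k<4. c k * of_real (g k z)) \<partial>distr \<tau> N p) = (\<integral>z. (\<Sum>k<4. c k * (u z * of_real (g k z))) \<partial>distr \<tau> N p)"
      by (simp add: sum_distrib_left mult.left_commute)
    also have "\<dots> = (\<Sum>k<4. c k * (\<integral>z. u z * of_real (g k z) \<partial>distr \<tau> N p))"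
      using i1 by (subst Bochner_Integration.integral_sum) auto
    also have "\<dots> = (\<Sum>k<4. c k * (\<integral>y. u (p y) * of_real (A k y) \<partial>\<tau>))" by (simp only: g(2)[OF u])
    also have "\<dots> = (\<integral>y. (\<Sum>k<4. c k * (u (p y) * of_real (A k y))) \<partial>\<tau>)"
      using i2 by (subst Bochner_Integration.integral_sum) auto
    also have "\<dots> = (\<integral>y. u (p y) * F y \<partial>\<tau>)"
      by (simp add: dec sum_distrib_left mult.left_commute)
    finally show "(\<integral>z. u z * (\<Sum>k<4. c k * of_real (g k z)) \<partial>distr \<tau> N p) = (\<integral>y. u (p y) * F y \<partial>\<tau>)" .
  qed
qed

text \<open>For a fixed coefficient vector the form of the densities is itself the density of a
  squared modulus, hence nonnegative almost everywhere. Countably many vectors suffice, and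
  \<open>G\<close> is set to zero on the exceptional null set.\<close>

lemma Gram_density:
  fixes f :: "nat \<Rightarrow> 'a \<Rightarrow> complex"
  assumes P: "prob_space \<tau>" and p: "p \<in> measurable \<tau> N" and f: "\<And>i. f i \<in> L2 \<tau>"
  shows "\<exists>G. (\<forall>z. psd (G z)) \<and> (\<forall>i j. integrable (distr \<tau> N p) (\<lambda>z. G z i j)) \<and>
    (\<forall>i j u B. u \<in> borel_measurable N \<longrightarrow> (\<forall>z\<in>space N. cmod (u z) \<le> B) \<longrightarrow>
      (\<integral>z. u z * G z i j \<partial>distr \<tau> N p) = (\<integral>y. u (p y) * (f i y * cnj (f j y)) \<partial>\<tau>))"
proof -
  interpret prob_space \<tau> by fact
  define \<nu> where "\<nu> = distr \<tau> N p"
  interpret \<nu>: prob_space \<nu> unfolding \<nu>_def by (rule prob_space_distr[OF p])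
  have "\<forall>i j. \<exists>g. integrable \<nu> g \<and>
    (\<forall>u B. u \<in> borel_measurable N \<longrightarrow> (\<forall>z\<in>space N. cmod (u z) \<le> B) \<longrightarrow>
      (\<integral>z. u z * g z \<partial>\<nu>) = (\<integral>y. u (p y) * (f i y * cnj (f j y)) \<partial>\<tau>))"
    unfolding \<nu>_def by (intro allI cond_density P p L2_mult_integrable f)
  then obtain g where g: "\<And>i j. integrable \<nu> (g i j)"
    "\<And>i j u B. u \<in> borel_measurable N \<Longrightarrow> (\<And>z. z \<in> space N \<Longrightarrow> cmod (u z) \<le> B) \<Longrightarrow>
      (\<integral>z. u z * g i j z \<partial>\<nu>) = (\<integral>y. u (p y) * (f i y * cnj (f j y)) \<partial>\<tau>)"
    by metis
  have pos: "AE z in \<nu>. qform (\<lambda>i j. g i j z) n a \<in> nonneg_Reals" for n a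
  proof -
    define F where "F y = (cmod (\<Sum>i<n. a i * f i y))\<^sup>2" for y
    have Fi: "integrable \<tau> F" unfolding F_def by (intro L2_integrable L2_sum L2_scale f)
    obtain h where h: "integrable \<nu> h" "\<And>z. 0 \<le> h z" and
      hu: "\<And>u :: 'b \<Rightarrow> complex. u \<in> borel_measurable N \<Longrightarrow>
      (\<integral>z. u z * of_real (h z) \<partial>\<nu>) = (\<integral>y. u (p y) * of_real (F y) \<partial>\<tau>)"
      using cond_density_nonneg[OF P p Fi] unfolding \<nu>_def by (auto simp: F_def)
    have Fq: "complex_of_real (F y) = (\<Sum>i<n. \<Sum>j<n. a i * cnj (a j) * (f i y * cnj (f j y)))" for y
      unfolding F_def complex_norm_square by (simp add: cnj_sum sum_product mult_ac)
    have "AE z in \<nu>. qform (\<lambda>i j. g i j z) n a = of_real (h z)"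
    proof (rule \<nu>.density_unique_banach)
      show "integrable \<nu> (\<lambda>z. qform (\<lambda>i j. g i j z) n a)"
        unfolding qform_def using g(1) by auto
      show "integrable \<nu> (\<lambda>z. complex_of_real (h z))" using h by auto
      fix A assume A: "A \<in> sets \<nu>"
      let ?u = "\<lambda>z. complex_of_real (indicator A z)"
      have A': "A \<in> sets N" using A by (simp add: \<nu>_def)
      have u: "?u \<in> borel_measurable N" using A' by measurable
      have ub: "cmod (?u z) \<le> 1" for z by (simp add: indicator_def)
      have ig: "integrable \<nu> (\<lambda>z. ?u z * g i j z)" for i j
        using g(1)[of i j] u ub by (intro integrable_bounded_mult[where B=1]) (auto simp: \<nu>_def)
      have if': "integrable \<tau> (\<lambda>y. ?u (p y) * (f i y * cnj (f j y)))" for i j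
        using u ub p by (intro integrable_bounded_mult[where B=1] L2_mult_integrable f) (auto intro: measurable_compose)
      have "(LINT z:A|\<nu>. qform (\<lambda>i j. g i j z) n a) = (\<integral>z. (\<Sum>i<n. \<Sum>j<n. a i * cnj (a j) * (?u z * g i j z)) \<partial>\<nu>)"
        unfolding set_lebesgue_integral_def qform_def scaleR_conv_of_real sum_distrib_left
        by (intro Bochner_Integration.integral_cong refl sum.cong) (simp add: mult_ac)
      also have "\<dots> = (\<Sum>i<n. \<Sum>j<n. a i * cnj (a j) * (\<integral>y. ?u (p y) * (f i y * cnj (f j y)) \<partial>\<tau>))"
        using ig by (simp add: g(2)[OF u ub])
      also have "\<dots> = (\<integral>y. (\<Sum>i<n. \<Sum>j<n. a i * cnj (a j) * (?u (p y) * (f i y * cnj (f j y)))) \<partial>\<tau>)"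
        using if' by simp
      also have "\<dots> = (\<integral>y. ?u (p y) * of_real (F y) \<partial>\<tau>)"
        unfolding Fq sum_distrib_left by (intro Bochner_Integration.integral_cong refl sum.cong) (simp add: mult_ac)
      also have "\<dots> = (LINT z:A|\<nu>. complex_of_real (h z))"
        using hu[OF u] by (simp add: set_lebesgue_integral_def scaleR_conv_of_real)
      finally show "(LINT z:A|\<nu>. qform (\<lambda>i j. g i j z) n a) = (LINT z:A|\<nu>. complex_of_real (h z))" .
    qed
    then show ?thesis by eventually_elim (use h(2) in auto)
  qed
  obtain D :: "complex set" where D: "countable D" "\<And>X. open X \<Longrightarrow> X \<noteq> {} \<Longrightarrow> \<exists>d\<in>D. d \<in> X"
    using countable_dense_exists by blast
  have "AE z in \<nu>. \<forall>n. \<forall>a\<in>{..<n} \<rightarrow>\<^sub>E D. qform (\<lambda>i j. g i j z) n a \<in> nonneg_Reals"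
    unfolding AE_all_countable
    by (intro allI, subst AE_ball_countable) (auto intro!: countable_PiE D pos)
  then have "AE z in \<nu>. psd (\<lambda>i j. g i j z)"
    by eventually_elim (auto intro!: psd_dense[OF D(2)])
  then obtain Z where Z: "Z \<in> null_sets \<nu>" "{z\<in>space \<nu>. \<not> psd (\<lambda>i j. g i j z)} \<subseteq> Z"
    by (auto elim!: AE_E intro: null_setsI)
  define G where "G z i j = (if z \<in> space \<nu> - Z then g i j z else 0)" for z i j
  have "psd (G z)" for z
  proof (cases "z \<in> space \<nu> - Z")
    case True then show ?thesis using Z by (auto simp: G_def[abs_def])
  next
    case False
    then have "G z = (\<lambda>i j. 0)" unfolding G_def by (intro ext if_not_P)
    then show ?thesis by (simp add: psd_def qform_def)
  qed
  moreover have AEG: "AE z in \<nu>. G z i j = g i j z" for i j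
    using AE_not_in[OF Z(1)] AE_space by eventually_elim (simp add: G_def)
  moreover have Gm: "(\<lambda>z. G z i j) \<in> borel_measurable \<nu>" for i j
  proof -
    note [measurable] = borel_measurable_integrable[OF g(1)] null_setsD2[OF Z(1)]
    show ?thesis unfolding G_def by measurable
  qed
  moreover have "integrable \<nu> (\<lambda>z. G z i j)" for i j
    using g(1)[of i j] AEG[of i j] Gm[of i j] borel_measurable_integrable[OF g(1)] by (subst integrable_cong_AE)
  moreover have "(\<integral>z. u z * G z i j \<partial>\<nu>) = (\<integral>y. u (p y) * (f i y * cnj (f j y)) \<partial>\<tau>)"
    if u: "u \<in> borel_measurable N" "\<forall>z\<in>space N. cmod (u z) \<le> B" for i j u B
  proof -
    have u\<nu>: "u \<in> borel_measurable \<nu>" using u by (simp add: \<nu>_def)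
    have "(\<integral>z. u z * G z i j \<partial>\<nu>) = (\<integral>z. u z * g i j z \<partial>\<nu>)"
      using AEG[of i j] Gm[of i j] borel_measurable_integrable[OF g(1)] u\<nu>
      by (intro integral_cong_AE borel_measurable_times) auto
    then show ?thesis using g(2)[of u B i j] u by simp
  qed
  ultimately show ?thesis unfolding \<nu>_def[symmetric] by blast
qed

lemma cnj_powi_circle: assumes "cmod z = 1" shows "cnj (z powi k) = z powi (-k)"
proof -
  have "z * cnj z = 1" using assms by (simp add: mult_cnj_self)
  then have inv: "inverse z = cnj z" by (rule inverse_unique)
  have "cnj (z powi k) = cnj z powi k" by (simp add: power_int_def)
  then show ?thesis by (simp add: inv[symmetric] power_int_inverse power_int_minus)
qed

text \<open>Vanishing coefficients make the two measures whose densities are the positive and the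
  negative part of \<open>H\<close> equal.\<close>

lemma circle_Fourier_zero_real:
  fixes H :: "complex \<Rightarrow> real"
  assumes fin: "finite_measure \<nu>" and sets: "sets \<nu> = sets circle_borel" and H: "integrable \<nu> H"
  and zero: "\<And>k::int. (\<integral>z. z powi k * of_real (H z) \<partial>\<nu>) = 0"
  shows "AE z in \<nu>. H z = 0"
proof -
  interpret finite_measure \<nu> by fact
  note [measurable] = borel_measurable_integrable[OF H] power_int_circle_measurable[OF sets]
  define P where "P s z = max 0 (s * H z)" for s z
  have Pi: "integrable \<nu> (P s)" for s unfolding P_def using H by auto
  have Pm[measurable]: "P s \<in> borel_measurable \<nu>" for s unfolding P_def by measurable
  have P0: "0 \<le> P s z" for s z by (simp add: P_def)
  have fd: "finite_measure (density \<nu> (\<lambda>z. ennreal (P s z)))" for s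
  proof (rule finite_measureI)
    have "emeasure (density \<nu> (\<lambda>z. ennreal (P s z))) (space \<nu>) = ennreal (\<integral>z. P s z \<partial>\<nu>)"
      by (subst emeasure_density) (auto simp: nn_integral_eq_integral[OF Pi] P0 cong: nn_integral_cong)
    then show "emeasure (density \<nu> (\<lambda>z. ennreal (P s z))) (space (density \<nu> (\<lambda>z. ennreal (P s z)))) \<noteq> \<infinity>" by simp
  qed
  have sp: "space \<nu> = sphere 0 1" using sets_eq_imp_space_eq[OF sets] by simp
  have zPi: "integrable \<nu> (\<lambda>z. z powi k * of_real (P s z))" for k s
    by (rule integrable_bounded_mult[where B=1]) (auto simp: sp norm_power_int intro: Pi)
  have "density \<nu> (\<lambda>z. ennreal (P 1 z)) = density \<nu> (\<lambda>z. ennreal (P (-1) z))"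
  proof (rule circle_measure_eqI[OF fd fd])
    fix k :: int
    have "(\<integral>z. z powi k * of_real (P 1 z) \<partial>\<nu>) - (\<integral>z. z powi k * of_real (P (-1) z) \<partial>\<nu>)
        = (\<integral>z. z powi k * of_real (P 1 z) - z powi k * of_real (P (-1) z) \<partial>\<nu>)"
      using zPi by simp
    also have "\<dots> = (\<integral>z. z powi k * of_real (H z) \<partial>\<nu>)"
      by (intro Bochner_Integration.integral_cong) (auto simp: P_def max_def algebra_simps)
    finally have "(\<integral>z. z powi k * of_real (P 1 z) \<partial>\<nu>) = (\<integral>z. z powi k * of_real (P (-1) z) \<partial>\<nu>)"
      using zero by simp
    then show "(\<integral>z. z powi k \<partial>density \<nu> (\<lambda>z. ennreal (P 1 z))) = (\<integral>z. z powi k \<partial>density \<nu> (\<lambda>z. ennreal (P (-1) z)))"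
      using P0 by (simp add: integral_density scaleR_conv_of_real mult.commute)
  qed (simp_all add: sets)
  then have "AE z in \<nu>. ennreal (P 1 z) = ennreal (P (-1) z)"
    by (intro density_unique) auto
  then show ?thesis
    by eventually_elim (auto simp: P_def max_def split: if_splits)
qed

lemma circle_Fourier_zero:
  fixes H :: "complex \<Rightarrow> complex"
  assumes fin: "finite_measure \<nu>" and sets: "sets \<nu> = sets circle_borel" and H: "integrable \<nu> H"
  and zero: "\<And>k::int. (\<integral>z. z powi k * H z \<partial>\<nu>) = 0"
  shows "AE z in \<nu>. H z = 0"
proof -
  interpret finite_measure \<nu> by fact
  have sp: "space \<nu> = sphere 0 1" using sets_eq_imp_space_eq[OF sets] by simp
  note pm = power_int_circle_measurable[OF sets]
  have re: "AE z in \<nu>. Re (K z) = 0" if K: "integrable \<nu> K" and Kz: "\<And>k::int. (\<integral>z. z powi k * K z \<partial>\<nu>) = 0" for K :: "complex \<Rightarrow> complex"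
  proof (rule circle_Fourier_zero_real[OF fin sets])
    show "integrable \<nu> (\<lambda>z. Re (K z))" using K by auto
    fix k :: int
    have i: "integrable \<nu> (\<lambda>z. z powi l * K z)" for l
      by (rule integrable_bounded_mult[where B=1]) (auto simp: sp norm_power_int intro: pm K)
    have ic: "integrable \<nu> (\<lambda>z. cnj (z powi (-k) * K z))" by (intro integrable_cnj i)
    \<comment> \<open>A coefficient of the real part is the average of a coefficient of
      \<open>K\<close> and the conjugate of the opposite one.\<close>
    have "(\<integral>z. z powi k * of_real (Re (K z)) \<partial>\<nu>) = (\<integral>z. (z powi k * K z + cnj (z powi (-k) * K z)) / 2 \<partial>\<nu>)"
    proof (intro Bochner_Integration.integral_cong refl)
      fix z assume "z \<in> space \<nu>"
      then have z1: "cmod z = 1" by (simp add: sp)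
      then have "cnj (z powi (-k)) = z powi k" using cnj_powi_circle[OF z1, of "-k"] by simp
      then have "z powi k * K z + cnj (z powi (-k) * K z) = z powi k * (K z + cnj (K z))"
        by (simp add: distrib_left)
      then show "z powi k * of_real (Re (K z)) = (z powi k * K z + cnj (z powi (-k) * K z)) / 2"
        by (simp add: complex_add_cnj)
    qed
    also have "\<dots> = ((\<integral>z. z powi k * K z \<partial>\<nu>) + cnj (\<integral>z. z powi (-k) * K z \<partial>\<nu>)) / 2"
      using Bochner_Integration.integral_add[OF i[of k] ic] by (simp add: Bochner_Integration.integral_cnj del: complex_cnj_mult)
    also have "\<dots> = 0" by (simp add: Kz)
    finally show "(\<integral>z. z powi k * of_real (Re (K z)) \<partial>\<nu>) = 0" .
  qed
  have "AE z in \<nu>. Re (H z) = 0" by (rule re[OF H zero])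
  moreover have "AE z in \<nu>. Re (\<i> * H z) = 0"
    using H zero by (intro re) (auto simp: mult.left_commute[of _ \<i>])
  ultimately show ?thesis by eventually_elim (simp add: complex_eq_iff)
qed

lemma measurable_pair_nat:
  assumes "\<And>k::nat. (\<lambda>z. f (z, k)) \<in> measurable M K"
  shows "f \<in> measurable (M \<Otimes>\<^sub>M count_space UNIV) K"
proof -
  have "(\<lambda>w. (\<lambda>k w. f (fst w, k)) (snd w) w) \<in> measurable (M \<Otimes>\<^sub>M count_space UNIV) K"
    by (rule measurable_compose_countable[where g=snd], rule measurable_compose[OF measurable_fst assms]) simp
  then show ?thesis by simp
qed

lemma count_space_finite_integral:
  fixes f :: "nat \<Rightarrow> 'b::{banach, second_countable_topology}"
  assumes "\<And>k. k > n \<Longrightarrow> f k = 0"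
  shows "integrable (count_space UNIV) f" "(\<integral>k. f k \<partial>count_space UNIV) = (\<Sum>k\<le>n. f k)"
proof -
  have fin: "finite {a. f a \<noteq> 0}"
    by (rule finite_subset[of _ "{..n}"]) (use assms in \<open>auto simp: not_le[symmetric]\<close>)
  show "integrable (count_space UNIV) f"
    unfolding integrable_count_space_nat_iff using assms by (intro summable_finite[of "{..n}"]) auto
  have "(\<integral>k. f k \<partial>count_space UNIV) = (\<Sum>a | a \<in> UNIV \<and> f a \<noteq> 0. f a)"
    by (rule lebesgue_integral_count_space_finite_support) (simp add: fin)
  also have "\<dots> = (\<Sum>k\<le>n. f k)"
    using assms by (intro sum.mono_neutral_left) (auto simp: not_le[symmetric])
  finally show "(\<integral>k. f k \<partial>count_space UNIV) = (\<Sum>k\<le>n. f k)" .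
qed

lemma pair_nat_finite_integral:
  fixes \<phi> :: "'a \<times> nat \<Rightarrow> 'b::{banach, second_countable_topology}"
  assumes P: "sigma_finite_measure \<nu>" and m: "\<And>k. (\<lambda>z. \<phi> (z, k)) \<in> borel_measurable \<nu>"
  and zero: "\<And>z k. k > n \<Longrightarrow> \<phi> (z, k) = 0" and int: "\<And>k. k \<le> n \<Longrightarrow> integrable \<nu> (\<lambda>z. \<phi> (z, k))"
  shows "integrable (\<nu> \<Otimes>\<^sub>M count_space UNIV) \<phi>"
    "(\<integral>w. \<phi> w \<partial>(\<nu> \<Otimes>\<^sub>M count_space UNIV)) = (\<integral>z. (\<Sum>k\<le>n. \<phi> (z, k)) \<partial>\<nu>)"
proof -
  interpret pair_sigma_finite \<nu> "count_space (UNIV :: nat set)"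
    by (rule pair_sigma_finite.intro[OF P sigma_finite_measure_count_space])
  note m' = measurable_pair_nat[OF m]
  show i: "integrable (\<nu> \<Otimes>\<^sub>M count_space UNIV) \<phi>"
  proof (rule Fubini_integrable[OF m'])
    show "integrable \<nu> (\<lambda>z. \<integral>k. norm (\<phi> (z, k)) \<partial>count_space UNIV)"
      using int by (subst count_space_finite_integral(2)[where n=n]) (auto simp: zero)
    show "AE z in \<nu>. integrable (count_space UNIV) (\<lambda>k. \<phi> (z, k))"
      by (intro AE_I2 count_space_finite_integral(1)[where n=n]) (auto simp: zero)
  qed
  show "(\<integral>w. \<phi> w \<partial>(\<nu> \<Otimes>\<^sub>M count_space UNIV)) = (\<integral>z. (\<Sum>k\<le>n. \<phi> (z, k)) \<partial>\<nu>)"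
    unfolding integral_fst'[OF i, symmetric]
    by (subst count_space_finite_integral(2)[where n=n]) (auto simp: zero)
qed

text \<open>The matrix of densities of the complex measures \<open>p\<^sub>*(f\<^sub>i f\<^sub>j\<^sup>* \<tau>)\<close> with respect to the image of \<open>\<tau>\<close> is almost
  everywhere positive semidefinite; the functions \<open>b\<^sub>i\<close> are the rows of its pointwise Cholesky factor.\<close>

lemma spectral_decomposition:
  fixes \<tau> :: "'a measure" and p :: "'a \<Rightarrow> complex" and f :: "nat \<Rightarrow> 'a \<Rightarrow> complex"
  assumes P: "prob_space \<tau>" and p: "p \<in> measurable \<tau> circle_borel" and f: "\<And>i. f i \<in> L2 \<tau>"
  and one: "\<And>y. y \<in> space \<tau> \<Longrightarrow> f i0 y = 1"
  shows "\<exists>\<sigma> b. prob_space \<sigma> \<and> sets \<sigma> = sets (circle_borel \<Otimes>\<^sub>M count_space UNIV) \<and> (\<forall>i. b i \<in> L2 \<sigma>) \<and>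
    (\<forall>i j (k::int). (\<integral>w. fst w powi k * (b i w * cnj (b j w)) \<partial>\<sigma>) = (\<integral>y. p y powi k * (f i y * cnj (f j y)) \<partial>\<tau>)) \<and>
    (\<forall>h\<in>L2 \<sigma>. (\<forall>i (k::int). (\<integral>w. fst w powi k * (h w * cnj (b i w)) \<partial>\<sigma>) = 0) \<longrightarrow> (AE w in \<sigma>. h w = 0)) \<and>
    equivalent_measures (circle_projection \<sigma>) (distr \<tau> circle_borel p)"
proof -
  interpret \<tau>: prob_space \<tau> by fact
  define \<nu> where "\<nu> = distr \<tau> circle_borel p"
  interpret \<nu>: prob_space \<nu> unfolding \<nu>_def by (rule \<tau>.prob_space_distr[OF p])
  have sets\<nu>: "sets \<nu> = sets circle_borel" by (simp add: \<nu>_def)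
  have sp\<nu>: "space \<nu> = sphere 0 1" by (simp add: \<nu>_def)
  note pm = power_int_circle_measurable[OF sets\<nu>]
  from Gram_density[where f=f, OF P p f, folded \<nu>_def]
  obtain G where G: "\<forall>z. psd (G z)" "\<forall>i j. integrable \<nu> (\<lambda>z. G z i j)"
    "\<forall>i j u B. u \<in> borel_measurable circle_borel \<longrightarrow> (\<forall>z\<in>space circle_borel. cmod (u z) \<le> B) \<longrightarrow>
      (\<integral>z. u z * G z i j \<partial>\<nu>) = (\<integral>y. u (p y) * (f i y * cnj (f j y)) \<partial>\<tau>)"
    by blast
  have psd: "psd (G z)" and Gi: "integrable \<nu> (\<lambda>z. G z i j)" for z i j using G by auto
  have Gk: "(\<integral>z. z powi k * G z i j \<partial>\<nu>) = (\<integral>y. p y powi k * (f i y * cnj (f j y)) \<partial>\<tau>)" for i j k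
    by (rule G(3)[rule_format, where B=1]) (auto simp: norm_power_int intro: power_int_circle_measurable)
  define L where "L z i k = chol (G z) i k" for z i k
  have Lm[measurable]: "(\<lambda>z. L z i k) \<in> borel_measurable \<nu>" for i k
    unfolding L_def by (intro chol_measurable borel_measurable_integrable Gi)
  have Lup: "L z i k = 0" if "k > i" for z i k using chol_upper[OF psd that] by (simp add: L_def)
  have Lcol: "L z i k = 0" if "L z k k = 0" for z i k using chol_zero_column[OF psd] that by (simp add: L_def)
  have Ldec: "G z i j = (\<Sum>k\<le>i. L z i k * cnj (L z j k))" for z i j
    unfolding L_def by (rule chol_decomp[OF psd])
  have Lsq: "integrable \<nu> (\<lambda>z. (cmod (L z i k))\<^sup>2)" for i k
  proof (cases "k \<le> i")
    case True
    show ?thesis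
    proof (rule Bochner_Integration.integrable_bound[of _ "\<lambda>z. G z i i"])
      show "AE z in \<nu>. norm ((cmod (L z i k))\<^sup>2) \<le> norm (G z i i)"
      proof (rule AE_I2)
        fix z
        have "G z i i = of_real (\<Sum>l\<le>i. (cmod (L z i l))\<^sup>2)"
          unfolding Ldec by (simp add: mult_cnj_self)
        then have "norm (G z i i) = (\<Sum>l\<le>i. (cmod (L z i l))\<^sup>2)"
          by (simp only: norm_of_real) (simp add: sum_nonneg)
        moreover have "(cmod (L z i k))\<^sup>2 \<le> (\<Sum>l\<le>i. (cmod (L z i l))\<^sup>2)"
          using True by (intro member_le_sum) auto
        ultimately show "norm ((cmod (L z i k))\<^sup>2) \<le> norm (G z i i)" by simp
      qed
    qed (auto intro: Gi)
  qed (simp add: Lup)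
  have LL: "integrable \<nu> (\<lambda>z. L z i k * cnj (L z j k))" for i j k
    by (intro L2_mult_integrable L2_I Lm Lsq)
  \<comment> \<open>The constant function in the family makes one diagonal density equal to 1 almost
    everywhere, so over almost every point some pivot is nonzero. Hence \<open>\<sigma>\<close>
    charges almost every fibre, and its projection loses no null sets.\<close>
  have ex: "AE z in \<nu>. \<exists>k. L z k k \<noteq> 0"
  proof -
    have "AE z in \<nu>. G z i0 i0 - 1 = 0"
    proof (rule circle_Fourier_zero[OF \<nu>.finite_measure_axioms sets\<nu>])
      show "integrable \<nu> (\<lambda>z. G z i0 i0 - 1)" using Gi by auto
      fix k :: int
      have "integrable \<nu> (\<lambda>z. z powi k * G z i0 i0)" "integrable \<nu> (\<lambda>z. z powi k)"
        using integrable_bounded_mult[OF Gi[of i0 i0], of "\<lambda>z. z powi k" 1] integrable_bounded_mult[of \<nu> "\<lambda>_. 1" "\<lambda>z. z powi k" 1] pm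
        by (auto simp: sp\<nu> norm_power_int)
      then have "(\<integral>z. z powi k * (G z i0 i0 - 1) \<partial>\<nu>) = (\<integral>z. z powi k * G z i0 i0 \<partial>\<nu>) - (\<integral>z. z powi k \<partial>\<nu>)"
        by (simp add: right_diff_distrib)
      also have "(\<integral>z. z powi k \<partial>\<nu>) = (\<integral>y. p y powi k \<partial>\<tau>)"
        unfolding \<nu>_def by (intro integral_distr p power_int_circle_measurable refl)
      also have "(\<integral>z. z powi k * G z i0 i0 \<partial>\<nu>) = (\<integral>y. p y powi k \<partial>\<tau>)"
        unfolding Gk by (intro Bochner_Integration.integral_cong refl) (simp add: one)
      finally show "(\<integral>z. z powi k * (G z i0 i0 - 1) \<partial>\<nu>) = 0" by simp
    qed
    then show ?thesis
    proof eventually_elim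
      case (elim z)
      then have "(\<Sum>k\<le>i0. L z i0 k * cnj (L z i0 k)) \<noteq> 0" using Ldec[of z i0 i0] by simp
      then obtain k where "L z i0 k * cnj (L z i0 k) \<noteq> 0" by (rule sum.not_neutral_contains_not_neutral)
      then have "L z i0 k \<noteq> 0" by auto
      then show ?case using Lcol by blast
    qed
  qed
  let ?N = "\<nu> \<Otimes>\<^sub>M count_space (UNIV :: nat set)"
  interpret N: pair_sigma_finite \<nu> "count_space (UNIV :: nat set)"
    by (rule pair_sigma_finite.intro[OF \<nu>.sigma_finite_measure_axioms sigma_finite_measure_count_space])
  \<comment> \<open>Geometric weights keep the mass over infinitely many fibre coordinates finite.
    Coordinates with zero pivot get no mass, since they would carry functions orthogonal to all
    \<open>b i\<close>.\<close>
  define w0 where "w0 x = (if L (fst x) (snd x) (snd x) = 0 then 0 else (1/2::real) ^ Suc (snd x))" for x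
  have w0m[measurable]: "w0 \<in> borel_measurable ?N"
    by (rule measurable_pair_nat) (simp add: w0_def)
  have w00: "0 \<le> w0 x" for x by (simp add: w0_def)
  have mle: "(\<integral>\<^sup>+x. ennreal (w0 x) \<partial>?N) \<le> 1"
  proof -
    have "(\<integral>\<^sup>+x. ennreal (w0 x) \<partial>?N) = (\<integral>\<^sup>+z. (\<Sum>k. ennreal (w0 (z, k))) \<partial>\<nu>)"
      by (subst N.M2.nn_integral_fst[symmetric]) (auto simp: nn_integral_count_space_nat)
    also have "\<dots> \<le> (\<integral>\<^sup>+z. (\<Sum>k. ennreal ((1/2) ^ Suc k)) \<partial>\<nu>)"
      by (intro nn_integral_mono suminf_le ennreal_leI summableI) (simp add: w0_def)
    also have "(\<Sum>k. ennreal ((1/2) ^ Suc k)) = ennreal 1"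
      by (intro suminf_ennreal_eq power_half_series) auto
    finally show ?thesis by (simp add: \<nu>.emeasure_space_1)
  qed
  have mpos: "(\<integral>\<^sup>+x. ennreal (w0 x) \<partial>?N) \<noteq> 0"
  proof
    assume "(\<integral>\<^sup>+x. ennreal (w0 x) \<partial>?N) = 0"
    then have "AE x in ?N. ennreal (w0 x) = 0" by (subst (asm) nn_integral_0_iff_AE) auto
    then have "AE z in \<nu>. AE k in count_space UNIV. ennreal (w0 (z, k)) = 0" by (rule N.AE_pair)
    then have "AE z in \<nu>. False"
      using ex by eventually_elim (auto simp: AE_count_space w0_def split: if_splits)
    then show False by (simp add: \<nu>.AE_False)
  qed
  define m where "m = enn2real (\<integral>\<^sup>+x. ennreal (w0 x) \<partial>?N)"
  have m: "ennreal m = (\<integral>\<^sup>+x. ennreal (w0 x) \<partial>?N)" "m > 0"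
  proof -
    have fin: "(\<integral>\<^sup>+x. ennreal (w0 x) \<partial>?N) < top" using mle by (rule le_less_trans) simp
    then show "ennreal m = (\<integral>\<^sup>+x. ennreal (w0 x) \<partial>?N)" unfolding m_def by simp
    show "m > 0" using fin mpos unfolding m_def by (simp add: enn2real_positive_iff zero_less_iff_neq_zero)
  qed
  define W where "W x = w0 x / m" for x
  have Wm[measurable]: "W \<in> borel_measurable ?N" unfolding W_def by measurable
  have W0: "0 \<le> W x" for x using w00[of x] m(2) by (simp add: W_def)
  define \<sigma> where "\<sigma> = density ?N (\<lambda>x. ennreal (W x))"
  have sets\<sigma>: "sets \<sigma> = sets (circle_borel \<Otimes>\<^sub>M count_space UNIV)"
    unfolding \<sigma>_def sets_density by (intro sets_pair_measure_cong sets\<nu> refl)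
  have m\<sigma>: "borel_measurable \<sigma> = borel_measurable ?N" unfolding \<sigma>_def by (rule measurable_cong_sets) simp_all
  have prob\<sigma>: "prob_space \<sigma>"
  proof (rule prob_spaceI)
    have "emeasure \<sigma> (space \<sigma>) = (\<integral>\<^sup>+x. ennreal (W x) \<partial>?N)"
      unfolding \<sigma>_def by (subst emeasure_density) (auto intro!: nn_integral_cong)
    also have "\<dots> = (\<integral>\<^sup>+x. ennreal (w0 x) / ennreal m \<partial>?N)"
      unfolding W_def using m(2) w00 by (simp add: divide_ennreal)
    also have "\<dots> = ennreal m / ennreal m"
      by (subst nn_integral_divide) (auto simp: m)
    finally show "emeasure \<sigma> (space \<sigma>) = 1" using m(2) by (simp add: ennreal_divide_self)
  qed
  \<comment> \<open>The root cancels the weight \<open>W\<close> in products of two such functions,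
    which leaves products of Cholesky entries.\<close>
  define b where "b i x = L (fst x) i (snd x) * of_real (sqrt (m * 2 ^ Suc (snd x)))" for i x
  have bm[measurable]: "b i \<in> borel_measurable ?N" for i
    by (rule measurable_pair_nat) (simp add: b_def)
  have Wb: "of_real (W (z, k)) * (b i (z, k) * cnj (b j (z, k))) = L z i k * cnj (L z j k)" for z k i j
  proof (cases "L z k k = 0")
    case True
    then show ?thesis using Lcol[OF True, of i] by (simp add: b_def)
  next
    case False
    have "complex_of_real (sqrt (m * 2 ^ Suc k)) * complex_of_real (sqrt (m * 2 ^ Suc k)) = of_real (m * 2 ^ Suc k)"
      using m(2) by (simp only: of_real_mult[symmetric] real_sqrt_mult_self) simp
    then have "b i (z, k) * cnj (b j (z, k)) = L z i k * cnj (L z j k) * of_real (m * 2 ^ Suc k)"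
      by (simp add: b_def mult_ac)
    moreover have "W (z, k) * (m * 2 ^ Suc k) = 1"
      using m(2) False by (simp add: W_def w0_def power_divide)
    then have "complex_of_real (W (z, k)) * complex_of_real (m * 2 ^ Suc k) = 1"
      unfolding of_real_mult[symmetric] by simp
    ultimately show ?thesis by (simp only: mult.left_commute[of "complex_of_real (W (z, k))"]) simp
  qed
  have Wcm: "W (z, k) * (cmod (b i (z, k)))\<^sup>2 = (cmod (L z i k))\<^sup>2" for z k i
  proof -
    have "complex_of_real (W (z, k) * (cmod (b i (z, k)))\<^sup>2) = complex_of_real ((cmod (L z i k))\<^sup>2)"
      using Wb[of z k i i] by (simp add: mult_cnj_self)
    then show ?thesis unfolding of_real_eq_iff .
  qed
  have bL2: "b i \<in> L2 \<sigma>" for i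
  proof (rule L2_I)
    show "integrable \<sigma> (\<lambda>x. (cmod (b i x))\<^sup>2)"
      unfolding \<sigma>_def
      by (subst integrable_density, measurable, simp add: W0)
         (rule pair_nat_finite_integral(1)[where n=i], auto simp: \<nu>.sigma_finite_measure_axioms Wcm Lup Lsq)
  qed (simp add: m\<sigma>)
  have Gram: "(\<integral>w. fst w powi k * (b i w * cnj (b j w)) \<partial>\<sigma>) = (\<integral>y. p y powi k * (f i y * cnj (f j y)) \<partial>\<tau>)" for i j k
  proof -
    have pk[measurable]: "(\<lambda>w. fst w powi k) \<in> borel_measurable ?N"
      by (rule measurable_compose[OF measurable_fst pm])
    have "(\<integral>w. fst w powi k * (b i w * cnj (b j w)) \<partial>\<sigma>) = (\<integral>w. W w *\<^sub>R (fst w powi k * (b i w * cnj (b j w))) \<partial>?N)"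
      unfolding \<sigma>_def using W0 by (subst integral_density) auto
    also have "\<dots> = (\<integral>w. fst w powi k * (L (fst w) i (snd w) * cnj (L (fst w) j (snd w))) \<partial>?N)"
      by (intro Bochner_Integration.integral_cong refl) (simp add: Wb[symmetric] scaleR_conv_of_real mult.left_commute)
    also have "\<dots> = (\<integral>z. (\<Sum>l\<le>i. z powi k * (L z i l * cnj (L z j l))) \<partial>\<nu>)"
      by (subst pair_nat_finite_integral(2)[where n=i])
         (auto simp: \<nu>.sigma_finite_measure_axioms Lup sp\<nu> norm_power_int
           intro!: borel_measurable_times pm measurable_cnj Lm integrable_bounded_mult[where B=1] LL)
    also have "\<dots> = (\<integral>z. z powi k * G z i j \<partial>\<nu>)" by (simp add: Ldec sum_distrib_left)
    finally show ?thesis by (simp add: Gk)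
  qed
  have total: "AE w in \<sigma>. h w = 0"
    if h: "h \<in> L2 \<sigma>" and z: "\<And>i k. (\<integral>w. fst w powi k * (h w * cnj (b i w)) \<partial>\<sigma>) = 0" for h
  proof -
    have hm[measurable]: "h \<in> borel_measurable ?N" using L2_measurable[OF h] by (simp add: m\<sigma>)
    define H where "H i x = W x *\<^sub>R (h x * cnj (b i x))" for i x
    have Hi: "integrable ?N (H i)" for i
      using L2_mult_integrable[OF h bL2, of i] W0 unfolding \<sigma>_def H_def[abs_def] by (subst (asm) integrable_density) auto
    have H0: "H i (z, k) = 0" if "k > i" for i k z using Lup[OF that] by (simp add: H_def b_def)
    have Hz: "AE z in \<nu>. (\<Sum>k\<le>i. H i (z, k)) = 0" for i
    proof (rule circle_Fourier_zero[OF \<nu>.finite_measure_axioms sets\<nu>])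
      have "integrable \<nu> (\<lambda>z. \<integral>k. H i (z, k) \<partial>count_space UNIV)" by (rule N.integrable_fst'[OF Hi])
      then show "integrable \<nu> (\<lambda>z. \<Sum>k\<le>i. H i (z, k))"
        by (subst (asm) count_space_finite_integral(2)[where n=i]) (auto simp: H0)
      fix k :: int
      have pk[measurable]: "(\<lambda>w. fst w powi k) \<in> borel_measurable ?N"
        by (rule measurable_compose[OF measurable_fst pm])
      have i: "integrable ?N (\<lambda>w. fst w powi k * H i w)"
        by (rule integrable_bounded_mult[where B=1]) (auto simp: Hi norm_power_int space_pair_measure sp\<nu>)
      have "0 = (\<integral>w. W w *\<^sub>R (fst w powi k * (h w * cnj (b i w))) \<partial>?N)"
        using z[of k i] W0 unfolding \<sigma>_def by (subst (asm) integral_density) auto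
      also have "\<dots> = (\<integral>w. fst w powi k * H i w \<partial>?N)" by (simp add: H_def)
      also have "\<dots> = (\<integral>z. \<integral>l. z powi k * H i (z, l) \<partial>count_space UNIV \<partial>\<nu>)"
        using N.integral_fst'[OF i] by simp
      also have "\<dots> = (\<integral>z. (\<Sum>l\<le>i. z powi k * H i (z, l)) \<partial>\<nu>)"
        by (subst count_space_finite_integral(2)[where n=i]) (auto simp: H0)
      finally show "(\<integral>z. z powi k * (\<Sum>k\<le>i. H i (z, k)) \<partial>\<nu>) = 0" by (simp add: sum_distrib_left)
    qed
    then have "AE z in \<nu>. \<forall>i. (\<Sum>k\<le>i. H i (z, k)) = 0" by (simp add: AE_all_countable)
    \<comment> \<open>Where \<open>W\<close> is positive the triangular factor has a nonzero
      diagonal entry, so the equations are solved coordinate by coordinate.\<close>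
    then have "AE z in \<nu>. \<forall>k. W (z, k) > 0 \<longrightarrow> h (z, k) = 0"
    proof eventually_elim
      case (elim z)
      show ?case
      proof
        fix k show "W (z, k) > 0 \<longrightarrow> h (z, k) = 0"
        proof (induction k rule: less_induct)
          case (less k)
          have "H k (z, l) = 0" if "l < k" for l
            using less[OF that] W0[of "(z, l)"] by (cases "W (z, l) = 0") (auto simp: H_def)
          then have "(\<Sum>l\<le>k. H k (z, l)) = H k (z, k)"
            by (simp add: lessThan_Suc_atMost[symmetric])
          then have "H k (z, k) = 0" using spec[OF elim, of k] by simp
          then show ?case using m(2)
            by (auto simp: H_def b_def W_def w0_def split: if_splits)
        qed
      qed
    qed
    then have "AE z in \<nu>. AE k in count_space UNIV. W (z, k) > 0 \<longrightarrow> h (z, k) = 0" by (simp add: AE_count_space)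
    then have "AE x in ?N. W x > 0 \<longrightarrow> h x = 0" by (intro N.AE_pair_measure) auto
    then show ?thesis unfolding \<sigma>_def by (subst AE_density) auto
  qed
  have fstm: "fst \<in> measurable \<sigma> circle_borel"
    using sets\<sigma> by (simp cong: measurable_cong_sets)
  have null: "E \<in> null_sets (circle_projection \<sigma>) \<longleftrightarrow> E \<in> null_sets \<nu>" if E: "E \<in> sets circle_borel" for E
  proof -
    have E': "{z \<in> space circle_borel. z \<notin> E} \<in> sets circle_borel"
      using sets.compl_sets[OF E] by (simp add: set_diff_eq)
    have "E \<in> null_sets (circle_projection \<sigma>) \<longleftrightarrow> (AE z in distr \<sigma> circle_borel fst. z \<notin> E)"
      unfolding circle_projection_def by (subst AE_iff_null_sets) (auto simp: E)
    also have "\<dots> \<longleftrightarrow> (AE w in \<sigma>. fst w \<notin> E)" by (rule AE_distr_iff[OF fstm E'])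
    also have "\<dots> \<longleftrightarrow> (AE x in ?N. W x > 0 \<longrightarrow> fst x \<notin> E)"
      unfolding \<sigma>_def by (subst AE_density) auto
    also have "\<dots> \<longleftrightarrow> (AE z in \<nu>. \<forall>k. W (z, k) > 0 \<longrightarrow> z \<notin> E)"
    proof
      assume "AE x in ?N. W x > 0 \<longrightarrow> fst x \<notin> E"
      from N.AE_pair[OF this] have "AE z in \<nu>. AE k in count_space UNIV. W (z, k) > 0 \<longrightarrow> z \<notin> E"
        by (simp only: fst_conv)
      then show "AE z in \<nu>. \<forall>k. W (z, k) > 0 \<longrightarrow> z \<notin> E"
        by (rule eventually_mono) (simp only: AE_count_space, blast)
    next
      have [measurable]: "E \<in> sets \<nu>" using E by (simp add: sets\<nu>)
      assume "AE z in \<nu>. \<forall>k. W (z, k) > 0 \<longrightarrow> z \<notin> E"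
      then show "AE x in ?N. W x > 0 \<longrightarrow> fst x \<notin> E"
        by (intro N.AE_pair_measure) (auto simp: AE_count_space)
    qed
    also have "\<dots> \<longleftrightarrow> (AE z in \<nu>. z \<notin> E)"
    proof
      assume "AE z in \<nu>. \<forall>k. W (z, k) > 0 \<longrightarrow> z \<notin> E"
      then show "AE z in \<nu>. z \<notin> E"
        using ex by eventually_elim (use m(2) in \<open>auto simp: W_def w0_def split: if_splits\<close>)
    qed (auto elim: eventually_mono)
    also have "\<dots> \<longleftrightarrow> E \<in> null_sets \<nu>" by (subst AE_iff_null_sets) (auto simp: E sets\<nu>)
    finally show ?thesis .
  qed
  have sets_proj: "sets (circle_projection \<sigma>) = sets circle_borel" by (simp add: circle_projection_def)
  have "null_sets (circle_projection \<sigma>) = null_sets \<nu>"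
  proof (rule set_eqI)
    fix E show "E \<in> null_sets (circle_projection \<sigma>) \<longleftrightarrow> E \<in> null_sets \<nu>"
    proof (cases "E \<in> sets circle_borel")
      case True then show ?thesis by (rule null)
    next
      case False
      then show ?thesis using null_setsD2[of E "circle_projection \<sigma>"] null_setsD2[of E \<nu>] by (auto simp: sets_proj sets\<nu>)
    qed
  qed
  then have equiv: "equivalent_measures (circle_projection \<sigma>) \<nu>"
    unfolding equivalent_measures_def absolutely_continuous_def by (simp add: sets_proj sets\<nu>)
  show ?thesis
  proof (intro exI[of _ \<sigma>] exI[of _ b] conjI allI ballI impI)
    show "equivalent_measures (circle_projection \<sigma>) (distr \<tau> circle_borel p)"
      using equiv by (simp only: \<nu>_def)
  qed (simp_all only: prob\<sigma> sets\<sigma> bL2 Gram total)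
qed

section \<open>Generalized Riesz products\<close>

fun height :: "(nat \<Rightarrow> nat) \<Rightarrow> nat \<Rightarrow> nat" where
  "height r 0 = 1"
| "height r (Suc j) = height r j * 2 ^ (r j + 3)"

text \<open>Powers of \<open>2\<close> form a Sidon set. The factor \<open>2\<close> to the power \<open>r j + 3\<close> in the height keeps the copies away from
  the ends of the next tower, so that an integer \<open>k + h\<^sub>j e\<close> of moderate size determines \<open>k\<close> and \<open>e\<close>.\<close>

definition spots :: "(nat \<Rightarrow> nat) \<Rightarrow> nat \<Rightarrow> nat set" where
  "spots r j = (\<lambda>i. 2 ^ (i + 1)) ` {..<r j}"

definition gaps :: "(nat \<Rightarrow> nat) \<Rightarrow> nat \<Rightarrow> int set" where
  "gaps r j = {int a - int b | a b. a \<in> spots r j \<and> b \<in> spots r j \<and> a \<noteq> b}"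

lemma height_pos: "0 < height r j" by (induction j) auto

lemma height_mono: "i \<le> j \<Longrightarrow> height r i \<le> height r j"
proof (induction j)
  case (Suc j)
  have "height r j * 1 \<le> height r j * 2 ^ (r j + 3)" by (intro mult_left_mono) auto
  then have "height r j \<le> height r (Suc j)" by simp
  then show ?case using Suc by (cases "i = Suc j") (auto simp del: height.simps)
qed simp

lemma finite_spots: "finite (spots r j)" by (simp add: spots_def)

lemma card_spots: "card (spots r j) = r j"
  unfolding spots_def by (subst card_image) (auto simp: inj_on_def)

lemma spots_bounds: "a \<in> spots r j \<Longrightarrow> 2 \<le> a \<and> a \<le> 2 ^ r j"
proof -
  assume "a \<in> spots r j"
  then obtain i where "i < r j" "a = 2 ^ (i + 1)" by (auto simp: spots_def)
  moreover have "(2::nat) ^ (i + 1) \<le> 2 ^ r j" using \<open>i < r j\<close> by (intro power_increasing) auto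
  moreover have "(2::nat) ^ 1 \<le> 2 ^ (i + 1)" by (intro power_increasing) auto
  ultimately show ?thesis by simp
qed

lemma spots_even: "a \<in> spots r j \<Longrightarrow> even a" by (auto simp: spots_def)

text \<open>Uniqueness of binary expansions: parity decides whether an exponent 0 occurs, and
  otherwise all exponents drop by one.\<close>

lemma pow2_sum_unique: "(2::nat) ^ i + 2 ^ l = 2 ^ k + 2 ^ j \<Longrightarrow> i \<noteq> j \<Longrightarrow> i = k"
proof (induction i arbitrary: j k l)
  case 0
  show ?case
  proof (rule ccontr)
    assume "0 \<noteq> k"
    then have "even ((2::nat) ^ k + 2 ^ j)" using 0 by simp
    then have "even ((2::nat) ^ 0 + 2 ^ l)" using 0 by simp
    then have "l = 0" by (cases l) auto
    then have "(2::nat) ^ k + 2 ^ j = 2" using 0 by simp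
    moreover have "(2::nat) ^ 1 \<le> 2 ^ k" using \<open>0 \<noteq> k\<close> by (intro power_increasing) auto
    ultimately have "(2::nat) ^ j = 0" unfolding power_one_right by linarith
    then show False by simp
  qed
next
  case (Suc i)
  show ?case
  proof (cases k)
    case k0: 0
    show ?thesis
    proof (cases l)
      case 0
      then have "j = Suc i" using Suc.prems(1) k0 power_inject_exp[of "2::nat" "Suc i" j] by simp
      then show ?thesis using Suc.prems(2) by simp
    next
      case (Suc l')
      then have "even ((2::nat) ^ k + 2 ^ j)" using Suc.prems(1) by (metis even_add even_power even_numeral zero_less_Suc)
      then have "j = 0" using k0 by (cases j) auto
      then have "(2::nat) ^ Suc i + 2 ^ l = 2" using Suc.prems(1) k0 by simp
      moreover have "(2::nat) ^ 1 \<le> 2 ^ Suc i" by (intro power_increasing) auto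
      ultimately have "(2::nat) ^ l = 0" unfolding power_one_right by linarith
      then show ?thesis by simp
    qed
  next
    case (Suc k')
    show ?thesis
    proof (cases j)
      case 0
      then have "odd ((2::nat) ^ k + 2 ^ j)" using Suc by simp
      then have "odd ((2::nat) ^ Suc i + 2 ^ l)" using Suc.prems(1) by simp
      then have "l = 0" by (cases l) auto
      then have "(2::nat) ^ Suc i = 2 ^ k" using Suc.prems(1) 0 by simp
      then show ?thesis using power_inject_exp[of "2::nat" "Suc i" k] by simp
    next
      case (Suc j')
      have "even ((2::nat) ^ Suc i + 2 ^ l)" using Suc.prems(1) \<open>k = Suc k'\<close> Suc by simp
      then obtain l' where l: "l = Suc l'" by (cases l) auto
      have "(2::nat) ^ i + 2 ^ l' = 2 ^ k' + 2 ^ j'" using Suc.prems(1) \<open>k = Suc k'\<close> Suc l by simp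
      then have "i = k'" using Suc.IH[of l' k' j'] Suc.prems(2) Suc by simp
      then show ?thesis using \<open>k = Suc k'\<close> by simp
    qed
  qed
qed

lemma spots_Sidon:
  assumes "a \<in> spots r j" "b \<in> spots r j" "c \<in> spots r j" "d \<in> spots r j"
  and "int a - int b = int c - int d" "a \<noteq> b"
  shows "a = c \<and> b = d"
proof -
  obtain i k l m where p: "a = 2 ^ i" "b = 2 ^ k" "c = 2 ^ l" "d = 2 ^ m"
    using assms(1-4) unfolding spots_def by blast
  have "a + d = c + b" using assms(5) by linarith
  then have "(2::nat) ^ i + 2 ^ m = 2 ^ l + 2 ^ k" using p by simp
  moreover have "i \<noteq> k" using assms(6) p by auto
  ultimately have "i = l" by (rule pow2_sum_unique)
  then show ?thesis using \<open>a + d = c + b\<close> p by simp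
qed

lemma gaps_bound: "e \<in> gaps r j \<Longrightarrow> \<bar>e\<bar> \<le> 2 ^ r j"
proof -
  assume "e \<in> gaps r j"
  then obtain a b where "e = int a - int b" "a \<in> spots r j" "b \<in> spots r j" by (auto simp: gaps_def)
  then have "\<bar>e\<bar> \<le> int (2 ^ r j)" using spots_bounds[of a r j] spots_bounds[of b r j] by linarith
  then show ?thesis by simp
qed

lemma gapsI: "a \<in> spots r j \<Longrightarrow> b \<in> spots r j \<Longrightarrow> a \<noteq> b \<Longrightarrow> int a - int b \<in> gaps r j"
  unfolding gaps_def by blast

lemma zero_notin_gaps: "0 \<notin> gaps r j" by (auto simp: gaps_def)

lemma uminus_gaps: "- e \<in> gaps r j \<longleftrightarrow> e \<in> gaps r j"
proof -
  have "- x \<in> gaps r j" if x: "x \<in> gaps r j" for x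
  proof -
    obtain a b where "x = int a - int b" "a \<in> spots r j" "b \<in> spots r j" "a \<noteq> b"
      using x by (auto simp: gaps_def)
    then show ?thesis using gapsI[of b r j a] by simp
  qed
  from this[of e] this[of "- e"] show ?thesis by auto
qed

lemma gaps_image: "gaps r j = (\<lambda>(a, b). int a - int b) ` {(a, b) \<in> spots r j \<times> spots r j. a \<noteq> b}"
  by (auto simp: gaps_def image_iff)

text \<open>By the Sidon property a gap comes from a single pair of spots. A shift by a gap
  therefore makes exactly one of \<open>r j\<close> copies coincide with another, which is the
  origin of the coefficient \<open>1 / r j\<close>.\<close>

lemma gaps_inj: "inj_on (\<lambda>(a, b). int a - int b) {(a, b) \<in> spots r j \<times> spots r j. a \<noteq> b}"
  using spots_Sidon[of _ r j] by (auto simp: inj_on_def)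

lemma finite_gaps: "finite (gaps r j)"
  unfolding gaps_image by (rule finite_imageI, rule finite_subset[of _ "spots r j \<times> spots r j"]) (auto simp: finite_spots)

lemma card_gaps: "card (gaps r j) \<le> r j * r j"
proof -
  have "card (gaps r j) \<le> card {(a, b) \<in> spots r j \<times> spots r j. a \<noteq> b}"
    unfolding gaps_image by (rule card_image_le, rule finite_subset[of _ "spots r j \<times> spots r j"]) (auto simp: finite_spots)
  also have "\<dots> \<le> card (spots r j \<times> spots r j)"
    by (rule card_mono) (auto simp: finite_spots)
  finally show ?thesis by (simp add: card_cartesian_product card_spots)
qed

text \<open>The Fourier coefficients of a single factor of the Riesz product, before the dilation by
  the height.\<close>

definition gap_coeff :: "(nat \<Rightarrow> nat) \<Rightarrow> (nat \<Rightarrow> real) \<Rightarrow> nat \<Rightarrow> int \<Rightarrow> real" where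
  "gap_coeff r \<epsilon> j e = (if e = 0 then 1 else if e \<in> gaps r j then \<epsilon> j else 0)"

lemma powi_mult_cnj: "cmod z = 1 \<Longrightarrow> z powi k * cnj (z powi l) = z powi (k - l)"
proof -
  assume z: "cmod z = 1"
  have "z \<noteq> 0" using z by auto
  then show ?thesis unfolding cnj_powi_circle[OF z] by (simp add: power_int_add[symmetric])
qed

lemma trig_sum: "finite Q \<Longrightarrow> (\<And>q. q \<in> Q \<Longrightarrow> trig (u q)) \<Longrightarrow> trig (\<lambda>z. \<Sum>q\<in>Q. u q z)"
proof (induction Q rule: finite_induct)
  case empty
  show ?case using trig.monom[of 0 0] by simp
qed (auto intro: trig.add)

lemma trig_powi: "trig (\<lambda>z. z powi k)" using trig.monom[of 1 k] by simp

text \<open>Formally, \<open>\<rho>\<close> is the product over \<open>j\<close> of the factors \<open>1 + \<epsilon>\<^sub>j \<Sum>e\<in>gaps r j. z\<close> to the power \<open>h\<^sub>j e\<close>.\<close>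

locale riesz =
  fixes r :: "nat \<Rightarrow> nat" and \<epsilon> :: "nat \<Rightarrow> real" and \<phi> :: "int \<Rightarrow> real" and \<rho> :: "complex measure"
  assumes r2: "\<And>j. 2 \<le> r j" and eps0: "\<And>j. 0 \<le> \<epsilon> j"
  and phi0: "\<phi> 0 = 1"
  and phi_mult: "\<And>J k e. 2 * \<bar>k\<bar> \<le> int (height r J) \<Longrightarrow> 2 * \<bar>k + int (height r J) * e\<bar> \<le> int (height r (Suc J)) \<Longrightarrow>
     \<phi> (k + int (height r J) * e) = \<phi> k * gap_coeff r \<epsilon> J e"
  and prob: "prob_space \<rho>" and sets_rho: "sets \<rho> = sets circle_borel"
  and Fourier: "\<And>k::int. (\<integral>z. z powi k \<partial>\<rho>) = complex_of_real (\<phi> k)"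
begin

abbreviation "h \<equiv> height r"

text \<open>Each exponent is \<open>h\<^sub>j\<close> times the difference of a spot and the smallest spot. The resulting sum \<open>Y\<close> is
  centred for Lebesgue measure, but has mean \<open>S\<close> for \<open>\<rho>\<close>, and its variance is of the order of \<open>S\<close> for both.\<close>

definition expo :: "nat \<times> nat \<Rightarrow> int" where
  "expo q = int (h (fst q)) * (2 ^ (snd q + 1) - 2)"

definition idx :: "nat set \<Rightarrow> (nat \<times> nat) set" where
  "idx I = (SIGMA j:I. {1..<r j})"

lemma spot_I: "i < r j \<Longrightarrow> 2 ^ (i + 1) \<in> spots r j" by (auto simp: spots_def)

lemma step_gap: "1 \<le> i \<Longrightarrow> i < r j \<Longrightarrow> (2 ^ (i + 1) - 2 :: int) \<in> gaps r j"
proof -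
  assume i: "1 \<le> i" "i < r j"
  have "2 ^ (i + 1) \<noteq> (2::nat) ^ (0 + 1)" using i by (subst power_inject_exp) auto
  from gapsI[OF spot_I[of _ j] spot_I[of _ j] this] show ?thesis using i by simp
qed

lemma step_diff_gap: "i < r j \<Longrightarrow> i' < r j \<Longrightarrow> i \<noteq> i' \<Longrightarrow> ((2 ^ (i + 1) - 2) - (2 ^ (i' + 1) - 2) :: int) \<in> gaps r j"
proof -
  assume i: "i < r j" "i' < r j" "i \<noteq> i'"
  have "2 ^ (i + 1) \<noteq> (2::nat) ^ (i' + 1)" using i by (subst power_inject_exp) auto
  from gapsI[OF spot_I[of _ j] spot_I[of _ j] this] show ?thesis using i by simp
qed

lemma abs_add_bound: "2 * \<bar>x\<bar> \<le> a \<Longrightarrow> \<bar>y\<bar> \<le> b \<Longrightarrow> H = 8 * b \<Longrightarrow> a \<le> b \<Longrightarrow> 2 * \<bar>x + y\<bar> \<le> H" for x y a b H :: int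
proof -
  have "2 * A \<le> a \<Longrightarrow> B \<le> b \<Longrightarrow> C \<le> A + B \<Longrightarrow> 0 \<le> B \<Longrightarrow> H = 8 * b \<Longrightarrow> a \<le> b \<Longrightarrow> 2 * C \<le> H" for A B C :: int
    by linarith
  from this[OF _ _ abs_triangle_ineq abs_ge_zero] show "2 * \<bar>x\<bar> \<le> a \<Longrightarrow> \<bar>y\<bar> \<le> b \<Longrightarrow> H = 8 * b \<Longrightarrow> a \<le> b \<Longrightarrow> 2 * \<bar>x + y\<bar> \<le> H" .
qed

lemma height_gap_bound: assumes "\<bar>e\<bar> \<le> 2 ^ r j" shows "\<bar>int (h j) * e\<bar> \<le> int (h j) * 2 ^ r j"
  unfolding abs_mult using assms by (simp add: mult_left_mono)

lemma height_Suc_int: "int (h (Suc j)) = 8 * (int (h j) * 2 ^ r j)"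
  by (simp add: power_add)

lemma height_pow: "int (h j) \<le> int (h j) * 2 ^ r j"
  using mult_left_mono[of 1 "2 ^ r j" "int (h j)"] by simp

lemma phi_gap: assumes "e \<in> gaps r j" shows "\<phi> (int (h j) * e) = \<epsilon> j"
proof -
  have "2 * \<bar>0 + int (h j) * e\<bar> \<le> int (h (Suc j))"
    by (rule abs_add_bound[OF _ height_gap_bound[OF gaps_bound[OF assms]] height_Suc_int height_pow]) simp
  from phi_mult[OF _ this] show ?thesis
    using assms zero_notin_gaps[of r j] by (auto simp: phi0 gap_coeff_def)
qed

text \<open>The lower frequency is at most half the height of the upper tower, so
  \<open>phi_mult\<close> separates the two digits.\<close>

lemma phi_two_gaps: assumes "j < j'" "e \<in> gaps r j" "e' \<in> gaps r j'"
  shows "\<phi> (int (h j) * e + int (h j') * e') = \<epsilon> j * \<epsilon> j'"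
proof -
  have "2 * \<bar>0 + int (h j) * e\<bar> \<le> int (h (Suc j))"
    by (rule abs_add_bound[OF _ height_gap_bound[OF gaps_bound[OF assms(2)]] height_Suc_int height_pow]) simp
  also have "\<dots> \<le> int (h j')" using height_mono[of "Suc j" j' r] assms(1) by (simp del: height.simps)
  finally have 1: "2 * \<bar>int (h j) * e\<bar> \<le> int (h j')" by simp
  have "2 * \<bar>int (h j) * e + int (h j') * e'\<bar> \<le> int (h (Suc j'))"
    by (rule abs_add_bound[OF 1 height_gap_bound[OF gaps_bound[OF assms(3)]] height_Suc_int height_pow])
  from phi_mult[OF 1 this] show ?thesis
    using assms zero_notin_gaps[of r j'] by (auto simp: phi_gap gap_coeff_def)
qed

text \<open>The three terms stand for the three kinds of difference: zero, a gap within one tower,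
  and gaps in two different towers. All are nonnegative, so one bound serves every case when the
  second moment of \<open>Y\<close> is summed.\<close>

lemma phi_expo_diff:
  assumes "q \<in> idx I" "q' \<in> idx I"
  shows "\<phi> (expo q - expo q') \<le> (if q = q' then 1 else 0) + (if fst q = fst q' then \<epsilon> (fst q) else 0) + \<epsilon> (fst q) * \<epsilon> (fst q')"
proof -
  obtain j i where q: "q = (j, i)" "1 \<le> i" "i < r j" using assms by (auto simp: idx_def)
  obtain j' i' where q': "q' = (j', i')" "1 \<le> i'" "i' < r j'" using assms by (auto simp: idx_def)
  consider "q = q'" | "j = j'" "i \<noteq> i'" | "j < j'" | "j' < j" using q q' by (cases "j = j'"; cases "i = i'"; force)
  then show ?thesis
  proof cases
    case 1
    have "0 \<le> \<epsilon> j * \<epsilon> j" using eps0[of j] by simp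
    then show ?thesis using 1 eps0[of j] by (auto simp: q phi0)
  next
    case 2
    have "expo q - expo q' = int (h j) * ((2 ^ (i + 1) - 2) - (2 ^ (i' + 1) - 2))"
      by (simp add: expo_def q q' 2 right_diff_distrib)
    then show ?thesis using phi_gap[OF step_diff_gap[of i j i']] 2 q q' eps0[of j] by simp
  next
    case 3
    have "expo q - expo q' = int (h j) * (2 ^ (i + 1) - 2) + int (h j') * (- (2 ^ (i' + 1) - 2))"
      unfolding expo_def q q' fst_conv snd_conv by (simp add: algebra_simps)
    moreover have "\<phi> (int (h j) * (2 ^ (i + 1) - 2) + int (h j') * (- (2 ^ (i' + 1) - 2))) = \<epsilon> j * \<epsilon> j'"
      using step_gap[OF q(2,3)] step_gap[OF q'(2,3)] by (intro phi_two_gaps 3) (simp_all only: uminus_gaps)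
    ultimately show ?thesis using 3 by (simp add: q q')
  next
    case 4
    have "expo q - expo q' = int (h j') * (- (2 ^ (i' + 1) - 2)) + int (h j) * (2 ^ (i + 1) - 2)"
      unfolding expo_def q q' fst_conv snd_conv by (simp add: algebra_simps)
    moreover have "\<phi> (int (h j') * (- (2 ^ (i' + 1) - 2)) + int (h j) * (2 ^ (i + 1) - 2)) = \<epsilon> j' * \<epsilon> j"
      using step_gap[OF q(2,3)] step_gap[OF q'(2,3)] by (intro phi_two_gaps 4) (simp_all only: uminus_gaps)
    ultimately show ?thesis using 4 by (simp add: q q' mult.commute)
  qed
qed

lemma expo_inj: assumes "q \<in> idx I" "q' \<in> idx I" "expo q = expo q'" shows "q = q'"
proof -
  obtain j i where q: "q = (j, i)" "1 \<le> i" "i < r j" using assms by (auto simp: idx_def)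
  obtain j' i' where q': "q' = (j', i')" "1 \<le> i'" "i' < r j'" using assms by (auto simp: idx_def)
  \<comment> \<open>An exponent is smaller than the height of every later tower, and at least the
    height of its own, since for \<open>1 \<le> i\<close> the difference to the smallest spot is
    positive.\<close>
  have less: False if "j1 < j2" "1 \<le> i1" "i1 < r j1" "1 \<le> i2" "expo (j1, i1) = expo (j2, i2)" for j1 i1 j2 i2
  proof -
    have "expo (j1, i1) \<le> int (h j1) * 2 ^ r j1"
      using height_gap_bound[OF gaps_bound[OF step_gap[OF that(2,3)]]] by (simp add: expo_def abs_le_iff)
    also have "\<dots> < int (h (Suc j1))" using height_Suc_int[of j1] height_pos[of r j1] height_pow[of j1] by simp
    also have "\<dots> \<le> int (h j2) * 1" using height_mono[of "Suc j1" j2 r] that(1) by (simp del: height.simps)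
    also have "\<dots> \<le> int (h j2) * (2 ^ (i2 + 1) - 2)"
    proof (intro mult_left_mono)
      have "(2::int) ^ 2 \<le> 2 ^ (i2 + 1)" using that(4) by (intro power_increasing) auto
      then show "1 \<le> (2::int) ^ (i2 + 1) - 2" by simp
    qed simp
    also have "\<dots> = expo (j2, i2)" by (simp add: expo_def)
    finally show False using that(5) by simp
  qed
  have "j = j'" using less[of j j' i i'] less[of j' j i' i] assms(3) q q' by (metis linorder_neqE_nat)
  then have "(2::int) ^ (i + 1) = 2 ^ (i' + 1)" using assms(3) height_pos[of r j] by (simp add: q q' expo_def)
  then have "i = i'" using power_inject_exp[of "2::int" "i + 1" "i' + 1"] by simp
  then show ?thesis using \<open>j = j'\<close> q q' by simp
qed

section \<open>Mean and variance of the separating trigonometric sum\<close>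

definition Y :: "nat set \<Rightarrow> complex \<Rightarrow> complex" where
  "Y I z = (\<Sum>q\<in>idx I. of_real (\<epsilon> (fst q)) * z powi (expo q))"

definition S :: "nat set \<Rightarrow> real" where "S I = (\<Sum>q\<in>idx I. (\<epsilon> (fst q))\<^sup>2)"

lemma finite_idx: "finite I \<Longrightarrow> finite (idx I)" by (auto simp: idx_def)

lemma trig_Y: "finite I \<Longrightarrow> trig (Y I)"
  unfolding Y_def[abs_def] by (intro trig_sum finite_idx trig.monom)

lemma Y_square:
  assumes "finite I" "finite_measure \<kappa>" "sets \<kappa> = sets circle_borel"
  shows "complex_of_real (\<integral>z. (cmod (Y I z))\<^sup>2 \<partial>\<kappa>) =
    (\<Sum>q\<in>idx I. \<Sum>q'\<in>idx I. of_real (\<epsilon> (fst q) * \<epsilon> (fst q')) * (\<integral>z. z powi (expo q - expo q') \<partial>\<kappa>))"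
proof -
  have sp: "space \<kappa> = sphere 0 1" using sets_eq_imp_space_eq[OF assms(3)] by simp
  have i: "integrable \<kappa> (\<lambda>z. z powi k)" for k by (rule trig_integrable[OF trig_powi assms(3,2)])
  have "complex_of_real (\<integral>z. (cmod (Y I z))\<^sup>2 \<partial>\<kappa>) = (\<integral>z. Y I z * cnj (Y I z) \<partial>\<kappa>)"
    unfolding integral_complex_of_real[symmetric] by (simp add: mult_cnj_self)
  also have "\<dots> = (\<integral>z. (\<Sum>q\<in>idx I. \<Sum>q'\<in>idx I. of_real (\<epsilon> (fst q) * \<epsilon> (fst q')) * z powi (expo q - expo q')) \<partial>\<kappa>)"
  proof (intro Bochner_Integration.integral_cong refl)
    fix z assume "z \<in> space \<kappa>"
    then have "cmod z = 1" by (simp add: sp)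
    then show "Y I z * cnj (Y I z) = (\<Sum>q\<in>idx I. \<Sum>q'\<in>idx I. of_real (\<epsilon> (fst q) * \<epsilon> (fst q')) * z powi (expo q - expo q'))"
      unfolding Y_def cnj_sum sum_product
      by (intro sum.cong refl) (simp add: powi_mult_cnj[symmetric] mult_ac)
  qed
  also have "\<dots> = (\<Sum>q\<in>idx I. \<Sum>q'\<in>idx I. of_real (\<epsilon> (fst q) * \<epsilon> (fst q')) * (\<integral>z. z powi (expo q - expo q') \<partial>\<kappa>))"
    using i by simp
  finally show ?thesis .
qed

lemma Y_lebesgue: assumes "finite I" shows "(\<integral>z. (cmod (Y I z))\<^sup>2 \<partial>circle_lebesgue) = 2 * pi * S I"
proof -
  have "complex_of_real (\<integral>z. (cmod (Y I z))\<^sup>2 \<partial>circle_lebesgue) =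
    (\<Sum>q\<in>idx I. \<Sum>q'\<in>idx I. if q' = q then of_real ((\<epsilon> (fst q))\<^sup>2 * (2 * pi)) else 0)"
    unfolding Y_square[OF assms finite_circle_lebesgue sets_circle_lebesgue] circle_lebesgue_powi
    by (intro sum.cong refl) (auto dest: expo_inj simp: power2_eq_square)
  also have "\<dots> = complex_of_real (2 * pi * S I)"
    using finite_idx[OF assms] by (simp add: S_def sum_distrib_left mult_ac)
  finally show ?thesis unfolding of_real_eq_iff .
qed

lemma S_eq: "finite I \<Longrightarrow> S I = (\<Sum>j\<in>I. real (r j - 1) * (\<epsilon> j)\<^sup>2)"
proof -
  assume I: "finite I"
  have "S I = (\<Sum>(j, i)\<in>(SIGMA j:I. {1..<r j}). (\<epsilon> j)\<^sup>2)" by (simp add: S_def idx_def split_def)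
  also have "\<dots> = (\<Sum>j\<in>I. \<Sum>i\<in>{1..<r j}. (\<epsilon> j)\<^sup>2)" using I by (subst sum.Sigma) auto
  finally show ?thesis by simp
qed

text \<open>Under \<open>\<rho>\<close> the mean of \<open>Y\<close> is \<open>S\<close>. The last
  term of \<open>phi_expo_diff\<close> sums to the square of this mean and cancels, the diagonal
  gives \<open>S\<close>, and the middle term at most \<open>S\<close>, because each index has fewer
  than \<open>r j\<close> partners in its tower, each with weight
  \<open>\<epsilon> j\<close>.\<close>

lemma Y_rho:
  assumes I: "finite I" and small: "\<And>j. real (r j) * \<epsilon> j \<le> 1"
  shows "(\<integral>z. (cmod (Y I z - of_real (S I)))\<^sup>2 \<partial>\<rho>) \<le> 2 * S I"
proof -
  interpret prob_space \<rho> by (rule prob)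
  note fin = finite_measure_axioms
  have mean: "ip \<rho> (Y I) (\<lambda>_. of_real (S I)) = of_real (S I * S I)"
  proof -
    have i: "integrable \<rho> (\<lambda>z. z powi k)" for k by (rule trig_integrable[OF trig_powi sets_rho fin])
    have "(\<integral>z. Y I z \<partial>\<rho>) = (\<Sum>q\<in>idx I. of_real (\<epsilon> (fst q)) * of_real (\<phi> (expo q)))"
      unfolding Y_def using i by (simp add: Fourier)
    also have "\<dots> = (\<Sum>q\<in>idx I. of_real ((\<epsilon> (fst q))\<^sup>2))"
    proof (intro sum.cong refl)
      fix q assume "q \<in> idx I"
      then have "\<phi> (expo q) = \<epsilon> (fst q)" unfolding expo_def
        by (intro phi_gap step_gap) (auto simp: idx_def)
      then show "complex_of_real (\<epsilon> (fst q)) * of_real (\<phi> (expo q)) = of_real ((\<epsilon> (fst q))\<^sup>2)"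
        by (simp add: power2_eq_square)
    qed
    finally show ?thesis by (simp add: ip_def S_def)
  qed
  have "(\<integral>z. (cmod (Y I z))\<^sup>2 \<partial>\<rho>) = (\<Sum>q\<in>idx I. \<Sum>q'\<in>idx I. \<epsilon> (fst q) * \<epsilon> (fst q') * \<phi> (expo q - expo q'))"
  proof -
    have "complex_of_real (\<integral>z. (cmod (Y I z))\<^sup>2 \<partial>\<rho>) = of_real (\<Sum>q\<in>idx I. \<Sum>q'\<in>idx I. \<epsilon> (fst q) * \<epsilon> (fst q') * \<phi> (expo q - expo q'))"
      by (simp add: Y_square[OF I fin sets_rho] Fourier)
    then show ?thesis unfolding of_real_eq_iff .
  qed
  also have "\<dots> \<le> (\<Sum>q\<in>idx I. \<Sum>q'\<in>idx I. \<epsilon> (fst q) * \<epsilon> (fst q') *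
      ((if q = q' then 1 else 0) + (if fst q = fst q' then \<epsilon> (fst q) else 0) + \<epsilon> (fst q) * \<epsilon> (fst q')))"
    by (intro sum_mono mult_left_mono phi_expo_diff) (auto simp: eps0)
  also have "\<dots> = (\<Sum>q\<in>idx I. \<Sum>q'\<in>idx I. if q' = q then (\<epsilon> (fst q))\<^sup>2 else 0)
     + (\<Sum>q\<in>idx I. \<Sum>q'\<in>idx I. if fst q' = fst q then (\<epsilon> (fst q))^3 else 0)
     + (\<Sum>q\<in>idx I. \<Sum>q'\<in>idx I. (\<epsilon> (fst q))\<^sup>2 * (\<epsilon> (fst q'))\<^sup>2)"
    unfolding sum.distrib[symmetric] by (intro sum.cong refl) (auto simp: power2_eq_square power3_eq_cube algebra_simps)
  also have "(\<Sum>q\<in>idx I. \<Sum>q'\<in>idx I. if q' = q then (\<epsilon> (fst q))\<^sup>2 else 0) = S I"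
    using finite_idx[OF I] by (simp add: S_def)
  also have "(\<Sum>q\<in>idx I. \<Sum>q'\<in>idx I. (\<epsilon> (fst q))\<^sup>2 * (\<epsilon> (fst q'))\<^sup>2) = S I * S I"
    by (simp add: S_def sum_product)
  also have "(\<Sum>q\<in>idx I. \<Sum>q'\<in>idx I. if fst q' = fst q then (\<epsilon> (fst q))^3 else 0) \<le> (\<Sum>q\<in>idx I. (\<epsilon> (fst q))\<^sup>2)"
  proof (intro sum_mono)
    fix q assume q: "q \<in> idx I"
    have "(\<Sum>q'\<in>idx I. if fst q' = fst q then (\<epsilon> (fst q))^3 else 0) = (\<Sum>q'\<in>{q'\<in>idx I. fst q' = fst q}. (\<epsilon> (fst q))^3)"
      using finite_idx[OF I] by (subst sum.inter_filter) auto
    also have "{q'\<in>idx I. fst q' = fst q} = Pair (fst q) ` {1..<r (fst q)}" using q by (auto simp: idx_def image_iff)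
    also have "(\<Sum>q'\<in>Pair (fst q) ` {1..<r (fst q)}. (\<epsilon> (fst q))^3) = real (r (fst q) - 1) * \<epsilon> (fst q) * (\<epsilon> (fst q))\<^sup>2"
      by (simp add: card_image inj_on_def power2_eq_square power3_eq_cube)
    also have "\<dots> \<le> 1 * (\<epsilon> (fst q))\<^sup>2"
    proof (intro mult_right_mono)
      have "real (r (fst q) - 1) * \<epsilon> (fst q) \<le> real (r (fst q)) * \<epsilon> (fst q)" by (intro mult_right_mono eps0) simp
      then show "real (r (fst q) - 1) * \<epsilon> (fst q) \<le> 1" using small[of "fst q"] by linarith
    qed simp
    finally show "(\<Sum>q'\<in>idx I. if fst q' = fst q then (\<epsilon> (fst q))^3 else 0) \<le> (\<epsilon> (fst q))\<^sup>2" by simp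
  qed
  finally have sq: "nsq \<rho> (Y I) \<le> S I * S I + 2 * S I" by (simp add: nsq_def S_def)
  have YL: "Y I \<in> L2 \<rho>"
  proof (rule L2_I)
    show m: "Y I \<in> borel_measurable \<rho>" by (rule trig_measurable[OF trig_Y[OF I] sets_rho])
    obtain B where B: "\<forall>z. cmod z = 1 \<longrightarrow> cmod (Y I z) \<le> B" using trig_bounded[OF trig_Y[OF I]] by blast
    show "integrable \<rho> (\<lambda>z. (cmod (Y I z))\<^sup>2)"
      using B sets_eq_imp_space_eq[OF sets_rho] m
      by (intro integrable_const_bound[of _ "B\<^sup>2"] AE_I2) (auto intro!: power_mono)
  qed
  have cL: "(\<lambda>_. complex_of_real (S I)) \<in> L2 \<rho>" by (rule L2_I) auto
  have "nsq \<rho> (\<lambda>z. Y I z - of_real (S I)) = nsq \<rho> (Y I) + nsq \<rho> (\<lambda>_. complex_of_real (S I)) - 2 * (S I * S I)"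
    using nsq_diff[OF YL cL] by (simp add: mean)
  also have "nsq \<rho> (\<lambda>_. complex_of_real (S I)) = S I * S I" by (simp add: nsq_def prob_space power2_eq_square)
  finally show ?thesis using sq by (simp add: nsq_def)
qed

end

lemma Markov_square:
  fixes f :: "'a \<Rightarrow> complex"
  assumes "finite_measure M" "f \<in> borel_measurable M" "integrable M (\<lambda>x. (cmod (f x))\<^sup>2)" "c > 0"
  shows "measure M {x \<in> space M. c \<le> cmod (f x)} \<le> nsq M f / c\<^sup>2"
proof -
  interpret finite_measure M by fact
  have "measure M {x \<in> space M. c\<^sup>2 \<le> (cmod (f x))\<^sup>2} \<le> (\<integral>x. (cmod (f x))\<^sup>2 \<partial>M) / c\<^sup>2"
    using assms by (intro integral_Markov_inequality_measure[where A="space M"]) auto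
  also have "{x \<in> space M. c\<^sup>2 \<le> (cmod (f x))\<^sup>2} = {x \<in> space M. c \<le> cmod (f x)}"
    using assms(4) by (auto intro: power_mono power2_le_imp_le)
  finally show ?thesis by (simp add: nsq_def)
qed

lemma trig_L2: assumes "trig u" "finite_measure \<kappa>" "sets \<kappa> = sets circle_borel" shows "u \<in> L2 \<kappa>"
proof (rule L2_I)
  interpret finite_measure \<kappa> by fact
  show m: "u \<in> borel_measurable \<kappa>" by (rule trig_measurable[OF assms(1,3)])
  obtain B where B: "\<forall>z. cmod z = 1 \<longrightarrow> cmod (u z) \<le> B" using trig_bounded[OF assms(1)] by blast
  show "integrable \<kappa> (\<lambda>z. (cmod (u z))\<^sup>2)"
    using B sets_eq_imp_space_eq[OF assms(3)] m
    by (intro integrable_const_bound[of _ "B\<^sup>2"] AE_I2) (auto intro!: power_mono)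
qed

lemma trig_const: "trig (\<lambda>_. c)" using trig.monom[of c 0] by simp

context riesz
begin

theorem singular:
  assumes small: "\<And>j. real (r j) * \<epsilon> j \<le> 1" and div: "\<not> summable (\<lambda>j. real (r j) * (\<epsilon> j)\<^sup>2)"
  shows "mutually_singular \<rho> circle_lebesgue"
proof -
  interpret prob_space \<rho> by (rule prob)
  have sp: "space \<rho> = sphere 0 1" using sets_eq_imp_space_eq[OF sets_rho] by simp
  have spl: "space circle_lebesgue = sphere 0 1" by (simp add: circle_lebesgue_def)
  interpret L: finite_measure circle_lebesgue by (rule finite_circle_lebesgue)
  have "\<exists>N. S {..<N} > K" for K
  proof (rule ccontr)
    assume "\<not> (\<exists>N. S {..<N} > K)"
    then have le: "S {..<N} \<le> K" for N by (simp add: not_less)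
    have "summable (\<lambda>j. real (r j) * (\<epsilon> j)\<^sup>2)"
    proof (rule bounded_imp_summable[where B="2 * K"])
      fix N
      have "(\<Sum>j<Suc N. real (r j) * (\<epsilon> j)\<^sup>2) \<le> (\<Sum>j<Suc N. 2 * (real (r j - 1) * (\<epsilon> j)\<^sup>2))"
      proof (intro sum_mono)
        fix j
        have "real (r j) \<le> 2 * real (r j - 1)" using r2[of j] by simp
        then show "real (r j) * (\<epsilon> j)\<^sup>2 \<le> 2 * (real (r j - 1) * (\<epsilon> j)\<^sup>2)"
          using mult_right_mono[of "real (r j)" "2 * real (r j - 1)" "(\<epsilon> j)\<^sup>2"] by (simp add: mult.assoc)
      qed
      also have "\<dots> = 2 * S {..<Suc N}" by (simp add: S_eq sum_distrib_left del: sum.lessThan_Suc)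
      also have "\<dots> \<le> 2 * K" using le[of "Suc N"] by simp
      finally show "(\<Sum>j\<le>N. real (r j) * (\<epsilon> j)\<^sup>2) \<le> 2 * K" by (simp only: lessThan_Suc_atMost)
    qed simp
    then show False using div by simp
  qed
  \<comment> \<open>With \<open>S\<close> beyond \<open>2 ^ i\<close> the Chebyshev bounds, which
    are of the order of \<open>1 / S\<close>, become summable.\<close>
  then have "\<exists>N. \<forall>i. S {..<N i} > 2 ^ i" by (intro choice allI) blast
  then obtain N where N: "\<And>i::nat. S {..<N i} > 2 ^ i" by blast
  define s where "s i = S {..<N i}" for i
  define F where "F i = Y {..<N i}" for i
  have s: "s i > 2 ^ i" "s i > 0" for i
    using N[of i] less_trans[of 0 "2 ^ i" "s i"] by (auto simp: s_def)
  have inv: "1 / s i \<le> (1/2) ^ i" for i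
    using s[of i] by (simp add: power_divide divide_left_mono less_imp_le)
  have tF: "trig (F i)" "trig (\<lambda>z. F i z - of_real (s i))" for i
  proof -
    show "trig (F i)" unfolding F_def by (intro trig_Y) simp
    from trig.add[OF this trig_const[of "- of_real (s i)"]]
    show "trig (\<lambda>z. F i z - of_real (s i))" by simp
  qed
  \<comment> \<open>The sum is centred at 0 for Lebesgue measure and at \<open>s i\<close> for
    \<open>\<rho>\<close>; half of \<open>s i\<close> is the threshold that tells them
    apart.\<close>
  define A where "A i = {z \<in> space circle_borel. s i / 2 \<le> cmod (F i z)}" for i
  have Fm: "F i \<in> borel_measurable circle_borel" for i by (rule trig_measurable[OF tF(1) refl])
  have Am: "A i \<in> sets circle_borel" for i unfolding A_def using Fm[of i] by measurable
  have leb: "measure circle_lebesgue (A i) \<le> 8 * pi * (1/2) ^ i" for i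
  proof -
    have "measure circle_lebesgue {z \<in> space circle_lebesgue. s i / 2 \<le> cmod (F i z)} \<le> nsq circle_lebesgue (F i) / (s i / 2)\<^sup>2"
      using trig_L2[OF tF(1) finite_circle_lebesgue sets_circle_lebesgue, of i] s[of i]
      by (intro Markov_square finite_circle_lebesgue) (auto simp: L2_def)
    also have "nsq circle_lebesgue (F i) = 2 * pi * s i"
      unfolding nsq_def F_def s_def by (rule Y_lebesgue) simp
    also have "2 * pi * s i / (s i / 2)\<^sup>2 = 8 * pi * (1 / s i)"
      using s[of i] by (simp add: power2_eq_square)
    also have "\<dots> \<le> 8 * pi * (1/2) ^ i" by (intro mult_left_mono inv) simp
    finally show ?thesis by (simp add: A_def spl)
  qed
  have rho: "measure \<rho> (space \<rho> - A i) \<le> 8 * (1/2) ^ i" for i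
  proof -
    have "measure \<rho> (space \<rho> - A i) \<le> measure \<rho> {z \<in> space \<rho>. s i / 2 \<le> cmod (F i z - of_real (s i))}"
    proof (rule finite_measure_mono)
      show "space \<rho> - A i \<subseteq> {z \<in> space \<rho>. s i / 2 \<le> cmod (F i z - of_real (s i))}"
      proof
        fix z assume "z \<in> space \<rho> - A i"
        then have z: "z \<in> space \<rho>" "cmod (F i z) < s i / 2" by (auto simp: A_def sp)
        have "s i \<le> cmod (F i z) + cmod (F i z - of_real (s i))"
          using norm_triangle_ineq4[of "F i z" "F i z - of_real (s i)"] s[of i] by simp
        then show "z \<in> {z \<in> space \<rho>. s i / 2 \<le> cmod (F i z - of_real (s i))}" using z by simp
      qed
      have "(\<lambda>z. F i z - of_real (s i)) \<in> borel_measurable \<rho>" by (rule trig_measurable[OF tF(2) sets_rho])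
      then show "{z \<in> space \<rho>. s i / 2 \<le> cmod (F i z - of_real (s i))} \<in> sets \<rho>" by measurable
    qed
    also have "\<dots> \<le> nsq \<rho> (\<lambda>z. F i z - of_real (s i)) / (s i / 2)\<^sup>2"
      using trig_L2[OF tF(2) finite_measure_axioms sets_rho, of i] s[of i]
      by (intro Markov_square finite_measure_axioms) (auto simp: L2_def)
    also have "\<dots> \<le> (2 * s i) / (s i / 2)\<^sup>2"
      unfolding nsq_def F_def s_def by (intro divide_right_mono Y_rho small) auto
    also have "\<dots> = 8 * (1 / s i)" using s[of i] by (simp add: power2_eq_square)
    also have "\<dots> \<le> 8 * (1/2) ^ i" by (intro mult_left_mono inv) simp
    finally show ?thesis .
  qed
  have n1: "limsup A \<in> null_sets circle_lebesgue"
  proof (rule borel_cantelli_limsup1)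
    show "summable (\<lambda>n. measure circle_lebesgue (A n))"
      by (rule summable_comparison_test'[where g="\<lambda>i. 8 * pi * (1/2) ^ i"]) (auto simp: leb)
  qed (auto simp: Am L.emeasure_finite less_top[symmetric])
  \<comment> \<open>A point outside the limit superior misses all \<open>A i\<close> from some index
    on, and each of these intersections has arbitrarily small measure.\<close>
  have n2: "space \<rho> - limsup A \<in> null_sets \<rho>"
  proof -
    have "space \<rho> - limsup A = (\<Union>n. space \<rho> \<inter> (\<Inter>i\<in>{n..}. space \<rho> - A i))"
      by (auto simp: limsup_INF_SUP)
    moreover have "space \<rho> \<inter> (\<Inter>i\<in>{n..}. space \<rho> - A i) \<in> null_sets \<rho>" for n
    proof -
      let ?E = "space \<rho> \<inter> (\<Inter>i\<in>{n..}. space \<rho> - A i)"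
      have E: "?E \<in> sets \<rho>" using Am sets_rho by auto
      have "measure \<rho> ?E \<le> 0"
      proof (rule LIMSEQ_le_const)
        have "(\<lambda>i. 8 * (1/2) ^ i) \<longlonglongrightarrow> 8 * (0::real)" by (intro tendsto_intros LIMSEQ_realpow_zero) auto
        then show "(\<lambda>i. 8 * (1/2::real) ^ i) \<longlonglongrightarrow> 0" by simp
        show "\<exists>N. \<forall>i\<ge>N. measure \<rho> ?E \<le> 8 * (1/2) ^ i"
        proof (intro exI[of _ n] allI impI)
          fix i assume "n \<le> i"
          then have "measure \<rho> ?E \<le> measure \<rho> (space \<rho> - A i)"
            using Am[of i] sets_rho by (intro finite_measure_mono) auto
          then show "measure \<rho> ?E \<le> 8 * (1/2) ^ i" using rho[of i] by linarith
        qed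
      qed
      then show ?thesis using E by (auto simp: emeasure_eq_measure measure_le_0_iff)
    qed
    ultimately show ?thesis by (metis null_sets_UN)
  qed
  have "space circle_lebesgue - (space \<rho> - limsup A) = limsup A"
    using sets.sets_into_space[OF null_setsD2[OF n1]] by (auto simp: sp spl)
  then show ?thesis
    unfolding mutually_singular_def using n1 n2
    by (intro conjI bexI[of _ "space \<rho> - limsup A"]) (auto simp: sets_rho)
qed

end

text \<open>The constant 2 makes the bound valid from -1/2 upwards without an upper limit on
  \<open>x\<close>: the factors of the Riesz product are bounded below but may be large.\<close>

lemma ln_one_plus_lower: assumes "- (1/2) \<le> (x::real)" shows "x - 2 * x\<^sup>2 \<le> ln (1 + x)"
proof (cases "x \<le> 0")
  case True
  then show ?thesis using ln_one_minus_pos_lower_bound[of "-x"] assms by simp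
next
  case pos: False
  show ?thesis
  proof (cases "x \<le> 1")
    case True
    have "x - x\<^sup>2 \<le> ln (1 + x)" using pos True by (intro ln_one_plus_pos_lower_bound) auto
    then show ?thesis using zero_le_power2[of x] by linarith
  next
    case False
    have "x \<le> x\<^sup>2" using False by (simp add: power2_eq_square)
    moreover have "0 \<le> ln (1 + x)" using pos by simp
    ultimately show ?thesis using zero_le_power2[of x] by linarith
  qed
qed

lemma abs_le_add: "\<bar>l\<bar> \<le> \<bar>l + y\<bar> + \<bar>y\<bar>" for l y :: int
  using abs_triangle_ineq4[of "l + y" y] by simp

text \<open>Used with \<open>c\<close> a height and \<open>B\<close> that height times
  \<open>2 ^ r j\<close>: frequencies beyond the range of the new partial products remain beyond
  that of the old ones after a shift by one or two frequencies of the new factor.\<close>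

lemma abs_far:
  fixes l y y' B c :: int
  assumes "\<bar>y\<bar> \<le> B" "8 * B < 4 * \<bar>l\<bar>" "c \<le> B" "0 < c" shows "c < 4 * \<bar>l + y\<bar>"
    and "\<bar>y'\<bar> \<le> B \<Longrightarrow> 4 * B < \<bar>l\<bar> \<Longrightarrow> c < 2 * \<bar>l + y + y'\<bar>" and "4 * B < \<bar>l\<bar> \<Longrightarrow> c < 2 * \<bar>l + y\<bar>"
proof -
  have 1: "L \<le> X + Y \<Longrightarrow> Y \<le> B \<Longrightarrow> 8 * B < 4 * L \<Longrightarrow> c < 4 * X" for L X Y using assms(3,4) by linarith
  show "c < 4 * \<bar>l + y\<bar>" by (rule 1[OF abs_le_add assms(1,2)])
  have 2: "L \<le> X + Y \<Longrightarrow> X \<le> Z + Y' \<Longrightarrow> Y \<le> B \<Longrightarrow> Y' \<le> B \<Longrightarrow> 4 * B < L \<Longrightarrow> c < 2 * Z" for L X Y Y' Z using assms(3,4) by linarith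
  show "\<bar>y'\<bar> \<le> B \<Longrightarrow> 4 * B < \<bar>l\<bar> \<Longrightarrow> c < 2 * \<bar>l + y + y'\<bar>"
    by (rule 2[OF abs_le_add[of l y] abs_le_add[of "l + y" y'] assms(1)])
  have 3: "L \<le> X + Y \<Longrightarrow> Y \<le> B \<Longrightarrow> 4 * B < L \<Longrightarrow> c < 2 * X" for L X Y using assms(3,4) by linarith
  show "4 * B < \<bar>l\<bar> \<Longrightarrow> c < 2 * \<bar>l + y\<bar>" by (rule 3[OF abs_le_add assms(1)])
qed

lemma abs_far':
  fixes k y c :: int
  assumes "c \<le> \<bar>y\<bar>" "2 * \<bar>k\<bar> \<le> c" "0 < c" shows "c < 4 * \<bar>k + y\<bar>"
proof -
  have "Y \<le> X + K \<Longrightarrow> c \<le> Y \<Longrightarrow> 2 * K \<le> c \<Longrightarrow> c < 4 * X" for X Y K using assms(3) by linarith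
  from this[OF abs_le_add[of y k] assms(1,2)] show ?thesis by (simp add: add.commute)
qed

lemma sum_if_neg_eq:
  fixes c :: "int \<Rightarrow> 'b::comm_monoid_add"
  assumes "finite D"
  shows "(\<Sum>e\<in>D. if x + e = 0 then c e else 0) = (if - x \<in> D then c (- x) else 0)"
proof -
  have "(\<Sum>e\<in>D. if x + e = 0 then c e else 0) = (\<Sum>e\<in>D. if e = - x then c e else 0)"
    by (intro sum.cong refl if_cong) auto
  then show ?thesis using assms by simp
qed

context riesz
begin

section \<open>Partial products and equivalence to Lebesgue measure\<close>

abbreviation "m \<equiv> circle_lebesgue"

text \<open>The squared modulus expands to \<open>r\<^sub>j\<close> plus the sum over the gaps, so \<open>g\<close> is real and \<open>P\<close> is the partial product.\<close>

definition g :: "nat \<Rightarrow> complex \<Rightarrow> real" where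
  "g j z = (cmod (\<Sum>a\<in>spots r j. z powi (int (h j * a))))\<^sup>2 - real (r j)"

definition D0 :: "nat \<Rightarrow> int set" where "D0 j = insert 0 (gaps r j)"

definition cf :: "nat \<Rightarrow> int \<Rightarrow> real" where "cf j e = (if e = 0 then 1 else \<epsilon> j)"

definition factor :: "nat \<Rightarrow> complex \<Rightarrow> real" where "factor j z = 1 + \<epsilon> j * g j z"

definition P :: "nat \<Rightarrow> complex \<Rightarrow> real" where "P J z = (\<Prod>j<J. factor j z)"

lemma finite_D0: "finite (D0 j)" by (simp add: D0_def finite_gaps)

lemma D0_bound: "e \<in> D0 j \<Longrightarrow> \<bar>e\<bar> \<le> 2 ^ r j" using gaps_bound by (auto simp: D0_def)

lemma uminus_D0: "- e \<in> D0 j \<longleftrightarrow> e \<in> D0 j" by (auto simp: D0_def uminus_gaps)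

lemma g_lower: "- real (r j) \<le> g j z" by (simp add: g_def)

lemma g_expand: assumes z: "cmod z = 1" shows "complex_of_real (g j z) = (\<Sum>e\<in>gaps r j. z powi (int (h j) * e))"
proof -
  let ?A = "spots r j" let ?Q = "{(a, b) \<in> ?A \<times> ?A. a \<noteq> b}"
  have "complex_of_real ((cmod (\<Sum>a\<in>?A. z powi (int (h j * a))))\<^sup>2) = (\<Sum>a\<in>?A. \<Sum>b\<in>?A. z powi (int (h j) * (int a - int b)))"
    unfolding complex_norm_square cnj_sum sum_product
    by (intro sum.cong refl) (simp only: powi_mult_cnj[OF z] right_diff_distrib of_nat_mult)
  also have "\<dots> = (\<Sum>q\<in>?A \<times> ?A. z powi (int (h j) * (int (fst q) - int (snd q))))"
    by (simp add: sum.cartesian_product split_def)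
  also have "?A \<times> ?A = ?Q \<union> (\<lambda>a. (a, a)) ` ?A" by auto
  also have "(\<Sum>q\<in>\<dots>. z powi (int (h j) * (int (fst q) - int (snd q)))) =
      (\<Sum>q\<in>?Q. z powi (int (h j) * (int (fst q) - int (snd q)))) + (\<Sum>q\<in>(\<lambda>a. (a, a)) ` ?A. z powi (int (h j) * (int (fst q) - int (snd q))))"
    using finite_spots[of r j]
    by (intro sum.union_disjoint finite_subset[of ?Q "?A \<times> ?A"]) auto
  also have "(\<Sum>q\<in>(\<lambda>a. (a, a)) ` ?A. z powi (int (h j) * (int (fst q) - int (snd q)))) = of_nat (r j)"
    by (subst sum.reindex) (auto simp: inj_on_def card_spots)
  also have "(\<Sum>q\<in>?Q. z powi (int (h j) * (int (fst q) - int (snd q)))) = (\<Sum>e\<in>gaps r j. z powi (int (h j) * e))"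
    unfolding gaps_image by (subst sum.reindex[OF gaps_inj]) (simp add: o_def split_def)
  finally show ?thesis by (simp add: g_def)
qed

lemma factor_expand: assumes z: "cmod z = 1"
  shows "complex_of_real (factor j z) = (\<Sum>e\<in>D0 j. of_real (cf j e) * z powi (int (h j) * e))"
proof -
  have "(\<Sum>e\<in>D0 j. of_real (cf j e) * z powi (int (h j) * e)) = 1 + (\<Sum>e\<in>gaps r j. of_real (cf j e) * z powi (int (h j) * e))"
    using zero_notin_gaps[of r j] by (simp add: D0_def finite_gaps cf_def)
  also have "(\<Sum>e\<in>gaps r j. of_real (cf j e) * z powi (int (h j) * e)) = of_real (\<epsilon> j) * (\<Sum>e\<in>gaps r j. z powi (int (h j) * e))"
    unfolding sum_distrib_left using zero_notin_gaps[of r j] by (intro sum.cong refl) (auto simp: cf_def)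
  finally show ?thesis by (simp add: factor_def g_expand[OF z])
qed

lemma trig_factor: "trig (\<lambda>z. complex_of_real (factor j z))"
  by (rule trig.cong[where u="\<lambda>z. \<Sum>e\<in>D0 j. of_real (cf j e) * z powi (int (h j) * e)"])
     (auto intro!: trig_sum finite_D0 trig.monom simp: factor_expand)

lemma trig_P: "trig (\<lambda>z. complex_of_real (P J z))"
  by (induction J) (auto simp: P_def trig_const intro: trig_mult trig_factor)

lemma int_trig: "trig u \<Longrightarrow> integrable m u"
  by (rule trig_integrable[OF _ sets_circle_lebesgue finite_circle_lebesgue])

lemma space_m: "space m = sphere 0 1" by (simp add: circle_lebesgue_def)

lemma integral_factor:
  assumes "trig u"
  shows "(\<integral>z. z powi l * (u z * of_real (factor j z)) \<partial>m) = (\<Sum>e\<in>D0 j. of_real (cf j e) * (\<integral>z. z powi (l + int (h j) * e) * u z \<partial>m))"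
proof -
  have "(\<integral>z. z powi l * (u z * of_real (factor j z)) \<partial>m) = (\<integral>z. (\<Sum>e\<in>D0 j. of_real (cf j e) * (z powi (l + int (h j) * e) * u z)) \<partial>m)"
  proof (intro Bochner_Integration.integral_cong refl)
    fix z assume "z \<in> space m"
    then have z: "cmod z = 1" "z \<noteq> 0" by (auto simp: space_m)
    show "z powi l * (u z * of_real (factor j z)) = (\<Sum>e\<in>D0 j. of_real (cf j e) * (z powi (l + int (h j) * e) * u z))"
      unfolding factor_expand[OF z(1)] sum_distrib_left using z by (intro sum.cong refl) (simp add: power_int_add mult_ac)
  qed
  also have "\<dots> = (\<Sum>e\<in>D0 j. of_real (cf j e) * (\<integral>z. z powi (l + int (h j) * e) * u z \<partial>m))"
    using assms by (simp add: int_trig trig_mult trig_powi)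
  finally show ?thesis .
qed

lemma P_0: "P 0 z = 1" and P_Suc: "P (Suc J) z = P J z * factor J z"
  by (simp_all add: P_def)

text \<open>All frequencies of \<open>P J\<close> are at most a quarter of \<open>h J\<close> in
  modulus: a new factor adds at most an eighth of the next height.\<close>

lemma moment_far: "4 * \<bar>l\<bar> > int (h J) \<Longrightarrow> (\<integral>z. z powi l * of_real (P J z) \<partial>m) = 0"
proof (induction J arbitrary: l)
  case 0
  then show ?case by (simp add: P_0 circle_lebesgue_powi)
next
  case (Suc J)
  have "(\<integral>z. z powi (l + int (h J) * e) * of_real (P J z) \<partial>m) = 0" if "e \<in> D0 J" for e
  proof (rule Suc.IH)
    show "int (h J) < 4 * \<bar>l + int (h J) * e\<bar>"
      by (rule abs_far(1)[OF height_gap_bound[OF D0_bound[OF that]] _ height_pow])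
         (use Suc.prems height_Suc_int[of J] height_pos[of r J] in simp_all)
  qed
  then show ?case using integral_factor[OF trig_P, of l J J] by (simp add: P_Suc)
qed

text \<open>Up to half the height, the partial product already has the coefficients of
  \<open>\<rho>\<close> times the mass \<open>2 * pi\<close>: only the multiple of
  \<open>h J\<close> nearest to \<open>l\<close> can contribute, and its digit is the one in
  \<open>phi_mult\<close>.\<close>

lemma moment_near: "2 * \<bar>l\<bar> \<le> int (h J) \<Longrightarrow> (\<integral>z. z powi l * of_real (P J z) \<partial>m) = 2 * pi * \<phi> l"
proof (induction J arbitrary: l)
  case 0
  then have "l = 0" by simp
  then show ?case using circle_lebesgue_powi[of 0] by (simp add: P_0 phi0)
next
  case (Suc J)
  \<comment> \<open>The integer nearest to the quotient of \<open>l\<close> and \<open>h J\<close>,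
    so that the remainder \<open>k\<close> is at most half the height.\<close>
  define e where "e = (l + int (h J) div 2) div int (h J)"
  define k where "k = l - int (h J) * e"
  have hp: "int (h J) > 0" using height_pos[of r J] by simp
  have k2: "2 * \<bar>k\<bar> \<le> int (h J)"
  proof -
    have "k + int (h J) div 2 = (l + int (h J) div 2) mod int (h J)"
      unfolding k_def e_def by (simp add: minus_div_mult_eq_mod[symmetric] mult.commute)
    then have "0 \<le> k + int (h J) div 2" "k + int (h J) div 2 < int (h J)" using hp by simp_all
    then show ?thesis by linarith
  qed
  have l: "l = k + int (h J) * e" by (simp add: k_def)
  have "\<phi> l = \<phi> k * gap_coeff r \<epsilon> J e" unfolding l by (rule phi_mult[OF k2]) (use Suc.prems l in simp)
  have main: "(\<integral>z. z powi (l + int (h J) * e') * of_real (P J z) \<partial>m) = (if e + e' = 0 then complex_of_real (2 * pi * \<phi> k) else 0)" for e'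
  proof (cases "e + e' = 0")
    case True
    have "l + int (h J) * e' = k + int (h J) * (e + e')" by (simp add: l distrib_left)
    then have "l + int (h J) * e' = k" using True by simp
    then show ?thesis using Suc.IH[OF k2] True by simp
  next
    case False
    have "int (h J) * 1 \<le> int (h J) * \<bar>e + e'\<bar>" using False by (intro mult_left_mono) auto
    then have "int (h J) \<le> \<bar>int (h J) * (e + e')\<bar>" by (simp add: abs_mult)
    moreover have "l + int (h J) * e' = k + int (h J) * (e + e')" by (simp add: l distrib_left)
    ultimately have "4 * \<bar>l + int (h J) * e'\<bar> > int (h J)" using abs_far'[OF _ k2 hp] by simp
    then show ?thesis using False by (simp add: moment_far)
  qed
  have "(\<integral>z. z powi l * of_real (P (Suc J) z) \<partial>m) = (\<Sum>e'\<in>D0 J. complex_of_real (cf J e') * (if e + e' = 0 then complex_of_real (2 * pi * \<phi> k) else 0))"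
    using integral_factor[OF trig_P, of l J J] by (simp add: P_Suc main)
  also have "\<dots> = (\<Sum>e'\<in>D0 J. if e + e' = 0 then of_real (cf J e' * (2 * pi * \<phi> k)) else 0)"
    by (intro sum.cong refl) simp
  also have "\<dots> = (if e \<in> D0 J then of_real (cf J (-e) * (2 * pi * \<phi> k)) else 0)"
    by (subst sum_if_neg_eq[OF finite_D0]) (simp add: uminus_D0)
  also have "\<dots> = of_real (2 * pi * \<phi> l)"
    unfolding \<open>\<phi> l = _\<close> by (auto simp: D0_def cf_def gap_coeff_def)
  finally show ?case by simp
qed

text \<open>A product of two partial products has at most twice the range of the larger one, hence
  the threshold of half the height.\<close>

lemma product_far: "J \<le> J' \<Longrightarrow> 2 * \<bar>l\<bar> > int (h J') \<Longrightarrow> (\<integral>z. z powi l * (of_real (P J z) * of_real (P J' z)) \<partial>m) = 0"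
proof (induction J' arbitrary: J l)
  case 0
  then show ?case by (simp add: P_0 circle_lebesgue_powi)
next
  case (Suc J')
  note hb = height_gap_bound[OF D0_bound]
  have far: "8 * (int (h J') * 2 ^ r J') < 4 * \<bar>l\<bar>" "4 * (int (h J') * 2 ^ r J') < \<bar>l\<bar>" "0 < int (h J')"
    using Suc.prems(2) height_Suc_int[of J'] height_pos[of r J'] by simp_all
  show ?case
  proof (cases "J \<le> J'")
    case True
    have "(\<integral>z. z powi (l + int (h J') * e) * (of_real (P J z) * of_real (P J' z)) \<partial>m) = 0" if "e \<in> D0 J'" for e
      by (rule Suc.IH[OF True]) (rule abs_far(3)[OF hb[OF that] far(1) height_pow far(3,2)])
    then show ?thesis using integral_factor[OF trig_mult[OF trig_P trig_P], of l J J' J'] by (simp add: P_Suc mult_ac)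
  next
    case False
    then have J: "J = Suc J'" using Suc.prems by simp
    have "(\<integral>z. z powi (l + int (h J') * e + int (h J') * e') * (of_real (P J' z) * of_real (P J' z)) \<partial>m) = 0"
      if "e \<in> D0 J'" "e' \<in> D0 J'" for e e'
      by (rule Suc.IH[OF order_refl]) (rule abs_far(2)[OF hb[OF that(1)] far(1) height_pow far(3) hb[OF that(2)] far(2)])
    then have "(\<integral>z. z powi (l + int (h J') * e) * ((of_real (P J' z) * of_real (P J' z)) * of_real (factor J' z)) \<partial>m) = 0"
      if "e \<in> D0 J'" for e
      using that by (simp add: integral_factor[OF trig_mult[OF trig_P trig_P]])
    then have "(\<integral>z. z powi l * (((of_real (P J' z) * of_real (P J' z)) * of_real (factor J' z)) * of_real (factor J' z)) \<partial>m) = 0"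
      by (simp add: integral_factor[OF trig_mult[OF trig_mult[OF trig_P trig_P] trig_factor]])
    then show ?thesis by (simp add: J P_Suc mult_ac)
  qed
qed

definition N2 :: "nat \<Rightarrow> real" where "N2 J = (\<integral>z. (P J z)\<^sup>2 \<partial>m)"

lemma N2_complex: "(\<integral>z. of_real (P J z) * of_real (P J z) \<partial>m) = complex_of_real (N2 J)"
  unfolding N2_def integral_complex_of_real[symmetric] by (simp add: power2_eq_square)

text \<open>The frequencies of the new factor exceed the range of the product of \<open>P J\<close>
  and \<open>P J'\<close>, so only its constant term survives.\<close>

lemma product_step: assumes "J \<le> J'"
  shows "(\<integral>z. of_real (P J z) * of_real (P (Suc J') z) \<partial>m) = (\<integral>z. of_real (P J z) * complex_of_real (P J' z) \<partial>m)"
proof -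
  have far: "(\<integral>z. z powi (int (h J') * e) * (of_real (P J z) * of_real (P J' z)) \<partial>m) = 0" if "e \<in> gaps r J'" for e
  proof (rule product_far[OF assms])
    have "e \<noteq> 0" using that zero_notin_gaps[of r J'] by auto
    then have "int (h J') * 1 \<le> int (h J') * \<bar>e\<bar>" by (intro mult_left_mono) auto
    then show "int (h J') < 2 * \<bar>int (h J') * e\<bar>" using height_pos[of r J'] by (simp add: abs_mult)
  qed
  have "(\<integral>z. of_real (P J z) * of_real (P (Suc J') z) \<partial>m) = (\<integral>z. z powi 0 * ((of_real (P J z) * of_real (P J' z)) * of_real (factor J' z)) \<partial>m)"
    by (simp add: P_Suc mult.assoc)
  also have "\<dots> = (\<Sum>e\<in>D0 J'. of_real (cf J' e) * (\<integral>z. z powi (int (h J') * e) * (of_real (P J z) * of_real (P J' z)) \<partial>m))"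
    by (subst integral_factor[OF trig_mult[OF trig_P trig_P]]) simp
  also have "\<dots> = (\<integral>z. of_real (P J z) * complex_of_real (P J' z) \<partial>m)"
    unfolding D0_def using zero_notin_gaps[of r J'] far by (simp add: finite_gaps cf_def)
  finally show ?thesis .
qed

text \<open>The partial products have orthogonal increments, like a martingale. The squared distance
  of two of them is thus a difference of values of \<open>N2\<close>, and convergence reduces to
  boundedness of \<open>N2\<close>.\<close>

lemma product_inner: "J \<le> J' \<Longrightarrow> (\<integral>z. of_real (P J z) * complex_of_real (P J' z) \<partial>m) = of_real (N2 J)"
  by (induction J' rule: dec_induct) (simp_all add: N2_complex product_step)

lemma N2_Suc: "N2 (Suc J) \<le> (1 + (\<epsilon> J * real (r J))\<^sup>2) * N2 J"
proof -
  have far: "(\<integral>z. z powi (int (h J) * e + int (h J) * e') * (of_real (P J z) * of_real (P J z)) \<partial>m) = (if e + e' = 0 then complex_of_real (N2 J) else 0)" for e e'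
  proof (cases "e + e' = 0")
    case True
    then have "int (h J) * e + int (h J) * e' = 0" by (simp add: distrib_left[symmetric])
    then show ?thesis using True by (simp add: N2_complex)
  next
    case False
    then have "int (h J) * 1 \<le> int (h J) * \<bar>e + e'\<bar>" by (intro mult_left_mono) auto
    then have "int (h J) < 2 * \<bar>int (h J) * e + int (h J) * e'\<bar>" using height_pos[of r J]
      by (simp add: abs_mult distrib_left[symmetric])
    then show ?thesis using False product_far[of J J] by simp
  qed
  have "complex_of_real (N2 (Suc J)) = (\<integral>z. z powi 0 * (((of_real (P J z) * of_real (P J z)) * of_real (factor J z)) * of_real (factor J z)) \<partial>m)"
    unfolding N2_complex[symmetric] by (simp add: P_Suc mult_ac)
  also have "\<dots> = (\<Sum>e\<in>D0 J. complex_of_real (cf J e) * (\<Sum>e'\<in>D0 J. complex_of_real (cf J e') * (if e + e' = 0 then complex_of_real (N2 J) else 0)))"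
    unfolding integral_factor[OF trig_mult[OF trig_mult[OF trig_P trig_P] trig_factor]]
      integral_factor[OF trig_mult[OF trig_P trig_P]] add_0_left far ..
  also have "\<dots> = (\<Sum>e\<in>D0 J. complex_of_real (cf J e) * (\<Sum>e'\<in>D0 J. if e + e' = 0 then complex_of_real (cf J e' * N2 J) else 0))"
    by (intro sum.cong refl arg_cong2[where f="(*)"]) simp
  also have "\<dots> = (\<Sum>e\<in>D0 J. complex_of_real (cf J e * (cf J (-e) * N2 J)))"
    by (intro sum.cong refl, subst sum_if_neg_eq[OF finite_D0]) (simp add: uminus_D0)
  also have "\<dots> = of_real (N2 J + (\<Sum>e\<in>gaps r J. (\<epsilon> J)\<^sup>2 * N2 J))"
  proof -
    have "(\<Sum>e\<in>gaps r J. complex_of_real (cf J e * (cf J (-e) * N2 J))) = (\<Sum>e\<in>gaps r J. of_real ((\<epsilon> J)\<^sup>2 * N2 J))"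
      using zero_notin_gaps[of r J] by (intro sum.cong refl) (auto simp: cf_def power2_eq_square)
    then show ?thesis unfolding D0_def using zero_notin_gaps[of r J] by (simp add: finite_gaps cf_def)
  qed
  finally have "N2 (Suc J) = N2 J + real (card (gaps r J)) * ((\<epsilon> J)\<^sup>2 * N2 J)" unfolding of_real_eq_iff by simp
  also have "\<dots> \<le> N2 J + real (r J * r J) * ((\<epsilon> J)\<^sup>2 * N2 J)"
    using card_gaps[of r J] by (intro add_left_mono mult_right_mono) (auto simp: N2_def simp del: of_nat_mult)
  finally show ?thesis by (simp add: power2_eq_square algebra_simps)
qed

lemma g_moment: "(\<integral>z. g j z \<partial>m) = 0" and g_square: "(\<integral>z. (g j z)\<^sup>2 \<partial>m) \<le> 2 * pi * (real (r j))\<^sup>2"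
  and trig_g: "trig (\<lambda>z. complex_of_real (g j z))"
proof -
  show tg: "trig (\<lambda>z. complex_of_real (g j z))"
    by (rule trig.cong[where u="\<lambda>z. \<Sum>e\<in>gaps r j. z powi (int (h j) * e)"])
       (auto intro!: trig_sum finite_gaps trig_powi simp: g_expand)
  have he: "int (h j) * e \<noteq> 0" if "e \<in> gaps r j" for e
    using that zero_notin_gaps[of r j] height_pos[of r j] by auto
  have "complex_of_real (\<integral>z. g j z \<partial>m) = (\<integral>z. (\<Sum>e\<in>gaps r j. z powi (int (h j) * e)) \<partial>m)"
    unfolding integral_complex_of_real[symmetric]
    by (intro Bochner_Integration.integral_cong refl g_expand) (simp add: space_m)
  also have "\<dots> = 0" using he height_pos[of r j] by (simp add: int_trig trig_powi circle_lebesgue_powi)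
  finally show "(\<integral>z. g j z \<partial>m) = 0" by simp
  have "complex_of_real (\<integral>z. (g j z)\<^sup>2 \<partial>m) = (\<integral>z. (\<Sum>e\<in>gaps r j. \<Sum>e'\<in>gaps r j. z powi (int (h j) * (e + e'))) \<partial>m)"
    unfolding integral_complex_of_real[symmetric]
  proof (intro Bochner_Integration.integral_cong refl)
    fix z assume "z \<in> space m"
    then have z: "cmod z = 1" "z \<noteq> 0" by (auto simp: space_m)
    have "complex_of_real ((g j z)\<^sup>2) = complex_of_real (g j z) * complex_of_real (g j z)" by (simp add: power2_eq_square)
    then show "complex_of_real ((g j z)\<^sup>2) = (\<Sum>e\<in>gaps r j. \<Sum>e'\<in>gaps r j. z powi (int (h j) * (e + e')))"
      unfolding g_expand[OF z(1)] sum_product using z by (simp add: power_int_add distrib_left)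
  qed
  also have "\<dots> = (\<Sum>e\<in>gaps r j. \<Sum>e'\<in>gaps r j. if e + e' = 0 then of_real (2 * pi) else 0)"
    using height_pos[of r j] by (simp add: int_trig trig_powi circle_lebesgue_powi trig_sum finite_gaps) (intro sum.cong refl, simp)
  also have "\<dots> = of_real (real (card (gaps r j)) * (2 * pi))"
    by (subst sum_if_neg_eq[OF finite_gaps]) (simp add: uminus_gaps)
  finally have "(\<integral>z. (g j z)\<^sup>2 \<partial>m) = real (card (gaps r j)) * (2 * pi)" unfolding of_real_eq_iff .
  also have "\<dots> \<le> real (r j * r j) * (2 * pi)"
    using card_gaps[of r j] by (intro mult_right_mono) (auto simp del: of_nat_mult)
  finally show "(\<integral>z. (g j z)\<^sup>2 \<partial>m) \<le> 2 * pi * (real (r j))\<^sup>2" by (simp add: power2_eq_square mult_ac)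
qed

end

lemma le_height: "j \<le> height r j"
proof (induction j)
  case (Suc j)
  have "(2::nat) \<le> 2 ^ (r j + 3)" using power_increasing[of 1 "r j + 3" "2::nat"] by simp
  then have "height r j * 2 \<le> height r (Suc j)" by simp
  then show ?case using Suc height_pos[of r j] by linarith
qed simp

context riesz
begin

theorem lebesgue:
  assumes small: "\<And>j. real (r j) * \<epsilon> j \<le> 1/2" and conv: "summable (\<lambda>j. (\<epsilon> j * real (r j))\<^sup>2)"
  shows "equivalent_measures \<rho> circle_lebesgue"
proof -
  interpret prob_space \<rho> by (rule prob)
  interpret L: finite_measure circle_lebesgue by (rule finite_circle_lebesgue)
  define C where "C = (\<Sum>j. (\<epsilon> j * real (r j))\<^sup>2)"
  have C: "(\<Sum>j<J. (\<epsilon> j * real (r j))\<^sup>2) \<le> C" for J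
    unfolding C_def by (intro sum_le_suminf conv) auto
  \<comment> \<open>The smallness assumption keeps every factor at least 1/2, which makes the
    logarithms and their lower bound available.\<close>
  have x_lower: "- (1/2) \<le> \<epsilon> j * g j z" for j z
  proof -
    have "\<epsilon> j * (- real (r j)) \<le> \<epsilon> j * g j z" by (intro mult_left_mono g_lower eps0)
    then show ?thesis using small[of j] by (simp add: mult.commute)
  qed
  have fpos: "0 < factor j z" for j z using x_lower[of j z] by (simp add: factor_def)
  have Ppos: "0 < P J z" for J z unfolding P_def by (intro prod_pos) (simp add: fpos)
  have N20: "N2 0 = 2 * pi" 
  proof -
    have "complex_of_real (N2 0) = complex_of_real (2 * pi)"
      using N2_complex[of 0] circle_lebesgue_powi[of 0] by (simp add: P_0)
    then show ?thesis unfolding of_real_eq_iff .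
  qed
  have N2nn: "0 \<le> N2 J" for J by (simp add: N2_def)
  have N2_bound: "N2 J \<le> 2 * pi * exp (\<Sum>j<J. (\<epsilon> j * real (r j))\<^sup>2)" for J
  proof (induction J)
    case (Suc J)
    have "N2 (Suc J) \<le> (1 + (\<epsilon> J * real (r J))\<^sup>2) * N2 J" by (rule N2_Suc)
    also have "\<dots> \<le> exp ((\<epsilon> J * real (r J))\<^sup>2) * (2 * pi * exp (\<Sum>j<J. (\<epsilon> j * real (r j))\<^sup>2))"
      by (intro mult_mono Suc.IH exp_ge_add_one_self N2nn) auto
    finally show ?case by (simp add: exp_add mult_ac)
  qed (simp add: N20)
  define f where "f J z = complex_of_real (P J z)" for J z
  have tf: "trig (f J)" for J unfolding f_def by (rule trig_P)
  have fL: "f J \<in> L2 m" for J by (rule trig_L2[OF tf finite_circle_lebesgue sets_circle_lebesgue])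
  have f_nsq: "nsq m (f J) = N2 J" for J by (simp add: nsq_def f_def N2_def)
  have f_ip: "ip m (f J) (f J') = of_real (N2 J)" if "J \<le> J'" for J J'
    using product_inner[OF that] by (simp add: ip_def f_def)
  have f_dist: "nsq m (\<lambda>z. f J z - f J' z) = N2 J' - N2 J" if "J \<le> J'" for J J'
    using nsq_diff[OF fL fL, of J J'] f_ip[OF that] by (simp add: f_nsq)
  have N2_mono: "N2 J \<le> N2 J'" if "J \<le> J'" for J J'
    using f_dist[OF that] nsq_nonneg[of m "\<lambda>z. f J z - f J' z"] by simp
  have "Bseq N2"
  proof (rule BseqI'[where K="2 * pi * exp C"])
    fix J have "N2 J \<le> 2 * pi * exp C"
      by (rule order_trans[OF N2_bound]) (intro mult_left_mono, use C[of J] in auto)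
    then show "norm (N2 J) \<le> 2 * pi * exp C" using N2nn[of J] by simp
  qed
  then have "convergent N2" by (intro Bseq_mono_convergent) (auto intro: N2_mono)
  then have Cau: "Cauchy N2" by (simp add: Cauchy_convergent_iff)
  have "\<exists>p\<in>L2 m. (\<lambda>n. nsq m (\<lambda>x. f n x - p x)) \<longlonglongrightarrow> 0 \<and>
    (\<exists>s::nat \<Rightarrow> nat. strict_mono s \<and> (AE x in m. (\<lambda>k. f (s k) x) \<longlonglongrightarrow> p x))"
  proof (rule L2_complete[OF fL])
    fix e :: real assume "e > 0"
    then obtain K where K: "\<And>i j. i \<ge> K \<Longrightarrow> j \<ge> K \<Longrightarrow> norm (N2 i - N2 j) < e" using CauchyD[OF Cau] by blast
    show "\<exists>K. \<forall>i\<ge>K. \<forall>j\<ge>K. nsq m (\<lambda>x. f i x - f j x) < e"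
    proof (intro exI[of _ K] allI impI)
      fix i j assume ij: "K \<le> i" "K \<le> j"
      show "nsq m (\<lambda>x. f i x - f j x) < e"
      proof (cases "i \<le> j")
        case True then show ?thesis using K[OF ij] f_dist[OF True] N2_mono[OF True] by simp
      next
        case False
        then have "j \<le> i" by simp
        then show ?thesis using K[OF ij] f_dist[of j i] N2_mono[of j i] by (simp add: nsq_minus_commute[of m "f i"])
      qed
    qed
  qed
  then obtain p s where p: "p \<in> L2 m" and lim: "(\<lambda>n. nsq m (\<lambda>x. f n x - p x)) \<longlonglongrightarrow> 0"
    and s: "strict_mono (s :: nat \<Rightarrow> nat)" and AEp: "AE x in m. (\<lambda>k. f (s k) x) \<longlonglongrightarrow> p x" by blast
  note pm[measurable] = L2_measurable[OF p]
  \<comment> \<open>Almost everywhere equal to \<open>p\<close>, but nonnegative everywhere, as a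
    density has to be.\<close>
  define q where "q z = max 0 (Re (p z))" for z
  have qm[measurable]: "q \<in> borel_measurable m" unfolding q_def by measurable
  have q0: "0 \<le> q z" for z by (simp add: q_def)
  have AEq: "AE z in m. (\<lambda>k. P (s k) z) \<longlonglongrightarrow> q z \<and> p z = of_real (q z)"
    using AEp
  proof eventually_elim
    case (elim z)
    have re: "(\<lambda>k. P (s k) z) \<longlonglongrightarrow> Re (p z)" using tendsto_Re[OF elim] by (simp add: f_def)
    have "(\<lambda>k. 0::real) \<longlonglongrightarrow> Im (p z)" using tendsto_Im[OF elim] by (simp add: f_def)
    then have "Im (p z) = 0" by (simp add: LIMSEQ_const_iff)
    moreover have "0 \<le> Re (p z)" by (rule LIMSEQ_le_const[OF re]) (auto intro: less_imp_le Ppos)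
    ultimately show ?case using re by (simp add: q_def complex_eq_iff)
  qed
  define \<kappa> where "\<kappa> = density m (\<lambda>z. ennreal (q z / (2 * pi)))"
  have pi: "integrable m p"
    using L2_mult_integrable[OF p trig_L2[OF trig_const[of 1] finite_circle_lebesgue sets_circle_lebesgue]] by simp
  have qi: "integrable m q" unfolding q_def using pi by auto
  have coef: "(\<integral>z. z powi k \<partial>\<kappa>) = complex_of_real (\<phi> k)" for k
  proof -
    have pk: "(\<lambda>z. z powi (- k)) \<in> L2 m" by (rule trig_L2[OF trig_powi finite_circle_lebesgue sets_circle_lebesgue])
    have ipk: "ip m u (\<lambda>z. z powi (- k)) = (\<integral>z. z powi k * u z \<partial>m)" for u
      unfolding ip_def by (intro Bochner_Integration.integral_cong refl) (simp only: space_m, simp add: cnj_powi_circle[where k="-k", simplified])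
    have a: "(\<lambda>J. ip m (f J) (\<lambda>z. z powi (- k))) \<longlonglongrightarrow> ip m p (\<lambda>z. z powi (- k))"
      by (rule ip_tendsto[OF fL p pk lim])
    have b: "\<forall>\<^sub>F J in sequentially. ip m (f J) (\<lambda>z. z powi (- k)) = complex_of_real (2 * pi * \<phi> k)"
      using eventually_ge_at_top[of "nat (2 * \<bar>k\<bar>)"]
    proof eventually_elim
      case (elim J)
      have "J \<le> h J" by (rule le_height)
      then have "2 * \<bar>k\<bar> \<le> int (h J)" using elim by linarith
      then show ?case unfolding ipk f_def by (subst moment_near) auto
    qed
    have "ip m p (\<lambda>z. z powi (- k)) = complex_of_real (2 * pi * \<phi> k)"
      by (rule LIMSEQ_unique[OF a tendsto_eventually[OF b]])
    then have "(\<integral>z. z powi k * p z \<partial>m) = complex_of_real (2 * pi * \<phi> k)" by (simp only: ipk)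
    also have "(\<integral>z. z powi k * p z \<partial>m) = (\<integral>z. z powi k * of_real (q z) \<partial>m)"
    proof (rule integral_cong_AE)
      note [measurable] = power_int_circle_measurable[OF sets_circle_lebesgue, of k]
      show "(\<lambda>z. z powi k * p z) \<in> borel_measurable m" "(\<lambda>z. z powi k * of_real (q z)) \<in> borel_measurable m"
        by measurable
      show "AE z in m. z powi k * p z = z powi k * of_real (q z)" using AEq by eventually_elim simp
    qed
    finally have main: "(\<integral>z. z powi k * of_real (q z) \<partial>m) = complex_of_real (2 * pi * \<phi> k)" .
    have "(\<integral>z. z powi k \<partial>\<kappa>) = (\<integral>z. (q z / (2 * pi)) *\<^sub>R z powi k \<partial>m)"
      unfolding \<kappa>_def using power_int_circle_measurable[OF sets_circle_lebesgue, of k] q0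
      by (subst integral_density) auto
    also have "\<dots> = (\<integral>z. z powi k * of_real (q z) / complex_of_real (2 * pi) \<partial>m)"
      by (simp add: scaleR_conv_of_real mult.commute)
    also have "\<dots> = complex_of_real (\<phi> k)"
      by (simp only: Bochner_Integration.integral_divide_zero main) simp
    finally show ?thesis .
  qed
  have fin\<kappa>: "finite_measure \<kappa>"
  proof (rule finite_measureI)
    have "emeasure \<kappa> (space \<kappa>) = (\<integral>\<^sup>+z. ennreal (q z / (2 * pi)) \<partial>m)"
      unfolding \<kappa>_def by (subst emeasure_density) (use sets.top[of m] in \<open>auto intro!: nn_integral_cong\<close>)
    also have "\<dots> = ennreal (\<integral>z. q z / (2 * pi) \<partial>m)"
      using qi q0 by (intro nn_integral_eq_integral) auto
    finally show "emeasure \<kappa> (space \<kappa>) \<noteq> \<infinity>" by simp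
  qed
  have "\<rho> = \<kappa>"
    by (rule circle_measure_eqI[OF finite_measure_axioms fin\<kappa> sets_rho]) (simp_all add: \<kappa>_def[symmetric] Fourier coef, simp add: \<kappa>_def)
  \<comment> \<open>Equivalence requires a density without zeros. The limit can vanish only where
    the negative logarithms of the partial products tend to infinity along the subsequence, and
    these have bounded integrals.\<close>
  have "AE z in m. q z \<noteq> 0"
  proof -
    \<comment> \<open>The summand \<open>P J z - 1\<close> integrates to zero and makes the function
      nonnegative, as Fatou's lemma demands.\<close>
    define v where "v J z = - ln (P J z) + P J z - 1" for J z
    have v0: "0 \<le> v J z" for J z using ln_le_minus_one[OF Ppos[of J z]] by (simp add: v_def)
    have gi: "integrable m (g j)" "integrable m (\<lambda>z. (g j z)\<^sup>2)" for j
    proof -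
      show "integrable m (g j)" using int_trig[OF trig_g[of j]] by (simp only: complex_of_real_integrable_eq)
      have "integrable m (\<lambda>z. complex_of_real ((g j z)\<^sup>2))"
        using int_trig[OF trig_mult[OF trig_g[of j] trig_g[of j]]] by (simp add: power2_eq_square)
      then show "integrable m (\<lambda>z. (g j z)\<^sup>2)" by (simp only: complex_of_real_integrable_eq)
    qed
    have Pi: "integrable m (P J)" for J using int_trig[OF trig_P[of J]] by (simp only: complex_of_real_integrable_eq)
    have PI: "(\<integral>z. P J z \<partial>m) = 2 * pi" for J
    proof -
      have "complex_of_real (\<integral>z. P J z \<partial>m) = complex_of_real (2 * pi)"
        using moment_near[of 0 J] by (simp add: phi0)
      then show ?thesis unfolding of_real_eq_iff .
    qed
    have one: "(\<integral>z. (1::real) \<partial>m) = 2 * pi" using PI[of 0] by (simp add: P_0)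
    define V where "V J z = (\<Sum>j<J. - (\<epsilon> j * g j z) + 2 * (\<epsilon> j * g j z)\<^sup>2) + P J z - 1" for J z
    have vV: "v J z \<le> V J z" for J z
    proof -
      have "ln (P J z) = (\<Sum>j<J. ln (factor j z))" unfolding P_def by (rule ln_prod) (auto simp: fpos less_imp_neq[OF fpos, symmetric])
      also have "\<dots> \<ge> (\<Sum>j<J. \<epsilon> j * g j z - 2 * (\<epsilon> j * g j z)\<^sup>2)"
        unfolding factor_def by (intro sum_mono ln_one_plus_lower x_lower)
      finally have "- ln (P J z) \<le> - (\<Sum>j<J. \<epsilon> j * g j z - 2 * (\<epsilon> j * g j z)\<^sup>2)" by simp
      also have "\<dots> = (\<Sum>j<J. - (\<epsilon> j * g j z) + 2 * (\<epsilon> j * g j z)\<^sup>2)" by (simp add: sum_negf[symmetric])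
      finally show ?thesis by (simp add: v_def V_def)
    qed
    have Vi: "integrable m (V J)" for J
      unfolding V_def power_mult_distrib using gi Pi by auto
    have VI: "(\<integral>z. V J z \<partial>m) \<le> 4 * pi * C" for J
    proof -
      have "(\<integral>z. V J z \<partial>m) = (\<Sum>j<J. - (\<epsilon> j * (\<integral>z. g j z \<partial>m)) + 2 * ((\<epsilon> j)\<^sup>2 * (\<integral>z. (g j z)\<^sup>2 \<partial>m))) + (\<integral>z. P J z \<partial>m) - (\<integral>z. 1 \<partial>m)"
        unfolding V_def power_mult_distrib using gi Pi by simp
      also have "\<dots> \<le> (\<Sum>j<J. 2 * ((\<epsilon> j)\<^sup>2 * (2 * pi * (real (r j))\<^sup>2)))"
        unfolding PI one g_moment
        by (simp only: mult_zero_right minus_zero add_0_left add_diff_cancel_right')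
           (intro sum_mono mult_left_mono g_square, auto)
      also have "\<dots> = 4 * pi * (\<Sum>j<J. (\<epsilon> j * real (r j))\<^sup>2)"
        by (simp add: sum_distrib_left power_mult_distrib mult_ac)
      also have "\<dots> \<le> 4 * pi * C" using C by (intro mult_left_mono) auto
      finally show ?thesis .
    qed
    have vm[measurable]: "v J \<in> borel_measurable m" for J
      using borel_measurable_integrable[OF Pi[of J]] unfolding v_def by measurable
    have vI: "(\<integral>\<^sup>+z. ennreal (v J z) \<partial>m) \<le> ennreal (4 * pi * C)" for J
    proof -
      have "(\<integral>\<^sup>+z. ennreal (v J z) \<partial>m) \<le> (\<integral>\<^sup>+z. ennreal (V J z) \<partial>m)"
        by (intro nn_integral_mono ennreal_leI vV)
      also have "\<dots> = ennreal (\<integral>z. V J z \<partial>m)"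
        using Vi by (intro nn_integral_eq_integral) (auto intro: order_trans[OF v0 vV])
      also have "\<dots> \<le> ennreal (4 * pi * C)" by (intro ennreal_leI VI)
      finally show ?thesis .
    qed
    have "(\<integral>\<^sup>+z. liminf (\<lambda>k. ennreal (v (s k) z)) \<partial>m) \<le> liminf (\<lambda>k. \<integral>\<^sup>+z. ennreal (v (s k) z) \<partial>m)"
      by (rule nn_integral_liminf) measurable
    also have "\<dots> \<le> limsup (\<lambda>k. \<integral>\<^sup>+z. ennreal (v (s k) z) \<partial>m)" by (intro Liminf_le_Limsup) simp
    also have "\<dots> \<le> ennreal (4 * pi * C)" by (intro Limsup_bounded always_eventually allI vI)
    finally have "(\<integral>\<^sup>+z. liminf (\<lambda>k. ennreal (v (s k) z)) \<partial>m) \<noteq> \<infinity>" by (auto simp: top_unique)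
    then have "AE z in m. liminf (\<lambda>k. ennreal (v (s k) z)) \<noteq> \<infinity>"
      by (intro nn_integral_PInf_AE) measurable
    then show ?thesis using AEq
    proof eventually_elim
      case (elim z)
      show ?case
      proof
        assume "q z = 0"
        then have lim0: "(\<lambda>k. P (s k) z) \<longlonglongrightarrow> 0" using elim by simp
        have "ennreal B \<le> liminf (\<lambda>k. ennreal (v (s k) z))" for B
        proof (rule Liminf_bounded)
          have "\<forall>\<^sub>F k in sequentially. P (s k) z < exp (- (B + 1))"
            using lim0 by (rule order_tendstoD) simp
          then show "\<forall>\<^sub>F k in sequentially. ennreal B \<le> ennreal (v (s k) z)"
          proof eventually_elim
            case (elim k)
            have "ln (P (s k) z) < - (B + 1)"
              using elim Ppos[of "s k" z] ln_less_cancel_iff[of "P (s k) z" "exp (- (B + 1))"] by simp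
            then show ?case using Ppos[of "s k" z] by (intro ennreal_leI) (simp add: v_def)
          qed
        qed
        note B = this
        obtain y where "liminf (\<lambda>k. ennreal (v (s k) z)) = ennreal y" "0 \<le> y"
          using elim by (cases "liminf (\<lambda>k. ennreal (v (s k) z))") auto
        then show False using B[of "y + 1"] by simp
      qed
    qed
  qed
  then have pos: "AE z in m. 0 < ennreal (q z / (2 * pi))"
    by eventually_elim (use q0 in \<open>auto simp: ennreal_zero_less_divide less_le\<close>)
  have null: "E \<in> null_sets \<kappa> \<longleftrightarrow> E \<in> null_sets m" for E
  proof -
    have "E \<in> null_sets \<kappa> \<longleftrightarrow> E \<in> sets m \<and> (AE z in m. z \<in> E \<longrightarrow> ennreal (q z / (2 * pi)) = 0)"
      unfolding \<kappa>_def by (rule null_sets_density_iff) measurable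
    also have "\<dots> \<longleftrightarrow> E \<in> sets m \<and> (AE z in m. z \<notin> E)"
    proof -
      have "AE z in m. z \<notin> E" if "AE z in m. z \<in> E \<longrightarrow> ennreal (q z / (2 * pi)) = 0"
        using that pos by eventually_elim auto
      moreover have "AE z in m. z \<in> E \<longrightarrow> ennreal (q z / (2 * pi)) = 0" if "AE z in m. z \<notin> E"
        using that by eventually_elim auto
      ultimately show ?thesis by blast
    qed
    also have "\<dots> \<longleftrightarrow> E \<in> null_sets m"
    proof (cases "E \<in> sets m")
      case True
      then show ?thesis by (simp only: AE_iff_null_sets simp_thms)
    qed (auto dest: null_setsD2)
    finally show ?thesis .
  qed
  have "null_sets \<kappa> = null_sets m" by (intro set_eqI null)
  moreover have "sets \<kappa> = sets m" unfolding \<kappa>_def by (rule sets_density)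
  ultimately show ?thesis
    unfolding equivalent_measures_def absolutely_continuous_def \<open>\<rho> = \<kappa>\<close> by simp
qed

end

text \<open>Spots lie between 2 and \<open>2 ^ r m\<close>, and the next tower has the height of
  \<open>8 * 2 ^ r m\<close> blocks. A copy thus keeps at least one old height from both ends, which
  is what \<open>deep\<close> rests on.\<close>

lemma height_step: "s < height r m \<Longrightarrow> a \<in> spots r m \<Longrightarrow> s + height r m * a < height r (Suc m)"
  and height_room: "s < height r m \<Longrightarrow> a \<in> spots r m \<Longrightarrow> height r m \<le> s + height r m * a \<and> s + height r m * a + height r m < height r (Suc m)"
proof -
  assume s: "s < height r m" and a: "a \<in> spots r m"
  have a2: "2 \<le> a" "a \<le> 2 ^ r m" using spots_bounds[OF a] by auto
  have "height r m * a \<le> height r m * 2 ^ r m" using a2 by (intro mult_left_mono) auto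
  moreover have "height r m * 1 \<le> height r m * 2 ^ r m" by (intro mult_left_mono) auto
  moreover have "height r (Suc m) = 8 * (height r m * 2 ^ r m)" by (simp add: power_add)
  moreover have "height r m * 1 \<le> height r m * a" using a2 by (intro mult_left_mono) auto
  ultimately show "height r m \<le> s + height r m * a \<and> s + height r m * a + height r m < height r (Suc m)"
    using s by linarith
  then show "s + height r m * a < height r (Suc m)" by simp
qed

section \<open>Rank-one towers\<close>

definition width :: "(nat \<Rightarrow> nat) \<Rightarrow> nat \<Rightarrow> real" where "width r m = 1 / (\<Prod>j<m. real (r j))"

text \<open>The heights in tower \<open>m\<close> at which the pieces of the level
  \<open>L 0 0\<close> sit; see \<open>base_split\<close>.\<close>

fun core :: "(nat \<Rightarrow> nat) \<Rightarrow> nat \<Rightarrow> nat set" where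
  "core r 0 = {0}"
| "core r (Suc m) = (\<lambda>(s, a). s + height r m * a) ` (core r m \<times> spots r m)"

lemma digits_inj: "s < height r m \<Longrightarrow> s' < height r m \<Longrightarrow> s + height r m * a = s' + height r m * a' \<Longrightarrow> s = s' \<and> a = a'"
proof -
  assume s: "s < height r m" "s' < height r m" and eq: "s + height r m * a = s' + height r m * a'"
  have "(s + height r m * a) mod height r m = s" using s(1) by simp
  moreover have "(s' + height r m * a') mod height r m = s'" using s(2) by simp
  ultimately have "s = s'" using eq by simp
  then show ?thesis using eq height_pos[of r m] by simp
qed

lemma core_bound: "s \<in> core r m \<Longrightarrow> 4 * s \<le> height r m \<and> s < height r m"
proof (induction m arbitrary: s)
  case (Suc m)
  then obtain s' a where s': "s' \<in> core r m" "a \<in> spots r m" "s = s' + height r m * a" by auto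
  have "a \<le> 2 ^ r m" using spots_bounds[OF s'(2)] by auto
  then have "height r m * a \<le> height r m * 2 ^ r m" by (intro mult_left_mono) auto
  moreover have "height r m * 1 \<le> height r m * 2 ^ r m" by (intro mult_left_mono) auto
  moreover have "height r (Suc m) = 8 * (height r m * 2 ^ r m)" by (simp add: power_add)
  ultimately show ?case using Suc.IH[OF s'(1)] s'(3) by linarith
qed auto

lemma finite_core: "finite (core r m)"
  by (induction m) (auto simp: finite_spots)

lemma core_inj: "inj_on (\<lambda>(s, a). s + height r m * a) (core r m \<times> spots r m)"
  using core_bound[of _ r m] by (auto simp: inj_on_def dest!: digits_inj[rotated 2])

lemma card_core: "card (core r m) = (\<Prod>j<m. r j)"
proof (induction m)
  case (Suc m)
  then show ?case by (simp add: card_image[OF core_inj] card_cartesian_product card_spots)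
qed simp

text \<open>Cutting and stacking without dynamics. The abstract form separates the ergodic theory
  from the concrete intervals, which enter in \<open>levels_real\<close>.\<close>

locale levels =
  fixes r :: "nat \<Rightarrow> nat" and M :: "'a measure" and L :: "nat \<Rightarrow> nat \<Rightarrow> 'a set"
  assumes r2: "\<And>j. 2 \<le> r j"
  and level_sets: "\<And>m s. s < height r m \<Longrightarrow> L m s \<in> sets M"
  and level_measure: "\<And>m s. s < height r m \<Longrightarrow> emeasure M (L m s) = ennreal (width r m)"
  and level_disjoint: "\<And>m s t. s < height r m \<Longrightarrow> t < height r m \<Longrightarrow> s \<noteq> t \<Longrightarrow> L m s \<inter> L m t = {}"
  and level_split: "\<And>m s. s < height r m \<Longrightarrow> L m s = (\<Union>a\<in>spots r m. L (Suc m) (s + height r m * a))"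
  and level_cover: "space M = (\<Union>m. \<Union>s<height r m. L m s)"
  and level_generate: "sets M = sigma_sets (space M) {L m s |m s. s < height r m}"
begin

abbreviation "h \<equiv> height r"
abbreviation "w \<equiv> width r"

lemma r_pos: "0 < r j" using r2[of j] by simp

lemma w_pos: "0 < w m"
proof -
  have "0 < (\<Prod>j<m. real (r j))" by (intro prod_pos) (simp add: r_pos)
  then show ?thesis unfolding width_def by (simp only: zero_less_divide_1_iff)
qed

lemma w_Suc: "real (r m) * w (Suc m) = w m"
  using r2[of m] by (simp add: width_def)

lemma w_core: "real (card (core r m)) * w m = 1"
  by (simp add: width_def card_core r_pos)

lemma level_subset: "s < h m \<Longrightarrow> L m s \<subseteq> space M"
  using level_cover by auto

lemma child_subset: "s < h m \<Longrightarrow> a \<in> spots r m \<Longrightarrow> L (Suc m) (s + h m * a) \<subseteq> L m s"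
  using level_split[of s m] by auto

lemma level_unique: "s < h m \<Longrightarrow> t < h m \<Longrightarrow> x \<in> L m s \<Longrightarrow> x \<in> L m t \<Longrightarrow> s = t"
  using level_disjoint[of s m t] by auto

lemma level_up: "m \<le> m' \<Longrightarrow> s < h m \<Longrightarrow> x \<in> L m s \<Longrightarrow> \<exists>t<h m'. x \<in> L m' t"
proof (induction m' rule: dec_induct)
  case (step n)
  then obtain t where t: "t < h n" "x \<in> L n t" by blast
  then obtain a where "a \<in> spots r n" "x \<in> L (Suc n) (t + h n * a)" using level_split[of t n] by auto
  then show ?case using height_step[OF t(1)] by blast
qed auto

lemma level_nested: "m \<le> m' \<Longrightarrow> s < h m \<Longrightarrow> t < h m' \<Longrightarrow> L m' t \<subseteq> L m s \<or> L m' t \<inter> L m s = {}"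
proof (induction m' arbitrary: t rule: dec_induct)
  case base
  then show ?case using level_disjoint[of t m s] by auto
next
  case (step n)
  show ?case
  proof (cases "L (Suc n) t \<inter> L m s = {}")
    case False
    then obtain x where x: "x \<in> L (Suc n) t" "x \<in> L m s" by auto
    obtain u where u: "u < h n" "x \<in> L n u" using level_up[OF _ step.prems(1) x(2), of n] step.hyps by auto
    obtain a where a: "a \<in> spots r n" "x \<in> L (Suc n) (u + h n * a)" using u level_split[of u n] by auto
    have "t = u + h n * a" by (rule level_unique[OF step.prems(2) height_step[OF u(1) a(1)] x(1) a(2)])
    then have "L (Suc n) t \<subseteq> L n u" using child_subset[OF u(1) a(1)] by simp
    moreover have "L n u \<subseteq> L m s" using step.IH[OF step.prems(1) u(1)] u x by auto
    ultimately show ?thesis by auto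
  qed simp
qed

text \<open>In the next tower a point lies in a copy of the previous one, hence far from both ends.
  So a piece of orbit of given length stays within one tower for every point, with no exceptional
  null set.\<close>

lemma deep: "x \<in> space M \<Longrightarrow> \<exists>m0. \<forall>m\<ge>m0. \<exists>s<h m. x \<in> L m s \<and> K \<le> s \<and> s + K < h m"
proof -
  assume "x \<in> space M"
  then obtain m1 s1 where m1: "s1 < h m1" "x \<in> L m1 s1" using level_cover by auto
  show ?thesis
  proof (rule exI[of _ "Suc (m1 + K)"], intro allI impI)
    fix m assume m: "Suc (m1 + K) \<le> m"
    then obtain n where n: "m = Suc n" "m1 + K \<le> n" by (cases m) auto
    obtain u where u: "u < h n" "x \<in> L n u" using level_up[OF _ m1, of n] n by auto
    obtain a where a: "a \<in> spots r n" "x \<in> L (Suc n) (u + h n * a)" using u level_split[of u n] by auto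
    have "K \<le> h n" using le_height[of n r] n by simp
    then show "\<exists>s<h m. x \<in> L m s \<and> K \<le> s \<and> s + K < h m"
      unfolding n(1) using height_room[OF u(1) a(1)] a(2)
      by (intro exI[of _ "u + h n * a"]) (auto simp del: height.simps)
  qed
qed

lemma deep_level: assumes "x \<in> space M"
  obtains m s where "s < h m" "x \<in> L m s" "K \<le> s" "s + K < h m"
  using deep[OF assms, of K] by blast

end

text \<open>\<open>act\<close> comprises all integer powers and satisfies the group law at every
  point of the space; the inverse transformation is therefore exact.\<close>

locale tower = levels r M L for r :: "nat \<Rightarrow> nat" and M :: "'a measure" and L +
  fixes act :: "int \<Rightarrow> 'a \<Rightarrow> 'a"
  assumes act_level: "\<And>m s k x. s < height r m \<Longrightarrow> x \<in> L m s \<Longrightarrow> 0 \<le> int s + k \<Longrightarrow> int s + k < int (height r m) \<Longrightarrow>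
      act k x \<in> L m (nat (int s + k))"
  and act_0: "\<And>x. x \<in> space M \<Longrightarrow> act 0 x = x"
  and act_add: "\<And>x k l. x \<in> space M \<Longrightarrow> act (k + l) x = act k (act l x)"
begin

lemma act_space: "x \<in> space M \<Longrightarrow> act k x \<in> space M"
proof -
  assume "x \<in> space M"
  then obtain m s where s: "s < h m" "x \<in> L m s" "nat \<bar>k\<bar> \<le> s" "s + nat \<bar>k\<bar> < h m" by (rule deep_level)
  have "act k x \<in> L m (nat (int s + k))" by (rule act_level[OF s(1,2)]) (use s in linarith)+
  moreover have "nat (int s + k) < h m" using s by linarith
  ultimately show ?thesis using level_subset by blast
qed

lemma act_inverse: "x \<in> space M \<Longrightarrow> act (- k) (act k x) = x" "x \<in> space M \<Longrightarrow> act k (act (- k) x) = x"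
  using act_add[of x "-k" k] act_add[of x k "-k"] act_0[of x] by auto

text \<open>The image of \<open>E\<close> under \<open>act k\<close>, written as a preimage under
  the inverse so that measurability is immediate.\<close>

definition shift :: "int \<Rightarrow> 'a set \<Rightarrow> 'a set" where "shift k E = act (- k) -` E \<inter> space M"

lemma shift_level: assumes s: "s < h m" and k: "0 \<le> int s + k" "int s + k < int (h m)"
  shows "shift k (L m s) = L m (nat (int s + k))"
proof
  show "shift k (L m s) \<subseteq> L m (nat (int s + k))"
  proof
    fix x assume "x \<in> shift k (L m s)"
    then have x: "act (-k) x \<in> L m s" "x \<in> space M" by (auto simp: shift_def)
    have "act k (act (-k) x) \<in> L m (nat (int s + k))" by (rule act_level[OF s x(1) k])
    then show "x \<in> L m (nat (int s + k))" using act_inverse(2)[OF x(2)] by simp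
  qed
  show "L m (nat (int s + k)) \<subseteq> shift k (L m s)"
  proof
    fix x assume x: "x \<in> L m (nat (int s + k))"
    have n: "nat (int s + k) < h m" using k by linarith
    have "act (-k) x \<in> L m (nat (int (nat (int s + k)) + - k))"
      by (rule act_level[OF n x]) (use s k in auto)
    then show "x \<in> shift k (L m s)" using k level_subset[OF n] x by (auto simp: shift_def)
  qed
qed

lemma shift_add: assumes "E \<subseteq> space M" shows "shift k (shift l E) = shift (k + l) E"
proof -
  have "act (- (k + l)) x = act (- l) (act (- k) x)" if "x \<in> space M" for x
    using act_add[OF that, of "-l" "-k"] by (simp add: add.commute)
  then show ?thesis by (auto simp: shift_def act_space)
qed

lemma shift_0: "E \<subseteq> space M \<Longrightarrow> shift 0 E = E" by (auto simp: shift_def act_0)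

lemma shift_UN: "shift k (\<Union>i\<in>I. E i) = (\<Union>i\<in>I. shift k (E i))" by (auto simp: shift_def)

lemma shift_Int: "shift k (E \<inter> F) = shift k E \<inter> shift k F" by (auto simp: shift_def)

lemma refine:
  assumes "s < h m"
  shows "\<exists>T. finite T \<and> (\<forall>t\<in>T. t < h (m + n) \<and> (n > 0 \<longrightarrow> h (m + n - 1) \<le> t \<and> t + h (m + n - 1) < h (m + n))) \<and> L m s = (\<Union>t\<in>T. L (m + n) t)"
proof (induction n)
  case 0
  show ?case by (intro exI[of _ "{s}"]) (use assms in auto)
next
  case (Suc n)
  then obtain T where T: "finite T" "\<And>t. t \<in> T \<Longrightarrow> t < h (m + n)" "L m s = (\<Union>t\<in>T. L (m + n) t)" by blast
  show ?case
  proof (intro exI[of _ "(\<lambda>(t, a). t + h (m + n) * a) ` (T \<times> spots r (m + n))"] conjI ballI)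
    show "finite ((\<lambda>(t, a). t + h (m + n) * a) ` (T \<times> spots r (m + n)))" using T(1) by (simp add: finite_spots)
    have "L m s = (\<Union>t\<in>T. \<Union>a\<in>spots r (m + n). L (Suc (m + n)) (t + h (m + n) * a))"
      unfolding T(3) using level_split[of _ "m + n"] T(2) by (intro SUP_cong refl) auto
    then show "L m s = (\<Union>t\<in>(\<lambda>(t, a). t + h (m + n) * a) ` (T \<times> spots r (m + n)). L (m + Suc n) t)" by auto
    fix u assume "u \<in> (\<lambda>(t, a). t + h (m + n) * a) ` (T \<times> spots r (m + n))"
    then obtain t a where ta: "t \<in> T" "a \<in> spots r (m + n)" "u = t + h (m + n) * a" by auto
    show "u < h (m + Suc n)" using height_step[OF T(2)[OF ta(1)] ta(2)] ta(3) by (simp del: height.simps)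
    show "0 < Suc n \<longrightarrow> h (m + Suc n - 1) \<le> u \<and> u + h (m + Suc n - 1) < h (m + Suc n)"
      using height_room[OF T(2)[OF ta(1)] ta(2)] ta(3) by (simp del: height.simps)
  qed
qed

text \<open>After |k| + 1 cuttings all pieces keep the distance |k| from both ends, so the translate
  by \<open>k\<close> is again a finite union of levels. Measurability and invariance of the action
  follow from this.\<close>

lemma refine_deep: assumes "s < h m"
  shows "\<exists>T m'. finite T \<and> (\<forall>t\<in>T. t < h m' \<and> 0 \<le> int t + k \<and> int t + k < int (h m')) \<and> L m s = (\<Union>t\<in>T. L m' t)"
proof -
  let ?n = "nat \<bar>k\<bar>"
  obtain T where T: "finite T" "L m s = (\<Union>t\<in>T. L (m + Suc ?n) t)" and
    T': "\<forall>t\<in>T. t < h (m + Suc ?n) \<and> (Suc ?n > 0 \<longrightarrow> h (m + Suc ?n - 1) \<le> t \<and> t + h (m + Suc ?n - 1) < h (m + Suc ?n))"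
    using refine[OF assms, of "Suc ?n"] by blast
  have big: "?n \<le> h (m + Suc ?n - 1)" using le_height[of "m + ?n" r] by simp
  have "t < h (m + Suc ?n) \<and> 0 \<le> int t + k \<and> int t + k < int (h (m + Suc ?n))" if t: "t \<in> T" for t
  proof -
    have "t < h (m + Suc ?n)" "h (m + Suc ?n - 1) \<le> t" "t + h (m + Suc ?n - 1) < h (m + Suc ?n)"
      using T' t by blast+
    then show ?thesis using big by linarith
  qed
  then show ?thesis using T by blast
qed

lemma shift_level_sets: "s < h m \<Longrightarrow> shift k (L m s) \<in> sets M"
proof -
  assume "s < h m"
  then obtain T m' where T1: "finite T" "\<forall>t\<in>T. t < h m' \<and> 0 \<le> int t + k \<and> int t + k < int (h m')" "L m s = (\<Union>t\<in>T. L m' t)"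
    using refine_deep[of s m k] by blast
  then have T: "finite T" "\<And>t. t \<in> T \<Longrightarrow> t < h m'" "\<And>t. t \<in> T \<Longrightarrow> 0 \<le> int t + k"
    "\<And>t. t \<in> T \<Longrightarrow> int t + k < int (h m')" "L m s = (\<Union>t\<in>T. L m' t)" by auto
  have "nat (int t + k) < h m'" if "t \<in> T" for t using T(3)[OF that] T(4)[OF that] by linarith
  then have "shift k (L m' t) \<in> sets M" if "t \<in> T" for t
    using that by (simp add: shift_level T level_sets)
  then show ?thesis unfolding T(5) shift_UN using T(1) by auto
qed

lemma shift_level_measure: "s < h m \<Longrightarrow> emeasure M (shift k (L m s)) = emeasure M (L m s)"
proof -
  assume "s < h m"
  then obtain T m' where T1: "finite T" "\<forall>t\<in>T. t < h m' \<and> 0 \<le> int t + k \<and> int t + k < int (h m')" "L m s = (\<Union>t\<in>T. L m' t)"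
    using refine_deep[of s m k] by blast
  then have T: "finite T" "\<And>t. t \<in> T \<Longrightarrow> t < h m'" "\<And>t. t \<in> T \<Longrightarrow> 0 \<le> int t + k"
    "\<And>t. t \<in> T \<Longrightarrow> int t + k < int (h m')" "L m s = (\<Union>t\<in>T. L m' t)" by auto
  have n: "nat (int t + k) < h m'" if "t \<in> T" for t using T(3)[OF that] T(4)[OF that] by linarith
  have "emeasure M (shift k (L m s)) = (\<Sum>t\<in>T. emeasure M (shift k (L m' t)))"
    unfolding T(5) shift_UN
  proof (rule sum_emeasure[symmetric])
    show "disjoint_family_on (\<lambda>t. shift k (L m' t)) T"
      using level_disjoint[of _ m'] T(2) by (auto simp: disjoint_family_on_def shift_def)
  qed (use T shift_level_sets in auto)
  also have "\<dots> = (\<Sum>t\<in>T. emeasure M (L m' t))"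
    using n by (intro sum.cong refl) (simp add: shift_level T level_measure)
  also have "\<dots> = emeasure M (L m s)"
    unfolding T(5) by (rule sum_emeasure) (use T level_sets level_disjoint[of _ m'] in \<open>auto simp: disjoint_family_on_def\<close>)
  finally show ?thesis .
qed

lemma act_measurable [measurable]: "act k \<in> measurable M M"
proof -
  have sub: "{L m s |m s. s < h m} \<subseteq> Pow (space M)" using level_subset by auto
  have "act k \<in> measurable M (sigma (space M) {L m s |m s. s < h m})"
  proof (rule measurable_sigma_sets[OF _ sub])
    show "act k \<in> space M \<rightarrow> space M" using act_space by auto
    show "sets (sigma (space M) {L m s |m s. s < h m}) = sigma_sets (space M) {L m s |m s. s < h m}"
      using sub by (simp add: sets_measure_of)
    fix y assume "y \<in> {L m s |m s. s < h m}"
    then show "act k -` y \<inter> space M \<in> sets M"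
      using shift_level_sets[of _ _ "-k"] by (auto simp: shift_def)
  qed
  also have "measurable M (sigma (space M) {L m s |m s. s < h m}) = measurable M M"
    using sub level_generate by (intro measurable_cong_sets refl) (simp add: sets_measure_of)
  finally show ?thesis .
qed

lemma shift_sets: "E \<in> sets M \<Longrightarrow> shift k E \<in> sets M"
  unfolding shift_def by (rule measurable_sets[OF act_measurable])

lemma levels_Int_stable: "Int_stable (insert {} {L m s |m s. s < h m})"
proof (rule Int_stableI)
  have *: "L m s \<inter> L m' t \<in> insert {} {L m s |m s. s < h m}" if "m \<le> m'" "s < h m" "t < h m'" for m m' s t
    using level_nested[OF that] that by (auto simp: Int_absorb1)
  fix A B assume A: "A \<in> insert {} {L m s |m s. s < h m}" and B: "B \<in> insert {} {L m s |m s. s < h m}"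
  show "A \<inter> B \<in> insert {} {L m s |m s. s < h m}"
  proof (cases "A = {} \<or> B = {}")
    case False
    then obtain m s m' t where "A = L m s" "B = L m' t" "s < h m" "t < h m'" using A B by blast
    then show ?thesis using *[of m m' s t] *[of m' m t s] by (cases "m \<le> m'") (auto simp: Int_commute)
  qed auto
qed

lemma countable_levels: "countable {L m s |m s. s < h m}"
proof -
  have "{L m s |m s. s < h m} \<subseteq> range (\<lambda>(m, s). L m s)" by auto
  then show ?thesis by (rule countable_subset) simp
qed

lemma level_measure_eqI:
  assumes "sets N = sets M" "sets N' = sets M"
  and "\<And>m s. s < h m \<Longrightarrow> emeasure N (L m s) = emeasure N' (L m s)" "\<And>m s. s < h m \<Longrightarrow> emeasure N (L m s) \<noteq> \<infinity>"
  shows "N = N'"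
proof (rule measure_eqI_generator_eq_countable[OF levels_Int_stable, where A="{L m s |m s. s < h m}" and \<Omega>="space M"])
  show "insert {} {L m s |m s. s < h m} \<subseteq> Pow (space M)" using level_subset by auto
  show "sets N = sigma_sets (space M) (insert {} {L m s |m s. s < h m})"
    "sets N' = sigma_sets (space M) (insert {} {L m s |m s. s < h m})"
    using assms(1,2) level_generate sigma_sets_eqI[of "{L m s |m s. s < h m}" "space M" "insert {} {L m s |m s. s < h m}"]
    by (auto intro: sigma_sets.Empty)
  show "\<Union> {L m s |m s. s < h m} = space M" using level_cover by auto
qed (use assms countable_levels in auto)

lemma act_preserves: "distr M M (act k) = M"
proof (rule level_measure_eqI)
  fix m s assume s: "s < h m"
  have "emeasure (distr M M (act k)) (L m s) = emeasure M (shift (-k) (L m s))"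
    using level_sets[OF s] by (simp add: emeasure_distr shift_def)
  then show "emeasure (distr M M (act k)) (L m s) = emeasure M (L m s)" by (simp add: shift_level_measure[OF s])
  then show "emeasure (distr M M (act k)) (L m s) \<noteq> \<infinity>" by (simp add: level_measure[OF s])
qed auto

lemma shift_measure: "E \<in> sets M \<Longrightarrow> emeasure M (shift k E) = emeasure M E"
  using emeasure_distr[of "act (-k)" M M E] by (simp add: act_preserves shift_def)

lemma sigma_finite: "sigma_finite_measure M"
proof (intro sigma_finite_measure.intro exI conjI ballI)
  show "countable {L m s |m s. s < h m}" by (rule countable_levels)
  show "{L m s |m s. s < h m} \<subseteq> sets M" using level_sets by auto
  show "\<Union> {L m s |m s. s < h m} = space M" using level_cover by auto
  show "emeasure M a \<noteq> \<infinity>" if "a \<in> {L m s |m s. s < h m}" for a using that level_measure by auto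
qed

lemma automorphism_act: "automorphism M (act 1)"
  unfolding automorphism_def
proof (intro conjI bexI[of _ "act (- 1)"])
  show "AE x in M. act (- 1) (act 1 x) = x" "AE x in M. act 1 (act (- 1) x) = x"
    by (auto intro!: AE_I2 act_inverse)
qed (rule act_measurable act_preserves)+

lemma base_split: "L 0 0 = (\<Union>s\<in>core r m. L m s)"
proof (induction m)
  case (Suc m)
  have "L 0 0 = (\<Union>s\<in>core r m. \<Union>a\<in>spots r m. L (Suc m) (s + h m * a))"
    unfolding Suc using level_split[of _ m] core_bound[of _ r m] by (intro SUP_cong refl) auto
  then show ?case by auto
qed simp

text \<open>An invariant set fills all levels of a tower equally, so its proportion is the same
  constant \<open>\<alpha>\<close> in every level. As levels generate, the indicator of
  \<open>A\<close> and the constant \<open>\<alpha>\<close> define the same measure; evaluation on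
  \<open>A\<close> and on its complement decides.\<close>

lemma ergodic_act: "ergodic M (act 1)"
  unfolding ergodic_def
proof (intro ballI impI)
  fix A assume A: "A \<in> sets M" and inv: "act 1 -` A \<inter> space M = A"
  have inv1: "shift (-1) A = A" using inv by (simp add: shift_def)
  have As: "A \<subseteq> space M" using sets.sets_into_space[OF A] .
  have shiftA: "shift (- int n) A = A" for n
  proof (induction n)
    case (Suc n)
    have "shift (- int (Suc n)) A = shift (-1) (shift (- int n) A)"
      using shift_add[OF As, of "-1" "- int n"] by (simp add: algebra_simps)
    then show ?case using Suc inv1 by simp
  qed (simp add: shift_0[OF As])
  have eqm: "emeasure M (A \<inter> L m s) = emeasure M (A \<inter> L m 0)" if s: "s < h m" for m s
  proof -
    have "emeasure M (A \<inter> L m s) = emeasure M (shift (- int s) (A \<inter> L m s))"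
      using A level_sets[OF s] by (intro shift_measure[symmetric]) auto
    also have "shift (- int s) (A \<inter> L m s) = A \<inter> L m 0"
      using shift_level[OF s, of "- int s"] s by (simp add: shift_Int shiftA)
    finally show ?thesis .
  qed
  \<comment> \<open>\<open>L 0 0\<close> has measure 1, so this is the proportion of
    \<open>A\<close> in it; its splitting along \<open>core r m\<close> transfers the proportion to
    all towers.\<close>
  define \<alpha> where "\<alpha> = emeasure M (A \<inter> L 0 0)"
  have \<alpha>: "emeasure M (A \<inter> L m s) = \<alpha> * emeasure M (L m s)" if s: "s < h m" for m s
  proof -
    have "\<alpha> = emeasure M (\<Union>t\<in>core r m. A \<inter> L m t)"
      unfolding \<alpha>_def by (subst base_split[of m]) (simp only: Int_UN_distrib)
    also have "\<dots> = (\<Sum>t\<in>core r m. emeasure M (A \<inter> L m t))"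
    proof (rule sum_emeasure[symmetric])
      show "disjoint_family_on (\<lambda>t. A \<inter> L m t) (core r m)"
        using level_unique[of _ m] core_bound[of _ r m] by (auto simp: disjoint_family_on_def)
    qed (use core_bound[of _ r m] A level_sets in \<open>auto simp: finite_core\<close>)
    also have "\<dots> = (\<Sum>t\<in>core r m. emeasure M (A \<inter> L m s))"
      using core_bound[of _ r m] by (intro sum.cong refl) (simp add: eqm s)
    also have "\<dots> = of_nat (card (core r m)) * emeasure M (A \<inter> L m s)" by simp
    finally have "\<alpha> * emeasure M (L m s) = of_nat (card (core r m)) * ennreal (w m) * emeasure M (A \<inter> L m s)"
      by (simp add: level_measure[OF s] mult_ac)
    also have "of_nat (card (core r m)) * ennreal (w m) = 1"
      using w_core[of m] w_pos[of m] by (simp add: ennreal_of_nat_eq_real_of_nat ennreal_mult[symmetric])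
    finally show ?thesis by simp
  qed
  have \<alpha>fin: "\<alpha> \<noteq> \<infinity>"
  proof -
    have "\<alpha> \<le> emeasure M (L 0 0)" unfolding \<alpha>_def using level_sets[of 0 0] by (intro emeasure_mono) auto
    then show ?thesis using level_measure[of 0 0] by (auto simp: top_unique)
  qed
  have "density M (indicator A) = density M (\<lambda>_. \<alpha>)"
  proof (rule level_measure_eqI)
    fix m s assume s: "s < h m"
    have 1: "emeasure (density M (indicator A)) (L m s) = emeasure M (A \<inter> L m s)"
      using A level_sets[OF s] by (subst emeasure_density) (auto simp: Int_commute nn_integral_indicator[symmetric] indicator_inter_arith simp del: nn_integral_indicator)
    have 2: "emeasure (density M (\<lambda>_. \<alpha>)) (L m s) = \<alpha> * emeasure M (L m s)"
      using level_sets[OF s] by (rule emeasure_density_const)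
    show "emeasure (density M (indicator A)) (L m s) = emeasure (density M (\<lambda>_. \<alpha>)) (L m s)"
      unfolding 1 2 by (rule \<alpha>[OF s])
    show "emeasure (density M (indicator A)) (L m s) \<noteq> \<infinity>"
      unfolding 1 \<alpha>[OF s] level_measure[OF s] using \<alpha>fin by (simp add: ennreal_mult_eq_top_iff)
  qed auto
  then have eq: "emeasure (density M (indicator A)) (space M - A) = emeasure (density M (\<lambda>_. \<alpha>)) (space M - A)"
    "emeasure (density M (indicator A)) A = emeasure (density M (\<lambda>_. \<alpha>)) A" by simp_all
  have 1: "emeasure (density M (indicator A)) (space M - A) = 0"
    using A by (subst emeasure_density) (auto simp: nn_integral_0_iff_AE intro!: AE_I2 split: split_indicator)
  have 2: "emeasure (density M (indicator A)) A = emeasure M A"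
    using A by (subst emeasure_density) (auto simp: nn_integral_indicator[symmetric] indicator_inter_arith[symmetric] simp del: nn_integral_indicator)
  show "A \<in> null_sets M \<or> space M - A \<in> null_sets M"
  proof (cases "\<alpha> = 0")
    case True
    then have "emeasure M A = 0" using eq(2) 2 A by (simp add: emeasure_density_const)
    then show ?thesis using A by (auto simp: null_sets_def)
  next
    case False
    then have "emeasure M (space M - A) = 0" using eq(1) 1 A by (simp add: emeasure_density_const)
    then show ?thesis using A by (auto simp: null_sets_def)
  qed
qed

end

lemma card_spot_shift:
  "card {a \<in> spots r j. int a + e \<in> int ` spots r j} = (if e = 0 then r j else if e \<in> gaps r j then 1 else 0)"
proof -
  consider "e = 0" | "e \<noteq> 0" "e \<in> gaps r j" | "e \<noteq> 0" "e \<notin> gaps r j" by blast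
  then show ?thesis
  proof cases
    case 1
    then have "{a \<in> spots r j. int a + e \<in> int ` spots r j} = spots r j" by auto
    then show ?thesis using 1 by (simp add: card_spots)
  next
    case 2
    then obtain a b where ab: "e = int a - int b" "a \<in> spots r j" "b \<in> spots r j" "a \<noteq> b" by (auto simp: gaps_def)
    have "{a \<in> spots r j. int a + e \<in> int ` spots r j} = {b}"
    proof (intro set_eqI iffI)
      fix c assume "c \<in> {a \<in> spots r j. int a + e \<in> int ` spots r j}"
      then obtain c' where c: "c \<in> spots r j" "c' \<in> spots r j" "int c + e = int c'" by auto
      have "int a - int b = int c' - int c" using c(3) ab(1) by simp
      then have "b = c" using spots_Sidon[OF ab(2,3) c(2,1)] ab(4) by blast
      then show "c \<in> {b}" by simp
    next
      fix c assume "c \<in> {b}"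
      then show "c \<in> {a \<in> spots r j. int a + e \<in> int ` spots r j}" using ab by auto
    qed
    then show ?thesis using 2 by simp
  next
    case 3
    have none: "{a \<in> spots r j. int a + e \<in> int ` spots r j} = {}"
    proof (rule ccontr)
      assume "{a \<in> spots r j. int a + e \<in> int ` spots r j} \<noteq> {}"
      then obtain a b where ab: "a \<in> spots r j" "b \<in> spots r j" "int a + e = int b" by auto
      then have "e = int b - int a" by simp
      moreover have "a \<noteq> b" using ab(3) 3(1) by auto
      ultimately show False using 3(2) gapsI[OF ab(2,1)] by auto
    qed
    show ?thesis unfolding none using 3 by simp
  qed
qed

context tower
begin

section \<open>Correlations of the base and conservativity of tensor powers\<close>

definition corr :: "int \<Rightarrow> real" where "corr k = measure M (L 0 0 \<inter> shift (- k) (L 0 0))"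

text \<open>\<open>core_bound\<close> puts the pieces of the base into the lowest quarter of tower
  \<open>J\<close>, so a move up by at most half the height stays inside the tower. A move below the
  bottom is excluded by moving back from the level that is reached.\<close>

lemma corr_core: assumes k: "2 * \<bar>k\<bar> \<le> int (h J)"
  shows "corr k = w J * real (card {s \<in> core r J. int s + k \<in> int ` core r J})"
proof -
  let ?T = "{s \<in> core r J. int s + k \<in> int ` core r J}"
  have "L 0 0 \<inter> shift (- k) (L 0 0) = (\<Union>s\<in>?T. L J s)"
  proof (intro set_eqI iffI)
    fix x assume "x \<in> L 0 0 \<inter> shift (- k) (L 0 0)"
    then have x: "x \<in> L 0 0" "act k x \<in> L 0 0" "x \<in> space M" by (auto simp: shift_def)
    obtain s where s: "s \<in> core r J" "x \<in> L J s" using x(1) base_split[of J] by auto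
    obtain t where t: "t \<in> core r J" "act k x \<in> L J t" using x(2) base_split[of J] by auto
    note sb = core_bound[OF s(1)] and tb = core_bound[OF t(1)]
    have "int s + k = int t"
    proof (cases "0 \<le> int s + k")
      case True
      have lt: "int s + k < int (h J)" using sb k by linarith
      have "act k x \<in> L J (nat (int s + k))" by (rule act_level[OF _ s(2) True lt]) (use sb in simp)
      moreover have "nat (int s + k) < h J" using True lt by linarith
      ultimately have "nat (int s + k) = t" using level_unique[OF _ _ _ t(2)] tb by blast
      then show ?thesis using True by simp
    next
      case False
      have ge: "0 \<le> int t + - k" using False by linarith
      have lt: "int t + - k < int (h J)" using tb k by linarith
      have "act (- k) (act k x) \<in> L J (nat (int t + - k))" by (rule act_level[OF _ t(2) ge lt]) (use tb in simp)
      then have "x \<in> L J (nat (int t + - k))" using act_inverse(1)[OF x(3)] by simp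
      moreover have "nat (int t + - k) < h J" using ge lt by linarith
      ultimately have "nat (int t + - k) = s" using level_unique[OF _ _ _ s(2)] sb by blast
      then show ?thesis using ge by simp
    qed
    then show "x \<in> (\<Union>s\<in>?T. L J s)" using s t by auto
  next
    fix x assume "x \<in> (\<Union>s\<in>?T. L J s)"
    then obtain s t where s: "s \<in> core r J" "x \<in> L J s" "t \<in> core r J" "int s + k = int t" by auto
    have sb: "s < h J" "t < h J" using core_bound s by auto
    have "act k x \<in> L J (nat (int s + k))" by (rule act_level[OF sb(1) s(2)]) (use s sb in auto)
    then have "act k x \<in> L J t" using s by simp
    then show "x \<in> L 0 0 \<inter> shift (- k) (L 0 0)"
      using s level_subset[OF sb(1)] base_split[of J] by (auto simp: shift_def)
  qed
  then have "emeasure M (L 0 0 \<inter> shift (- k) (L 0 0)) = (\<Sum>s\<in>?T. emeasure M (L J s))"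
    using core_bound[of _ r J] level_sets
  proof (simp, intro sum_emeasure[symmetric])
    show "disjoint_family_on (L J) ?T"
      using level_unique[of _ J] core_bound[of _ r J] by (auto simp: disjoint_family_on_def)
  qed (use core_bound[of _ r J] level_sets in \<open>auto simp: finite_core\<close>)
  also have "\<dots> = (\<Sum>s\<in>?T. ennreal (w J))"
    using core_bound[of _ r J] by (intro sum.cong refl) (simp add: level_measure)
  also have "\<dots> = ennreal (w J * real (card ?T))"
    using w_pos[of J] by (simp add: ennreal_of_nat_eq_real_of_nat ennreal_mult mult.commute)
  finally show ?thesis unfolding corr_def measure_def using w_pos[of J] by simp
qed

lemma corr_0: "corr 0 = 1"
  using corr_core[of 0 0] by (simp add: width_def)

text \<open>Digits do not interact: if two pieces of \<open>L 0 0\<close> in tower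
  \<open>J + 1\<close> differ by \<open>k + h J * e\<close>, the discrepancy of the lower parts is a
  multiple of \<open>h J\<close> smaller than \<open>h J\<close>, hence zero. The lower parts then
  differ by \<open>k\<close> and the spots by \<open>e\<close>.\<close>

lemma corr_mult:
  assumes k: "2 * \<bar>k\<bar> \<le> int (h J)" and ke: "2 * \<bar>k + int (h J) * e\<bar> \<le> int (h (Suc J))"
  shows "corr (k + int (h J) * e) = corr k * gap_coeff r (\<lambda>j. 1 / real (r j)) J e"
proof -
  let ?f = "\<lambda>(s, a). s + h J * a"
  let ?S = "{s \<in> core r J. int s + k \<in> int ` core r J}" and ?A = "{a \<in> spots r J. int a + e \<in> int ` spots r J}"
  have "{t \<in> core r (Suc J). int t + (k + int (h J) * e) \<in> int ` core r (Suc J)} = ?f ` (?S \<times> ?A)"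
  proof (intro set_eqI iffI)
    fix t assume "t \<in> {t \<in> core r (Suc J). int t + (k + int (h J) * e) \<in> int ` core r (Suc J)}"
    then obtain s a s' a' where *: "t = s + h J * a" "s \<in> core r J" "a \<in> spots r J" "s' \<in> core r J" "a' \<in> spots r J"
      "int t + (k + int (h J) * e) = int (s' + h J * a')" by auto
    have eq: "int s + k - int s' = int (h J) * (int a' - int a - e)"
      using *(6) by (simp add: *(1) algebra_simps)
    have "\<bar>int s + k - int s'\<bar> < int (h J)"
      using core_bound[OF *(2)] core_bound[OF *(4)] k by linarith
    then have "int (h J) * \<bar>int a' - int a - e\<bar> < int (h J) * 1" unfolding eq by (simp add: abs_mult)
    then have "\<bar>int a' - int a - e\<bar> < 1" using height_pos[of r J] by (simp only: mult_less_cancel_left_pos of_nat_0_less_iff)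
    then have ae: "int a + e = int a'" by simp
    then have "int a' - int a - e = 0" by simp
    then have "int s + k = int s'" using eq by simp
    with ae show "t \<in> ?f ` (?S \<times> ?A)" using * by (intro image_eqI[of _ _ "(s, a)"]) auto
  next
    fix t assume "t \<in> ?f ` (?S \<times> ?A)"
    then obtain s a s' a' where *: "t = s + h J * a" "s \<in> core r J" "a \<in> spots r J" "s' \<in> core r J" "a' \<in> spots r J"
      "int s + k = int s'" "int a + e = int a'" by auto
    have "int t + (k + int (h J) * e) = (int s + k) + int (h J) * (int a + e)"
      by (simp add: *(1) algebra_simps)
    also have "\<dots> = int (s' + h J * a')" by (simp add: *(6,7))
    finally have "int t + (k + int (h J) * e) = int (s' + h J * a')" .
    moreover have "s' + h J * a' \<in> core r (Suc J)" "t \<in> core r (Suc J)" using *(1-5) by auto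
    ultimately show "t \<in> {t \<in> core r (Suc J). int t + (k + int (h J) * e) \<in> int ` core r (Suc J)}" by blast
  qed
  moreover have "card (?f ` (?S \<times> ?A)) = card ?S * card ?A"
    by (subst card_image) (auto intro: inj_on_subset[OF core_inj[of r J]] simp: card_cartesian_product)
  ultimately have "corr (k + int (h J) * e) = w (Suc J) * (real (card ?S) * real (card ?A))"
    using corr_core[OF ke] by simp
  also have "\<dots> = w J * real (card ?S) * (real (card ?A) / real (r J))"
    using w_Suc[of J] r_pos[of J] by (simp add: field_simps)
  also have "real (card ?A) / real (r J) = gap_coeff r (\<lambda>j. 1 / real (r j)) J e"
    using r_pos[of J] by (simp add: card_spot_shift gap_coeff_def)
  finally show ?thesis using corr_core[OF k] by simp
qed

section \<open>Tensor powers and conservativity by returns to cubes\<close>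

lemma product_sigma_finite: "product_sigma_finite (\<lambda>_. M)"
  by (intro product_sigma_finite.intro sigma_finite)

lemma tensor_measurable:
  assumes [measurable]: "T \<in> measurable M M"
  shows "tensor_power d T \<in> measurable (power_space d M) (power_space d M)"
  unfolding tensor_power_def power_space_def by measurable

lemma tensor_preserves: "distr (power_space d M) (power_space d M) (tensor_power d (act k)) = power_space d M"
  unfolding power_space_def
proof (rule product_sigma_finite.PiM_eqI[OF product_sigma_finite])
  let ?N = "PiM {..<d} (\<lambda>_. M)"
  fix A assume A: "\<And>i. i \<in> {..<d} \<Longrightarrow> A i \<in> sets M"
  have tm: "tensor_power d (act k) \<in> measurable ?N ?N"
    using tensor_measurable[OF act_measurable] by (simp add: power_space_def)
  have "emeasure (distr ?N ?N (tensor_power d (act k))) (Pi\<^sub>E {..<d} A) = emeasure ?N (tensor_power d (act k) -` Pi\<^sub>E {..<d} A \<inter> space ?N)"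
    using A by (intro emeasure_distr tm) auto
  also have "tensor_power d (act k) -` Pi\<^sub>E {..<d} A \<inter> space ?N = Pi\<^sub>E {..<d} (\<lambda>i. shift (-k) (A i))"
    by (auto simp: tensor_power_def space_PiM shift_def PiE_iff extensional_def)
  also have "emeasure ?N \<dots> = (\<Prod>i<d. emeasure M (A i))"
    using A by (subst product_sigma_finite.emeasure_PiM[OF product_sigma_finite]) (auto intro: shift_sets simp: shift_measure)
  finally show "emeasure (distr ?N ?N (tensor_power d (act k))) (Pi\<^sub>E {..<d} A) = (\<Prod>i\<in>{..<d}. emeasure M (A i))" .
qed auto

lemma tensor_space: "x \<in> space (power_space d M) \<Longrightarrow> tensor_power d (act k) x \<in> space (power_space d M)"
  using measurable_space[OF tensor_measurable[OF act_measurable]] by blast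

lemma tensor_add: "x \<in> space (power_space d M) \<Longrightarrow>
    tensor_power d (act k) (tensor_power d (act l) x) = tensor_power d (act (k + l)) x"
  by (auto simp: tensor_power_def power_space_def space_PiM PiE_iff act_add)

lemma tensor_0: "x \<in> space (power_space d M) \<Longrightarrow> tensor_power d (act 0) x = x"
  by (auto simp: tensor_power_def power_space_def space_PiM PiE_iff act_0 extensional_def)

lemma tensor_funpow: "x \<in> space (power_space d M) \<Longrightarrow> (tensor_power d (act 1) ^^ n) x = tensor_power d (act (int n)) x"
proof (induction n)
  case (Suc n)
  then show ?case using tensor_add[OF Suc.prems, of 1 "int n"] by simp
qed (simp add: tensor_0)

definition box :: "nat \<Rightarrow> nat \<Rightarrow> (nat \<Rightarrow> nat) \<Rightarrow> (nat \<Rightarrow> 'a) set" where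
  "box d m s = Pi\<^sub>E {..<d} (\<lambda>i. L m (s i))"

definition cube :: "nat \<Rightarrow> nat \<Rightarrow> (nat \<Rightarrow> 'a) set" where
  "cube d m = Pi\<^sub>E {..<d} (\<lambda>_. \<Union>s<h m. L m s)"

text \<open>The digit \<open>2\<close> is excluded so that replacing the common digit \<open>a\<close> by \<open>2\<close> is a shift by a nonzero time.\<close>

definition common_digit :: "nat \<Rightarrow> nat \<Rightarrow> (nat \<Rightarrow> 'a) \<Rightarrow> bool" where
  "common_digit d j x \<longleftrightarrow> (\<exists>a\<in>spots r j. a \<noteq> 2 \<and> (\<forall>i<d. \<exists>s<h j. x i \<in> L (Suc j) (s + h j * a)))"

definition other_digits :: "nat \<Rightarrow> nat \<Rightarrow> (nat \<Rightarrow> nat) set" where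
  "other_digits d j = Pi\<^sub>E {..<d} (\<lambda>_. spots r j) - (\<lambda>a. \<lambda>i\<in>{..<d}. a) ` (spots r j - {2})"

text \<open>Addresses in tower \<open>p + n\<close> of the boxes that can contain points of
  \<open>cube d p\<close> without a common digit from stage \<open>p\<close> to stage
  \<open>p + n - 1\<close>.\<close>

fun indices :: "nat \<Rightarrow> nat \<Rightarrow> nat \<Rightarrow> (nat \<Rightarrow> nat) set" where
  "indices d p 0 = Pi\<^sub>E {..<d} (\<lambda>_. {..<h p})"
| "indices d p (Suc n) = (\<lambda>(s, a). \<lambda>i\<in>{..<d}. s i + h (p + n) * a i) ` (indices d p n \<times> other_digits d (p + n))"

lemma finite_other: "finite (other_digits d j)"
  unfolding other_digits_def by (intro finite_Diff finite_PiE) (auto simp: finite_spots)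

lemma finite_indices: "finite (indices d p n)"
  by (induction n) (auto simp: finite_other intro!: finite_PiE)

lemma card_other: assumes "d \<ge> 1" shows "real (card (other_digits d j)) = real (r j) ^ d - real (r j - 1)"
proof -
  have two: "2 \<in> spots r j" using r_pos[of j] by (auto simp: spots_def intro!: image_eqI[of _ _ 0])
  have inj: "inj_on (\<lambda>a. \<lambda>i\<in>{..<d}. a) (spots r j - {2})"
  proof (rule inj_onI)
    fix a b assume "(\<lambda>i\<in>{..<d}. a) = (\<lambda>i\<in>{..<d}. b)"
    from fun_cong[OF this, of 0] show "a = b" using assms by simp
  qed
  have c: "card ((\<lambda>a. \<lambda>i\<in>{..<d}. a) ` (spots r j - {2})) = r j - 1"
    using two by (simp add: card_image[OF inj] card_Diff_singleton card_spots)
  have sub: "(\<lambda>a. \<lambda>i\<in>{..<d}. a) ` (spots r j - {2}) \<subseteq> Pi\<^sub>E {..<d} (\<lambda>_. spots r j)"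
    by (rule image_subsetI) (simp add: PiE_iff)
  have P: "card (Pi\<^sub>E {..<d} (\<lambda>_. spots r j)) = r j ^ d" by (simp add: card_PiE card_spots)
  have "r j - 1 \<le> r j ^ d"
    using card_mono[OF _ sub] c P by (simp add: finite_PiE finite_spots)
  moreover have "card (other_digits d j) = r j ^ d - (r j - 1)"
    unfolding other_digits_def using card_Diff_subset[OF _ sub] c P by (simp add: finite_spots)
  ultimately show ?thesis by simp
qed

lemma indices_bound: "s \<in> indices d p n \<Longrightarrow> i < d \<Longrightarrow> s i < h (p + n)"
proof (induction n arbitrary: s)
  case (Suc n)
  then obtain t a where t: "t \<in> indices d p n" "a \<in> other_digits d (p + n)" "s = (\<lambda>i\<in>{..<d}. t i + h (p + n) * a i)" by auto
  have "a i \<in> spots r (p + n)" using t(2) Suc.prems(2) by (auto simp: other_digits_def PiE_iff)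
  then show ?case using height_step[OF Suc.IH[OF t(1) Suc.prems(2)]] t(3) Suc.prems(2) by (simp del: height.simps)
qed (auto simp: PiE_iff)

lemma no_common_digit:
  assumes x: "x \<in> cube d p" and no: "\<And>j. p \<le> j \<Longrightarrow> j < p + n \<Longrightarrow> \<not> common_digit d j x"
  shows "x \<in> (\<Union>s\<in>indices d p n. box d (p + n) s)"
  using no
proof (induction n)
  case 0
  have "\<forall>i\<in>{..<d}. \<exists>s. s < h p \<and> x i \<in> L p s" using x by (auto simp: cube_def PiE_iff)
  then obtain f where f: "\<forall>i\<in>{..<d}. f i < h p \<and> x i \<in> L p (f i)" by metis
  have "(\<lambda>i\<in>{..<d}. f i) \<in> indices d p 0" "x \<in> box d p (\<lambda>i\<in>{..<d}. f i)"
    using f x by (auto simp: box_def cube_def PiE_iff)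
  then show ?case unfolding add_0_right by blast
next
  case (Suc n)
  have "x \<in> (\<Union>s\<in>indices d p n. box d (p + n) s)" by (rule Suc.IH) (use Suc.prems in auto)
  then obtain s where s: "s \<in> indices d p n" "x \<in> box d (p + n) s" by blast
  have sb: "s i < h (p + n)" if "i < d" for i using indices_bound[OF s(1) that] .
  have "\<forall>i\<in>{..<d}. \<exists>a. a \<in> spots r (p + n) \<and> x i \<in> L (Suc (p + n)) (s i + h (p + n) * a)"
    using s(2) sb level_split[of _ "p + n"] by (fastforce simp: box_def PiE_iff)
  then obtain a where a: "\<forall>i\<in>{..<d}. a i \<in> spots r (p + n) \<and> x i \<in> L (Suc (p + n)) (s i + h (p + n) * a i)" by metis
  define a' where "a' = (\<lambda>i\<in>{..<d}. a i)"
  have "a' \<in> other_digits d (p + n)"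
    unfolding other_digits_def
  proof
    show "a' \<in> Pi\<^sub>E {..<d} (\<lambda>_. spots r (p + n))" using a by (auto simp: a'_def)
    show "a' \<notin> (\<lambda>a. \<lambda>i\<in>{..<d}. a) ` (spots r (p + n) - {2})"
    proof
      assume "a' \<in> (\<lambda>a. \<lambda>i\<in>{..<d}. a) ` (spots r (p + n) - {2})"
      then obtain c where c: "c \<in> spots r (p + n)" "c \<noteq> 2" "a' = (\<lambda>i\<in>{..<d}. c)" by auto
      have "a i = c" if "i < d" for i using fun_cong[OF c(3), of i] that by (simp add: a'_def)
      then have "common_digit d (p + n) x"
        unfolding common_digit_def using c a sb by (intro bexI[of _ c] conjI allI impI) auto
      then show False using Suc.prems[of "p + n"] by simp
    qed
  qed
  then have "(\<lambda>i\<in>{..<d}. s i + h (p + n) * a' i) \<in> indices d p (Suc n)" using s(1) by (auto intro!: image_eqI[of _ _ "(s, a')"])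
  moreover have "x \<in> box d (p + Suc n) (\<lambda>i\<in>{..<d}. s i + h (p + n) * a' i)"
    using a s(2) by (auto simp: box_def a'_def PiE_iff)
  ultimately show ?case by blast
qed

lemma box_sets: "(\<And>i. i < d \<Longrightarrow> s i < h m) \<Longrightarrow> box d m s \<in> sets (power_space d M)"
  unfolding box_def power_space_def by (intro sets_PiM_I_finite) (auto intro: level_sets)

lemma box_measure: "(\<And>i. i < d \<Longrightarrow> s i < h m) \<Longrightarrow> emeasure (power_space d M) (box d m s) = ennreal (w m ^ d)"
  unfolding box_def power_space_def
  using w_pos[of m]
  by (subst product_sigma_finite.emeasure_PiM[OF product_sigma_finite])
     (auto intro: level_sets simp: level_measure ennreal_power)

text \<open>Given the levels at stage \<open>j\<close>, the digits of the \<open>d\<close>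
  coordinates are independent and uniform, so a common digit other than 2 has probability
  \<open>(r j - 1) / r j ^ d\<close>. By divergence the product of the complementary probabilities
  is zero; counting boxes replaces the language of independence.\<close>

lemma AE_common_digit:
  assumes d: "d \<ge> 1" and div: "\<not> summable (\<lambda>j. real (r j - 1) / real (r j) ^ d)"
  shows "AE x in power_space d M. x \<in> cube d p \<longrightarrow> (\<exists>j\<ge>p. common_digit d j x)"
proof -
  let ?N = "power_space d M"
  define c where "c j = real (r j - 1) / real (r j) ^ d" for j
  have c01: "0 \<le> c j" "c j \<le> 1" for j
  proof -
    have "r j ^ 1 \<le> r j ^ d" using d r_pos[of j] by (intro power_increasing) auto
    then have "real (r j - 1) \<le> real (r j) ^ d" by (simp flip: of_nat_power)
    then show "c j \<le> 1" using r_pos[of j] by (simp add: c_def)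
  qed (simp add: c_def)
  define U where "U n = (\<Union>s\<in>indices d p n. box d (p + n) s)" for n
  have Us: "U n \<in> sets ?N" for n
    unfolding U_def using finite_indices indices_bound by (intro sets.finite_UN box_sets) auto
  \<comment> \<open>The measure of \<open>cube d p\<close>, summed over its boxes.\<close>
  define K where "K = real (card (indices d p 0)) * w p ^ d"
  have cardb: "real (card (indices d p n)) * w (p + n) ^ d \<le> K * (\<Prod>j<n. 1 - c (p + j))" for n
  proof (induction n)
    case (Suc n)
    let ?j = "p + n"
    have "card (indices d p (Suc n)) \<le> card (indices d p n) * card (other_digits d ?j)"
      using card_image_le[of "indices d p n \<times> other_digits d ?j"] by (simp add: finite_indices finite_other card_cartesian_product)
    then have "real (card (indices d p (Suc n))) \<le> real (card (indices d p n)) * real (card (other_digits d ?j))"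
      by (metis of_nat_le_iff of_nat_mult)
    then have "real (card (indices d p (Suc n))) * w (p + Suc n) ^ d \<le> real (card (indices d p n)) * real (card (other_digits d ?j)) * w (p + Suc n) ^ d"
      using w_pos[of "p + Suc n"] by (intro mult_right_mono) auto
    also have "\<dots> = (real (card (indices d p n)) * w ?j ^ d) * (1 - c ?j)"
    proof -
      have "w ?j ^ d = real (r ?j) ^ d * w (p + Suc n) ^ d"
        using w_Suc[of ?j] by (simp flip: power_mult_distrib)
      moreover have "real (card (other_digits d ?j)) = real (r ?j) ^ d * (1 - c ?j)"
      proof -
        have *: "R - X = R * (1 - X / R)" if "R \<noteq> 0" for R X :: real using that by (simp add: right_diff_distrib)
        show ?thesis unfolding card_other[OF d] c_def by (rule *) (use r_pos[of ?j] in simp)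
      qed
      ultimately show ?thesis by (simp only: mult_ac)
    qed
    also have "\<dots> \<le> (K * (\<Prod>j<n. 1 - c (p + j))) * (1 - c ?j)"
      using c01(2)[of ?j] by (intro mult_right_mono Suc.IH) auto
    finally show ?case by (simp add: mult.assoc)
  qed (simp add: K_def)
  have prod0: "(\<lambda>n. \<Prod>j<n. 1 - c (p + j)) \<longlonglongrightarrow> 0"
  proof (rule tendsto_sandwich[OF _ _ tendsto_const])
    have ns: "\<not> summable (\<lambda>j. c (p + j))"
      using div summable_iff_shift[of c p] by (simp add: c_def[abs_def] add.commute)
    have inf: "filterlim (\<lambda>n. \<Sum>j<n. c (p + j)) at_top sequentially"
      unfolding filterlim_at_top
    proof
      fix Z
      have "\<exists>N. (\<Sum>j<N. c (p + j)) \<ge> Z"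
      proof (rule ccontr)
        assume "\<not> (\<exists>N. (\<Sum>j<N. c (p + j)) \<ge> Z)"
        then have "(\<Sum>j\<le>n. c (p + j)) \<le> Z" for n
          using lessThan_Suc_atMost[of n] by (metis linear)
        then have "summable (\<lambda>j. c (p + j))" by (intro bounded_imp_summable) (auto simp: c01)
        then show False using ns by simp
      qed
      then obtain N where N: "(\<Sum>j<N. c (p + j)) \<ge> Z" by blast
      show "\<forall>\<^sub>F n in sequentially. Z \<le> (\<Sum>j<n. c (p + j))"
        using eventually_ge_at_top[of N]
      proof eventually_elim
        case (elim n)
        have "(\<Sum>j<N. c (p + j)) \<le> (\<Sum>j<n. c (p + j))" using elim c01 by (intro sum_mono2) auto
        then show ?case using N by linarith
      qed
    qed
    show "(\<lambda>n. exp (- (\<Sum>j<n. c (p + j)))) \<longlonglongrightarrow> 0"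
      by (rule filterlim_compose[OF exp_at_bot]) (use inf in \<open>simp add: filterlim_uminus_at_top\<close>)
    show "\<forall>\<^sub>F n in sequentially. 0 \<le> (\<Prod>j<n. 1 - c (p + j))"
      using c01(2) by (intro always_eventually allI prod_nonneg) auto
    have "(\<Prod>j<n. 1 - c (p + j)) \<le> (\<Prod>j<n. exp (- c (p + j)))" for n
      using c01(2) exp_ge_add_one_self[of "- c (p + _)"] by (intro prod_mono) auto
    then show "\<forall>\<^sub>F n in sequentially. (\<Prod>j<n. 1 - c (p + j)) \<le> exp (- (\<Sum>j<n. c (p + j)))"
      by (simp add: exp_sum sum_negf[symmetric] del: sum_negf)
  qed
  have Um: "emeasure ?N (U n) \<le> ennreal (K * (\<Prod>j<n. 1 - c (p + j)))" for n
  proof -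
    have "emeasure ?N (U n) \<le> (\<Sum>s\<in>indices d p n. emeasure ?N (box d (p + n) s))"
      unfolding U_def using finite_indices indices_bound by (intro emeasure_subadditive_finite) (auto intro: box_sets)
    also have "\<dots> = (\<Sum>s\<in>indices d p n. ennreal (w (p + n) ^ d))"
      using indices_bound by (intro sum.cong refl box_measure) auto
    also have "\<dots> = ennreal (real (card (indices d p n)) * w (p + n) ^ d)"
      using w_pos[of "p + n"] by (simp add: ennreal_of_nat_eq_real_of_nat ennreal_mult)
    also have "\<dots> \<le> ennreal (K * (\<Prod>j<n. 1 - c (p + j)))" by (intro ennreal_leI cardb)
    finally show ?thesis .
  qed
  have "emeasure ?N (\<Inter>n. U n) \<le> ennreal 0"
  proof (rule LIMSEQ_le_const)
    have "(\<lambda>n. K * (\<Prod>j<n. 1 - c (p + j))) \<longlonglongrightarrow> K * 0" by (intro tendsto_intros prod0)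
    then show "(\<lambda>n. ennreal (K * (\<Prod>j<n. 1 - c (p + j)))) \<longlonglongrightarrow> ennreal 0" by (intro tendsto_ennrealI) simp
    have "emeasure ?N (\<Inter>n. U n) \<le> emeasure ?N (U n)" for n using Us by (intro emeasure_mono) auto
    then show "\<exists>N. \<forall>n\<ge>N. emeasure ?N (\<Inter>n. U n) \<le> ennreal (K * (\<Prod>j<n. 1 - c (p + j)))"
      using Um order_trans by blast
  qed
  then have "(\<Inter>n. U n) \<in> null_sets ?N" using Us by (intro null_setsI) auto
  from AE_not_in[OF this] show ?thesis
  proof eventually_elim
    case (elim x)
    show ?case
    proof
      assume x: "x \<in> cube d p"
      show "\<exists>j\<ge>p. common_digit d j x"
      proof (rule ccontr)
        assume "\<not> (\<exists>j\<ge>p. common_digit d j x)"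
        then have "x \<in> U n" for n unfolding U_def by (intro no_common_digit[OF x]) auto
        then show False using elim by auto
      qed
    qed
  qed
qed

lemma cube_mono: "m \<le> m' \<Longrightarrow> cube d m \<subseteq> cube d m'"
  unfolding cube_def by (rule PiE_mono) (use level_up in blast)

lemma cube_cover: "space (power_space d M) = (\<Union>m. cube d m)"
proof (intro set_eqI iffI)
  fix x assume x: "x \<in> space (power_space d M)"
  then have "\<forall>i\<in>{..<d}. \<exists>m. x i \<in> (\<Union>s<h m. L m s)"
    unfolding power_space_def space_PiM PiE_iff using level_cover by auto
  then obtain f where f: "\<forall>i\<in>{..<d}. x i \<in> (\<Union>s<h (f i). L (f i) s)" by metis
  have "x i \<in> (\<Union>s<h (\<Sum>i<d. f i). L (\<Sum>i<d. f i) s)" if i: "i < d" for i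
  proof -
    have "f i \<le> (\<Sum>i<d. f i)" using i by (intro member_le_sum) auto
    then show ?thesis using level_up[of "f i" "\<Sum>i<d. f i"] f i by fastforce
  qed
  then have "x \<in> cube d (\<Sum>i<d. f i)" using x by (auto simp: cube_def power_space_def space_PiM PiE_iff)
  then show "x \<in> (\<Union>m. cube d m)" by blast
next
  fix x assume "x \<in> (\<Union>m. cube d m)"
  then show "x \<in> space (power_space d M)"
    unfolding cube_def power_space_def space_PiM using level_cover by (force simp: PiE_iff)
qed

text \<open>Replacing the common digit \<open>a\<close> by 2 is a move down by
  \<open>h j * (a - 2)\<close> in all coordinates at once. Each coordinate keeps its level of tower
  \<open>j\<close>, hence its level of tower \<open>m\<close>, so the point is back in the
  cube.\<close>

lemma common_digit_return:
  assumes x: "x \<in> cube d m" and j: "m \<le> j" and cd: "common_digit d j x"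
  shows "\<exists>k>j. tensor_power d (act (- int k)) x \<in> cube d m"
proof -
  obtain a where a: "a \<in> spots r j" "a \<noteq> 2" "\<And>i. i < d \<Longrightarrow> \<exists>s<h j. x i \<in> L (Suc j) (s + h j * a)"
    using cd by (auto simp: common_digit_def)
  have two: "2 \<in> spots r j" using r_pos[of j] by (auto simp: spots_def intro!: image_eqI[of _ _ 0])
  \<comment> \<open>Spots are even, so a spot other than 2 is at least 4. The return time is then at
    least \<open>2 * h j\<close> and exceeds \<open>j\<close>, which makes the return times
    unbounded.\<close>
  have a2: "4 \<le> a" using spots_bounds[OF a(1)] spots_even[OF a(1)] a(2) by (cases "a = 3") auto
  define k where "k = h j * (a - 2)"
  have "h j * 2 \<le> k" unfolding k_def using a2 by (intro mult_left_mono) auto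
  then have kj: "j < k" using le_height[of j r] height_pos[of r j] by linarith
  have "act (- int k) (x i) \<in> (\<Union>s<h m. L m s)" if i: "i < d" for i
  proof -
    obtain s where s: "s < h j" "x i \<in> L (Suc j) (s + h j * a)" using a(3)[OF i] by blast
    have eq: "int (s + h j * a) + - int k = int (s + h j * 2)"
      using a2 by (simp add: k_def of_nat_diff algebra_simps)
    have "act (- int k) (x i) \<in> L (Suc j) (nat (int (s + h j * a) + - int k))"
      by (rule act_level[OF height_step[OF s(1) a(1)] s(2)]) (use eq height_step[OF s(1) two] in linarith)+
    then have "act (- int k) (x i) \<in> L (Suc j) (s + h j * 2)" unfolding eq nat_int .
    then have in_j: "act (- int k) (x i) \<in> L j s" using child_subset[OF s(1) two] by auto
    obtain u where u: "u < h m" "x i \<in> L m u" using x i by (auto simp: cube_def PiE_iff)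
    have "x i \<in> L j s" using s child_subset[OF s(1) a(1)] by auto
    then have "L j s \<subseteq> L m u" using level_nested[OF j u(1) s(1)] u(2) by auto
    then show ?thesis using in_j u(1) by auto
  qed
  then have "tensor_power d (act (- int k)) x \<in> cube d m" by (auto simp: tensor_power_def cube_def)
  then show ?thesis using kj by blast
qed

lemma cube_sets: "cube d m \<in> sets (power_space d M)"
  unfolding cube_def power_space_def by (intro sets_PiM_I_finite) (auto intro: level_sets)

lemma cube_finite: "emeasure (power_space d M) (cube d m) \<noteq> \<infinity>"
proof -
  have "emeasure M (\<Union>s<h m. L m s) \<le> (\<Sum>s<h m. emeasure M (L m s))"
    by (intro emeasure_subadditive_finite) (auto intro: level_sets)
  also have "\<dots> = (\<Sum>s<h m. ennreal (w m))" by (intro sum.cong refl) (simp add: level_measure)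
  also have "\<dots> < \<infinity>" by (simp add: ennreal_mult_less_top of_nat_less_top)
  finally have "emeasure M (\<Union>s<h m. L m s) \<noteq> \<infinity>" by simp
  then show ?thesis unfolding cube_def power_space_def
    by (subst product_sigma_finite.emeasure_PiM[OF product_sigma_finite])
       (auto intro!: level_sets sets.finite_UN simp: ennreal_prod_eq_top power_eq_top_ennreal)
qed

text \<open>Returns to a cube of finite measure suffice in place of returns to the set. The
  preimages of a wandering \<open>W\<close> are disjoint, so their parts in a cube have finite total
  measure; by invariance almost every point of \<open>W\<close> was in the cube only finitely often
  in the past. Common digits force infinitely many such visits.\<close>

theorem conservative_tensor:
  assumes d: "d \<ge> 1" and div: "\<not> summable (\<lambda>j. real (r j - 1) / real (r j) ^ d)"
  shows "conservative (power_space d M) (tensor_power d (act 1))"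
  unfolding conservative_def
proof (rule notI, elim exE conjE)
  let ?N = "power_space d M"
  let ?t = "\<lambda>k. tensor_power d (act k)"
  fix W assume wand: "wandering ?N (?t 1) W" and pos: "0 < emeasure ?N W"
  have W: "W \<in> sets ?N" using wand by (simp add: wandering_def)
  have Ws: "W \<subseteq> space ?N" using sets.sets_into_space[OF W] .
  have tm: "?t k \<in> measurable ?N ?N" for k by (rule tensor_measurable[OF act_measurable])
  \<comment> \<open>Only nonpositive exponents are used, for which \<open>set_power\<close> amounts
    to a preimage and is measurable.\<close>
  define V where "V k = ?t (int k) -` W \<inter> space ?N" for k
  have Vs: "V k \<in> sets ?N" for k unfolding V_def by (rule measurable_sets[OF tm W])
  have "set_power ?N (?t 1) (- int k) W = V k" for k
  proof (cases "k = 0")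
    case True
    then show ?thesis using Ws by (auto simp: set_power_def V_def tensor_0)
  next
    case False
    then show ?thesis by (auto simp: set_power_def V_def tensor_funpow)
  qed
  moreover have "disjoint_family (\<lambda>k::nat. set_power ?N (?t 1) (- int k) W)"
    using wand unfolding wandering_def disjoint_family_on_def by auto
  ultimately have disj: "disjoint_family V" by simp
  have key: "AE x in ?N. x \<notin> W \<inter> cube d m" for m
  proof -
    let ?F = "cube d m"
    define A where "A k = W \<inter> (?t (- int k) -` ?F \<inter> space ?N)" for k
    have As: "A k \<in> sets ?N" for k unfolding A_def using W measurable_sets[OF tm cube_sets] by auto
    have Am: "emeasure ?N (A k) = emeasure ?N (V k \<inter> ?F)" for k
    proof -
      have "emeasure ?N (V k \<inter> ?F) = emeasure (distr ?N ?N (?t (- int k))) (V k \<inter> ?F)"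
        by (simp only: tensor_preserves)
      also have "\<dots> = emeasure ?N (?t (- int k) -` (V k \<inter> ?F) \<inter> space ?N)"
        using Vs cube_sets by (intro emeasure_distr tm) auto
      also have "?t (- int k) -` (V k \<inter> ?F) \<inter> space ?N = A k"
        by (auto simp: A_def V_def tensor_add tensor_0 tensor_space)
      finally show ?thesis by simp
    qed
    have fin: "emeasure ?N (V k \<inter> ?F) < \<infinity>" for k
      using emeasure_mono[of "V k \<inter> ?F" ?F ?N] cube_sets cube_finite[of d m] by (auto simp: less_top[symmetric] top_unique)
    have "summable (\<lambda>k. measure ?N (A k))"
    proof (rule bounded_imp_summable[where B="measure ?N ?F"])
      fix n
      have "(\<Sum>k\<le>n. measure ?N (A k)) = (\<Sum>k\<le>n. measure ?N (V k \<inter> ?F))" by (simp add: measure_def Am)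
      also have "\<dots> = measure ?N (\<Union>k\<le>n. V k \<inter> ?F)"
        using disj Vs cube_sets fin
        by (intro measure_finite_Union[symmetric]) (auto simp: disjoint_family_on_def image_subset_iff less_top)
      also have "\<dots> \<le> measure ?N ?F"
        using Vs cube_sets cube_finite by (intro measure_mono_fmeasurable) (auto simp: fmeasurable_def less_top[symmetric])
      finally show "(\<Sum>k\<le>n. measure ?N (A k)) \<le> measure ?N ?F" .
    qed simp
    then have "AE x in ?N. eventually (\<lambda>k. x \<in> space ?N - A k) sequentially"
      using As Am fin by (intro borel_cantelli_AE1) auto
    moreover have "AE x in ?N. \<forall>p. x \<in> cube d p \<longrightarrow> (\<exists>j\<ge>p. common_digit d j x)"
      unfolding AE_all_countable using AE_common_digit[OF d div] by blast
    ultimately show ?thesis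
    proof eventually_elim
      case (elim x)
      show ?case
      proof
        assume x: "x \<in> W \<inter> ?F"
        obtain K where K: "\<And>k. k \<ge> K \<Longrightarrow> x \<notin> A k"
          using elim(1) by (auto simp: eventually_sequentially)
        \<comment> \<open>Searching for a common digit from stage \<open>max m K\<close> on yields a
          return time beyond \<open>K\<close>.\<close>
        have "x \<in> cube d (max m K)" using x cube_mono[of m "max m K"] by auto
        then obtain j where j: "j \<ge> max m K" "common_digit d j x" using elim(2) by blast
        then obtain k where k: "k > j" "?t (- int k) x \<in> ?F"
          using common_digit_return[of x d m j] x by auto
        then have "x \<in> A k" using x Ws by (auto simp: A_def)
        then show False using K[of k] k j by simp
      qed
    qed
  qed
  have "AE x in ?N. \<forall>m. x \<notin> W \<inter> cube d m" unfolding AE_all_countable using key by blast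
  then have "AE x in ?N. x \<notin> W"
    using AE_space by eventually_elim (use cube_cover in blast)
  then have "W \<in> null_sets ?N" using AE_iff_null_sets[OF W] by simp
  then show False using pos by (simp add: null_sets_def)
qed

end

lemma indicator_L2:
  assumes "A \<in> sets M" "emeasure M A < \<infinity>"
  shows "indicator A \<in> L2 M"
proof (rule L2_I)
  show "indicator A \<in> borel_measurable M" using assms by simp
  have "(\<lambda>x. (cmod (indicator A x))\<^sup>2) = (indicator A :: 'a \<Rightarrow> real)" by (auto simp: indicator_def)
  then show "integrable M (\<lambda>x. (cmod (indicator A x))\<^sup>2)" using assms by (simp add: integrable_indicator_iff)
qed

lemma ip_indicator:
  assumes "A \<in> sets M" "B \<in> sets M"
  shows "ip M (indicator A) (indicator B) = complex_of_real (measure M (A \<inter> B))"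
proof -
  have eq: "indicator A x * cnj (indicator B x) = complex_of_real (indicator (A \<inter> B) x)" for x
    by (auto simp: indicator_def)
  have "A \<inter> B \<inter> space M = A \<inter> B" using sets.sets_into_space[OF assms(1)] by auto
  then show ?thesis unfolding ip_def eq integral_complex_of_real by simp
qed

lemma measure_split:
  assumes fin: "finite I" and E: "\<And>i. i \<in> I \<Longrightarrow> E i \<in> sets M" and disj: "disjoint_family_on E I"
  and X: "X \<in> sets M" "emeasure M X < \<infinity>"
  shows "measure M ((\<Union>i\<in>I. E i) \<inter> X) = (\<Sum>i\<in>I. measure M (E i \<inter> X))"
proof -
  have "emeasure M (E i \<inter> X) \<le> emeasure M X" for i using X by (intro emeasure_mono) auto
  then have f: "emeasure M (E i \<inter> X) \<noteq> \<infinity>" for i using X(2) by (metis leD infinity_ennreal_def)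
  have "measure M (\<Union>i\<in>I. E i \<inter> X) = (\<Sum>i\<in>I. measure M (E i \<inter> X))"
    using fin E disj X f by (intro measure_finite_Union) (auto simp: disjoint_family_on_def)
  then show ?thesis by simp
qed

context tower
begin

section \<open>The spectrum of tensor powers\<close>

definition self_corr :: "'a set \<Rightarrow> int \<Rightarrow> real" where "self_corr B k = measure M (B \<inter> shift (- k) B)"

lemma shift_pair:
  assumes "B \<in> sets M" "C \<in> sets M"
  shows "measure M (shift k B \<inter> shift l C) = measure M (B \<inter> shift (l - k) C)"
proof -
  have "shift k B \<inter> shift l C = shift k (B \<inter> shift (l - k) C)"
    using sets.sets_into_space[OF assms(2)] by (simp add: shift_Int shift_add)
  then show ?thesis using shift_measure[of "B \<inter> shift (l - k) C" k] assms shift_sets by (simp add: measure_def)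
qed

lemma self_corr_uminus: assumes "B \<in> sets M" shows "self_corr B (- k) = self_corr B k"
  using shift_pair[OF assms assms, of "- k" 0] shift_0[OF sets.sets_into_space[OF assms]]
  by (simp add: self_corr_def Int_commute)

text \<open>The sequence is positive definite because its quadratic form is a squared norm of a
  combination of translated indicators; dividing by the measure of \<open>B\<close> normalizes
  it.\<close>

lemma exists_circle_measure:
  assumes B: "B \<in> sets M" "emeasure M B < \<infinity>" "0 < measure M B"
  shows "\<exists>\<sigma>. prob_space \<sigma> \<and> sets \<sigma> = sets circle_borel \<and>
    (\<forall>k. (\<integral>z. z powi k \<partial>\<sigma>) = complex_of_real (self_corr B k / measure M B))"
proof (rule Herglotz)
  have "B \<inter> shift 0 B = B" using shift_0[OF sets.sets_into_space[OF B(1)]] by simp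
  then show "complex_of_real (self_corr B 0 / measure M B) = 1" using B(3) by (simp add: self_corr_def)
next
  fix N :: nat and z :: complex assume z: "cmod z = 1"
  define u :: "nat \<Rightarrow> 'a \<Rightarrow> complex" where "u k = indicator (shift (int k) B)" for k
  have u: "u k \<in> L2 M" for k
    unfolding u_def using B shift_sets[OF B(1)] shift_measure[OF B(1)] by (intro indicator_L2) auto
  have ipu: "ip M (u k) (u l) = complex_of_real (self_corr B (int k - int l))" for k l
    unfolding u_def using shift_sets[OF B(1)] shift_pair[OF B(1) B(1)]
    by (simp add: ip_indicator self_corr_def)
  let ?c = "\<lambda>k. z powi (- int k)"
  have c: "?c k * cnj (?c l) = z powi (int l - int k)" for k l
    using powi_mult_cnj[OF z, of "- int k" "- int l"] by simp
  have "complex_of_real (nsq M (lincomb u ?c N)) = (\<Sum>k<N. \<Sum>l<N. z powi (int l - int k) * complex_of_real (self_corr B (int k - int l)))"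
    unfolding nsq_lincomb[OF u] c ipu ..
  then have "(\<Sum>k<N. \<Sum>l<N. complex_of_real (self_corr B (int k - int l) / measure M B) * z powi (int l - int k)) =
    complex_of_real (nsq M (lincomb u ?c N) / measure M B)"
    by (simp add: sum_divide_distrib mult.commute)
  moreover have "0 \<le> nsq M (lincomb u ?c N) / measure M B" by (intro divide_nonneg_nonneg nsq_nonneg measure_nonneg)
  ultimately show "\<exists>x\<ge>0. (\<Sum>k<N. \<Sum>l<N. complex_of_real (self_corr B (int k - int l) / measure M B) * z powi (int l - int k)) = complex_of_real x"
    by blast
qed

lemma zero_less_h: "0 < h m" by (rule height_pos)

lemma base_sets: "L m 0 \<in> sets M" and base_finite: "emeasure M (L m 0) < \<infinity>" and base_measure: "measure M (L m 0) = w m"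
  using level_sets[OF zero_less_h] level_measure[OF zero_less_h, of m] w_pos[of m] by (auto simp: measure_def)

text \<open>The normalized spectral measure of the indicator of \<open>L m 0\<close>.\<close>

definition circ :: "nat \<Rightarrow> complex measure" where
  "circ m = (SOME \<sigma>. prob_space \<sigma> \<and> sets \<sigma> = sets circle_borel \<and>
    (\<forall>k. (\<integral>z. z powi k \<partial>\<sigma>) = complex_of_real (self_corr (L m 0) k / w m)))"

lemma circ: "prob_space (circ m)" "sets (circ m) = sets circle_borel"
  "(\<integral>z. z powi k \<partial>circ m) = complex_of_real (self_corr (L m 0) k / w m)"
proof -
  have "\<exists>\<sigma>. prob_space \<sigma> \<and> sets \<sigma> = sets circle_borel \<and>
    (\<forall>k. (\<integral>z. z powi k \<partial>\<sigma>) = complex_of_real (self_corr (L m 0) k / w m))"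
    using exists_circle_measure[OF base_sets base_finite, of m] w_pos[of m] by (simp add: base_measure)
  from someI_ex[OF this] show "prob_space (circ m)" "sets (circ m) = sets circle_borel"
    "(\<integral>z. z powi k \<partial>circ m) = complex_of_real (self_corr (L m 0) k / w m)"
    unfolding circ_def by blast+
qed

lemma finite_circ: "finite_measure (circ m)"
  using circ(1) by (simp add: prob_space.finite_measure)

lemma space_circ: "space (circ m) = sphere 0 1"
  using sets_eq_imp_space_eq[OF circ(2)] by simp

lemma circ_0: "(\<integral>z. z powi k \<partial>circ 0) = complex_of_real (corr k)"
  unfolding circ(3) by (simp add: width_def self_corr_def corr_def)

text \<open>The indicator of \<open>L 0 0\<close> arises from that of \<open>L m 0\<close> by this
  polynomial in the Koopman operator. The exponents are negative because that operator moves sets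
  backwards.\<close>

definition gen :: "nat \<Rightarrow> complex \<Rightarrow> complex" where
  "gen m z = (\<Sum>v\<in>core r m. z powi (- int v))"

lemma trig_gen: "trig (gen m)"
  unfolding gen_def[abs_def] by (intro trig_sum trig_powi finite_core)

lemma level_shift: "s < h m \<Longrightarrow> L m s = shift (int s) (L m 0)"
  using shift_level[OF zero_less_h, of "int s" m] by simp

lemma base_corr_expand:
  "corr k = (\<Sum>v\<in>core r m. \<Sum>v'\<in>core r m. self_corr (L m 0) (k + int v - int v'))"
proof -
  let ?C = "core r m"
  have v: "v < h m" if "v \<in> ?C" for v using core_bound[OF that] by simp
  have disj: "disjoint_family_on (L m) ?C"
    using level_disjoint v unfolding disjoint_family_on_def by blast
  have sets: "L m v \<in> sets M" "shift l (L m v) \<in> sets M" if "v \<in> ?C" for v l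
    using level_sets[OF v[OF that]] shift_sets by auto
  have fin: "emeasure M (L m v) < \<infinity>" if "v \<in> ?C" for v using level_measure[OF v[OF that]] by simp
  have disj': "disjoint_family_on (\<lambda>v. shift (- k) (L m v)) ?C"
    using disj unfolding disjoint_family_on_def by (auto simp: shift_def)
  have "corr k = measure M ((\<Union>v\<in>?C. L m v) \<inter> shift (- k) (L 0 0))"
    unfolding corr_def base_split[of m, symmetric] ..
  also have "\<dots> = (\<Sum>v\<in>?C. measure M (L m v \<inter> shift (- k) (L 0 0)))"
    using base_finite[of 0] base_sets[of 0] shift_sets shift_measure
    by (intro measure_split finite_core sets disj) auto
  also have "\<dots> = (\<Sum>v\<in>?C. \<Sum>v'\<in>?C. self_corr (L m 0) (k + int v - int v'))"
  proof (rule sum.cong[OF refl])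
    fix v assume vC: "v \<in> ?C"
    have "L m v \<inter> shift (- k) (L 0 0) = (\<Union>v'\<in>?C. shift (- k) (L m v')) \<inter> L m v"
      by (subst base_split[of m]) (auto simp: shift_UN)
    then have "measure M (L m v \<inter> shift (- k) (L 0 0)) = (\<Sum>v'\<in>?C. measure M (shift (- k) (L m v') \<inter> L m v))"
      using measure_split[OF finite_core sets(2) disj' sets(1)[OF vC] fin[OF vC]] by simp
    also have "\<dots> = (\<Sum>v'\<in>?C. self_corr (L m 0) (k + int v - int v'))"
    proof (rule sum.cong[OF refl])
      fix v' assume v': "v' \<in> ?C"
      have "shift (- k) (L m v') = shift (int v' - k) (L m 0)"
        using sets.sets_into_space[OF base_sets] by (subst level_shift[OF v[OF v']]) (simp add: shift_add)
      then have "measure M (shift (- k) (L m v') \<inter> L m v) = measure M (shift (int v) (L m 0) \<inter> shift (int v' - k) (L m 0))"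
        using level_shift[OF v[OF vC]] by (simp add: Int_commute)
      also have "\<dots> = self_corr (L m 0) (k + int v - int v')"
        unfolding shift_pair[OF base_sets base_sets] self_corr_def by (simp add: algebra_simps)
      finally show "measure M (shift (- k) (L m v') \<inter> L m v) = self_corr (L m 0) (k + int v - int v')" .
    qed
    finally show "measure M (L m v \<inter> shift (- k) (L 0 0)) = (\<Sum>v'\<in>?C. self_corr (L m 0) (k + int v - int v'))" .
  qed
  finally show ?thesis .
qed

lemma gen_square: assumes "cmod z = 1"
  shows "z powi k * (complex_of_real (cmod (gen m z)))\<^sup>2 = (\<Sum>v\<in>core r m. \<Sum>v'\<in>core r m. z powi (k + int v' - int v))"
proof -
  have z0: "z \<noteq> 0" using assms by auto
  have "z powi k * (complex_of_real (cmod (gen m z)))\<^sup>2 = z powi k * (gen m z * cnj (gen m z))"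
    by (simp only: mult_cnj_self)
  also have "\<dots> = (\<Sum>v\<in>core r m. \<Sum>v'\<in>core r m. z powi k * (z powi (- int v) * cnj (z powi (- int v'))))"
    unfolding gen_def cnj_sum sum_product by (simp only: sum_distrib_left)
  also have "\<dots> = (\<Sum>v\<in>core r m. \<Sum>v'\<in>core r m. z powi (k + int v' - int v))"
  proof (intro sum.cong refl)
    fix v v'
    have "z powi k * (z powi (- int v) * cnj (z powi (- int v'))) = z powi k * z powi (- int v - - int v')"
      by (simp only: powi_mult_cnj[OF assms])
    also have "\<dots> = z powi (k + (- int v - - int v'))" by (rule power_int_add[symmetric, OF disjI1[OF z0]])
    finally show "z powi k * (z powi (- int v) * cnj (z powi (- int v'))) = z powi (k + int v' - int v)"
      by (simp add: algebra_simps)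
  qed
  finally show ?thesis .
qed

lemma gen_integrable: "integrable (circ m) (\<lambda>z. (cmod (gen m z))\<^sup>2)"
  by (rule L2_integrable[OF trig_L2[OF trig_gen finite_circ circ(2)]])

lemma gen_measurable: "sets \<mu> = sets circle_borel \<Longrightarrow> gen m \<in> borel_measurable \<mu>"
  by (rule trig_measurable[OF trig_gen])

text \<open>Applying a polynomial in a unitary operator to a vector multiplies its spectral measure
  by the squared modulus of the polynomial; \<open>w m\<close> is the quotient of the two
  normalizations. The comparison runs over Fourier coefficients.\<close>

lemma circ_density: "circ 0 = density (circ m) (\<lambda>z. ennreal (w m * (cmod (gen m z))\<^sup>2))"
proof (rule circle_measure_eqI)
  note [measurable] = gen_measurable[OF circ(2)]
  let ?D = "density (circ m) (\<lambda>z. ennreal (w m * (cmod (gen m z))\<^sup>2))"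
  have int: "integrable (circ m) (\<lambda>z. w m * (cmod (gen m z))\<^sup>2)" using gen_integrable by simp
  have "emeasure ?D (space ?D) = (\<integral>\<^sup>+z. ennreal (w m * (cmod (gen m z))\<^sup>2) \<partial>circ m)"
    by (subst emeasure_density) (auto intro!: nn_integral_cong simp: indicator_def)
  also have "\<dots> = ennreal (\<integral>z. w m * (cmod (gen m z))\<^sup>2 \<partial>circ m)"
    using w_pos[of m] by (intro nn_integral_eq_integral int) auto
  finally show "finite_measure ?D" by (intro finite_measureI) simp
  show "finite_measure (circ 0)" by (rule finite_circ)
  show "sets (circ 0) = sets circle_borel" by (rule circ(2))
  show "sets ?D = sets circle_borel" by (simp add: circ(2))
  fix k
  have "(\<integral>z. z powi k \<partial>?D) = (\<integral>z. (w m * (cmod (gen m z))\<^sup>2) *\<^sub>R z powi k \<partial>circ m)"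
    using w_pos[of m] power_int_circle_measurable[OF circ(2), of k m] by (intro integral_density) auto
  also have "\<dots> = (\<integral>z. complex_of_real (w m) * (\<Sum>v\<in>core r m. \<Sum>v'\<in>core r m. z powi (k + int v' - int v)) \<partial>circ m)"
  proof (rule Bochner_Integration.integral_cong[OF refl])
    fix z assume "z \<in> space (circ m)"
    then have z: "cmod z = 1" by (simp add: space_circ)
    show "(w m * (cmod (gen m z))\<^sup>2) *\<^sub>R z powi k = complex_of_real (w m) * (\<Sum>v\<in>core r m. \<Sum>v'\<in>core r m. z powi (k + int v' - int v))"
      unfolding gen_square[OF z, symmetric] scaleR_conv_of_real by (simp add: mult_ac)
  qed
  also have "\<dots> = complex_of_real (w m) * (\<Sum>v\<in>core r m. \<Sum>v'\<in>core r m. (\<integral>z. z powi (k + int v' - int v) \<partial>circ m))"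
  proof -
    have i: "integrable (circ m) (\<lambda>z. z powi l)" for l by (rule trig_integrable[OF trig_powi circ(2) finite_circ])
    have "(\<integral>z. (\<Sum>v\<in>core r m. \<Sum>v'\<in>core r m. z powi (k + int v' - int v)) \<partial>circ m) =
      (\<Sum>v\<in>core r m. \<integral>z. (\<Sum>v'\<in>core r m. z powi (k + int v' - int v)) \<partial>circ m)"
      by (intro Bochner_Integration.integral_sum Bochner_Integration.integrable_sum i)
    also have "\<dots> = (\<Sum>v\<in>core r m. \<Sum>v'\<in>core r m. (\<integral>z. z powi (k + int v' - int v) \<partial>circ m))"
      by (intro sum.cong refl Bochner_Integration.integral_sum i)
    finally show ?thesis by simp
  qed
  also have "\<dots> = complex_of_real (\<Sum>v\<in>core r m. \<Sum>v'\<in>core r m. self_corr (L m 0) (k + int v' - int v))"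
    unfolding circ(3) sum_distrib_left of_real_sum using w_pos[of m] by (intro sum.cong refl) simp
  also have "(\<Sum>v\<in>core r m. \<Sum>v'\<in>core r m. self_corr (L m 0) (k + int v' - int v)) = corr k"
    unfolding base_corr_expand[of k m] by (rule sum.swap)
  finally show "(\<integral>z. z powi k \<partial>circ 0) = (\<integral>z. z powi k \<partial>?D)" unfolding circ_0 by simp
qed

lemma height_gap: "i < j \<Longrightarrow> 8 * h i \<le> h j"
proof -
  assume "i < j"
  then have "h (Suc i) \<le> h j" by (intro height_mono) simp
  moreover have "8 * h i \<le> h (Suc i)" 
  proof -
    have "(2::nat) ^ 3 \<le> 2 ^ (r i + 3)" by (intro power_increasing) auto
    then have "h i * 2 ^ 3 \<le> h i * 2 ^ (r i + 3)" by (intro mult_left_mono) auto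
    then show ?thesis by simp
  qed
  ultimately show ?thesis by linarith
qed

text \<open>The difference has the digit -1 in tower \<open>j\<close>, and -1 is not a gap since all
  spots are even.\<close>

lemma corr_heights: "i < j \<Longrightarrow> corr (int (h i) - int (h j)) = 0"
proof -
  assume ij: "i < j"
  have "8 * h i \<le> h j" "8 * h j \<le> h (Suc j)" using height_gap[OF ij] height_gap[of j "Suc j"] by (simp_all del: height.simps)
  then have "int (8 * h i) \<le> int (h j)" "int (8 * h j) \<le> int (h (Suc j))" by (simp_all only: of_nat_le_iff)
  then have "8 * int (h i) \<le> int (h j)" "8 * int (h j) \<le> int (h (Suc j))" unfolding of_nat_mult of_nat_numeral .
  moreover have "2 * \<bar>x\<bar> \<le> y \<and> 2 * \<bar>x + y * (- 1)\<bar> \<le> z" if "0 \<le> x" "8 * x \<le> y" "8 * y \<le> z" for x y z :: int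
    using that by (auto simp: abs_if)
  ultimately have "2 * \<bar>int (h i)\<bar> \<le> int (h j)" "2 * \<bar>int (h i) + int (h j) * (- 1)\<bar> \<le> int (h (Suc j))" using of_nat_0_le_iff by blast+
  from corr_mult[OF this] have "corr (int (h i) - int (h j)) = corr (int (h i)) * gap_coeff r (\<lambda>j. 1 / real (r j)) j (- 1)" by simp
  moreover have "- 1 \<notin> gaps r j"
  proof
    assume "- 1 \<in> gaps r j"
    then obtain a b where ab: "- 1 = int a - int b" "a \<in> spots r j" "b \<in> spots r j" by (auto simp: gaps_def)
    then have "b = a + 1" by linarith
    then show False using spots_even[OF ab(2)] spots_even[OF ab(3)] by simp
  qed
  ultimately show ?thesis by (simp add: gap_coeff_def)
qed

text \<open>\<open>L 0 0\<close> contains a translate of \<open>L m 0\<close>, so the overlap of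
  translates of \<open>L m 0\<close> is at most that of \<open>L 0 0\<close>.\<close>

lemma self_corr_heights: assumes "i \<noteq> j" shows "self_corr (L m 0) (int (h i) - int (h j)) = 0"
proof -
  have *: "self_corr (L m 0) (int (h i) - int (h j)) = 0" if ij: "i < j" for i j
  proof -
    let ?k = "int (h i) - int (h j)"
    have "0 < (\<Prod>j<m. r j)" by (intro prod_pos) (simp add: r_pos)
    then have "0 < card (core r m)" unfolding card_core .
    then have "core r m \<noteq> {}" using card_gt_0_iff by blast
    then obtain v where v: "v \<in> core r m" by blast
    have vh: "v < h m" using core_bound[OF v] by simp
    have "shift (- ?k) (L m v) = shift (int v - ?k) (L m 0)"
      using sets.sets_into_space[OF base_sets] by (subst level_shift[OF vh]) (simp add: shift_add algebra_simps)
    then have "measure M (L m v \<inter> shift (- ?k) (L m v)) = measure M (shift (int v) (L m 0) \<inter> shift (int v - ?k) (L m 0))"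
      using level_shift[OF vh] by simp
    then have "self_corr (L m 0) ?k = measure M (L m v \<inter> shift (- ?k) (L m v))"
      unfolding shift_pair[OF base_sets base_sets] self_corr_def by simp
    also have "\<dots> \<le> measure M (L 0 0 \<inter> shift (- ?k) (L 0 0))"
    proof (rule measure_mono_fmeasurable)
      have "L m v \<subseteq> L 0 0" using v by (subst base_split[of m]) blast
      then show "L m v \<inter> shift (- ?k) (L m v) \<subseteq> L 0 0 \<inter> shift (- ?k) (L 0 0)" unfolding shift_def by blast
      show "L m v \<inter> shift (- ?k) (L m v) \<in> sets M" using level_sets[OF vh] shift_sets by auto
      have "emeasure M (L 0 0 \<inter> shift (- ?k) (L 0 0)) \<le> emeasure M (L 0 0)" using base_sets by (intro emeasure_mono) auto
      then show "L 0 0 \<inter> shift (- ?k) (L 0 0) \<in> fmeasurable M"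
        using base_finite[of 0] base_sets[of 0] shift_sets by (intro fmeasurableI) (auto intro: le_less_trans)
    qed
    also have "\<dots> = 0" using corr_heights[OF ij] by (simp add: corr_def)
    finally show ?thesis by (simp add: self_corr_def measure_le_0_iff)
  qed
  consider "i < j" | "j < i" using assms by linarith
  then show ?thesis
  proof cases
    case 1 then show ?thesis by (rule *)
  next
    case 2 from *[OF this] show ?thesis using self_corr_uminus[OF base_sets, of m "int (h j) - int (h i)"] by simp
  qed
qed

text \<open>Averaging \<open>(z / c)\<^sup>h\<close> over many heights \<open>h\<close> bounds the mass of a point \<open>c\<close>, because the
  translates of a base by distinct heights are disjoint.\<close>

lemma circ_atom: assumes c: "cmod c = 1" shows "measure (circ m) {c} = 0"
proof -
  have bound: "measure (circ m) {c} \<le> 1 / real (Suc n)" for n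
  proof -
    define u where "u j z = z powi int (h j)" for j and z :: complex
    define d where "d j = c powi (- int (h j))" for j
    let ?f = "lincomb u d (Suc n)"
    have u: "u j \<in> L2 (circ m)" for j unfolding u_def[abs_def] by (rule trig_L2[OF trig_powi finite_circ circ(2)])
    have self: "self_corr (L m 0) 0 = w m"
      using shift_0[OF sets.sets_into_space[OF base_sets]] by (simp add: self_corr_def base_measure)
    have ipu: "ip (circ m) (u i) (u j) = (if i = j then 1 else 0)" for i j
    proof -
      have "ip (circ m) (u i) (u j) = (\<integral>z. z powi (int (h i) - int (h j)) \<partial>circ m)"
        unfolding ip_def u_def by (intro Bochner_Integration.integral_cong refl powi_mult_cnj) (simp add: space_circ)
      then show ?thesis unfolding circ(3) using self_corr_heights[of i j m] self w_pos[of m] by auto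
    qed
    have "complex_of_real (nsq (circ m) ?f) = (\<Sum>i<Suc n. \<Sum>j<Suc n. d i * cnj (d j) * (if i = j then 1 else 0))"
      unfolding nsq_lincomb[OF u] ipu ..
    also have "\<dots> = (\<Sum>i<Suc n. d i * cnj (d i))" by (intro sum.cong refl) (simp add: if_distrib sum.delta' cong: if_cong)
    also have "\<dots> = (\<Sum>i<Suc n. 1)" unfolding d_def using powi_mult_cnj[OF c] by (intro sum.cong refl) simp
    finally have "complex_of_real (nsq (circ m) ?f) = complex_of_real (real (Suc n))"
      by (simp only: sum_constant card_lessThan mult_1_right of_real_of_nat_eq)
    then have ns: "nsq (circ m) ?f = real (Suc n)" by (simp only: of_real_eq_iff)
    have "?f c = (\<Sum>i<Suc n. 1)" unfolding lincomb_def u_def d_def using c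
      by (intro sum.cong refl) (auto simp: power_int_minus field_simps)
    then have fc: "cmod (?f c) = real (Suc n)" by (simp only: sum_constant card_lessThan mult_1_right norm_of_nat)
    have "measure (circ m) {c} \<le> measure (circ m) {z \<in> space (circ m). real (Suc n) \<le> cmod (?f z)}"
    proof (rule finite_measure.finite_measure_mono[OF finite_circ])
      show "{c} \<subseteq> {z \<in> space (circ m). real (Suc n) \<le> cmod (?f z)}" using c fc by (simp add: space_circ)
      have [measurable]: "?f \<in> borel_measurable (circ m)" by (rule L2_measurable[OF lincomb_L2[OF u]])
      show "{z \<in> space (circ m). real (Suc n) \<le> cmod (?f z)} \<in> sets (circ m)" by measurable
    qed
    also have "\<dots> \<le> nsq (circ m) ?f / (real (Suc n))\<^sup>2"
      using lincomb_L2[OF u] by (intro Markov_square finite_circ L2_measurable L2_integrable) auto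
    also have "\<dots> = 1 / real (Suc n)" unfolding ns by (simp add: power2_eq_square)
    finally show ?thesis .
  qed
  have "measure (circ m) {c} \<le> 0"
    by (rule LIMSEQ_le_const[OF LIMSEQ_Suc[OF lim_1_over_n]]) (use bound in auto)
  then show ?thesis by (simp add: measure_le_0_iff)
qed

text \<open>Multiplied by \<open>z ^ h m\<close> the sum becomes a polynomial, whose value at 1 is
  the number of summands and thus not zero.\<close>

lemma gen_zeros_finite: "finite {z. cmod z = 1 \<and> gen m z = 0}"
proof -
  define P where "P = (\<Sum>v\<in>core r m. monom (1::complex) (h m - v))"
  have P: "poly P z = z ^ h m * gen m z" if "z \<noteq> 0" for z
    unfolding P_def poly_sum poly_monom gen_def sum_distrib_left
  proof (rule sum.cong[OF refl])
    fix v assume "v \<in> core r m"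
    from core_bound[OF this] have v: "v \<le> h m" by simp
    have "z ^ h m * z powi (- int v) = z powi (int (h m) + - int v)"
      unfolding power_int_add[OF disjI1[OF that]] power_int_of_nat ..
    also have "int (h m) + - int v = int (h m - v)" using v by simp
    finally have "z ^ h m * z powi (- int v) = z ^ (h m - v)" unfolding power_int_of_nat .
    then show "1 * z ^ (h m - v) = z ^ h m * z powi (- int v)" unfolding mult_1_left by (rule sym)
  qed
  have "poly P 1 = of_nat (card (core r m))" using P[of 1] by (simp add: gen_def)
  moreover have "0 < (\<Prod>j<m. r j)" by (intro prod_pos) (simp add: r_pos)
  ultimately have "poly P 1 \<noteq> 0" unfolding card_core by simp
  then have "P \<noteq> 0" by auto
  then have "finite {z. poly P z = 0}" by (rule poly_roots_finite)
  then show ?thesis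
  proof (rule rev_finite_subset, intro subsetI)
    fix z assume "z \<in> {z. cmod z = 1 \<and> gen m z = 0}"
    then have "z \<noteq> 0" "gen m z = 0" by auto
    then show "z \<in> {z. poly P z = 0}" using P[of z] by simp
  qed
qed

text \<open>There are finitely many zeros and none is an atom; this justifies the division in
  \<open>vec\<close>.\<close>

lemma gen_nonzero: "AE z in circ m. gen m z \<noteq> 0"
proof -
  let ?Z = "{z. cmod z = 1 \<and> gen m z = 0}"
  have sets1: "{z} \<in> sets (circ m)" if "cmod z = 1" for z
  proof -
    have "{z} \<in> sets circle_borel" unfolding circle_borel_def using that by (subst sets_restrict_space_iff) auto
    then show ?thesis by (simp add: circ(2))
  qed
  have "(\<Union>z\<in>?Z. {z}) \<in> null_sets (circ m)"
  proof (rule null_sets_UN')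
    show "countable ?Z" using gen_zeros_finite by (rule countable_finite)
    fix z assume "z \<in> ?Z"
    then show "{z} \<in> null_sets (circ m)"
      using sets1[of z] circ_atom[of z m] finite_measure.emeasure_eq_measure[OF finite_circ] by (auto intro: null_setsI)
  qed
  from AE_not_in[OF this] show ?thesis
    using AE_space by eventually_elim (auto simp: space_circ)
qed

lemma gen_nonzero_0: "AE z in circ 0. gen m z \<noteq> 0"
proof -
  note [measurable] = gen_measurable[OF circ(2)]
  show ?thesis unfolding circ_density[of m] by (subst AE_density) auto
qed

text \<open>In the spectral representation on \<open>L\<^sub>2(circ 0)\<close> that sends the indicator of \<open>L 0 0\<close> to \<open>1\<close>, the indicator of
  \<open>shift k (L m 0)\<close> must go to \<open>vec (m, k)\<close>, as \<open>L 0 0\<close> is the disjoint union of the \<open>shift v (L m 0)\<close> with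
  \<open>v \<in> core r m\<close>.\<close>

definition vec :: "nat \<times> int \<Rightarrow> complex \<Rightarrow> complex" where
  "vec p z = z powi (- snd p) / gen (fst p) z"

lemma vec_base: "vec (0, 0) z = 1" by (simp add: vec_def gen_def)

lemma vec_shift: "cmod z = 1 \<Longrightarrow> vec (m, k - l) z = z powi l * vec (m, k) z"
proof -
  assume "cmod z = 1"
  then have "z \<noteq> 0" by auto
  then have "z powi (l + - k) = z powi l * z powi (- k)" by (rule power_int_add[OF disjI1])
  then show ?thesis by (simp add: vec_def)
qed

lemma vec_measurable: "sets \<mu> = sets circle_borel \<Longrightarrow> vec p \<in> borel_measurable \<mu>"
  unfolding vec_def[abs_def] by (intro borel_measurable_divide power_int_circle_measurable gen_measurable)

lemma vec_L2: "vec (m, k) \<in> L2 (circ 0)"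
proof (rule L2_I)
  show "vec (m, k) \<in> borel_measurable (circ 0)" by (rule vec_measurable[OF circ(2)])
  note [measurable] = gen_measurable[OF circ(2)] vec_measurable[OF circ(2)]
  have eq: "AE z in circ m. (w m * (cmod (gen m z))\<^sup>2) *\<^sub>R (cmod (vec (m, k) z))\<^sup>2 = w m"
    using gen_nonzero AE_space
    by eventually_elim (auto simp: space_circ vec_def norm_divide norm_power_int power_divide)
  have "integrable (circ m) (\<lambda>z. (w m * (cmod (gen m z))\<^sup>2) *\<^sub>R (cmod (vec (m, k) z))\<^sup>2)"
    by (subst integrable_cong_AE[OF _ _ eq]) (auto simp: finite_measure.integrable_const[OF finite_circ])
  then show "integrable (circ 0) (\<lambda>z. (cmod (vec (m, k) z))\<^sup>2)"
    unfolding circ_density[of m] using w_pos[of m] by (subst integrable_density) auto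
qed

text \<open>Passing from \<open>circ 0\<close> to \<open>circ m\<close> brings in exactly the
  squared modulus of \<open>gen m\<close>, which cancels the two denominators.\<close>

lemma vec_Gram_same: "ip (circ 0) (vec (m, k)) (vec (m, k')) = complex_of_real (measure M (shift k (L m 0) \<inter> shift k' (L m 0)))"
proof -
  note [measurable] = gen_measurable[OF circ(2)] vec_measurable[OF circ(2)]
  have "ip (circ 0) (vec (m, k)) (vec (m, k')) = (\<integral>z. (w m * (cmod (gen m z))\<^sup>2) *\<^sub>R (vec (m, k) z * cnj (vec (m, k') z)) \<partial>circ m)"
    unfolding ip_def circ_density[of m] using w_pos[of m] by (intro integral_density) auto
  also have "\<dots> = (\<integral>z. complex_of_real (w m) * z powi (k' - k) \<partial>circ m)"
  proof (rule integral_cong_AE)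
    show "AE z in circ m. (w m * (cmod (gen m z))\<^sup>2) *\<^sub>R (vec (m, k) z * cnj (vec (m, k') z)) = complex_of_real (w m) * z powi (k' - k)"
      using gen_nonzero AE_space
    proof eventually_elim
      case (elim z)
      have z: "cmod z = 1" using elim(2) by (simp add: space_circ)
      have "vec (m, k) z * cnj (vec (m, k') z) = (z powi (- k) * cnj (z powi (- k'))) / (gen m z * cnj (gen m z))"
        by (simp add: vec_def del: complex_cnj_power_int)
      also have "\<dots> = z powi (- k - - k') / (complex_of_real (cmod (gen m z)))\<^sup>2"
        unfolding powi_mult_cnj[OF z] mult_cnj_self ..
      finally show ?case using elim(1) by (simp add: scaleR_conv_of_real)
    qed
  qed (use power_int_circle_measurable[OF circ(2)] in auto)
  also have "\<dots> = complex_of_real (self_corr (L m 0) (k' - k))"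
    unfolding integral_mult_right_zero circ(3) using w_pos[of m] by simp
  also have "self_corr (L m 0) (k' - k) = measure M (shift k (L m 0) \<inter> shift k' (L m 0))"
    using self_corr_uminus[OF base_sets, of m "k' - k"] unfolding shift_pair[OF base_sets base_sets] by (simp add: self_corr_def)
  finally show ?thesis .
qed

lemma gen_Suc: assumes "z \<noteq> 0"
  shows "gen (Suc m) z = gen m z * (\<Sum>a\<in>spots r m. z powi (- int (h m * a)))"
proof -
  have "gen (Suc m) z = (\<Sum>(v, a)\<in>core r m \<times> spots r m. z powi (- int (v + h m * a)))"
    unfolding gen_def core.simps by (subst sum.reindex[OF core_inj]) (auto intro!: sum.cong)
  also have "\<dots> = (\<Sum>v\<in>core r m. \<Sum>a\<in>spots r m. z powi (- int v) * z powi (- int (h m * a)))"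
    unfolding sum.cartesian_product using assms by (intro sum.cong refl) (auto simp: power_int_add[symmetric])
  finally show ?thesis unfolding gen_def sum_product .
qed

lemma vec_refine: "AE z in circ 0. vec (m, k) z = (\<Sum>a\<in>spots r m. vec (Suc m, k + int (h m * a)) z)"
  using gen_nonzero_0[of "Suc m"] AE_space
proof eventually_elim
  case (elim z)
  have z0: "z \<noteq> 0" using elim(2) by (auto simp: space_circ)
  let ?S = "\<Sum>a\<in>spots r m. z powi (- int (h m * a))"
  have nz: "gen m z \<noteq> 0" "?S \<noteq> 0" using elim(1) unfolding gen_Suc[OF z0] by auto
  have "z powi (- (k + int (h m * a))) = z powi (- k) * z powi (- int (h m * a))" for a
    using z0 power_int_add[of z "- k" "- int (h m * a)"] by (simp del: of_nat_mult)
  then have "(\<Sum>a\<in>spots r m. vec (Suc m, k + int (h m * a)) z) = z powi (- k) * ?S / gen (Suc m) z"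
    unfolding vec_def fst_conv snd_conv by (simp only: sum_divide_distrib sum_distrib_left)
  then show ?case unfolding gen_Suc[OF z0] using nz by (simp add: vec_def)
qed

text \<open>Both sides are additive when the thicker base is cut into levels of the next tower, so
  the case of equal towers suffices.\<close>

lemma vec_Gram_le: "m \<le> m' \<Longrightarrow> ip (circ 0) (vec (m, k)) (vec (m', k')) = complex_of_real (measure M (shift k (L m 0) \<inter> shift k' (L m' 0)))"
proof (induction m arbitrary: k rule: inc_induct)
  case base
  show ?case by (rule vec_Gram_same)
next
  case (step m)
  let ?E = "\<lambda>a. shift (k + int (h m * a)) (L (Suc m) 0)"
  have ah: "h m * a < h (Suc m)" if "a \<in> spots r m" for a using height_step[OF zero_less_h that] by simp
  have E: "?E a = shift k (L (Suc m) (h m * a))" if "a \<in> spots r m" for a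
    using sets.sets_into_space[OF base_sets] by (subst level_shift[OF ah[OF that]]) (simp add: shift_add)
  have "shift k (L m 0) = (\<Union>a\<in>spots r m. shift k (L (Suc m) (h m * a)))"
    unfolding level_split[OF zero_less_h] shift_UN by simp
  also have "\<dots> = (\<Union>a\<in>spots r m. ?E a)" using E by simp
  finally have split: "shift k (L m 0) = (\<Union>a\<in>spots r m. ?E a)" .
  have disj: "disjoint_family_on ?E (spots r m)"
    unfolding disjoint_family_on_def
  proof (intro ballI impI)
    fix a b assume ab: "a \<in> spots r m" "b \<in> spots r m" "a \<noteq> b"
    have "L (Suc m) (h m * a) \<inter> L (Suc m) (h m * b) = {}"
      using ab zero_less_h[of m] by (intro level_disjoint ah) auto
    then show "?E a \<inter> ?E b = {}" unfolding E[OF ab(1)] E[OF ab(2)] by (auto simp: shift_def)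
  qed
  have "ip (circ 0) (vec (m, k)) (vec (m', k')) = ip (circ 0) (\<lambda>z. \<Sum>a\<in>spots r m. vec (Suc m, k + int (h m * a)) z) (vec (m', k'))"
    by (rule ip_cong_AE[OF _ _ _ vec_refine]) (intro L2_measurable vec_L2 L2_sum)+
  also have "\<dots> = (\<Sum>a\<in>spots r m. ip (circ 0) (vec (Suc m, k + int (h m * a))) (vec (m', k')))"
    by (intro ip_sum_left vec_L2)
  also have "\<dots> = (\<Sum>a\<in>spots r m. complex_of_real (measure M (?E a \<inter> shift k' (L m' 0))))"
    by (intro sum.cong refl step.IH)
  also have "\<dots> = complex_of_real (measure M (shift k (L m 0) \<inter> shift k' (L m' 0)))"
    unfolding split using finite_spots disj base_sets base_finite shift_sets shift_measure
    by (subst measure_split) auto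
  finally show ?case .
qed

lemma vec_Gram: "ip (circ 0) (vec p) (vec q) =
  complex_of_real (measure M (shift (snd p) (L (fst p) 0) \<inter> shift (snd q) (L (fst q) 0)))"
proof (cases "fst p \<le> fst q")
  case True
  then show ?thesis using vec_Gram_le[of "fst p" "fst q" "snd p" "snd q"] by simp
next
  case False
  then have "fst q \<le> fst p" by simp
  from vec_Gram_le[OF this, of "snd q" "snd p"] show ?thesis
    by (subst ip_commute) (simp add: Int_commute)
qed

end

section \<open>Rectangles in the power space and their partners on the torus\<close>

lemma power_int_prod: "(\<Prod>i\<in>A. f i) powi k = (\<Prod>i\<in>A. f i powi k)" for f :: "'b \<Rightarrow> 'a :: field"
  by (induction A rule: infinite_finite_induct) (auto simp: power_int_mult_distrib)

lemma L2_preserved: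
  assumes T: "T \<in> measurable N N" "distr N N T = N" and f: "f \<in> L2 N"
  shows "(\<lambda>x. f (T x)) \<in> L2 N"
proof (rule L2_I)
  note [measurable] = T(1) L2_measurable[OF f]
  show "(\<lambda>x. f (T x)) \<in> borel_measurable N" by measurable
  have "integrable (distr N N T) (\<lambda>x. (cmod (f x))\<^sup>2)" unfolding T(2) by (rule L2_integrable[OF f])
  then show "integrable N (\<lambda>x. (cmod (f (T x)))\<^sup>2)" by (subst (asm) integrable_distr_eq) auto
qed

lemma ip_preserved:
  assumes T: "T \<in> measurable N N" "distr N N T = N" and f: "f \<in> borel_measurable N" "g \<in> borel_measurable N"
  shows "ip N (\<lambda>x. f (T x)) (\<lambda>x. g (T x)) = ip N f g"
proof -
  note [measurable] = T(1) f
  have "ip N f g = (\<integral>x. f x * cnj (g x) \<partial>distr N N T)" unfolding ip_def T(2) ..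
  also have "\<dots> = (\<integral>x. f (T x) * cnj (g (T x)) \<partial>N)" by (subst integral_distr) auto
  finally show ?thesis by (simp add: ip_def)
qed

lemma gap_coeff_power: "d \<ge> 1 \<Longrightarrow> gap_coeff r (\<lambda>j. \<epsilon> j ^ d) J e = gap_coeff r \<epsilon> J e ^ d"
  by (simp add: gap_coeff_def)

context tower
begin

text \<open>An enumeration of all families of pairs indexed by \<open>{..<d}\<close>; the unspecified values of \<open>code n\<close> beyond the
  length of the list do no harm.\<close>

definition code :: "nat \<Rightarrow> nat \<Rightarrow> nat \<times> int" where "code n i = (from_nat n :: (nat \<times> int) list) ! i"

lemma code_surj: "\<exists>n. \<forall>i<d. code n i = g i"
  by (rule exI[of _ "to_nat (map g [0..<d])"]) (simp add: code_def)

text \<open>The index of the cell with every coordinate translated by \<open>- l\<close>; on the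
  torus this is multiplication by \<open>winding d y powi l\<close>.\<close>

definition moved :: "nat \<Rightarrow> nat \<Rightarrow> int \<Rightarrow> nat" where
  "moved d n l = (SOME n'. \<forall>i<d. code n' i = (fst (code n i), snd (code n i) - l))"

lemma moved: "i < d \<Longrightarrow> code (moved d n l) i = (fst (code n i), snd (code n i) - l)"
  unfolding moved_def using someI_ex[OF code_surj[of d "\<lambda>i. (fst (code n i), snd (code n i) - l)"]] by blast

definition cell :: "nat \<Rightarrow> nat \<Rightarrow> (nat \<Rightarrow> 'a) set" where
  "cell d n = Pi\<^sub>E {..<d} (\<lambda>i. shift (snd (code n i)) (L (fst (code n i)) 0))"

lemma cell_sets: "cell d n \<in> sets (power_space d M)"
  unfolding cell_def power_space_def by (intro sets_PiM_I_finite) (auto intro: shift_sets base_sets)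

lemma rect_emeasure:
  assumes A: "\<And>i. i < d \<Longrightarrow> A i \<in> sets M" "\<And>i. i < d \<Longrightarrow> emeasure M (A i) < \<infinity>"
  shows "emeasure (power_space d M) (Pi\<^sub>E {..<d} A) = ennreal (\<Prod>i<d. measure M (A i))"
proof -
  have "emeasure (power_space d M) (Pi\<^sub>E {..<d} A) = (\<Prod>i<d. emeasure M (A i))"
    unfolding power_space_def using A by (subst product_sigma_finite.emeasure_PiM[OF product_sigma_finite]) auto
  also have "\<dots> = (\<Prod>i<d. ennreal (measure M (A i)))"
    by (intro prod.cong refl emeasure_eq_ennreal_measure) (metis A(2) infinity_ennreal_def lessThan_iff less_irrefl)
  finally show ?thesis by (simp add: prod_ennreal)
qed

lemma cell_finite: "emeasure (power_space d M) (cell d n) < \<infinity>"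
  unfolding cell_def by (subst rect_emeasure) (auto intro: shift_sets base_sets simp: shift_measure base_sets base_finite[unfolded infinity_ennreal_def])

lemma cell_L2: "indicator (cell d n) \<in> L2 (power_space d M)"
  by (rule indicator_L2[OF cell_sets cell_finite])

lemma cell_Gram: "ip (power_space d M) (indicator (cell d n)) (indicator (cell d n')) =
  (\<Prod>i<d. ip (circ 0) (vec (code n i)) (vec (code n' i)))"
proof -
  let ?A = "\<lambda>i. shift (snd (code n i)) (L (fst (code n i)) 0) \<inter> shift (snd (code n' i)) (L (fst (code n' i)) 0)"
  have s: "shift k (L m 0) \<in> sets M" for k m by (rule shift_sets[OF base_sets])
  have f: "emeasure M (?A i) < \<infinity>" for i
  proof -
    have "emeasure M (?A i) \<le> emeasure M (shift (snd (code n i)) (L (fst (code n i)) 0))" using s by (intro emeasure_mono) auto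
    also have "\<dots> < \<infinity>" using base_finite by (simp add: shift_measure base_sets)
    finally show ?thesis .
  qed
  have "cell d n \<inter> cell d n' = Pi\<^sub>E {..<d} ?A" unfolding cell_def PiE_Int ..
  then have "measure (power_space d M) (cell d n \<inter> cell d n') = (\<Prod>i<d. measure M (?A i))"
    using rect_emeasure[of d ?A] s f by (simp add: measure_def prod_nonneg)
  then show ?thesis unfolding ip_indicator[OF cell_sets cell_sets] vec_Gram by simp
qed

definition rects :: "nat \<Rightarrow> (nat \<Rightarrow> 'a) set set" where
  "rects d = {Pi\<^sub>E {..<d} A |A. A \<in> {..<d} \<rightarrow> insert {} {L m s |m s. s < h m}}"

lemma rects_cases: assumes "X \<in> rects d" shows "X = {} \<or> (\<exists>n. X = cell d n)"
proof -
  obtain A where A: "X = Pi\<^sub>E {..<d} A" "A \<in> {..<d} \<rightarrow> insert {} {L m s |m s. s < h m}" using assms by (auto simp: rects_def)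
  show ?thesis
  proof (cases "\<exists>i<d. A i = {}")
    case True
    then show ?thesis unfolding A(1) by (auto simp: PiE_eq_empty_iff)
  next
    case False
    then have "\<forall>i. \<exists>q. i < d \<longrightarrow> snd q < h (fst q) \<and> A i = L (fst q) (snd q)"
      using A(2) by (fastforce simp: Pi_iff)
    then obtain q where q: "\<And>i. i < d \<Longrightarrow> snd (q i) < h (fst (q i)) \<and> A i = L (fst (q i)) (snd (q i))" by metis
    obtain n where n: "\<And>i. i < d \<Longrightarrow> code n i = (fst (q i), int (snd (q i)))"
      using code_surj[of d "\<lambda>i. (fst (q i), int (snd (q i)))"] by blast
    have "X = cell d n" unfolding A(1) cell_def
    proof (rule PiE_cong)
      fix i assume "i \<in> {..<d}"
      then show "A i = shift (snd (code n i)) (L (fst (code n i)) 0)"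
        using q[of i] n[of i] level_shift[of "snd (q i)" "fst (q i)"] by simp
    qed
    then show ?thesis by blast
  qed
qed

lemma rects_Int_stable: "Int_stable (rects d)"
proof (rule Int_stableI)
  fix X Y assume "X \<in> rects d" "Y \<in> rects d"
  then obtain A B where *: "X = Pi\<^sub>E {..<d} A" "A \<in> {..<d} \<rightarrow> insert {} {L m s |m s. s < h m}"
    "Y = Pi\<^sub>E {..<d} B" "B \<in> {..<d} \<rightarrow> insert {} {L m s |m s. s < h m}" unfolding rects_def by blast
  have "(\<lambda>i. A i \<inter> B i) \<in> {..<d} \<rightarrow> insert {} {L m s |m s. s < h m}"
  proof
    fix i assume "i \<in> {..<d}"
    then have "A i \<in> insert {} {L m s |m s. s < h m}" "B i \<in> insert {} {L m s |m s. s < h m}" using * by auto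
    then show "A i \<inter> B i \<in> insert {} {L m s |m s. s < h m}" by (rule Int_stableD[OF levels_Int_stable])
  qed
  then show "X \<inter> Y \<in> rects d" unfolding rects_def *(1,3) PiE_Int by blast
qed

lemma rects_generate: "sets (power_space d M) = sigma_sets (space (power_space d M)) (rects d)"
proof -
  let ?E = "insert {} {L m s |m s. s < h m}" and ?X = "space M"
  have E: "?E \<subseteq> Pow ?X" using level_subset by auto
  have gen: "sigma_sets ?X ?E = sets M"
    using level_generate sigma_sets_eqI[of "{L m s |m s. s < h m}" "space M" ?E] by (auto intro: sigma_sets.Empty)
  have sets: "sets M = sets (sigma ?X ?E)" using E gen by simp
  have P: "{{f\<in>(\<Pi>\<^sub>E i\<in>{..<d}. ?X). \<forall>i\<in>j. f i \<in> A i} | A j. j \<in> {{..<d}} \<and> A \<in> Pi j (\<lambda>_. ?E)} = rects d"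
  proof -
    have "{f\<in>(\<Pi>\<^sub>E i\<in>{..<d}. ?X). \<forall>i\<in>{..<d}. f i \<in> A i} = Pi\<^sub>E {..<d} A" if "A \<in> {..<d} \<rightarrow> ?E" for A
    proof -
      have "A i \<subseteq> ?X" if "i < d" for i using \<open>A \<in> {..<d} \<rightarrow> ?E\<close> E that by (force simp: Pi_iff)
      then show ?thesis by (auto simp: PiE_def Pi_def)
    qed
    note eq = this
    show ?thesis
    proof (intro set_eqI iffI)
      fix X assume "X \<in> {{f\<in>(\<Pi>\<^sub>E i\<in>{..<d}. ?X). \<forall>i\<in>j. f i \<in> A i} | A j. j \<in> {{..<d}} \<and> A \<in> Pi j (\<lambda>_. ?E)}"
      then obtain A where A: "A \<in> {..<d} \<rightarrow> ?E" "X = {f\<in>(\<Pi>\<^sub>E i\<in>{..<d}. ?X). \<forall>i\<in>{..<d}. f i \<in> A i}" by blast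
      show "X \<in> rects d" unfolding rects_def A(2) eq[OF A(1)] using A(1) by blast
    next
      fix X assume "X \<in> rects d"
      then obtain A where A: "A \<in> {..<d} \<rightarrow> ?E" "X = Pi\<^sub>E {..<d} A" unfolding rects_def by blast
      show "X \<in> {{f\<in>(\<Pi>\<^sub>E i\<in>{..<d}. ?X). \<forall>i\<in>j. f i \<in> A i} | A j. j \<in> {{..<d}} \<and> A \<in> Pi j (\<lambda>_. ?E)}"
        unfolding A(2) eq[OF A(1), symmetric] using A(1) by blast
    qed
  qed
  have "sets (power_space d M) = sets (PiM {..<d} (\<lambda>_. sigma ?X ?E))"
    unfolding power_space_def by (rule sets_PiM_cong[OF refl sets])
  also have "\<dots> = sets (sigma (\<Pi>\<^sub>E i\<in>{..<d}. ?X) {{f\<in>(\<Pi>\<^sub>E i\<in>{..<d}. ?X). \<forall>i\<in>j. f i \<in> A i} | A j. j \<in> {{..<d}} \<and> A \<in> Pi j (\<lambda>_. ?E)})"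
  proof (rule sets_PiM_sigma)
    show "\<exists>S\<subseteq>?E. countable S \<and> ?X = \<Union>S"
      by (rule exI[of _ "{L m s |m s. s < h m}"]) (use countable_levels level_cover in auto)
  qed (use E in auto)
  also have "\<dots> = sets (sigma (\<Pi>\<^sub>E i\<in>{..<d}. ?X) (rects d))" unfolding P ..
  also have "\<dots> = sigma_sets (\<Pi>\<^sub>E i\<in>{..<d}. ?X) (rects d)"
  proof (rule sets_measure_of)
    have "cell d n \<subseteq> (\<Pi>\<^sub>E i\<in>{..<d}. ?X)" for n
      using sets.sets_into_space[OF cell_sets, of d n] unfolding power_space_def space_PiM .
    then show "rects d \<subseteq> Pow (\<Pi>\<^sub>E i\<in>{..<d}. ?X)" using rects_cases by blast
  qed
  finally show ?thesis by (simp add: power_space_def space_PiM)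
qed

text \<open>The positive and the negative part of \<open>g\<close> are densities of two measures
  that agree on cells, hence on the generating family \<open>rects d\<close>, hence
  everywhere.\<close>

lemma cell_zero_real:
  fixes g :: "(nat \<Rightarrow> 'a) \<Rightarrow> real"
  assumes g [measurable]: "g \<in> borel_measurable (power_space d M)"
  and int: "\<And>n. integrable (power_space d M) (\<lambda>x. g x * indicator (cell d n) x)"
  and zero: "\<And>n. (\<integral>x. g x * indicator (cell d n) x \<partial>power_space d M) = 0"
  shows "AE x in power_space d M. g x = 0"
proof -
  let ?N = "power_space d M"
  let ?P = "density ?N (\<lambda>x. ennreal (max 0 (g x)))" and ?Q = "density ?N (\<lambda>x. ennreal (max 0 (- g x)))"
  note cell_sets[measurable]
  have iP: "integrable ?N (\<lambda>x. max 0 (g x) * indicator (cell d n) x)"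
    and iQ: "integrable ?N (\<lambda>x. max 0 (- g x) * indicator (cell d n) x)" for n
    by (rule Bochner_Integration.integrable_bound[OF int[of n]]; force simp: indicator_def)+
  have eP: "emeasure ?P (cell d n) = ennreal (\<integral>x. max 0 (g x) * indicator (cell d n) x \<partial>?N)"
    and eQ: "emeasure ?Q (cell d n) = ennreal (\<integral>x. max 0 (- g x) * indicator (cell d n) x \<partial>?N)" for n
  proof -
    have *: "(\<integral>\<^sup>+x. ennreal (F x) * indicator (cell d n) x \<partial>?N) = (\<integral>\<^sup>+x. ennreal (F x * indicator (cell d n) x) \<partial>?N)"
      for F :: "(nat \<Rightarrow> 'a) \<Rightarrow> real" by (intro nn_integral_cong) (auto simp: indicator_def)
    show "emeasure ?P (cell d n) = ennreal (\<integral>x. max 0 (g x) * indicator (cell d n) x \<partial>?N)"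
      by (subst emeasure_density[OF _ cell_sets], simp, unfold *, rule nn_integral_eq_integral[OF iP]) (auto intro!: AE_I2)
    show "emeasure ?Q (cell d n) = ennreal (\<integral>x. max 0 (- g x) * indicator (cell d n) x \<partial>?N)"
      by (subst emeasure_density[OF _ cell_sets], simp, unfold *, rule nn_integral_eq_integral[OF iQ]) (auto intro!: AE_I2)
  qed
  have same: "emeasure ?P (cell d n) = emeasure ?Q (cell d n)" for n
  proof -
    have "(\<integral>x. max 0 (g x) * indicator (cell d n) x \<partial>?N) - (\<integral>x. max 0 (- g x) * indicator (cell d n) x \<partial>?N) =
      (\<integral>x. max 0 (g x) * indicator (cell d n) x - max 0 (- g x) * indicator (cell d n) x \<partial>?N)"
      by (rule Bochner_Integration.integral_diff[symmetric, OF iP iQ])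
    also have "\<dots> = (\<integral>x. g x * indicator (cell d n) x \<partial>?N)"
      by (intro Bochner_Integration.integral_cong refl) (auto simp: indicator_def max_def)
    finally show ?thesis using zero[of n] unfolding eP eQ by simp
  qed
  have cover: "\<exists>n. x \<in> cell d n \<and> cell d n \<in> rects d" if x: "x \<in> space ?N" for x
  proof -
    have "\<forall>i. \<exists>q. i < d \<longrightarrow> snd q < h (fst q) \<and> x i \<in> L (fst q) (snd q)"
    proof
      fix i
      show "\<exists>q. i < d \<longrightarrow> snd q < h (fst q) \<and> x i \<in> L (fst q) (snd q)"
      proof (cases "i < d")
        case True
        then have "x i \<in> space M" using x by (auto simp: power_space_def space_PiM PiE_iff)
        then obtain m s where "s < h m" "x i \<in> L m s" using level_cover by auto
        then show ?thesis by (intro exI[of _ "(m, s)"]) auto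
      qed auto
    qed
    then obtain q where q: "\<And>i. i < d \<Longrightarrow> snd (q i) < h (fst (q i)) \<and> x i \<in> L (fst (q i)) (snd (q i))" by metis
    let ?R = "Pi\<^sub>E {..<d} (\<lambda>i. L (fst (q i)) (snd (q i)))"
    have R: "?R \<in> rects d" unfolding rects_def using q by blast
    have xR: "x \<in> ?R" using q x by (auto simp: power_space_def space_PiM PiE_iff)
    then show ?thesis using rects_cases[OF R] R by auto
  qed
  have sets: "cell d n \<in> rects d \<Longrightarrow> cell d n \<subseteq> space ?N" for n using sets.sets_into_space[OF cell_sets] by auto
  have "?P = ?Q"
  proof (rule measure_eqI_generator_eq_countable[OF rects_Int_stable[of d], where \<Omega>="space ?N" and A="range (cell d) \<inter> rects d"])
    show "rects d \<subseteq> Pow (space ?N)" using rects_cases sets.sets_into_space[OF cell_sets] by blast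
    show "emeasure ?P X = emeasure ?Q X" if "X \<in> rects d" for X using rects_cases[OF that] same by auto
    show "sets ?P = sigma_sets (space ?N) (rects d)" "sets ?Q = sigma_sets (space ?N) (rects d)"
      using rects_generate by simp_all
    show "\<Union> (range (cell d) \<inter> rects d) = space ?N" using cover sets by blast
    show "emeasure ?P a \<noteq> \<infinity>" if "a \<in> range (cell d) \<inter> rects d" for a using that eP by auto
  qed auto
  moreover have "sigma_finite_measure ?N"
    unfolding power_space_def by (rule product_sigma_finite.sigma_finite[OF product_sigma_finite]) simp
  ultimately have "AE x in ?N. ennreal (max 0 (g x)) = ennreal (max 0 (- g x))"
    by (intro sigma_finite_measure.density_unique) auto
  then show ?thesis by eventually_elim (auto simp: max_def split: if_splits)
qed

lemma total_cells: "total (power_space d M) (\<lambda>n. indicator (cell d n))"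
  unfolding total_def
proof (intro conjI allI ballI impI cell_L2)
  let ?N = "power_space d M"
  fix f assume f: "f \<in> L2 ?N" and z: "\<forall>i. ip ?N f (indicator (cell d i)) = 0"
  have i: "integrable ?N (\<lambda>x. f x * complex_of_real (indicator (cell d n) x))"
    and z': "(\<integral>x. f x * complex_of_real (indicator (cell d n) x) \<partial>?N) = 0" for n
  proof -
    have eq: "cnj (indicator (cell d n) x) = complex_of_real (indicator (cell d n) x)" for x by (simp add: indicator_def)
    show "integrable ?N (\<lambda>x. f x * complex_of_real (indicator (cell d n) x))"
      using L2_mult_integrable[OF f cell_L2[of d n]] unfolding eq .
    show "(\<integral>x. f x * complex_of_real (indicator (cell d n) x) \<partial>?N) = 0"
      using z[rule_format, of n] unfolding ip_def eq .
  qed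
  note [measurable] = L2_measurable[OF f]
  have "AE x in ?N. Re (f x) = 0"
  proof (rule cell_zero_real)
    fix n
    show "integrable ?N (\<lambda>x. Re (f x) * indicator (cell d n) x)" using integrable_Re[OF i[of n]] by simp
    show "(\<integral>x. Re (f x) * indicator (cell d n) x \<partial>?N) = 0" using integral_Re[OF i[of n]] z'[of n] by simp
  qed simp
  moreover have "AE x in ?N. Im (f x) = 0"
  proof (rule cell_zero_real)
    fix n
    show "integrable ?N (\<lambda>x. Im (f x) * indicator (cell d n) x)" using integrable_Im[OF i[of n]] by simp
    show "(\<integral>x. Im (f x) * indicator (cell d n) x \<partial>?N) = 0" using integral_Im[OF i[of n]] z'[of n] by simp
  qed simp
  ultimately show "AE x in ?N. f x = 0" by eventually_elim (simp add: complex_eq_iff)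
qed

definition torus :: "nat \<Rightarrow> (nat \<Rightarrow> complex) measure" where "torus d = PiM {..<d} (\<lambda>_. circ 0)"

text \<open>The partner of the indicator of \<open>cell d n\<close> on the torus: a tensor product
  of functions \<open>vec\<close>.\<close>

definition dual :: "nat \<Rightarrow> nat \<Rightarrow> (nat \<Rightarrow> complex) \<Rightarrow> complex" where
  "dual d n y = (\<Prod>i<d. vec (code n i) (y i))"

lemma prob_torus: "prob_space (torus d)"
  unfolding torus_def by (rule prob_space_PiM) (rule circ(1))

lemma torus_sigma_finite: "product_sigma_finite (\<lambda>_::nat. circ 0)"
  by (intro product_sigma_finite.intro prob_space_imp_sigma_finite circ(1))

lemma torus_unit: "y \<in> space (torus d) \<Longrightarrow> i < d \<Longrightarrow> cmod (y i) = 1"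
  by (auto simp: torus_def space_PiM PiE_iff space_circ)

lemma vec_L2': "vec p \<in> L2 (circ 0)" using vec_L2[of "fst p" "snd p"] by simp

lemma dual_measurable: "dual d n \<in> borel_measurable (torus d)"
  unfolding dual_def[abs_def]
proof (rule borel_measurable_prod)
  fix i assume "i \<in> {..<d}"
  then have "(\<lambda>y. y i) \<in> measurable (torus d) (circ 0)" unfolding torus_def by measurable
  from measurable_compose[OF this vec_measurable[OF circ(2)]]
  show "(\<lambda>y. vec (code n i) (y i)) \<in> borel_measurable (torus d)" .
qed

lemma dual_L2: "dual d n \<in> L2 (torus d)"
proof (rule L2_I[OF dual_measurable])
  have "integrable (torus d) (\<lambda>y. \<Prod>i\<in>{..<d}. (cmod (vec (code n i) (y i)))\<^sup>2)"
    unfolding torus_def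
    by (rule product_sigma_finite.product_integrable_prod[OF torus_sigma_finite]) (auto intro: L2_integrable vec_L2')
  moreover have "(cmod (dual d n y))\<^sup>2 = (\<Prod>i\<in>{..<d}. (cmod (vec (code n i) (y i)))\<^sup>2)" for y
    unfolding dual_def prod_norm[symmetric] prod_power_distrib ..
  ultimately show "integrable (torus d) (\<lambda>y. (cmod (dual d n y))\<^sup>2)" by simp
qed

lemma dual_Gram: "ip (torus d) (dual d n) (dual d n') = (\<Prod>i<d. ip (circ 0) (vec (code n i)) (vec (code n' i)))"
proof -
  have "ip (torus d) (dual d n) (dual d n') = (\<integral>y. (\<Prod>i\<in>{..<d}. vec (code n i) (y i) * cnj (vec (code n' i) (y i))) \<partial>torus d)"
    unfolding ip_def dual_def cnj_prod prod.distrib ..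
  also have "\<dots> = (\<Prod>i\<in>{..<d}. ip (circ 0) (vec (code n i)) (vec (code n' i)))"
    unfolding torus_def ip_def
    by (rule product_sigma_finite.product_integral_prod[OF torus_sigma_finite]) (auto intro: L2_mult_integrable vec_L2')
  finally show ?thesis .
qed

definition winding :: "nat \<Rightarrow> (nat \<Rightarrow> complex) \<Rightarrow> complex" where "winding d y = (\<Prod>i<d. y i)"

lemma winding_unit: "y \<in> space (torus d) \<Longrightarrow> cmod (winding d y) = 1"
  unfolding winding_def prod_norm[symmetric] by (simp add: torus_unit)

lemma winding_measurable: "winding d \<in> measurable (torus d) circle_borel"
  unfolding circle_borel_def
proof (rule measurable_restrict_space2)
  show "winding d \<in> space (torus d) \<rightarrow> sphere 0 1" using winding_unit by auto
  show "winding d \<in> borel_measurable (torus d)"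
    unfolding winding_def[abs_def]
  proof (rule borel_measurable_prod)
    fix i assume "i \<in> {..<d}"
    then have "(\<lambda>y. y i) \<in> measurable (torus d) (circ 0)" unfolding torus_def by measurable
    from measurable_compose[OF this borel_measurable_circle[of "\<lambda>z. z", OF _ circ(2)]]
    show "(\<lambda>y. y i) \<in> borel_measurable (torus d)" by simp
  qed
qed

lemma dual_moved: assumes "y \<in> space (torus d)"
  shows "dual d (moved d n l) y = winding d y powi l * dual d n y"
proof -
  have "dual d (moved d n l) y = (\<Prod>i<d. y i powi l * vec (code n i) (y i))"
    unfolding dual_def
  proof (rule prod.cong[OF refl])
    fix i assume "i \<in> {..<d}"
    then show "vec (code (moved d n l) i) (y i) = y i powi l * vec (code n i) (y i)"
      using moved[of i d n l] vec_shift[OF torus_unit[OF assms], of i "fst (code n i)" "snd (code n i)" l] by simp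
  qed
  then show ?thesis by (simp add: prod.distrib winding_def dual_def power_int_prod)
qed

text \<open>The image measure is the \<open>d\<close>-fold convolution power of
  \<open>circ 0\<close>, the expected maximal spectral type of a tensor power.\<close>

lemma winding_Fourier: "(\<integral>z. z powi k \<partial>distr (torus d) circle_borel (winding d)) = complex_of_real (corr k ^ d)"
proof -
  have "(\<integral>z. z powi k \<partial>distr (torus d) circle_borel (winding d)) = (\<integral>y. winding d y powi k \<partial>torus d)"
    by (rule integral_distr[OF winding_measurable power_int_circle_measurable[OF refl]])
  also have "\<dots> = (\<integral>y. (\<Prod>i\<in>{..<d}. y i powi k) \<partial>torus d)" unfolding winding_def power_int_prod ..
  also have "\<dots> = (\<Prod>i\<in>{..<d}. (\<integral>z. z powi k \<partial>circ 0))"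
    unfolding torus_def
    by (rule product_sigma_finite.product_integral_prod[OF torus_sigma_finite])
       (auto intro: trig_integrable[OF trig_powi circ(2) finite_circ])
  finally show ?thesis by (simp add: circ_0)
qed

lemma cell_moved:
  assumes x: "x \<in> space (power_space d M)"
  shows "tensor_power d (act 1) x \<in> cell d (moved d n (- 1)) \<longleftrightarrow> x \<in> cell d n"
proof -
  have xi: "x i \<in> space M" if "i < d" for i using x that by (auto simp: power_space_def space_PiM PiE_iff)
  have "act 1 (x i) \<in> shift (k + 1) B \<longleftrightarrow> x i \<in> shift k B" if "i < d" for i k B
    using act_add[OF xi[OF that], of "- (k + 1)" 1] act_space[OF xi[OF that]] xi[OF that] by (simp add: shift_def)
  moreover have "x \<in> extensional {..<d}" using x by (auto simp: power_space_def space_PiM PiE_iff)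
  ultimately show ?thesis by (auto simp: cell_def tensor_power_def PiE_iff moved)
qed

text \<open>Cells and their duals have equal Gram matrices, and
  \<open>spectral_decomposition\<close> carries the duals to functions \<open>b\<close> over the
  circle times the naturals, turning the winding into the coordinate. Matching the total families of
  cells and of \<open>b\<close> gives the unitary operator.\<close>

theorem spectral_tensor:
  "\<exists>\<sigma>. spectral_model (power_space d M) (koopman (tensor_power d (act 1))) \<sigma> \<and>
     equivalent_measures (circle_projection \<sigma>) (distr (torus d) circle_borel (winding d))"
proof -
  let ?N = "power_space d M" and ?T = "tensor_power d (act 1)" and ?a = "\<lambda>n. indicator (cell d n)"
  \<comment> \<open>The cell built from copies of \<open>L 0 0\<close> has the constant 1 as its
    dual, as \<open>spectral_decomposition\<close> demands.\<close>
  obtain i0 where i0: "\<forall>i<d. code i0 i = (0, 0)" using code_surj[of d "\<lambda>_. (0, 0)"] by blast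
  have one: "dual d i0 y = 1" for y using i0 by (simp add: dual_def vec_base)
  from spectral_decomposition[OF prob_torus[of d] winding_measurable[of d], of "dual d" i0, OF dual_L2 one]
  obtain \<sigma> b where P: "prob_space \<sigma>" and ss: "sets \<sigma> = sets (circle_borel \<Otimes>\<^sub>M count_space UNIV)" and b': "\<forall>i. b i \<in> L2 \<sigma>"
    and G': "\<forall>i j (k::int). (\<integral>w. fst w powi k * (b i w * cnj (b j w)) \<partial>\<sigma>) =
      (\<integral>y. winding d y powi k * (dual d i y * cnj (dual d j y)) \<partial>torus d)"
    and tot: "\<forall>f\<in>L2 \<sigma>. (\<forall>i (k::int). (\<integral>w. fst w powi k * (f w * cnj (b i w)) \<partial>\<sigma>) = 0) \<longrightarrow> (AE w in \<sigma>. f w = 0)"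
    and eq: "equivalent_measures (circle_projection \<sigma>) (distr (torus d) circle_borel (winding d))"
    by (elim exE conjE)
  note b = b'[rule_format] and G = G'[rule_format]
  have unit: "cmod (fst w) = 1" if "w \<in> space \<sigma>" for w
    using that sets_eq_imp_space_eq[OF ss] by (auto simp: space_pair_measure)
  have fm: "(\<lambda>w. fst w powi k) \<in> borel_measurable \<sigma>" for k
  proof -
    have "fst \<in> measurable \<sigma> circle_borel" unfolding measurable_cong_sets[OF ss refl] by simp
    from measurable_compose[OF this power_int_circle_measurable[OF refl]] show ?thesis .
  qed
  have zL2: "(\<lambda>w. fst w powi l * f w) \<in> L2 \<sigma>" if "f \<in> L2 \<sigma>" for f l
    by (rule L2_unitary_mult[OF that fm]) (simp add: unit norm_power_int)
  have G0: "ip \<sigma> (b i) (b j) = ip (torus d) (dual d i) (dual d j)" for i j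
    using G[of 0 i j] by (simp add: ip_def)
  have nsqb: "nsq \<sigma> (b i) = nsq (torus d) (dual d i)" for i
    using G0[of i i] unfolding ip_self by (simp only: of_real_eq_iff)
  \<comment> \<open>The difference has norm zero, because the two squared norms and the inner
    product all coincide.\<close>
  have bm: "AE w in \<sigma>. b (moved d n l) w = fst w powi l * b n w" for n l
  proof -
    let ?n = "moved d n l" and ?g = "\<lambda>w. fst w powi l * b n w"
    have "nsq \<sigma> ?g = nsq \<sigma> (b n)"
      unfolding nsq_def by (intro Bochner_Integration.integral_cong refl) (simp add: norm_mult unit norm_power_int)
    moreover have "nsq (torus d) (dual d ?n) = nsq (torus d) (dual d n)"
      unfolding nsq_def
      by (intro Bochner_Integration.integral_cong refl) (simp add: dual_moved norm_mult winding_unit norm_power_int)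
    moreover have "ip \<sigma> (b ?n) ?g = complex_of_real (nsq (torus d) (dual d n))"
    proof -
      have "ip \<sigma> (b ?n) ?g = (\<integral>w. fst w powi (- l) * (b ?n w * cnj (b n w)) \<partial>\<sigma>)"
        unfolding ip_def
      proof (rule Bochner_Integration.integral_cong[OF refl])
        fix w assume "w \<in> space \<sigma>"
        from cnj_powi_circle[OF unit[OF this], of l]
        show "b ?n w * cnj (fst w powi l * b n w) = fst w powi (- l) * (b ?n w * cnj (b n w))"
          unfolding complex_cnj_mult by (simp only: mult_ac)
      qed
      also have "\<dots> = (\<integral>y. winding d y powi (- l) * (dual d ?n y * cnj (dual d n y)) \<partial>torus d)" by (rule G)
      also have "\<dots> = (\<integral>y. dual d n y * cnj (dual d n y) \<partial>torus d)"
      proof (rule Bochner_Integration.integral_cong[OF refl])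
        fix y assume y: "y \<in> space (torus d)"
        have nz: "winding d y \<noteq> 0" using winding_unit[OF y] by auto
        have "winding d y powi (- l) * winding d y powi l = 1"
          using nz power_int_add[of "winding d y" "- l" l] by simp
        then show "winding d y powi (- l) * (dual d ?n y * cnj (dual d n y)) = dual d n y * cnj (dual d n y)"
          unfolding dual_moved[OF y] by (simp only: mult.assoc[symmetric] mult_1_left)
      qed
      finally show ?thesis unfolding ip_self[symmetric] ip_def .
    qed
    ultimately have "nsq \<sigma> (\<lambda>w. b ?n w - ?g w) = 0"
      unfolding nsq_diff[OF b zL2[OF b]] by (simp add: nsqb)
    then have "AE w in \<sigma>. b ?n w - ?g w = 0" using nsq_eq_0_iff[OF L2_diff[OF b zL2[OF b]]] by blast
    then show ?thesis by eventually_elim simp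
  qed
  have ip_moved: "ip \<sigma> f (b (moved d n l)) = (\<integral>w. fst w powi (- l) * (f w * cnj (b n w)) \<partial>\<sigma>)" if f: "f \<in> L2 \<sigma>" for f n l
    unfolding ip_def
  proof (rule integral_cong_AE)
    note [measurable] = L2_measurable[OF f] L2_measurable[OF b] fm
    show "(\<lambda>w. f w * cnj (b (moved d n l) w)) \<in> borel_measurable \<sigma>" by measurable
    show "(\<lambda>w. fst w powi (- l) * (f w * cnj (b n w))) \<in> borel_measurable \<sigma>" by measurable
    show "AE w in \<sigma>. f w * cnj (b (moved d n l) w) = fst w powi (- l) * (f w * cnj (b n w))"
      using bm[of n l] AE_space
    proof eventually_elim
      case (elim w)
      show ?case unfolding elim(1) complex_cnj_mult cnj_powi_circle[OF unit[OF elim(2)]] by (simp only: mult_ac)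
    qed
  qed
  \<comment> \<open>Powers of the coordinate are absorbed into \<open>moved\<close>, so
    orthogonality to all \<open>b i\<close> includes orthogonality to their multiples by such
    powers.\<close>
  have tb: "total \<sigma> b"
    unfolding total_def
  proof (intro conjI allI b ballI impI)
    fix f assume f: "f \<in> L2 \<sigma>" and z: "\<forall>i. ip \<sigma> f (b i) = 0"
    show "AE w in \<sigma>. f w = 0"
    proof (rule tot[rule_format, OF f])
      fix i k
      show "(\<integral>w. fst w powi k * (f w * cnj (b i w)) \<partial>\<sigma>) = 0"
        using ip_moved[OF f, of i "- k"] z by simp
    qed
  qed
  have "ip ?N (?a i) (?a j) = ip \<sigma> (b i) (b j)" for i j unfolding G0 cell_Gram dual_Gram ..
  then obtain \<Phi> where \<Phi>: "unitary_L2 ?N \<sigma> \<Phi>" "\<And>f j. f \<in> L2 ?N \<Longrightarrow> ip \<sigma> (\<Phi> f) (b j) = ip ?N f (?a j)"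
    using unitary_from_Gram[OF total_cells tb] by metis
  have \<Phi>L: "\<Phi> f \<in> L2 \<sigma>" if "f \<in> L2 ?N" for f using \<Phi>(1) that by (auto simp: unitary_L2_def)
  have Tm: "?T \<in> measurable ?N ?N" by (rule tensor_measurable[OF act_measurable])
  note Tp = tensor_preserves[of d 1]
  have "AE w in \<sigma>. \<Phi> (koopman ?T f) w = mult_coordinate (\<Phi> f) w" if f: "f \<in> L2 ?N" for f
  proof (rule total_unique[OF tb])
    have Uf: "koopman ?T f \<in> L2 ?N" unfolding koopman_def by (rule L2_preserved[OF Tm Tp f])
    then show "\<Phi> (koopman ?T f) \<in> L2 \<sigma>" by (rule \<Phi>L)
    have mc: "mult_coordinate (\<Phi> f) = (\<lambda>w. fst w powi 1 * \<Phi> f w)" by (auto simp: mult_coordinate_def)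
    show "mult_coordinate (\<Phi> f) \<in> L2 \<sigma>" unfolding mc by (rule zL2[OF \<Phi>L[OF f]])
    fix n
    let ?n = "moved d n (- 1)"
    have "ip \<sigma> (\<Phi> (koopman ?T f)) (b n) = ip ?N (\<lambda>x. f (?T x)) (?a n)" using \<Phi>(2)[OF Uf, of n] unfolding koopman_def .
    also have "\<dots> = ip ?N (\<lambda>x. f (?T x)) (\<lambda>x. ?a ?n (?T x))"
      unfolding ip_def by (intro Bochner_Integration.integral_cong refl) (simp add: indicator_def cell_moved)
    also have "\<dots> = ip ?N f (?a ?n)"
      by (rule ip_preserved[OF Tm Tp L2_measurable[OF f] L2_measurable[OF cell_L2]])
    also have "\<dots> = ip \<sigma> (\<Phi> f) (b ?n)" unfolding \<Phi>(2)[OF f] ..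
    also have "\<dots> = ip \<sigma> (mult_coordinate (\<Phi> f)) (b n)"
      unfolding ip_moved[OF \<Phi>L[OF f]] unfolding mc ip_def by (simp add: mult.assoc)
    finally show "ip \<sigma> (\<Phi> (koopman ?T f)) (b n) = ip \<sigma> (mult_coordinate (\<Phi> f)) (b n)" .
  qed
  then have "spectral_model ?N (koopman ?T) \<sigma>" unfolding spectral_model_def using P ss \<Phi>(1) by blast
  then show ?thesis using eq by blast
qed

lemma riesz_tensor:
  assumes d: "d \<ge> 1"
  shows "riesz r (\<lambda>j. (1 / real (r j)) ^ d) (\<lambda>k. corr k ^ d) (distr (torus d) circle_borel (winding d))"
proof (rule riesz.intro)
  show "2 \<le> r j" for j by (rule r2)
  show "corr 0 ^ d = 1" by (simp add: corr_0)
  show "prob_space (distr (torus d) circle_borel (winding d))"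
    by (rule prob_space.prob_space_distr[OF prob_torus winding_measurable])
  show "(\<integral>z. z powi k \<partial>distr (torus d) circle_borel (winding d)) = complex_of_real (corr k ^ d)" for k
    by (rule winding_Fourier)
  show "corr (k + int (h J) * e) ^ d = corr k ^ d * gap_coeff r (\<lambda>j. (1 / real (r j)) ^ d) J e"
    if "2 * \<bar>k\<bar> \<le> int (h J)" "2 * \<bar>k + int (h J) * e\<bar> \<le> int (h (Suc J))" for J k e
    unfolding corr_mult[OF that] gap_coeff_power[OF d] power_mult_distrib ..
qed auto

theorem singular_tensor:
  assumes d: "d \<ge> 1" and div: "\<not> summable (\<lambda>j. real (r j) * ((1 / real (r j)) ^ d)\<^sup>2)"
  shows "singular_spectrum (power_space d M) (koopman (tensor_power d (act 1)))"
proof -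
  let ?\<nu> = "distr (torus d) circle_borel (winding d)"
  obtain \<sigma> where \<sigma>: "spectral_model (power_space d M) (koopman (tensor_power d (act 1))) \<sigma>"
    "equivalent_measures (circle_projection \<sigma>) ?\<nu>" using spectral_tensor by blast
  have "mutually_singular ?\<nu> circle_lebesgue"
  proof (rule riesz.singular[OF riesz_tensor[OF d] _ div])
    fix j
    have "(1 / real (r j)) ^ d \<le> (1 / real (r j)) ^ 1" using d r_pos[of j] by (intro power_decreasing) auto
    then have "real (r j) * (1 / real (r j)) ^ d \<le> real (r j) * (1 / real (r j)) ^ 1" by (intro mult_left_mono) auto
    then show "real (r j) * (1 / real (r j)) ^ d \<le> 1" using r_pos[of j] by simp
  qed
  then obtain A where A: "A \<in> sets ?\<nu>" "emeasure ?\<nu> A = 0" "emeasure circle_lebesgue (space circle_lebesgue - A) = 0"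
    and s: "sets ?\<nu> = sets circle_lebesgue" unfolding mutually_singular_def
    using sets_eq_imp_space_eq[of ?\<nu> circle_lebesgue] by auto
  have "A \<in> null_sets (circle_projection \<sigma>)"
    using \<sigma>(2) null_setsI[OF A(2,1)] unfolding equivalent_measures_def absolutely_continuous_def by blast
  moreover have s': "sets (circle_projection \<sigma>) = sets circle_lebesgue" using \<sigma>(2) s by (simp add: equivalent_measures_def)
  moreover have "space (circle_projection \<sigma>) = space circle_lebesgue" by (rule sets_eq_imp_space_eq[OF s'])
  ultimately have "mutually_singular (circle_projection \<sigma>) circle_lebesgue"
    unfolding mutually_singular_def using A(3) by (intro conjI bexI[of _ A]) (auto dest: null_setsD1 null_setsD2)
  then show ?thesis unfolding singular_spectrum_def using \<sigma>(1) by blast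
qed

theorem lebesgue_tensor:
  assumes d: "d \<ge> 2" and conv: "summable (\<lambda>j. ((1 / real (r j)) ^ d * real (r j))\<^sup>2)"
  shows "lebesgue_spectrum (power_space d M) (koopman (tensor_power d (act 1)))"
proof -
  let ?\<nu> = "distr (torus d) circle_borel (winding d)"
  obtain \<sigma> where \<sigma>: "spectral_model (power_space d M) (koopman (tensor_power d (act 1))) \<sigma>"
    "equivalent_measures (circle_projection \<sigma>) ?\<nu>" using spectral_tensor by blast
  have "equivalent_measures ?\<nu> circle_lebesgue"
  proof (rule riesz.lebesgue[OF riesz_tensor _ conv])
    fix j
    \<comment> \<open>With \<open>d \<ge> 2\<close> a factor \<open>1 / r j\<close> remains, which
      is at most 1/2 as \<open>riesz.lebesgue\<close> demands.\<close>
    have "(1 / real (r j)) ^ d \<le> (1 / real (r j)) ^ 2" using d r_pos[of j] by (intro power_decreasing) auto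
    then have "real (r j) * (1 / real (r j)) ^ d \<le> real (r j) * (1 / real (r j)) ^ 2" by (intro mult_left_mono) auto
    also have "\<dots> = 1 / real (r j)" using r_pos[of j] by (simp add: power2_eq_square)
    also have "\<dots> \<le> 1 / 2" using r2[of j] by (simp add: field_simps)
    finally show "real (r j) * (1 / real (r j)) ^ d \<le> 1 / 2" .
  qed (use d in simp)
  then have "equivalent_measures (circle_projection \<sigma>) circle_lebesgue"
    using \<sigma>(2) unfolding equivalent_measures_def absolutely_continuous_def by auto
  then show ?thesis unfolding lebesgue_spectrum_def using \<sigma>(1) by blast
qed

end

section \<open>A tower on the real line\<close>

text \<open>The pieces of a cut level are laid side by side in the order of their spots; this is the
  place of a piece.\<close>

definition rank :: "(nat \<Rightarrow> nat) \<Rightarrow> nat \<Rightarrow> nat \<Rightarrow> nat" where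
  "rank r m a = card {b \<in> spots r m. b < a}"

text \<open>A level of tower \<open>m + 1\<close> that is not part of a copy of tower \<open>m\<close> is put at an integer reserved for it.\<close>

fun pos :: "(nat \<Rightarrow> nat) \<Rightarrow> nat \<Rightarrow> nat \<Rightarrow> real" where
  "pos r 0 t = 0"
| "pos r (Suc m) t = (if t div height r m \<in> spots r m
     then pos r m (t mod height r m) + width r (Suc m) * real (rank r m (t div height r m))
     else 1 + real (prod_encode (m, t)))"

definition ivl :: "(nat \<Rightarrow> nat) \<Rightarrow> nat \<Rightarrow> nat \<Rightarrow> real set" where
  "ivl r m s = {pos r m s ..< pos r m s + width r m}"

definition tower_space :: "(nat \<Rightarrow> nat) \<Rightarrow> real set" where
  "tower_space r = (\<Union>m. \<Union>s<height r m. ivl r m s)"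

definition tower_measure :: "(nat \<Rightarrow> nat) \<Rightarrow> real measure" where
  "tower_measure r = restrict_space lborel (tower_space r)"

definition moves :: "(nat \<Rightarrow> nat) \<Rightarrow> int \<Rightarrow> real \<Rightarrow> nat \<Rightarrow> nat \<Rightarrow> bool" where
  "moves r k x m s \<longleftrightarrow> s < height r m \<and> x \<in> ivl r m s \<and> 0 \<le> int s + k \<and> int s + k < int (height r m)"

text \<open>The translation amount does not depend on the chosen level (see \<open>moves_unique\<close>).\<close>

definition real_act :: "(nat \<Rightarrow> nat) \<Rightarrow> int \<Rightarrow> real \<Rightarrow> real" where
  "real_act r k x = (let (m, s) = (SOME (m, s). moves r k x m s) in x - pos r m s + pos r m (nat (int s + k)))"

lemma rank_spot:
  assumes i: "i < r m"
  shows "rank r m (2 ^ (i + 1)) = i"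
proof -
  have "{b \<in> spots r m. b < 2 ^ (i + 1)} = (\<lambda>k. 2 ^ (k + 1)) ` {..<i}"
  proof (intro set_eqI iffI)
    fix b assume "b \<in> {b \<in> spots r m. b < 2 ^ (i + 1)}"
    then obtain k where k: "k < r m" "b = 2 ^ (k + 1)" "(2::nat) ^ (k + 1) < 2 ^ (i + 1)" by (auto simp: spots_def)
    then have "k + 1 < i + 1" using power_strict_increasing_iff[of "2::nat" "k + 1" "i + 1"] by simp
    then show "b \<in> (\<lambda>k. 2 ^ (k + 1)) ` {..<i}" using k by auto
  next
    fix b :: nat assume "b \<in> (\<lambda>k. 2 ^ (k + 1)) ` {..<i}"
    then obtain k where k: "k < i" "b = 2 ^ (k + 1)" by auto
    have "(2::nat) ^ (k + 1) < 2 ^ (i + 1)" using k by (intro power_strict_increasing) auto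
    then show "b \<in> {b \<in> spots r m. b < 2 ^ (i + 1)}" using k i by (auto simp: spots_def)
  qed
  then show ?thesis unfolding rank_def by (simp add: card_image inj_on_def)
qed

lemma pos_old: "s < height r m \<Longrightarrow> a \<in> spots r m \<Longrightarrow> pos r (Suc m) (s + height r m * a) = pos r m s + width r (Suc m) * real (rank r m a)"
  using height_pos[of r m] by simp

context
  fixes r :: "nat \<Rightarrow> nat" assumes r2: "\<And>j. 2 \<le> r j"
begin

lemma r_pos: "0 < r j" using r2[of j] by simp

lemma width_pos: "0 < width r m"
proof -
  have "0 < (\<Prod>j<m. real (r j))" by (intro prod_pos) (simp add: r_pos)
  then show ?thesis unfolding width_def by (simp only: zero_less_divide_1_iff)
qed

lemma width_Suc: "real (r m) * width r (Suc m) = width r m"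
  using r_pos[of m] by (simp add: width_def)

lemma width_bound: "width r m \<le> (1/2) ^ m"
proof (induction m)
  case (Suc m)
  have "2 * width r (Suc m) \<le> real (r m) * width r (Suc m)"
    using r2[of m] width_pos[of "Suc m"] by (intro mult_right_mono) auto
  then show ?case using Suc width_Suc[of m] by simp
qed (simp add: width_def)

lemma ivl_split: assumes s: "s < height r m"
  shows "ivl r m s = (\<Union>a\<in>spots r m. ivl r (Suc m) (s + height r m * a))"
proof -
  let ?w = "width r (Suc m)"
  have w: "?w > 0" by (rule width_pos)
  have child: "ivl r (Suc m) (s + height r m * 2 ^ (i + 1)) = {pos r m s + ?w * real i ..< pos r m s + ?w * (real i + 1)}"
    if "i < r m" for i
  proof -
    have "2 ^ (i + 1) \<in> spots r m" using that by (auto simp: spots_def)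
    then have "pos r (Suc m) (s + height r m * 2 ^ (i + 1)) = pos r m s + ?w * real i"
      using pos_old[OF s] rank_spot[of i r m, OF that] by (simp del: pos.simps)
    then show ?thesis unfolding ivl_def by (simp add: distrib_left add.assoc del: pos.simps)
  qed
  have "(\<Union>a\<in>spots r m. ivl r (Suc m) (s + height r m * a)) = (\<Union>i<r m. {pos r m s + ?w * real i ..< pos r m s + ?w * (real i + 1)})"
    unfolding spots_def using child by (simp del: pos.simps)
  also have "\<dots> = ivl r m s"
  proof (intro set_eqI iffI)
    fix x assume "x \<in> (\<Union>i<r m. {pos r m s + ?w * real i ..< pos r m s + ?w * (real i + 1)})"
    then obtain i where i: "i < r m" "pos r m s + ?w * real i \<le> x" "x < pos r m s + ?w * (real i + 1)" by auto
    have "?w * (real i + 1) \<le> ?w * real (r m)" using i(1) w by (intro mult_left_mono) auto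
    moreover have "0 \<le> ?w * real i" using w by simp
    ultimately show "x \<in> ivl r m s" using i width_Suc[of m] by (simp add: ivl_def mult.commute)
  next
    fix x assume x: "x \<in> ivl r m s"
    define y where "y = (x - pos r m s) / ?w"
    have xy: "x = pos r m s + ?w * y" using w by (simp add: y_def)
    have y0: "0 \<le> y" using x w by (simp add: y_def ivl_def)
    have "?w * y < ?w * real (r m)" using x xy width_Suc[of m] by (simp add: ivl_def mult.commute)
    then have "y < real (r m)" using w by (simp only: mult_less_cancel_left_pos)
    then have "nat \<lfloor>y\<rfloor> < r m" using y0 by linarith
    moreover have "real (nat \<lfloor>y\<rfloor>) \<le> y" "y < real (nat \<lfloor>y\<rfloor>) + 1" using y0 by linarith+
    moreover from this have "?w * real (nat \<lfloor>y\<rfloor>) \<le> ?w * y" "?w * y < ?w * (real (nat \<lfloor>y\<rfloor>) + 1)"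
      using w by (auto intro!: mult_left_mono mult_strict_left_mono simp del: of_nat_nat)
    ultimately show "x \<in> (\<Union>i<r m. {pos r m s + ?w * real i ..< pos r m s + ?w * (real i + 1)})"
      unfolding xy by (intro UN_I[of "nat \<lfloor>y\<rfloor>"]) auto
  qed
  finally show ?thesis by simp
qed

text \<open>The left ends of the unit intervals that tower \<open>m\<close> may use: 0 for the base,
  and those reserved for the levels added up to tower \<open>m\<close>.\<close>

definition cells :: "nat \<Rightarrow> nat set" where
  "cells m = insert 0 {1 + prod_encode (m', t) |m' t. m' < m}"

lemma width_le_1: "width r m \<le> 1"
  using width_bound[of m] power_le_one[of "1/2::real" m] by linarith

lemma ivl_cell: "s < height r m \<Longrightarrow> \<exists>n\<in>cells m. ivl r m s \<subseteq> {real n..<real n + 1}"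
proof (induction m arbitrary: s)
  case 0
  then show ?case by (auto simp: cells_def ivl_def width_def)
next
  case (Suc m)
  let ?a = "s div height r m" and ?s = "s mod height r m"
  show ?case
  proof (cases "?a \<in> spots r m")
    case True
    have s: "?s < height r m" using height_pos[of r m] by simp
    obtain n where n: "n \<in> cells m" "ivl r m ?s \<subseteq> {real n..<real n + 1}" using Suc.IH[OF s] by blast
    have "ivl r (Suc m) (?s + height r m * ?a) \<subseteq> ivl r m ?s" using ivl_split[OF s] True by blast
    then have "ivl r (Suc m) s \<subseteq> {real n..<real n + 1}" using n(2) by simp
    moreover have "n \<in> cells (Suc m)" using n(1) by (auto simp: cells_def less_Suc_eq)
    ultimately show ?thesis by blast
  next
    case False
    then have "ivl r (Suc m) s \<subseteq> {real (1 + prod_encode (m, s))..<real (1 + prod_encode (m, s)) + 1}"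
      using width_le_1[of "Suc m"] by (auto simp: ivl_def)
    moreover have "1 + prod_encode (m, s) \<in> cells (Suc m)" by (auto simp: cells_def)
    ultimately show ?thesis by blast
  qed
qed

lemma unit_disjoint: "n \<noteq> n' \<Longrightarrow> {real n..<real n + 1} \<inter> {real n'..<real n' + 1} = {}"
proof -
  assume "n \<noteq> n'"
  then have "real n + 1 \<le> real n' \<or> real n' + 1 \<le> real n" by linarith
  then show ?thesis by auto
qed

text \<open>New levels have unit intervals of their own. Pieces of different old levels are
  separated by induction, pieces of the same old level by their ranks.\<close>

lemma ivl_disjoint: "s < height r m \<Longrightarrow> t < height r m \<Longrightarrow> s \<noteq> t \<Longrightarrow> ivl r m s \<inter> ivl r m t = {}"
proof (induction m arbitrary: s t)
  case (Suc m)
  have new: "ivl r (Suc m) u \<subseteq> {real (1 + prod_encode (m, u))..<real (1 + prod_encode (m, u)) + 1}"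
    if "u div height r m \<notin> spots r m" for u
    using that width_le_1[of "Suc m"] by (auto simp: ivl_def)
  have old: "ivl r (Suc m) u \<subseteq> ivl r m (u mod height r m)" if "u div height r m \<in> spots r m" for u
  proof -
    have s: "u mod height r m < height r m" using height_pos[of r m] by simp
    have "ivl r (Suc m) (u mod height r m + height r m * (u div height r m)) \<subseteq> ivl r m (u mod height r m)"
      using ivl_split[OF s] that by blast
    then show ?thesis by simp
  qed
  have mixed: "ivl r (Suc m) u \<inter> ivl r (Suc m) v = {}"
    if uv: "u div height r m \<in> spots r m" "v div height r m \<notin> spots r m" for u v
  proof -
    obtain n where n: "n \<in> cells m" "ivl r m (u mod height r m) \<subseteq> {real n..<real n + 1}"
      using ivl_cell[of "u mod height r m" m] height_pos[of r m] by auto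
    have "n \<noteq> 1 + prod_encode (m, v)" using n(1) by (auto simp: cells_def)
    from unit_disjoint[OF this] show ?thesis using old[OF uv(1)] new[OF uv(2)] n(2) by blast
  qed
  consider (nn) "s div height r m \<notin> spots r m" "t div height r m \<notin> spots r m"
    | (on) "s div height r m \<in> spots r m" "t div height r m \<notin> spots r m"
    | (no) "s div height r m \<notin> spots r m" "t div height r m \<in> spots r m"
    | (oo) "s div height r m \<in> spots r m" "t div height r m \<in> spots r m" by blast
  then show ?case
  proof cases
    case nn
    have "1 + prod_encode (m, s) \<noteq> 1 + prod_encode (m, t)" using Suc.prems(3) by simp
    from unit_disjoint[OF this] show ?thesis using new[OF nn(1)] new[OF nn(2)] by blast
  next
    case on then show ?thesis by (rule mixed)
  next
    case no then show ?thesis using mixed[OF no(2,1)] by (simp add: Int_commute)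
  next
    case oo
    show ?thesis
    proof (cases "s mod height r m = t mod height r m")
      case False
      have "ivl r m (s mod height r m) \<inter> ivl r m (t mod height r m) = {}"
        using height_pos[of r m] by (intro Suc.IH[OF _ _ False]) auto
      then show ?thesis using old[OF oo(1)] old[OF oo(2)] by blast
    next
      case True
      let ?w = "width r (Suc m)"
      have ne: "s div height r m \<noteq> t div height r m"
        using True Suc.prems(3) by (metis div_mult_mod_eq)
      obtain i where i: "i < r m" "s div height r m = 2 ^ (i + 1)" using oo(1) by (auto simp: spots_def)
      obtain j where j: "j < r m" "t div height r m = 2 ^ (j + 1)" using oo(2) by (auto simp: spots_def)
      have "i \<noteq> j" using ne i j by auto
      then have "real i + 1 \<le> real j \<or> real j + 1 \<le> real i" by linarith
      then have "?w * (real i + 1) \<le> ?w * real j \<or> ?w * (real j + 1) \<le> ?w * real i"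
        using width_pos[of "Suc m"] by (auto intro: mult_left_mono)
      moreover have "pos r (Suc m) s = pos r m (s mod height r m) + ?w * real i"
        using oo(1) rank_spot[of i r m, OF i(1)] i(2) by simp
      moreover have "pos r (Suc m) t = pos r m (s mod height r m) + ?w * real j"
        using oo(2) rank_spot[of j r m, OF j(1)] j(2) True by simp
      ultimately show ?thesis unfolding ivl_def by (auto simp: distrib_left simp del: pos.simps)
    qed
  qed
qed simp

lemma ivl_up: "m \<le> m' \<Longrightarrow> s < height r m \<Longrightarrow> x \<in> ivl r m s \<Longrightarrow> \<exists>t<height r m'. x \<in> ivl r m' t"
proof (induction m' rule: dec_induct)
  case (step n)
  then obtain t where t: "t < height r n" "x \<in> ivl r n t" by blast
  then obtain a where "a \<in> spots r n" "x \<in> ivl r (Suc n) (t + height r n * a)" using ivl_split[of t n] by auto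
  then show ?case using height_step[OF t(1)] by blast
qed auto

lemma tower_space_borel: "tower_space r \<in> sets borel"
  unfolding tower_space_def ivl_def by (intro sets.countable_UN) auto

lemma space_tower: "space (tower_measure r) = tower_space r"
  by (simp add: tower_measure_def space_restrict_space)

lemma ivl_subset: "s < height r m \<Longrightarrow> ivl r m s \<subseteq> tower_space r"
  by (auto simp: tower_space_def)

lemma ivl_sets: "s < height r m \<Longrightarrow> ivl r m s \<in> sets (tower_measure r)"
  unfolding tower_measure_def using ivl_subset[of s m] tower_space_borel
  by (subst sets_restrict_space_iff) (auto simp: ivl_def)

lemma ivl_measure: "s < height r m \<Longrightarrow> emeasure (tower_measure r) (ivl r m s) = ennreal (width r m)"
  unfolding tower_measure_def using ivl_subset[of s m] tower_space_borel width_pos[of m]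
  by (subst emeasure_restrict_space) (auto simp: ivl_def)

lemma ivl_generate: "sets (tower_measure r) = sigma_sets (space (tower_measure r)) {ivl r m s |m s. s < height r m}"
proof
  let ?X = "tower_space r" and ?E = "{ivl r m s |m s. s < height r m}"
  show "sigma_sets (space (tower_measure r)) ?E \<subseteq> sets (tower_measure r)"
    by (rule sets.sigma_sets_subset) (auto intro: ivl_sets)
  have sub: "?E \<subseteq> Pow ?X" using ivl_subset by auto
  have setsS: "sets (sigma ?X ?E) = sigma_sets ?X ?E" using sub by (simp add: sets_measure_of)
  have spS: "space (sigma ?X ?E) = ?X" by (rule space_measure_of[OF sub])
  \<comment> \<open>The widths tend to zero, so the part of an open set in the space is the union of
    the countably many levels contained in it.\<close>
  have id: "(\<lambda>x. x) \<in> borel_measurable (sigma ?X ?E)"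
  proof (rule borel_measurableI)
    fix S :: "real set" assume S: "open S"
    let ?I = "{A \<in> ?E. A \<subseteq> S}"
    have "(\<lambda>x. x) -` S \<inter> space (sigma ?X ?E) = \<Union> ?I"
    proof (intro set_eqI iffI)
      fix x assume "x \<in> (\<lambda>x. x) -` S \<inter> space (sigma ?X ?E)"
      then have x: "x \<in> S" "x \<in> ?X" by (auto simp: spS)
      obtain e where e: "e > 0" "ball x e \<subseteq> S" using S x(1) openE by blast
      obtain n where n: "(1/2::real) ^ n < e" using real_arch_pow_inv[of e "1/2"] e(1) by auto
      obtain m s where ms: "s < height r m" "x \<in> ivl r m s" using x(2) by (auto simp: tower_space_def)
      obtain t where t: "t < height r (max m n)" "x \<in> ivl r (max m n) t" using ivl_up[OF _ ms, of "max m n"] by auto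
      have "width r (max m n) \<le> (1/2) ^ max m n" by (rule width_bound)
      also have "\<dots> \<le> (1/2) ^ n" by (intro power_decreasing) auto
      finally have "width r (max m n) < e" using n by simp
      then have "ivl r (max m n) t \<subseteq> ball x e" using t(2) by (auto simp: ivl_def dist_real_def)
      then show "x \<in> \<Union> ?I" using t e(2) by blast
    next
      fix x assume "x \<in> \<Union> ?I"
      then show "x \<in> (\<lambda>x. x) -` S \<inter> space (sigma ?X ?E)" using sub by (auto simp: spS)
    qed
    moreover have "\<Union> ?I \<in> sets (sigma ?X ?E)"
    proof (rule sets.countable_Union)
      have "?I \<subseteq> range (\<lambda>(m, s). ivl r m s)" by auto
      then show "countable ?I" by (rule countable_subset) simp
      show "?I \<subseteq> sets (sigma ?X ?E)" unfolding setsS by auto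
    qed
    ultimately show "(\<lambda>x. x) -` S \<inter> space (sigma ?X ?E) \<in> sets (sigma ?X ?E)" by simp
  qed
  show "sets (tower_measure r) \<subseteq> sigma_sets (space (tower_measure r)) ?E"
  proof
    fix A assume A: "A \<in> sets (tower_measure r)"
    then have A': "A \<in> sets borel" "A \<subseteq> ?X"
      unfolding tower_measure_def using tower_space_borel by (simp_all add: sets_restrict_space_iff)
    have "(\<lambda>x. x) -` A \<inter> space (sigma ?X ?E) \<in> sets (sigma ?X ?E)" by (rule measurable_sets[OF id A'(1)])
    also have "(\<lambda>x. x) -` A \<inter> space (sigma ?X ?E) = A" using A'(2) by (auto simp: spS)
    finally show "A \<in> sigma_sets (space (tower_measure r)) ?E" by (simp only: setsS space_tower)
  qed
qed

lemma levels_real: "levels r (tower_measure r) (ivl r)"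
proof (rule levels.intro)
  show "space (tower_measure r) = (\<Union>m. \<Union>s<height r m. ivl r m s)" unfolding space_tower tower_space_def ..
  show "ivl r m s = (\<Union>a\<in>spots r m. ivl r (Suc m) (s + height r m * a))" if "s < height r m" for m s
    by (rule ivl_split[OF that])
  show "sets (tower_measure r) = sigma_sets (space (tower_measure r)) {ivl r m s |m s. s < height r m}"
    by (rule ivl_generate)
qed (fact r2 ivl_sets ivl_measure ivl_disjoint)+

interpretation levels r "tower_measure r" "ivl r" by (rule levels_real)

text \<open>Source and target level are cut alike, so the offset of the piece is the same in both
  and cancels in the translation amount.\<close>

lemma moves_Suc: assumes "moves r k x m s"
  shows "\<exists>t. moves r k x (Suc m) t \<and> x - pos r (Suc m) t + pos r (Suc m) (nat (int t + k)) = x - pos r m s + pos r m (nat (int s + k))"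
proof -
  have s: "s < height r m" "x \<in> ivl r m s" "0 \<le> int s + k" "int s + k < int (height r m)" using assms by (auto simp: moves_def)
  obtain a where a: "a \<in> spots r m" "x \<in> ivl r (Suc m) (s + height r m * a)" using ivl_split[OF s(1)] s(2) by auto
  let ?t = "s + height r m * a" and ?s' = "nat (int s + k)"
  have s': "?s' < height r m" using s by linarith
  have "int ?s' = int s + k" using s(3) by (rule nat_0_le)
  then have eq: "int ?t + k = int (?s' + height r m * a)" by (simp only: of_nat_add)
  have "moves r k x (Suc m) ?t"
    unfolding moves_def eq using a(2) height_step[OF s(1) a(1)] height_step[OF s' a(1)]
    by (simp only: of_nat_less_iff of_nat_0_le_iff simp_thms)
  moreover have "nat (int ?t + k) = ?s' + height r m * a" unfolding eq nat_int ..
  ultimately show ?thesis using pos_old[OF s(1) a(1)] pos_old[OF s' a(1)] by (intro exI[of _ ?t]) (simp del: pos.simps)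
qed

lemma moves_up: "m \<le> m' \<Longrightarrow> moves r k x m s \<Longrightarrow> \<exists>t. moves r k x m' t \<and> x - pos r m' t + pos r m' (nat (int t + k)) = x - pos r m s + pos r m (nat (int s + k))"
proof (induction m' rule: dec_induct)
  case (step n)
  then obtain t where t: "moves r k x n t" "x - pos r n t + pos r n (nat (int t + k)) = x - pos r m s + pos r m (nat (int s + k))" by blast
  from moves_Suc[OF t(1)] t(2) show ?case by metis
qed auto

lemma moves_unique:
  assumes "moves r k x m s" "moves r k x m' s'"
  shows "x - pos r m s + pos r m (nat (int s + k)) = x - pos r m' s' + pos r m' (nat (int s' + k))"
proof -
  have *: "x - pos r m s + pos r m (nat (int s + k)) = x - pos r m' s' + pos r m' (nat (int s' + k))"
    if le: "m \<le> m'" and mv: "moves r k x m s" "moves r k x m' s'" for m m' s s'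
  proof -
    obtain t where t: "moves r k x m' t" "x - pos r m' t + pos r m' (nat (int t + k)) = x - pos r m s + pos r m (nat (int s + k))"
      using moves_up[OF le mv(1)] by blast
    have "t = s'" using t(1) mv(2) level_unique[of t m' s' x] by (auto simp: moves_def)
    then show ?thesis using t(2) by simp
  qed
  show ?thesis using *[OF _ assms] *[OF _ assms(2,1)] by (cases "m \<le> m'") auto
qed

lemma real_act_eq: assumes "moves r k x m s" shows "real_act r k x = x - pos r m s + pos r m (nat (int s + k))"
proof -
  obtain m' s' where ms: "(SOME (m, s). moves r k x m s) = (m', s')" by (cases "SOME (m, s). moves r k x m s")
  have "case (SOME (m, s). moves r k x m s) of (m, s) \<Rightarrow> moves r k x m s"
    by (rule someI[of _ "(m, s)"]) (simp add: assms)
  then have "moves r k x m' s'" unfolding ms by simp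
  from moves_unique[OF assms this] show ?thesis unfolding real_act_def ms by simp
qed

lemma real_act_level:
  assumes "s < height r m" "x \<in> ivl r m s" "0 \<le> int s + k" "int s + k < int (height r m)"
  shows "real_act r k x \<in> ivl r m (nat (int s + k))"
proof -
  have "moves r k x m s" using assms by (simp add: moves_def)
  from real_act_eq[OF this] show ?thesis using assms(2) by (auto simp: ivl_def)
qed

theorem tower_real: "tower r (tower_measure r) (ivl r) (real_act r)"
proof (intro tower.intro tower_axioms.intro)
  show "levels r (tower_measure r) (ivl r)" by (rule levels_real)
  fix m s k x assume "s < height r m" "x \<in> ivl r m s" "0 \<le> int s + k" "int s + k < int (height r m)"
  then show "real_act r k x \<in> ivl r m (nat (int s + k))" by (rule real_act_level)
next
  fix x assume "x \<in> space (tower_measure r)"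
  then obtain m s where s: "s < height r m" "x \<in> ivl r m s" by (rule deep_level[where K=0])
  then have "moves r 0 x m s" by (simp add: moves_def)
  from real_act_eq[OF this] show "real_act r 0 x = x" by simp
next
  fix x k l assume "x \<in> space (tower_measure r)"
  \<comment> \<open>A margin of |k| + |l| lets a single tower serve both moves and their
    sum.\<close>
  then obtain m s where s: "s < height r m" "x \<in> ivl r m s" "nat (\<bar>k\<bar> + \<bar>l\<bar>) \<le> s" "s + nat (\<bar>k\<bar> + \<bar>l\<bar>) < height r m"
    by (rule deep_level)
  have l: "0 \<le> int s + l" "int s + l < int (height r m)" and kl: "0 \<le> int s + (k + l)" "int s + (k + l) < int (height r m)"
    using s(3,4) by linarith+
  let ?s = "nat (int s + l)"
  have s': "?s < height r m" using l by linarith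
  have "moves r l x m s" "moves r (k + l) x m s" using s l kl by (simp_all add: moves_def)
  note e = this[THEN real_act_eq]
  have "real_act r l x \<in> ivl r m ?s" by (rule real_act_level[OF s(1,2) l])
  then have "moves r k (real_act r l x) m ?s" using s' l kl by (simp add: moves_def algebra_simps)
  from real_act_eq[OF this] show "real_act r (k + l) x = real_act r k (real_act r l x)"
    using l by (simp add: e algebra_simps)
qed

end

section \<open>The choice of the cut numbers\<close>

text \<open>\<open>r j\<close> is the integer part of the \<open>p\<close>-th root of
  \<open>j + 1\<close>, plus 1. This guarantees \<open>2 \<le> r j\<close> and stays between the
  root and its double, so the sums compare with those of the powers -1 and -(1 + 1 / p) of
  \<open>j + 1\<close>.\<close>

lemma cut_numbers:
  assumes p: "p \<ge> 1"
  shows "\<exists>r :: nat \<Rightarrow> nat. (\<forall>j. 2 \<le> r j) \<and> \<not> summable (\<lambda>j. 1 / real (r j) ^ p) \<and> summable (\<lambda>j. 1 / real (r j) ^ (p + 1))"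
proof -
  define q where "q j = real (Suc j) powr (1 / real p)" for j
  define r where "r j = nat \<lfloor>q j\<rfloor> + 1" for j
  have q1: "1 \<le> q j" for j unfolding q_def by (rule ge_one_powr_ge_zero) auto
  have fl: "1 \<le> \<lfloor>q j\<rfloor>" for j using q1[of j] by linarith
  have rq: "q j \<le> real (r j)" "real (r j) \<le> 2 * q j" for j
  proof -
    have "real (r j) = of_int \<lfloor>q j\<rfloor> + 1" using fl[of j] by (simp add: r_def)
    moreover have "of_int \<lfloor>q j\<rfloor> \<le> q j" "q j < of_int \<lfloor>q j\<rfloor> + 1" by linarith+
    ultimately show "q j \<le> real (r j)" "real (r j) \<le> 2 * q j" using q1[of j] by linarith+
  qed
  have r2: "2 \<le> r j" for j using fl[of j] unfolding r_def by linarith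
  have qp: "q j ^ p = real (Suc j)" for j
  proof -
    have "q j ^ p = q j powr real p" using q1[of j] by (intro powr_realpow[symmetric]) simp
    also have "\<dots> = real (Suc j) powr (1 / real p * real p)" unfolding q_def powr_powr ..
    also have "\<dots> = real (Suc j)" using p by simp
    finally show ?thesis .
  qed
  have "\<not> summable (\<lambda>j. 1 / real (r j) ^ p)"
  proof
    assume s: "summable (\<lambda>j. 1 / real (r j) ^ p)"
    have "summable (\<lambda>j. real (Suc j) powr (- 1))"
    proof (rule summable_comparison_test'[OF summable_mult[OF s, of "2 ^ p"], of 0])
      fix j
      have "real (r j) ^ p \<le> (2 * q j) ^ p" using rq(2)[of j] by (intro power_mono) auto
      then have b: "real (r j) ^ p \<le> 2 ^ p * real (Suc j)" by (simp only: power_mult_distrib qp)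
      have "0 < real (r j) ^ p" using r2[of j] by (intro zero_less_power) simp
      moreover have "0 < real (Suc j)" by simp
      moreover have "1 / x \<le> c * (1 / y)" if "y \<le> c * x" "0 < y" "0 < x" for x y c :: real
        using that by (simp add: field_simps)
      ultimately have "1 / real (Suc j) \<le> 2 ^ p * (1 / real (r j) ^ p)" using b by blast
      then show "norm (real (Suc j) powr (- 1)) \<le> 2 ^ p * (1 / real (r j) ^ p)"
        by (simp add: powr_minus_divide)
    qed
    then have "summable (\<lambda>j. real j powr (- 1))" by (subst (asm) summable_Suc_iff)
    then show False unfolding summable_real_powr_iff by simp
  qed
  moreover have "summable (\<lambda>j. 1 / real (r j) ^ (p + 1))"
  proof (rule summable_comparison_test'[where N=0])
    have "summable (\<lambda>j. real j powr (- (1 + 1 / real p)))" using p by (simp add: summable_real_powr_iff)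
    then show "summable (\<lambda>j. real (Suc j) powr (- (1 + 1 / real p)))" by (subst summable_Suc_iff)
    fix j :: nat
    have "q j * q j ^ p \<le> real (r j) ^ (p + 1)"
      using power_mono[OF rq(1)[of j], of "p + 1"] q1[of j] by simp
    then have "real (Suc j) powr (1 + 1 / real p) \<le> real (r j) ^ (p + 1)"
      unfolding qp by (simp add: q_def powr_add mult.commute)
    moreover have "0 < real (Suc j) powr (1 + 1 / real p)" by simp
    ultimately have "1 / real (r j) ^ (p + 1) \<le> 1 / real (Suc j) powr (1 + 1 / real p)" by (intro frac_le) simp_all
    then show "norm (1 / real (r j) ^ (p + 1)) \<le> real (Suc j) powr (- (1 + 1 / real p))"
      unfolding powr_minus_divide by simp
  qed
  ultimately show ?thesis using r2 by blast
qed

theorem theorem1: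
  fixes n :: nat
  assumes "n \<ge> 1"
  shows "\<exists>(M :: real measure) (T :: real \<Rightarrow> real).
    sigma_finite_measure M \<and> automorphism M T \<and> ergodic M T \<and>
    conservative (power_space (2 * n) M) (tensor_power (2 * n) T) \<and>
    lebesgue_spectrum (power_space (n + 1) M) (koopman (tensor_power (n + 1) T)) \<and>
    singular_spectrum (power_space n M) (koopman (tensor_power n T))"
proof -
  let ?p = "2 * n - 1"
  have p: "?p \<ge> 1" "2 * n = ?p + 1" using assms by auto
  obtain r :: "nat \<Rightarrow> nat" where r2: "\<And>j. 2 \<le> r j" and div: "\<not> summable (\<lambda>j. 1 / real (r j) ^ ?p)"
    and conv: "summable (\<lambda>j. 1 / real (r j) ^ (?p + 1))" using cut_numbers[OF p(1)] by blast
  interpret tower r "tower_measure r" "ivl r" "real_act r" by (rule tower_real[OF r2])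
  have r0: "0 < real (r j)" for j using r2[of j] by simp
  have "conservative (power_space (2 * n) (tower_measure r)) (tensor_power (2 * n) (real_act r 1))"
  proof (rule conservative_tensor)
    show "\<not> summable (\<lambda>j. real (r j - 1) / real (r j) ^ (2 * n))"
    proof
      assume "summable (\<lambda>j. real (r j - 1) / real (r j) ^ (2 * n))"
      then have "summable (\<lambda>j. 2 * (real (r j - 1) / real (r j) ^ (2 * n)))" by (rule summable_mult)
      then have "summable (\<lambda>j. 1 / real (r j) ^ ?p)"
      proof (rule summable_comparison_test'[where N=0])
        fix j
        \<comment> \<open>Excluding the digit 2 has replaced \<open>r j\<close> by
          \<open>r j - 1\<close>, at the cost of a factor 2 only.\<close>
        have "real (r j) \<le> 2 * real (r j - 1)" using r2[of j] by linarith
        then have "real (r j) / real (r j) ^ (?p + 1) \<le> 2 * real (r j - 1) / real (r j) ^ (?p + 1)"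
          by (intro divide_right_mono) auto
        then show "norm (1 / real (r j) ^ ?p) \<le> 2 * (real (r j - 1) / real (r j) ^ (2 * n))"
          unfolding p(2)[symmetric] using r0[of j] by (subst (asm) p(2)) simp
      qed
      then show False using div by blast
    qed
  qed (use assms in simp)
  moreover have "lebesgue_spectrum (power_space (n + 1) (tower_measure r)) (koopman (tensor_power (n + 1) (real_act r 1)))"
  proof (rule lebesgue_tensor)
    have "((1 / real (r j)) ^ (n + 1) * real (r j))\<^sup>2 = 1 / real (r j) ^ (?p + 1)" for j
    proof -
      have "(1 / real (r j)) ^ (n + 1) * real (r j) = (1 / real (r j)) ^ n" using r0[of j] by simp
      then show ?thesis unfolding p(2)[symmetric] by (simp add: power_divide power_mult[symmetric] mult.commute)
    qed
    then show "summable (\<lambda>j. ((1 / real (r j)) ^ (n + 1) * real (r j))\<^sup>2)" using conv by simp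
  qed (use assms in simp)
  moreover have "singular_spectrum (power_space n (tower_measure r)) (koopman (tensor_power n (real_act r 1)))"
  proof (rule singular_tensor[OF assms])
    have "real (r j) * ((1 / real (r j)) ^ n)\<^sup>2 = 1 / real (r j) ^ ?p" for j
    proof -
      have "((1 / real (r j)) ^ n)\<^sup>2 = 1 / real (r j) ^ (2 * n)" by (simp add: power_divide power_mult[symmetric] mult.commute)
      also have "\<dots> = 1 / (real (r j) * real (r j) ^ ?p)" by (subst p(2)) simp
      finally show ?thesis using r0[of j] by simp
    qed
    then show "\<not> summable (\<lambda>j. real (r j) * ((1 / real (r j)) ^ n)\<^sup>2)" using div by simp
  qed
  ultimately show ?thesis using sigma_finite automorphism_act ergodic_act by blast
qed

end
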